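(* Let $G$ be a real Lie group, let $X$ be a $G$-manifold, and let $\mathrm U^{\mathbb C}:\mathrm{Vect}_{T_{\mathbb C}G}^{\mathrm{aff},\mathbb C}(X)\to\mathrm{Vect}_G^{\mathbb C}(X)$ and $\mathrm F^{\mathbb C},\sigma^{\mathbb C}:\mathrm{Vect}_G^{\mathbb C}(X)\to\mathrm{Vect}_{T_{\mathbb C}G}^{\mathrm{aff},\mathbb C}(X)$ be the functors defined in the context. Then: (1) $\mathrm F^{\mathbb C}$ is left adjoint to $\mathrm U^{\mathbb C}$. (2) The adjunction $\mathrm F^{\mathbb C}\dashv\mathrm U^{\mathbb C}$ is monadic. (3) $\sigma^{\mathbb C}$ is the unique section of $\mathrm U^{\mathbb C}$, i.e. the unique functor with $\mathrm U^{\mathbb C}\circ\sigma^{\mathbb C}=\mathrm{id}$.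
   Context: All manifolds are smooth, finite-dimensional and real; complex vector bundles are smooth of finite rank. A $G$-manifold is a manifold $X$ with a smooth left action $t:G\times X\to X$, $t(g,x)=g\cdot x$. $\mathrm{Vect}_G^{\mathbb C}(X)$ is the category of $G$-equivariant complex vector bundles over $X$ (left $G$-action covering $t$ and fibrewise complex linear) with $G$-equivariant complex vector bundle morphisms over $X$. $\mathfrak g_{\mathbb C}=\mathfrak g\otimes\mathbb C$ carries the complexified adjoint representation, and $(\mathfrak g_{\mathbb C})_X$ is $X\times\mathfrak g_{\mathbb C}$ with $g\cdot(x,\alpha)=(g\cdot x,\mathrm{Ad}_g\alpha)$. $T_{\mathbb C}G=TG\otimes\mathbb C$ is a complex vector bundle over $G$ and a real Lie group, with multiplication $v_g\bullet w_h=(L_g)_*w_h+(R_h)_*v_g$ (complex-linearly extended derivatives). A complex affine action of $T_{\mathbb C}G$ on a complex vector bundle $E\to X$ is a left action $T_{\mathbb C}G\times E\to E$ of the Lie group $T_{\mathbb C}G$ that is a morphism of complex vector bundles covering $t$ (with $T_{\mathbb C}G\times E$ a complex vector bundle over $G\times X$). Morphisms are $T_{\mathbb C}G$-equivariant morphisms of complex vector bundles over $X$. These form $\mathrm{Vect}_{T_{\mathbb C}G}^{\mathrm{aff},\mathbb C}(X)$. Functors (each sends a morphism to the evident underlying bundle map): $\mathrm U^{\mathbb C}$ sends an affine action on $E$ to $E$ with $G$-action $g\cdot e=0_g\cdot e$; $\sigma^{\mathbb C}$ sends $E$ to $E$ with $v_g\cdot e=g\cdot e$; $\mathrm F^{\mathbb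 C}$ sends $E$ to $(\mathfrak g_{\mathbb C})_X\oplus E$ with $v_g\cdot((x,\alpha),e_x)=((g\cdot x,\mathrm{Ad}_g\alpha+(R_{g^{-1}})_*v_g),g\cdot e_x)$ and a morphism $\psi$ to $\mathrm{id}\oplus\psi$. Equivalently, identifying complex affine actions with pairs $(E,\phi)$, $\phi:(\mathfrak g_{\mathbb C})_X\to E$ a morphism in $\mathrm{Vect}_G^{\mathbb C}(X)$, via $\phi(x,\alpha)=\alpha\cdot 0_x$, one has $\mathrm U^{\mathbb C}(E,\phi)=E$, $\sigma^{\mathbb C}(E)=(E,0)$, $\mathrm F^{\mathbb C}(E)=((\mathfrak g_{\mathbb C})_X\oplus E,i)$ with $i$ the inclusion of the first summand. An adjunction $\mathcal F\dashv\mathcal U$, $\mathcal U:\mathscr D\to\mathscr C$, is monadic if the canonical comparison functor from $\mathscr D$ to the category of algebras over the induced monad on $\mathscr C$ is an isomorphism of categories. *)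

theory Defs
  imports "HOL-Analysis.Analysis" "HOL-Algebra.Group"
begin

section \<open>Smooth functions on open subsets of Euclidean spaces\<close>

text \<open>Points of \<open>\<real>\<^sup>n\<close> are the points of \<^const>\<open>Euclidean_space\<close> \<open>n\<close>, i.e. functions \<open>nat \<Rightarrow> real\<close>
  vanishing from index \<open>n\<close> on, so that dimensions (including dimension 0) are ordinary natural numbers.\<close>

definition pderiv_at :: "nat \<Rightarrow> ((nat \<Rightarrow> real) \<Rightarrow> real) \<Rightarrow> (nat \<Rightarrow> real) \<Rightarrow> real" where
  "pderiv_at i f x = deriv (\<lambda>s. f (x(i := s))) (x i)"

primrec Ck_on :: "nat \<Rightarrow> nat \<Rightarrow> (nat \<Rightarrow> real) set \<Rightarrow> ((nat \<Rightarrow> real) \<Rightarrow> real) \<Rightarrow> bool" where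
  "Ck_on n 0 U f \<longleftrightarrow> continuous_map (subtopology (Euclidean_space n) U) euclideanreal f"
| "Ck_on n (Suc k) U f \<longleftrightarrow>
     continuous_map (subtopology (Euclidean_space n) U) euclideanreal f \<and>
     (\<forall>i<n. (\<forall>x\<in>U. (\<lambda>s. f (x(i := s))) differentiable (at (x i))) \<and> Ck_on n k U (pderiv_at i f))"

definition smooth_between ::
  "nat \<Rightarrow> nat \<Rightarrow> (nat \<Rightarrow> real) set \<Rightarrow> ((nat \<Rightarrow> real) \<Rightarrow> nat \<Rightarrow> real) \<Rightarrow> bool" where
  "smooth_between n m U F \<longleftrightarrow>
     F ` U \<subseteq> topspace (Euclidean_space m) \<and> (\<forall>j<m. \<forall>k. Ck_on n k U (\<lambda>x. F x j))"

definition jacobian_apply ::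
  "nat \<Rightarrow> nat \<Rightarrow> ((nat \<Rightarrow> real) \<Rightarrow> nat \<Rightarrow> real) \<Rightarrow> (nat \<Rightarrow> real) \<Rightarrow> (nat \<Rightarrow> real) \<Rightarrow> nat \<Rightarrow> real" where
  "jacobian_apply n m F x \<xi> =
     (\<lambda>j. if j < m then \<Sum>i<n. pderiv_at i (\<lambda>y. F y j) x * \<xi> i else 0)"

definition cat :: "nat \<Rightarrow> (nat \<Rightarrow> real) \<Rightarrow> (nat \<Rightarrow> real) \<Rightarrow> nat \<Rightarrow> real" where
  "cat n x y = (\<lambda>i. if i < n then x i else y (i - n))"


section \<open>Smooth manifolds\<close>

record 'a chart =
  cdom :: "'a set"
  cdim :: nat
  cmap :: "'a \<Rightarrow> nat \<Rightarrow> real"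

record 'a smooth_mfd =
  points :: "'a set"
  atlas :: "'a chart set"

definition is_chart :: "'a set \<Rightarrow> 'a chart \<Rightarrow> bool" where
  "is_chart S c \<longleftrightarrow>
     cdom c \<subseteq> S \<and> cmap c \<in> extensional (cdom c) \<and> inj_on (cmap c) (cdom c) \<and>
     openin (Euclidean_space (cdim c)) (cmap c ` cdom c)"

definition chart_inv :: "'a chart \<Rightarrow> (nat \<Rightarrow> real) \<Rightarrow> 'a" where
  "chart_inv c = inv_into (cdom c) (cmap c)"

definition local_rep ::
  "'a chart \<Rightarrow> 'b chart \<Rightarrow> ('a \<Rightarrow> 'b) \<Rightarrow> (nat \<Rightarrow> real) \<Rightarrow> nat \<Rightarrow> real" where
  "local_rep c d f = (\<lambda>x. cmap d (f (chart_inv c x)))"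

definition smooth_transition :: "'a chart \<Rightarrow> 'a chart \<Rightarrow> bool" where
  "smooth_transition c d \<longleftrightarrow>
     openin (Euclidean_space (cdim c)) (cmap c ` (cdom c \<inter> cdom d)) \<and>
     smooth_between (cdim c) (cdim d) (cmap c ` (cdom c \<inter> cdom d)) (local_rep c d id)"

definition compatible :: "'a chart \<Rightarrow> 'a chart \<Rightarrow> bool" where
  "compatible c d \<longleftrightarrow> smooth_transition c d \<and> smooth_transition d c"

definition mtop :: "'a smooth_mfd \<Rightarrow> 'a topology" where
  "mtop M = topology (\<lambda>W. W \<subseteq> points M \<and>
     (\<forall>c\<in>atlas M. openin (Euclidean_space (cdim c)) (cmap c ` (W \<inter> cdom c))))"

text \<open>Atlases are maximal. The dimension is locally constant, but may differ between components.\<close>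

definition smooth_manifold :: "'a smooth_mfd \<Rightarrow> bool" where
  "smooth_manifold M \<longleftrightarrow>
     (\<forall>c\<in>atlas M. is_chart (points M) c) \<and>
     \<Union>(cdom ` atlas M) = points M \<and>
     (\<forall>c\<in>atlas M. \<forall>d\<in>atlas M. compatible c d) \<and>
     (\<forall>c. is_chart (points M) c \<and> (\<forall>d\<in>atlas M. compatible c d) \<longrightarrow> c \<in> atlas M) \<and>
     Hausdorff_space (mtop M) \<and> second_countable (mtop M)"

definition charts_at :: "'a smooth_mfd \<Rightarrow> 'a \<Rightarrow> 'a chart set" where
  "charts_at M p = {c \<in> atlas M. p \<in> cdom c}"

definition smooth_map :: "'a smooth_mfd \<Rightarrow> 'b smooth_mfd \<Rightarrow> ('a \<Rightarrow> 'b) \<Rightarrow> bool" where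
  "smooth_map M N f \<longleftrightarrow>
     f \<in> points M \<rightarrow> points N \<and>
     (\<forall>p\<in>points M. \<exists>c\<in>charts_at M p. \<exists>d\<in>charts_at N (f p).
        f ` cdom c \<subseteq> cdom d \<and>
        smooth_between (cdim c) (cdim d) (cmap c ` cdom c) (local_rep c d f))"

definition diffeomorphism :: "'a smooth_mfd \<Rightarrow> 'b smooth_mfd \<Rightarrow> ('a \<Rightarrow> 'b) \<Rightarrow> bool" where
  "diffeomorphism M N f \<longleftrightarrow>
     bij_betw f (points M) (points N) \<and> smooth_map M N f \<and> smooth_map N M (inv_into (points M) f)"

definition mfd_generated :: "'a set \<Rightarrow> 'a chart set \<Rightarrow> 'a smooth_mfd" where
  "mfd_generated S A =
     \<lparr>points = S, atlas = {c. is_chart S c \<and> (\<forall>d\<in>A. compatible c d)}\<rparr>"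

definition open_submfd :: "'a smooth_mfd \<Rightarrow> 'a set \<Rightarrow> 'a smooth_mfd" where
  "open_submfd M U = \<lparr>points = U, atlas = {c \<in> atlas M. cdom c \<subseteq> U}\<rparr>"

definition prod_chart :: "'a chart \<Rightarrow> 'b chart \<Rightarrow> ('a \<times> 'b) chart" where
  "prod_chart c d =
     \<lparr>cdom = cdom c \<times> cdom d, cdim = cdim c + cdim d,
      cmap = restrict (\<lambda>(p, q). cat (cdim c) (cmap c p) (cmap d q)) (cdom c \<times> cdom d)\<rparr>"

definition prod_mfd :: "'a smooth_mfd \<Rightarrow> 'b smooth_mfd \<Rightarrow> ('a \<times> 'b) smooth_mfd" where
  "prod_mfd M N =
     mfd_generated (points M \<times> points N) {prod_chart c d | c d. c \<in> atlas M \<and> d \<in> atlas N}"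

text \<open>The smooth structure on \<open>S\<close> that makes the bijection \<open>f\<close> from \<open>S\<close> onto \<open>M\<close> a diffeomorphism.\<close>

definition transport_mfd :: "'s set \<Rightarrow> ('s \<Rightarrow> 'a) \<Rightarrow> 'a smooth_mfd \<Rightarrow> 's smooth_mfd" where
  "transport_mfd S f M =
     \<lparr>points = S,
      atlas = {\<lparr>cdom = {s \<in> S. f s \<in> cdom c}, cdim = cdim c,
                cmap = restrict (cmap c \<circ> f) {s \<in> S. f s \<in> cdom c}\<rparr> | c. c \<in> atlas M}\<rparr>"

definition complex_space :: "nat \<Rightarrow> (nat \<Rightarrow> complex) smooth_mfd" where
  "complex_space r =
     (let S = {z. \<forall>i\<ge>r. z i = 0} in
      mfd_generated S
        {\<lparr>cdom = S, cdim = r + r, cmap = restrict (\<lambda>z. cat r (Re \<circ> z) (Im \<circ> z)) S\<rparr>})"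


section \<open>Tangent vectors and their complexification\<close>

text \<open>A tangent vector at \<open>p\<close> is a family of coordinate vectors, one for each chart around \<open>p\<close>, that
  transforms by the Jacobians of the transition maps (value \<open>0\<close> on all other charts).\<close>

type_synonym 'a tvec = "'a chart \<Rightarrow> nat \<Rightarrow> real"

definition tangent_space :: "'a smooth_mfd \<Rightarrow> 'a \<Rightarrow> 'a tvec set" where
  "tangent_space M p =
     {v. (\<forall>c. c \<notin> charts_at M p \<longrightarrow> v c = (\<lambda>_. 0)) \<and>
         (\<forall>c\<in>charts_at M p. v c \<in> topspace (Euclidean_space (cdim c))) \<and>
         (\<forall>c\<in>charts_at M p. \<forall>d\<in>charts_at M p.
            v d = jacobian_apply (cdim c) (cdim d) (local_rep c d id) (cmap c p) (v c))}"

definition pushforward ::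
  "'a smooth_mfd \<Rightarrow> 'b smooth_mfd \<Rightarrow> ('a \<Rightarrow> 'b) \<Rightarrow> 'a \<Rightarrow> 'a tvec \<Rightarrow> 'b tvec" where
  "pushforward M N f p v =
     (\<lambda>d. if d \<in> charts_at N (f p)
          then (let c = (SOME c. c \<in> charts_at M p) in
                jacobian_apply (cdim c) (cdim d) (local_rep c d f) (cmap c p) (v c))
          else (\<lambda>_. 0))"

text \<open>The pair \<open>(v, w)\<close> stands for \<open>v + \<i> w\<close> in the complexified tangent space.\<close>

type_synonym 'a ctvec = "'a tvec \<times> 'a tvec"

definition ctangent_space :: "'a smooth_mfd \<Rightarrow> 'a \<Rightarrow> 'a ctvec set" where
  "ctangent_space M p = tangent_space M p \<times> tangent_space M p"

definition ct_zero :: "'a ctvec" where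
  "ct_zero = ((\<lambda>_ _. 0), (\<lambda>_ _. 0))"

definition ct_add :: "'a ctvec \<Rightarrow> 'a ctvec \<Rightarrow> 'a ctvec" where
  "ct_add \<alpha> \<beta> = ((\<lambda>c i. fst \<alpha> c i + fst \<beta> c i), (\<lambda>c i. snd \<alpha> c i + snd \<beta> c i))"

definition ct_scale :: "complex \<Rightarrow> 'a ctvec \<Rightarrow> 'a ctvec" where
  "ct_scale z \<alpha> =
     ((\<lambda>c i. Re z * fst \<alpha> c i - Im z * snd \<alpha> c i), (\<lambda>c i. Re z * snd \<alpha> c i + Im z * fst \<alpha> c i))"

definition ct_push ::
  "'a smooth_mfd \<Rightarrow> 'b smooth_mfd \<Rightarrow> ('a \<Rightarrow> 'b) \<Rightarrow> 'a \<Rightarrow> 'a ctvec \<Rightarrow> 'b ctvec" where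
  "ct_push M N f p = map_prod (pushforward M N f p) (pushforward M N f p)"

definition ctangent_space_mfd :: "'a smooth_mfd \<Rightarrow> 'a \<Rightarrow> 'a ctvec smooth_mfd" where
  "ctangent_space_mfd M p =
     mfd_generated (ctangent_space M p)
       {\<lparr>cdom = ctangent_space M p, cdim = cdim c + cdim c,
         cmap = restrict (\<lambda>\<alpha>. cat (cdim c) (fst \<alpha> c) (snd \<alpha> c)) (ctangent_space M p)\<rparr>
        | c. c \<in> charts_at M p}"

definition ctangent_mfd :: "'a smooth_mfd \<Rightarrow> ('a \<times> 'a ctvec) smooth_mfd" where
  "ctangent_mfd M =
     mfd_generated (Sigma (points M) (ctangent_space M))
       {\<lparr>cdom = Sigma (cdom c) (ctangent_space M), cdim = cdim c + (cdim c + cdim c),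
         cmap = restrict (\<lambda>(p, \<alpha>). cat (cdim c) (cmap c p) (cat (cdim c) (fst \<alpha> c) (snd \<alpha> c)))
                  (Sigma (cdom c) (ctangent_space M))\<rparr>
        | c. c \<in> atlas M}"


section \<open>Complex vector bundles\<close>

record ('x, 'p) cbundle =
  tot :: "'p smooth_mfd"
  proj :: "'p \<Rightarrow> 'x"
  vadd :: "'p \<Rightarrow> 'p \<Rightarrow> 'p"
  vzero :: "'x \<Rightarrow> 'p"
  vscale :: "complex \<Rightarrow> 'p \<Rightarrow> 'p"

definition fibre :: "('x, 'p) cbundle \<Rightarrow> 'x \<Rightarrow> 'p set" where
  "fibre E x = {e \<in> points (tot E). proj E e = x}"

definition complex_vector_space ::
  "'p set \<Rightarrow> ('p \<Rightarrow> 'p \<Rightarrow> 'p) \<Rightarrow> 'p \<Rightarrow> (complex \<Rightarrow> 'p \<Rightarrow> 'p) \<Rightarrow> bool" where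
  "complex_vector_space V add z smul \<longleftrightarrow>
     z \<in> V \<and> (\<forall>u\<in>V. \<forall>v\<in>V. add u v \<in> V) \<and> (\<forall>a. \<forall>u\<in>V. smul a u \<in> V) \<and>
     (\<forall>u\<in>V. \<forall>v\<in>V. \<forall>w\<in>V. add (add u v) w = add u (add v w)) \<and>
     (\<forall>u\<in>V. \<forall>v\<in>V. add u v = add v u) \<and>
     (\<forall>u\<in>V. add z u = u) \<and> (\<forall>u\<in>V. \<exists>v\<in>V. add u v = z) \<and>
     (\<forall>a. \<forall>u\<in>V. \<forall>v\<in>V. smul a (add u v) = add (smul a u) (smul a v)) \<and>
     (\<forall>a b. \<forall>u\<in>V. smul (a + b) u = add (smul a u) (smul b u)) \<and>
     (\<forall>a b. \<forall>u\<in>V. smul (a * b) u = smul a (smul b u)) \<and>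
     (\<forall>u\<in>V. smul 1 u = u)"

definition local_trivialization ::
  "'x smooth_mfd \<Rightarrow> ('x, 'p) cbundle \<Rightarrow> 'x set \<Rightarrow> nat \<Rightarrow> ('p \<Rightarrow> 'x \<times> (nat \<Rightarrow> complex)) \<Rightarrow> bool" where
  "local_trivialization X E U r \<Phi> \<longleftrightarrow>
     openin (mtop X) U \<and>
     diffeomorphism (open_submfd (tot E) {e \<in> points (tot E). proj E e \<in> U})
       (prod_mfd (open_submfd X U) (complex_space r)) \<Phi> \<and>
     (\<forall>x\<in>U. \<forall>e\<in>fibre E x. fst (\<Phi> e) = x \<and>
        (\<forall>a. snd (\<Phi> (vscale E a e)) = (\<lambda>i. a * snd (\<Phi> e) i)) \<and>
        (\<forall>e'\<in>fibre E x. snd (\<Phi> (vadd E e e')) = (\<lambda>i. snd (\<Phi> e) i + snd (\<Phi> e') i)))"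

text \<open>The operations are required to be undefined outside their domains, so that equality of records
  is equality of bundles.\<close>

definition complex_vector_bundle :: "'x smooth_mfd \<Rightarrow> ('x, 'p) cbundle \<Rightarrow> bool" where
  "complex_vector_bundle X E \<longleftrightarrow>
     smooth_manifold (tot E) \<and> smooth_map (tot E) X (proj E) \<and>
     proj E \<in> extensional (points (tot E)) \<and> vzero E \<in> extensional (points X) \<and>
     (\<forall>e e'. \<not> (e \<in> points (tot E) \<and> e' \<in> points (tot E) \<and> proj E e = proj E e')
        \<longrightarrow> vadd E e e' = undefined) \<and>
     (\<forall>a e. e \<notin> points (tot E) \<longrightarrow> vscale E a e = undefined) \<and>
     (\<forall>x\<in>points X. complex_vector_space (fibre E x) (vadd E) (vzero E x) (vscale E)) \<and>
     (\<forall>x\<in>points X. \<exists>U r \<Phi>. x \<in> U \<and> local_trivialization X E U r \<Phi>)"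

definition cbundle_morphism ::
  "('x, 'p) cbundle \<Rightarrow> ('y, 'q) cbundle \<Rightarrow> ('x \<Rightarrow> 'y) \<Rightarrow> ('p \<Rightarrow> 'q) \<Rightarrow> bool" where
  "cbundle_morphism E E' f \<psi> \<longleftrightarrow>
     smooth_map (tot E) (tot E') \<psi> \<and>
     (\<forall>e\<in>points (tot E). proj E' (\<psi> e) = f (proj E e)) \<and>
     (\<forall>e\<in>points (tot E). \<forall>e'\<in>points (tot E). proj E e = proj E e' \<longrightarrow>
        \<psi> (vadd E e e') = vadd E' (\<psi> e) (\<psi> e')) \<and>
     (\<forall>a. \<forall>e\<in>points (tot E). \<psi> (vscale E a e) = vscale E' a (\<psi> e))"

definition prod_cbundle ::
  "('x, 'p) cbundle \<Rightarrow> ('y, 'q) cbundle \<Rightarrow> ('x \<times> 'y, 'p \<times> 'q) cbundle" where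
  "prod_cbundle E E' =
     \<lparr>tot = prod_mfd (tot E) (tot E'),
      proj = map_prod (proj E) (proj E'),
      vadd = (\<lambda>(e, e') (f, f'). (vadd E e f, vadd E' e' f')),
      vzero = map_prod (vzero E) (vzero E'),
      vscale = (\<lambda>a. map_prod (vscale E a) (vscale E' a))\<rparr>"

definition ctangent_cbundle :: "'a smooth_mfd \<Rightarrow> ('a, 'a \<times> 'a ctvec) cbundle" where
  "ctangent_cbundle M =
     \<lparr>tot = ctangent_mfd M,
      proj = fst,
      vadd = (\<lambda>(p, \<alpha>) (q, \<beta>). (p, ct_add \<alpha> \<beta>)),
      vzero = (\<lambda>p. (p, ct_zero)),
      vscale = (\<lambda>a (p, \<alpha>). (p, ct_scale a \<alpha>))\<rparr>"


section \<open>Lie groups and actions\<close>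

record 'g lie_group = "'g monoid" +
  mfd :: "'g smooth_mfd"

definition is_lie_group :: "'g lie_group \<Rightarrow> bool" where
  "is_lie_group G \<longleftrightarrow>
     group G \<and> smooth_manifold (mfd G) \<and> points (mfd G) = carrier G \<and>
     smooth_map (prod_mfd (mfd G) (mfd G)) (mfd G) (\<lambda>(g, h). g \<otimes>\<^bsub>G\<^esub> h) \<and>
     smooth_map (mfd G) (mfd G) (m_inv G)"

definition left_action :: "('h, 'b) monoid_scheme \<Rightarrow> 's set \<Rightarrow> ('h \<times> 's \<Rightarrow> 's) \<Rightarrow> bool" where
  "left_action H S a \<longleftrightarrow>
     a \<in> carrier H \<times> S \<rightarrow> S \<and> (\<forall>s\<in>S. a (\<one>\<^bsub>H\<^esub>, s) = s) \<and>
     (\<forall>g\<in>carrier H. \<forall>h\<in>carrier H. \<forall>s\<in>S. a (g \<otimes>\<^bsub>H\<^esub> h, s) = a (g, a (h, s)))"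

definition G_manifold :: "'g lie_group \<Rightarrow> 'x smooth_mfd \<Rightarrow> ('g \<times> 'x \<Rightarrow> 'x) \<Rightarrow> bool" where
  "G_manifold G X t \<longleftrightarrow>
     smooth_manifold X \<and> left_action G (points X) t \<and> smooth_map (prod_mfd (mfd G) X) X t"

definition lie_gC :: "'g lie_group \<Rightarrow> 'g ctvec set" where
  "lie_gC G = ctangent_space (mfd G) \<one>\<^bsub>G\<^esub>"

definition Ad :: "'g lie_group \<Rightarrow> 'g \<Rightarrow> 'g ctvec \<Rightarrow> 'g ctvec" where
  "Ad G g = ct_push (mfd G) (mfd G) (\<lambda>h. g \<otimes>\<^bsub>G\<^esub> h \<otimes>\<^bsub>G\<^esub> m_inv G g) \<one>\<^bsub>G\<^esub>"

definition right_transport :: "'g lie_group \<Rightarrow> 'g \<times> 'g ctvec \<Rightarrow> 'g ctvec" where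
  "right_transport G = (\<lambda>(g, v). ct_push (mfd G) (mfd G) (\<lambda>h. h \<otimes>\<^bsub>G\<^esub> m_inv G g) g v)"

definition TC :: "'g lie_group \<Rightarrow> ('g \<times> 'g ctvec) lie_group" where
  "TC G =
     \<lparr>carrier = points (ctangent_mfd (mfd G)),
      mult = (\<lambda>(g, v) (h, w). (g \<otimes>\<^bsub>G\<^esub> h,
         ct_add (ct_push (mfd G) (mfd G) (\<lambda>k. g \<otimes>\<^bsub>G\<^esub> k) h w)
                (ct_push (mfd G) (mfd G) (\<lambda>k. k \<otimes>\<^bsub>G\<^esub> h) g v))),
      one = (\<one>\<^bsub>G\<^esub>, ct_zero),
      mfd = ctangent_mfd (mfd G)\<rparr>"


section \<open>Categories, adjunctions and monadicity\<close>

record ('o, 'm) category =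
  Obj :: "'o set"
  Hom :: "'o \<Rightarrow> 'o \<Rightarrow> 'm set"
  Ident :: "'o \<Rightarrow> 'm"
  Cmp :: "'o \<Rightarrow> 'o \<Rightarrow> 'o \<Rightarrow> 'm \<Rightarrow> 'm \<Rightarrow> 'm"

text \<open>\<^term>\<open>Cmp C A B D g f\<close> is the composite of \<open>f : A \<rightarrow> B\<close> followed by \<open>g : B \<rightarrow> D\<close>.\<close>

definition is_category :: "('o, 'm) category \<Rightarrow> bool" where
  "is_category C \<longleftrightarrow>
     (\<forall>A\<in>Obj C. Ident C A \<in> Hom C A A) \<and>
     (\<forall>A\<in>Obj C. \<forall>B\<in>Obj C. \<forall>D\<in>Obj C. \<forall>f\<in>Hom C A B. \<forall>g\<in>Hom C B D. Cmp C A B D g f \<in> Hom C A D) \<and>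
     (\<forall>A\<in>Obj C. \<forall>B\<in>Obj C. \<forall>f\<in>Hom C A B.
        Cmp C A A B f (Ident C A) = f \<and> Cmp C A B B (Ident C B) f = f) \<and>
     (\<forall>A\<in>Obj C. \<forall>B\<in>Obj C. \<forall>D\<in>Obj C. \<forall>E\<in>Obj C. \<forall>f\<in>Hom C A B. \<forall>g\<in>Hom C B D. \<forall>h\<in>Hom C D E.
        Cmp C A D E h (Cmp C A B D g f) = Cmp C A B E (Cmp C B D E h g) f)"

record ('o, 'm, 'p, 'n) func =
  fob :: "'o \<Rightarrow> 'p"
  fmor :: "'o \<Rightarrow> 'o \<Rightarrow> 'm \<Rightarrow> 'n"

definition is_functor ::
  "('o, 'm) category \<Rightarrow> ('p, 'n) category \<Rightarrow> ('o, 'm, 'p, 'n) func \<Rightarrow> bool" where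
  "is_functor C D F \<longleftrightarrow>
     is_category C \<and> is_category D \<and>
     (\<forall>A\<in>Obj C. fob F A \<in> Obj D) \<and>
     (\<forall>A\<in>Obj C. \<forall>B\<in>Obj C. \<forall>f\<in>Hom C A B. fmor F A B f \<in> Hom D (fob F A) (fob F B)) \<and>
     (\<forall>A\<in>Obj C. fmor F A A (Ident C A) = Ident D (fob F A)) \<and>
     (\<forall>A\<in>Obj C. \<forall>B\<in>Obj C. \<forall>E\<in>Obj C. \<forall>f\<in>Hom C A B. \<forall>g\<in>Hom C B E.
        fmor F A E (Cmp C A B E g f) =
        Cmp D (fob F A) (fob F B) (fob F E) (fmor F B E g) (fmor F A B f))"

definition func_id :: "('o, 'm, 'o, 'm) func" where
  "func_id = \<lparr>fob = (\<lambda>A. A), fmor = (\<lambda>A B f. f)\<rparr>"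

definition func_comp ::
  "('p, 'n, 'q, 'k) func \<Rightarrow> ('o, 'm, 'p, 'n) func \<Rightarrow> ('o, 'm, 'q, 'k) func" where
  "func_comp S F =
     \<lparr>fob = (\<lambda>A. fob S (fob F A)),
      fmor = (\<lambda>A B f. fmor S (fob F A) (fob F B) (fmor F A B f))\<rparr>"

text \<open>Equality of functors on \<open>C\<close>; values outside the objects and hom-sets of \<open>C\<close> are irrelevant.\<close>

definition func_eq ::
  "('o, 'm) category \<Rightarrow> ('o, 'm, 'p, 'n) func \<Rightarrow> ('o, 'm, 'p, 'n) func \<Rightarrow> bool" where
  "func_eq C F S \<longleftrightarrow>
     (\<forall>A\<in>Obj C. fob F A = fob S A) \<and>
     (\<forall>A\<in>Obj C. \<forall>B\<in>Obj C. \<forall>f\<in>Hom C A B. fmor F A B f = fmor S A B f)"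

definition category_isomorphism ::
  "('o, 'm) category \<Rightarrow> ('p, 'n) category \<Rightarrow> ('o, 'm, 'p, 'n) func \<Rightarrow> bool" where
  "category_isomorphism C D K \<longleftrightarrow>
     is_functor C D K \<and>
     (\<exists>L. is_functor D C L \<and> func_eq C (func_comp L K) func_id \<and> func_eq D (func_comp K L) func_id)"

definition natural_transformation ::
  "('o, 'm) category \<Rightarrow> ('p, 'n) category \<Rightarrow> ('o, 'm, 'p, 'n) func \<Rightarrow> ('o, 'm, 'p, 'n) func
     \<Rightarrow> ('o \<Rightarrow> 'n) \<Rightarrow> bool" where
  "natural_transformation C D F S \<tau> \<longleftrightarrow>
     is_functor C D F \<and> is_functor C D S \<and>
     (\<forall>A\<in>Obj C. \<tau> A \<in> Hom D (fob F A) (fob S A)) \<and>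
     (\<forall>A\<in>Obj C. \<forall>B\<in>Obj C. \<forall>f\<in>Hom C A B.
        Cmp D (fob F A) (fob F B) (fob S B) (\<tau> B) (fmor F A B f) =
        Cmp D (fob F A) (fob S A) (fob S B) (fmor S A B f) (\<tau> A))"

text \<open>\<open>F : C \<rightarrow> D\<close> is left adjoint to \<open>U : D \<rightarrow> C\<close> with unit \<open>\<eta>\<close> and counit \<open>\<epsilon>\<close>.\<close>

definition adjunction ::
  "('o, 'm) category \<Rightarrow> ('p, 'n) category \<Rightarrow> ('o, 'm, 'p, 'n) func \<Rightarrow> ('p, 'n, 'o, 'm) func
     \<Rightarrow> ('o \<Rightarrow> 'm) \<Rightarrow> ('p \<Rightarrow> 'n) \<Rightarrow> bool" where
  "adjunction C D F U \<eta> \<epsilon> \<longleftrightarrow>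
     is_functor C D F \<and> is_functor D C U \<and>
     natural_transformation C C func_id (func_comp U F) \<eta> \<and>
     natural_transformation D D (func_comp F U) func_id \<epsilon> \<and>
     (\<forall>A\<in>Obj C.
        Cmp D (fob F A) (fob F (fob U (fob F A))) (fob F A)
          (\<epsilon> (fob F A)) (fmor F A (fob U (fob F A)) (\<eta> A)) = Ident D (fob F A)) \<and>
     (\<forall>B\<in>Obj D.
        Cmp C (fob U B) (fob U (fob F (fob U B))) (fob U B)
          (fmor U (fob F (fob U B)) B (\<epsilon> B)) (\<eta> (fob U B)) = Ident C (fob U B))"

definition algebras ::
  "('o, 'm) category \<Rightarrow> ('o, 'm, 'o, 'm) func \<Rightarrow> ('o \<Rightarrow> 'm) \<Rightarrow> ('o \<Rightarrow> 'm) \<Rightarrow> ('o \<times> 'm, 'm) category" where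
  "algebras C T \<eta> \<mu> =
     \<lparr>Obj = {(A, h). A \<in> Obj C \<and> h \<in> Hom C (fob T A) A \<and>
         Cmp C A (fob T A) A h (\<eta> A) = Ident C A \<and>
         Cmp C (fob T (fob T A)) (fob T A) A h (fmor T (fob T A) A h) =
         Cmp C (fob T (fob T A)) (fob T A) A h (\<mu> A)},
      Hom = (\<lambda>(A, h) (B, k). {f \<in> Hom C A B.
         Cmp C (fob T A) A B f h = Cmp C (fob T A) (fob T B) B k (fmor T A B f)}),
      Ident = (\<lambda>(A, h). Ident C A),
      Cmp = (\<lambda>(A, _) (B, _) (D, _). Cmp C A B D)\<rparr>"

definition comparison ::
  "('o, 'm, 'p, 'n) func \<Rightarrow> ('p, 'n, 'o, 'm) func \<Rightarrow> ('p \<Rightarrow> 'n) \<Rightarrow> ('p, 'n, 'o \<times> 'm, 'm) func" where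
  "comparison F U \<epsilon> =
     \<lparr>fob = (\<lambda>B. (fob U B, fmor U (fob F (fob U B)) B (\<epsilon> B))), fmor = fmor U\<rparr>"

definition monadic ::
  "('o, 'm) category \<Rightarrow> ('p, 'n) category \<Rightarrow> ('o, 'm, 'p, 'n) func \<Rightarrow> ('p, 'n, 'o, 'm) func
     \<Rightarrow> ('o \<Rightarrow> 'm) \<Rightarrow> ('p \<Rightarrow> 'n) \<Rightarrow> bool" where
  "monadic C D F U \<eta> \<epsilon> \<longleftrightarrow>
     adjunction C D F U \<eta> \<epsilon> \<and>
     category_isomorphism D
       (algebras C (func_comp U F) \<eta>
          (\<lambda>A. fmor U (fob F (fob U (fob F A))) (fob F A) (\<epsilon> (fob F A))))
       (comparison F U \<epsilon>)"


section \<open>Equivariant bundles and complex affine actions\<close>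

text \<open>Points of total spaces are taken from a type that contains an arbitrary type \<open>'a\<close> and is closed
  under forming points \<open>((x, \<alpha>), e)\<close> (written \<open>Plus (x, \<alpha>) e\<close>) of \<open>(\<gg>\<^sub>\<complex>)\<^sub>X \<oplus> E\<close>, so that the
  functor \<open>F\<close> stays inside one type of bundles.\<close>

datatype ('x, 'c, 'a) bundle_pt = Pt 'a | Plus "'x \<times> 'c" "('x, 'c, 'a) bundle_pt"

type_synonym ('x, 'g, 'a) pt = "('x, 'g ctvec, 'a) bundle_pt"

type_synonym ('x, 'g, 'a) G_bundle =
  "('x, ('x, 'g, 'a) pt) cbundle \<times> ('g \<times> ('x, 'g, 'a) pt \<Rightarrow> ('x, 'g, 'a) pt)"

type_synonym ('x, 'g, 'a) affine_bundle =
  "('x, ('x, 'g, 'a) pt) cbundle \<times> (('g \<times> 'g ctvec) \<times> ('x, 'g, 'a) pt \<Rightarrow> ('x, 'g, 'a) pt)"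

type_synonym ('x, 'g, 'a) bundle_map = "('x, 'g, 'a) pt \<Rightarrow> ('x, 'g, 'a) pt"

definition is_G_bundle ::
  "'g lie_group \<Rightarrow> 'x smooth_mfd \<Rightarrow> ('g \<times> 'x \<Rightarrow> 'x) \<Rightarrow>
     ('x, 'p) cbundle \<Rightarrow> ('g \<times> 'p \<Rightarrow> 'p) \<Rightarrow> bool" where
  "is_G_bundle G X t E \<rho> \<longleftrightarrow>
     complex_vector_bundle X E \<and>
     \<rho> \<in> extensional (carrier G \<times> points (tot E)) \<and>
     left_action G (points (tot E)) \<rho> \<and>
     smooth_map (prod_mfd (mfd G) (tot E)) (tot E) \<rho> \<and>
     (\<forall>g\<in>carrier G. \<forall>e\<in>points (tot E). proj E (\<rho> (g, e)) = t (g, proj E e)) \<and>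
     (\<forall>g\<in>carrier G. \<forall>e\<in>points (tot E). \<forall>e'\<in>points (tot E). proj E e = proj E e' \<longrightarrow>
        \<rho> (g, vadd E e e') = vadd E (\<rho> (g, e)) (\<rho> (g, e'))) \<and>
     (\<forall>g\<in>carrier G. \<forall>a. \<forall>e\<in>points (tot E). \<rho> (g, vscale E a e) = vscale E a (\<rho> (g, e)))"

definition is_affine_action ::
  "'g lie_group \<Rightarrow> 'x smooth_mfd \<Rightarrow> ('g \<times> 'x \<Rightarrow> 'x) \<Rightarrow>
     ('x, 'p) cbundle \<Rightarrow> (('g \<times> 'g ctvec) \<times> 'p \<Rightarrow> 'p) \<Rightarrow> bool" where
  "is_affine_action G X t E A \<longleftrightarrow>
     complex_vector_bundle X E \<and>
     A \<in> extensional (carrier (TC G) \<times> points (tot E)) \<and>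
     left_action (TC G) (points (tot E)) A \<and>
     cbundle_morphism (prod_cbundle (ctangent_cbundle (mfd G)) E) E t A"

definition equivariant_morphisms ::
  "('h, 'b) monoid_scheme \<Rightarrow> ('x, 'p) cbundle \<times> ('h \<times> 'p \<Rightarrow> 'p) \<Rightarrow>
     ('x, 'p) cbundle \<times> ('h \<times> 'p \<Rightarrow> 'p) \<Rightarrow> ('p \<Rightarrow> 'p) set" where
  "equivariant_morphisms H = (\<lambda>(E, a) (E', a').
     {\<psi>. \<psi> \<in> extensional (points (tot E)) \<and> cbundle_morphism E E' id \<psi> \<and>
         (\<forall>g\<in>carrier H. \<forall>e\<in>points (tot E). \<psi> (a (g, e)) = a' (g, \<psi> e))})"

definition VectG ::
  "'a itself \<Rightarrow> 'g lie_group \<Rightarrow> 'x smooth_mfd \<Rightarrow> ('g \<times> 'x \<Rightarrow> 'x) \<Rightarrow>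
     (('x, 'g, 'a) G_bundle, ('x, 'g, 'a) bundle_map) category" where
  "VectG _ G X t =
     \<lparr>Obj = {(E, \<rho>). is_G_bundle G X t E \<rho>},
      Hom = equivariant_morphisms G,
      Ident = (\<lambda>(E, _). restrict id (points (tot E))),
      Cmp = (\<lambda>(E, _) _ _ g f. compose (points (tot E)) g f)\<rparr>"

definition VectAff ::
  "'a itself \<Rightarrow> 'g lie_group \<Rightarrow> 'x smooth_mfd \<Rightarrow> ('g \<times> 'x \<Rightarrow> 'x) \<Rightarrow>
     (('x, 'g, 'a) affine_bundle, ('x, 'g, 'a) bundle_map) category" where
  "VectAff _ G X t =
     \<lparr>Obj = {(E, A). is_affine_action G X t E A},
      Hom = equivariant_morphisms (TC G),
      Ident = (\<lambda>(E, _). restrict id (points (tot E))),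
      Cmp = (\<lambda>(E, _) _ _ g f. compose (points (tot E)) g f)\<rparr>"

definition UC ::
  "'a itself \<Rightarrow> 'g lie_group \<Rightarrow>
     (('x, 'g, 'a) affine_bundle, ('x, 'g, 'a) bundle_map,
      ('x, 'g, 'a) G_bundle, ('x, 'g, 'a) bundle_map) func" where
  "UC _ G =
     \<lparr>fob = (\<lambda>(E, A). (E, restrict (\<lambda>(g, e). A ((g, ct_zero), e)) (carrier G \<times> points (tot E)))),
      fmor = (\<lambda>_ _ \<psi>. \<psi>)\<rparr>"

definition sigmaC ::
  "'a itself \<Rightarrow> 'g lie_group \<Rightarrow>
     (('x, 'g, 'a) G_bundle, ('x, 'g, 'a) bundle_map,
      ('x, 'g, 'a) affine_bundle, ('x, 'g, 'a) bundle_map) func" where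
  "sigmaC _ G =
     \<lparr>fob = (\<lambda>(E, \<rho>). (E, restrict (\<lambda>((g, v), e). \<rho> (g, e)) (carrier (TC G) \<times> points (tot E)))),
      fmor = (\<lambda>_ _ \<psi>. \<psi>)\<rparr>"

definition free_points :: "'g lie_group \<Rightarrow> ('x, ('x, 'g, 'a) pt) cbundle \<Rightarrow> ('x, 'g, 'a) pt set" where
  "free_points G E = {Plus (proj E e, \<alpha>) e | \<alpha> e. \<alpha> \<in> lie_gC G \<and> e \<in> points (tot E)}"

text \<open>The Whitney sum \<open>(\<gg>\<^sub>\<complex>)\<^sub>X \<oplus> E\<close>. As the first summand is the trivial bundle \<open>X \<times> \<gg>\<^sub>\<complex>\<close>, its total
  space is identified with the product manifold \<open>\<gg>\<^sub>\<complex> \<times> E\<close> by \<open>((x, \<alpha>), e) \<mapsto> (\<alpha>, e)\<close>.\<close>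

definition free_cbundle ::
  "'g lie_group \<Rightarrow> 'x smooth_mfd \<Rightarrow> ('x, ('x, 'g, 'a) pt) cbundle \<Rightarrow> ('x, ('x, 'g, 'a) pt) cbundle" where
  "free_cbundle G X E =
     \<lparr>tot = transport_mfd (free_points G E)
         (\<lambda>p. case p of Plus (x, \<alpha>) e \<Rightarrow> (\<alpha>, e) | Pt _ \<Rightarrow> undefined)
         (prod_mfd (ctangent_space_mfd (mfd G) \<one>\<^bsub>G\<^esub>) (tot E)),
      proj = restrict (\<lambda>p. case p of Plus (x, \<alpha>) e \<Rightarrow> x | Pt _ \<Rightarrow> undefined) (free_points G E),
      vadd = (\<lambda>p q. if p \<in> free_points G E \<and> q \<in> free_points G E then
         (case (p, q) of
            (Plus (x, \<alpha>) e, Plus (y, \<beta>) f) \<Rightarrow>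
              if x = y then Plus (x, ct_add \<alpha> \<beta>) (vadd E e f) else undefined
          | _ \<Rightarrow> undefined) else undefined),
      vzero = restrict (\<lambda>x. Plus (x, ct_zero) (vzero E x)) (points X),
      vscale = (\<lambda>a p. if p \<in> free_points G E then
         (case p of Plus (x, \<alpha>) e \<Rightarrow> Plus (x, ct_scale a \<alpha>) (vscale E a e) | Pt _ \<Rightarrow> undefined)
         else undefined)\<rparr>"

definition FC ::
  "'a itself \<Rightarrow> 'g lie_group \<Rightarrow> 'x smooth_mfd \<Rightarrow> ('g \<times> 'x \<Rightarrow> 'x) \<Rightarrow>
     (('x, 'g, 'a) G_bundle, ('x, 'g, 'a) bundle_map,
      ('x, 'g, 'a) affine_bundle, ('x, 'g, 'a) bundle_map) func" where
  "FC _ G X t =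
     \<lparr>fob = (\<lambda>(E, \<rho>). (free_cbundle G X E,
         restrict (\<lambda>((g, v), p). case p of
             Plus (x, \<alpha>) e \<Rightarrow>
               Plus (t (g, x), ct_add (Ad G g \<alpha>) (right_transport G (g, v))) (\<rho> (g, e))
           | Pt _ \<Rightarrow> undefined)
           (carrier (TC G) \<times> free_points G E))),
      fmor = (\<lambda>(E, _) _ \<psi>.
         restrict (\<lambda>p. case p of Plus u e \<Rightarrow> Plus u (\<psi> e) | Pt _ \<Rightarrow> undefined) (free_points G E))\<rparr>"

end

(*
  The unit is e |-> (0, e). For an affine action A on E the counit sends ((x, a), e) to a . e, which
  is phi(x, a) + e because the action is affine; it is equivariant because in T_C G
    (1, Ad_g a + (R_(g^-1))_* v) * 0_g = (g, (L_g)_* a + v) = v * (1, a).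
  Smoothness of (v_g, a) |-> Ad_g a + (R_(g^-1))_* v follows from one fact about manifolds: if
  f : Q x M -> N is smooth, then so is the fibrewise derivative Q x T_C M -> T_C N.

  Monadicity is shown for an arbitrary unit eta and counit eps of F -| U. An algebra h on E carries the
  action v . e = h (v . eta e). For p in F E, naturality of eta at h gives eta (h p) = (F h) (eta p), so
    h (v . eta (h p)) = h ((F h) (v . eta p)) = h (eps (v . eta p)) = h (v . eps (eta p)) = h (v . p),
  i.e. h is equivariant; the axioms of an action and eps = h follow.

  If S is a section of U, the zero endomorphism of E is a G-morphism, hence commutes with the affine
  action of S E. So v . 0 = 0 for all v, and v . e = (v + 0_g) . (0 + e) = v . 0 + 0_g . e = g e.
*)
theory Submission
  imports Defs
begin

section \<open>Calculus on open subsets of Euclidean spaces\<close>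

text \<open>The overview speaks of actions and functors; most of the length is the analysis beneath
  them. Smoothness means iterated partial derivatives of functions on
  \<open>nat \<Rightarrow> real\<close>, so the chain rule has to be earned from continuous partial
  derivatives alone, and every smooth bundle map is then assembled from compositions, pairings,
  projections and a few maps written out in charts. Two demands fix the amount of geometry. The
  total space of the free bundle must again carry a maximal atlas and a Hausdorff, second countable
  topology, which leads to products and transport of structure. And the action on it must be smooth
  in the group element as well as in the vector, which leads to tangent maps with parameters. Smooth
  maps and tangent vectors are developed for \<open>pre_mfd\<close>, which keeps the chart axioms
  and leaves the topology aside, so that open pieces and tangent bundles enter without topological
  proofs. As the comparison functor must be an isomorphism and not just an equivalence, bundles and
  actions are compared by equality; the \<open>extensional\<close> conditions turn pointwise
  agreement into equality.\<close>

abbreviation EE :: "nat \<Rightarrow> (nat \<Rightarrow> real) set" where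
  "EE n \<equiv> topspace (Euclidean_space n)"

abbreviation eopen :: "nat \<Rightarrow> (nat \<Rightarrow> real) set \<Rightarrow> bool" where
  "eopen n \<equiv> openin (Euclidean_space n)"

text \<open>Sup-norm cubes rather than balls: replacing some coordinates of the centre by those of
  another point of the cube never leaves it, and the slope argument below depends on that.\<close>

definition ebox :: "nat \<Rightarrow> (nat \<Rightarrow> real) \<Rightarrow> real \<Rightarrow> (nat \<Rightarrow> real) set" where
  "ebox n x e = {y \<in> EE n. \<forall>i<n. \<bar>y i - x i\<bar> < e}"

lemma EE_iff: "x \<in> EE n \<longleftrightarrow> (\<forall>i\<ge>n. x i = 0)"
  by (simp add: topspace_Euclidean_space)

lemma Euclidean_space_top_of_set: "Euclidean_space n = top_of_set (EE n)"
  by (simp add: Euclidean_space_def euclidean_product_topology)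

lemma eopen_iff_open: "eopen n U \<longleftrightarrow> (\<exists>T. open T \<and> U = EE n \<inter> T)"
  by (subst Euclidean_space_top_of_set) (auto simp: openin_open)

lemma eopen_trans: "eopen n U \<Longrightarrow> openin (top_of_set U) W \<Longrightarrow> eopen n W"
  by (subst (asm) (1) Euclidean_space_top_of_set, subst Euclidean_space_top_of_set) (rule openin_trans)

lemma EE_upd: "x \<in> EE n \<Longrightarrow> i < n \<Longrightarrow> x(i := s) \<in> EE n"
  by (auto simp: EE_iff)

lemma EE_eqI: "x \<in> EE n \<Longrightarrow> y \<in> EE n \<Longrightarrow> (\<And>i. i < n \<Longrightarrow> x i = y i) \<Longrightarrow> x = y"
  by (rule ext) (metis EE_iff not_le)

lemma eopen_subset: "eopen n U \<Longrightarrow> U \<subseteq> EE n"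
  by (rule openin_subset)

lemma eopen_EE: "eopen n (EE n)"
  by (rule openin_topspace)

lemma eopen_ebox: "eopen n (ebox n x e)"
proof -
  \<comment> \<open>Only finitely many coordinates are constrained, so this is a basic open set of
    the product topology; \<open>EE n\<close> pins the others to 0.\<close>
  have "open {y. \<forall>i\<in>{..<n}. y (id i) \<in> {z. \<bar>z - x i\<bar> < e}}"
  proof (rule product_topology_basis')
    show "open {z. \<bar>z - x i\<bar> < e}" for i
      using open_ball[of "x i" e] by (simp add: ball_def dist_real_def abs_minus_commute)
  qed simp
  then show ?thesis
    unfolding eopen_iff_open ebox_def by (intro exI conjI) (assumption, auto)
qed

lemma ebox_centre: "x \<in> EE n \<Longrightarrow> 0 < e \<Longrightarrow> x \<in> ebox n x e"
  by (simp add: ebox_def)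

lemma ebox_mono: "d \<le> e \<Longrightarrow> ebox n x d \<subseteq> ebox n x e"
  by (auto simp: ebox_def)

lemma eopen_contains_ebox:
  assumes "eopen n U" "x \<in> U"
  obtains e where "e > 0" "ebox n x e \<subseteq> U"
proof -
  obtain T where T: "open T" "U = EE n \<inter> T"
    using assms(1) by (auto simp: eopen_iff_open)
  have "openin (product_topology (\<lambda>i. euclidean) UNIV) T" "x \<in> T"
    using T assms(2) by (auto simp: euclidean_product_topology)
  then obtain Y where Y: "x \<in> Pi\<^sub>E UNIV Y" "\<And>i. open (Y i)" "Pi\<^sub>E UNIV Y \<subseteq> T"
    using product_topology_open_contains_basis[of "\<lambda>i. euclidean" UNIV T x] by auto
  have "\<exists>e>0. \<forall>z. \<bar>z - x i\<bar> < e \<longrightarrow> z \<in> Y i" for i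
  proof -
    have "x i \<in> Y i" using Y(1) by auto
    with Y(2)[of i] obtain e where "e > 0" "ball (x i) e \<subseteq> Y i"
      using openE by blast
    then show ?thesis
      by (intro exI[of _ e]) (auto simp: ball_def dist_real_def subset_iff abs_minus_commute)
  qed
  then obtain e where e: "\<And>i. e i > 0" "\<And>i z. \<bar>z - x i\<bar> < e i \<Longrightarrow> z \<in> Y i"
    by metis
  \<comment> \<open>Radii are taken only for coordinates below n, since all points of
    \<open>EE n\<close> agree from n on. The 1 keeps the set nonempty when n = 0.\<close>
  define d where "d = Min (insert 1 (e ` {..<n}))"
  have "d > 0" using e(1) by (auto simp: d_def)
  moreover have "ebox n x d \<subseteq> U"
  proof
    fix y assume y: "y \<in> ebox n x d"
    have "y i \<in> Y i" for i
    proof (cases "i < n")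
      case True
      then have "d \<le> e i" by (auto simp: d_def)
      moreover have "\<bar>y i - x i\<bar> < d" using y True by (simp add: ebox_def)
      ultimately show ?thesis by (intro e(2)) simp
    next
      case False
      then have "y i = x i"
        using y assms(2) T(2) by (simp add: ebox_def EE_iff)
      then show ?thesis using Y(1) by auto
    qed
    then have "y \<in> T" using Y(3) by auto
    then show "y \<in> U" using y T(2) by (simp add: ebox_def)
  qed
  ultimately show ?thesis using that by blast
qed

lemma eopenI:
  assumes "\<And>x. x \<in> U \<Longrightarrow> \<exists>V. eopen n V \<and> x \<in> V \<and> V \<subseteq> U"
  shows "eopen n U"
  using assms openin_subopen by blast

lemma continuous_map_eopen:
  assumes "eopen n U"
  shows "continuous_map (subtopology (Euclidean_space n) U) euclideanreal f \<longleftrightarrow> continuous_on U f"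
proof -
  have "EE n \<inter> U = U" using eopen_subset[OF assms] by blast
  then show ?thesis
    by (subst Euclidean_space_top_of_set) (simp add: subtopology_subtopology)
qed

lemma continuous_on_ebox:
  fixes f :: "(nat \<Rightarrow> real) \<Rightarrow> real"
  assumes "eopen n U" "continuous_on U f" "x \<in> U" "e > 0"
  obtains d where "d > 0" "ebox n x d \<subseteq> U" "\<And>y. y \<in> ebox n x d \<Longrightarrow> \<bar>f y - f x\<bar> < e"
proof -
  have "openin (top_of_set U) (U \<inter> f -` ball (f x) e)"
    using assms(2) by (rule continuous_openin_preimage_gen) simp
  then have "eopen n (U \<inter> f -` ball (f x) e)"
    using assms(1) eopen_trans by blast
  moreover have "x \<in> U \<inter> f -` ball (f x) e" using assms by simp
  ultimately obtain d where "d > 0" "ebox n x d \<subseteq> U \<inter> f -` ball (f x) e"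
    by (rule eopen_contains_ebox)
  then show ?thesis
    by (intro that[of d]) (auto simp: ball_def dist_real_def abs_minus_commute subset_iff)
qed

lemma eopen_preimage:
  assumes "eopen n U" "eopen m V" "\<And>x. x \<in> U \<Longrightarrow> F x \<in> EE m"
    and "\<And>j. j < m \<Longrightarrow> continuous_on U (\<lambda>x. F x j)"
  shows "eopen n {x \<in> U. F x \<in> V}"
proof -
  obtain T where T: "open T" "V = EE m \<inter> T"
    using assms(2) by (auto simp: eopen_iff_open)
  \<comment> \<open>From m on the coordinates of F are constantly 0, because F maps U into
    \<open>EE m\<close>.\<close>
  have "continuous_on U (\<lambda>x. F x j)" for j
  proof (cases "j < m")
    case False
    then have "\<And>x. x \<in> U \<Longrightarrow> F x j = 0" using assms(3) by (simp add: EE_iff)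
    then show ?thesis using continuous_on_cong[of U U "\<lambda>x. F x j" "\<lambda>x. 0"] by simp
  qed (rule assms(4))
  then have "continuous_on U F" by (rule continuous_on_coordinatewise_then_product)
  then have "openin (top_of_set U) (U \<inter> F -` T)"
    using T(1) by (rule continuous_openin_preimage_gen)
  then have "eopen n (U \<inter> F -` T)"
    using assms(1) eopen_trans by blast
  moreover have "U \<inter> F -` T = {x \<in> U. F x \<in> V}" using T(2) assms(3) by auto
  ultimately show ?thesis by simp
qed

section \<open>Partial derivatives, C^k functions and the chain rule\<close>

lemma upd_eventually:
  assumes "eopen n U" "x \<in> U" "i < n"
  shows "eventually (\<lambda>s. x(i := s) \<in> U) (nhds (x i))"
proof -
  obtain e where e: "e > 0" "ebox n x e \<subseteq> U"
    using eopen_contains_ebox[OF assms(1,2)] .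
  have x: "x \<in> EE n" using eopen_subset[OF assms(1)] assms(2) by blast
  have "x(i := s) \<in> U" if "dist s (x i) < e" for s
  proof -
    have "x(i := s) \<in> ebox n x e"
      using that e(1) EE_upd[OF x assms(3)] by (auto simp: ebox_def dist_real_def)
    then show ?thesis using e(2) by blast
  qed
  then show ?thesis using e(1) by (auto simp: eventually_nhds_metric)
qed

text \<open>\<open>pderiv_at\<close> is total and has some value even where no derivative exists;
  the relational form also records existence.\<close>

definition has_pderiv :: "nat \<Rightarrow> ((nat \<Rightarrow> real) \<Rightarrow> real) \<Rightarrow> (nat \<Rightarrow> real) \<Rightarrow> real \<Rightarrow> bool" where
  "has_pderiv i f x D \<longleftrightarrow> ((\<lambda>s. f (x(i := s))) has_real_derivative D) (at (x i))"

lemma has_pderivD: "has_pderiv i f x D \<Longrightarrow> pderiv_at i f x = D"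
  unfolding has_pderiv_def pderiv_at_def by (rule DERIV_imp_deriv)

lemma has_pderiv_diff: "has_pderiv i f x D \<Longrightarrow> (\<lambda>s. f (x(i := s))) differentiable (at (x i))"
  unfolding has_pderiv_def by (auto simp: real_differentiable_def)

lemma diff_has_pderiv:
  "(\<lambda>s. f (x(i := s))) differentiable (at (x i)) \<Longrightarrow> has_pderiv i f x (pderiv_at i f x)"
  unfolding has_pderiv_def pderiv_at_def by (simp add: DERIV_deriv_iff_real_differentiable)

lemma has_pderiv_cong:
  assumes "eopen n U" "x \<in> U" "i < n" "\<And>y. y \<in> U \<Longrightarrow> f y = g y"
  shows "has_pderiv i f x D \<longleftrightarrow> has_pderiv i g x D"
  unfolding has_pderiv_def
  by (rule DERIV_cong_ev[OF refl _ refl])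
    (use upd_eventually[OF assms(1-3)] assms(4) in \<open>auto elim: eventually_mono\<close>)

text \<open>\<open>deriv\<close> selects a value from the derivative relation, so equal relations
  give equal selections whether or not a derivative exists.\<close>

lemma pderiv_at_cong:
  assumes "eopen n U" "x \<in> U" "i < n" "\<And>y. y \<in> U \<Longrightarrow> f y = g y"
  shows "pderiv_at i f x = pderiv_at i g x"
proof -
  have "has_pderiv i f x D \<longleftrightarrow> has_pderiv i g x D" for D
    using has_pderiv_cong[OF assms(1-3), of f g] assms(4) by blast
  then show ?thesis unfolding has_pderiv_def pderiv_at_def deriv_def by simp
qed

lemma Ck_on_Suc_iff:
  assumes "eopen n U"
  shows "Ck_on n (Suc k) U f \<longleftrightarrow> continuous_on U f \<and>
    (\<forall>i<n. (\<forall>x\<in>U. has_pderiv i f x (pderiv_at i f x)) \<and> Ck_on n k U (pderiv_at i f))"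
proof -
  have "(\<lambda>s. f (x(i := s))) differentiable (at (x i)) \<longleftrightarrow> has_pderiv i f x (pderiv_at i f x)" for i x
    using has_pderiv_diff diff_has_pderiv by blast
  then show ?thesis by (simp only: Ck_on.simps continuous_map_eopen[OF assms])
qed

lemma Ck_on_0_iff: "eopen n U \<Longrightarrow> Ck_on n 0 U f \<longleftrightarrow> continuous_on U f"
  by (simp add: continuous_map_eopen)

text \<open>From here on unfolding goes through the equivalences above, phrased with
  \<open>continuous_on\<close> and \<open>has_pderiv\<close> instead of subspace topologies.\<close>

declare Ck_on.simps [simp del]

lemma Ck_on_continuous: "eopen n U \<Longrightarrow> Ck_on n k U f \<Longrightarrow> continuous_on U f"
  by (cases k) (auto simp: Ck_on_0_iff Ck_on_Suc_iff)

lemma Ck_on_SucD: "eopen n U \<Longrightarrow> Ck_on n (Suc k) U f \<Longrightarrow> Ck_on n k U f"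
proof (induction k arbitrary: f)
  case 0
  then show ?case by (simp add: Ck_on_0_iff Ck_on_Suc_iff)
next
  case (Suc k)
  then show ?case by (subst Ck_on_Suc_iff) (auto simp: Ck_on_Suc_iff[where k = "Suc k"])
qed

lemma Ck_on_cong:
  assumes "eopen n U" "\<And>x. x \<in> U \<Longrightarrow> f x = g x" "Ck_on n k U f"
  shows "Ck_on n k U g"
  using assms(2,3)
proof (induction k arbitrary: f g)
  case 0
  then show ?case using assms(1) continuous_on_cong[of U U f g] by (simp add: Ck_on_0_iff)
next
  case (Suc k)
  have "continuous_on U g"
    using Suc.prems assms(1) continuous_on_cong[of U U f g] by (simp add: Ck_on_Suc_iff)
  moreover have "has_pderiv i g x (pderiv_at i g x)" if "i < n" "x \<in> U" for i x
  proof -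
    have "has_pderiv i f x (pderiv_at i f x)"
      using Suc.prems(2) that assms(1) by (auto simp: Ck_on_Suc_iff)
    then have "has_pderiv i g x (pderiv_at i f x)"
      using has_pderiv_cong[OF assms(1) that(2,1), of f g] Suc.prems(1) by blast
    then show ?thesis using has_pderivD by metis
  qed
  moreover have "Ck_on n k U (pderiv_at i g)" if "i < n" for i
    by (rule Suc.IH[of "pderiv_at i f"])
      (use that Suc.prems assms(1) pderiv_at_cong[OF assms(1) _ that, of _ f g] in \<open>auto simp: Ck_on_Suc_iff\<close>)
  ultimately show ?case using assms(1) by (auto simp: Ck_on_Suc_iff)
qed

lemma Ck_on_subset:
  assumes "eopen n U" "eopen n V" "V \<subseteq> U" "Ck_on n k U f"
  shows "Ck_on n k V f"
  using assms(4)
proof (induction k arbitrary: f)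
  case 0
  then show ?case using assms continuous_on_subset by (auto simp: Ck_on_0_iff)
next
  case (Suc k)
  then show ?case
    using assms(1-3) continuous_on_subset[of U f V] by (auto simp: Ck_on_Suc_iff)
qed

lemma continuous_on_local:
  assumes "eopen n U" "\<And>x. x \<in> U \<Longrightarrow> \<exists>V. eopen n V \<and> x \<in> V \<and> continuous_on V f"
  shows "continuous_on U (f :: (nat \<Rightarrow> real) \<Rightarrow> real)"
  unfolding continuous_on_eq_continuous_within
proof
  fix x assume x: "x \<in> U"
  obtain V where V: "eopen n V" "x \<in> V" "continuous_on V f" using assms(2)[OF x] by blast
  obtain T where T: "open T" "V \<inter> U = EE n \<inter> T"
    using V(1) assms(1) openin_Int by (metis eopen_iff_open)
  \<comment> \<open>\<open>T\<close> cuts the same piece out of U as out of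
    \<open>V \<inter> U\<close>, so a limit at x cannot tell the two sets apart.\<close>
  have "at x within U = at x within (V \<inter> U)"
    by (rule at_within_nhd[of x T]) (use T x V eopen_subset[OF assms(1)] in auto)
  moreover have "continuous (at x within (V \<inter> U)) f"
    using V x continuous_on_subset[OF V(3), of "V \<inter> U"] by (simp add: continuous_on_eq_continuous_within)
  ultimately show "continuous (at x within U) f" by (simp add: continuous_within)
qed

lemma Ck_on_local:
  assumes "eopen n U" "\<And>x. x \<in> U \<Longrightarrow> \<exists>V. eopen n V \<and> x \<in> V \<and> Ck_on n k V f"
  shows "Ck_on n k U f"
  using assms(2)
proof (induction k arbitrary: f)
  case (0 f)
  then show ?case
    using continuous_on_local[OF assms(1), of f] assms(1) by (metis Ck_on_0_iff)
next
  case (Suc k f)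
  have "continuous_on U f"
    using continuous_on_local[OF assms(1), of f] Suc.prems by (metis Ck_on_Suc_iff)
  moreover have "has_pderiv i f x (pderiv_at i f x)" if "i < n" "x \<in> U" for i x
    using Suc.prems[OF that(2)] that(1) by (auto simp: Ck_on_Suc_iff)
  moreover have "Ck_on n k U (pderiv_at i f)" if "i < n" for i
  proof (rule Suc.IH)
    fix x assume "x \<in> U"
    from Suc.prems[OF this] show "\<exists>V. eopen n V \<and> x \<in> V \<and> Ck_on n k V (pderiv_at i f)"
      using that by (auto simp: Ck_on_Suc_iff)
  qed
  ultimately show ?case using assms(1) by (auto simp: Ck_on_Suc_iff)
qed

lemma Ck_on_const: "eopen n U \<Longrightarrow> Ck_on n k U (\<lambda>x. c)"
proof (induction k arbitrary: c)
  case (Suc k)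
  have p: "has_pderiv i (\<lambda>x. c) x 0" for i x by (simp add: has_pderiv_def)
  then have "pderiv_at i (\<lambda>x. c) = (\<lambda>x. 0)" for i using has_pderivD by blast
  with p Suc show ?case by (simp add: Ck_on_Suc_iff)
qed (simp add: Ck_on_0_iff)

lemma Ck_on_coord: "eopen n U \<Longrightarrow> Ck_on n k U (\<lambda>x. x i)"
proof (cases k)
  case 0
  then show "eopen n U \<Longrightarrow> ?thesis"
    using continuous_on_subset[OF continuous_on_product_coordinates] by (auto simp: Ck_on_0_iff)
next
  case (Suc k)
  have p: "has_pderiv j (\<lambda>x. x i) x (if i = j then 1 else 0)" for j x
    by (auto simp: has_pderiv_def)
  then have "pderiv_at j (\<lambda>x. x i) = (\<lambda>x. if i = j then 1 else 0)" for j using has_pderivD by blast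
  with p Suc show "eopen n U \<Longrightarrow> ?thesis"
    using continuous_on_subset[OF continuous_on_product_coordinates]
    by (auto simp: Ck_on_Suc_iff Ck_on_const)
qed

lemma has_pderiv_add:
  "has_pderiv i f x a \<Longrightarrow> has_pderiv i g x b \<Longrightarrow> has_pderiv i (\<lambda>x. f x + g x) x (a + b)"
  unfolding has_pderiv_def by (rule DERIV_add)

lemma has_pderiv_mult:
  "has_pderiv i f x a \<Longrightarrow> has_pderiv i g x b \<Longrightarrow> has_pderiv i (\<lambda>x. f x * g x) x (a * g x + f x * b)"
  unfolding has_pderiv_def by (drule (1) DERIV_mult) (simp add: algebra_simps)

lemma Ck_on_add:
  assumes U: "eopen n U" shows "Ck_on n k U f \<Longrightarrow> Ck_on n k U g \<Longrightarrow> Ck_on n k U (\<lambda>x. f x + g x)"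
proof (induction k arbitrary: f g)
  case 0
  then show ?case using U by (simp add: Ck_on_0_iff continuous_on_add)
next
  case (Suc k)
  have p: "has_pderiv i (\<lambda>x. f x + g x) x (pderiv_at i f x + pderiv_at i g x)" if "i < n" "x \<in> U" for i x
    using Suc.prems that U by (auto simp: Ck_on_Suc_iff intro!: has_pderiv_add)
  have "Ck_on n k U (pderiv_at i (\<lambda>x. f x + g x))" if "i < n" for i
    by (rule Ck_on_cong[OF U _ Suc.IH[of "pderiv_at i f" "pderiv_at i g"]])
      (use has_pderivD[OF p] Suc.prems U that in \<open>auto simp: Ck_on_Suc_iff\<close>)
  then show ?case
    using Suc.prems U has_pderivD[OF p] p by (auto simp: Ck_on_Suc_iff continuous_on_add)
qed

lemma Ck_on_mult:
  assumes U: "eopen n U" shows "Ck_on n k U f \<Longrightarrow> Ck_on n k U g \<Longrightarrow> Ck_on n k U (\<lambda>x. f x * g x)"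
proof (induction k arbitrary: f g)
  case 0
  then show ?case using U by (simp add: Ck_on_0_iff continuous_on_mult)
next
  case (Suc k)
  have p: "has_pderiv i (\<lambda>x. f x * g x) x (pderiv_at i f x * g x + f x * pderiv_at i g x)"
    if "i < n" "x \<in> U" for i x
    using Suc.prems that U by (auto simp: Ck_on_Suc_iff intro!: has_pderiv_mult)
  have "Ck_on n k U (pderiv_at i (\<lambda>x. f x * g x))" if "i < n" for i
  proof (rule Ck_on_cong[OF U])
    show "Ck_on n k U (\<lambda>x. pderiv_at i f x * g x + f x * pderiv_at i g x)"
      \<comment> \<open>The product rule contains f and g themselves besides their derivatives; they
        are lowered from order k + 1 to order k.\<close>
      using Suc.prems Ck_on_SucD[OF U] that U
      by (intro Ck_on_add Suc.IH) (auto simp: Ck_on_Suc_iff[OF U])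
  qed (use has_pderivD[OF p] that in auto)
  then show ?case
    using Suc.prems U has_pderivD[OF p] p by (auto simp: Ck_on_Suc_iff continuous_on_mult)
qed

lemma Ck_on_sum:
  assumes U: "eopen n U" and "finite I" "\<And>j. j \<in> I \<Longrightarrow> Ck_on n k U (f j)"
  shows "Ck_on n k U (\<lambda>x. \<Sum>j\<in>I. f j x)"
  using assms(2,3) by (induction I) (auto simp: Ck_on_const[OF U] Ck_on_add[OF U])

text \<open>Caratheodory slopes: \<open>f z - f y\<close> telescopes along the path from \<open>y\<close> to \<open>z\<close> that changes one
  coordinate at a time, and the mean value theorem applies to each step.\<close>

lemma C1_slopes:
  assumes U: "eopen m U" and f: "Ck_on m (Suc 0) U f" and y: "y \<in> U"
  obtains d g where "d > 0" "ebox m y d \<subseteq> U"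
    "\<forall>z\<in>ebox m y d. f z - f y = (\<Sum>j<m. g z j * (z j - y j))"
    "\<forall>e>0. \<exists>\<delta>>0. \<forall>z\<in>ebox m y \<delta>. \<forall>j<m. \<bar>g z j - pderiv_at j f y\<bar> < e"
proof -
  have yE: "y \<in> EE m" using eopen_subset[OF U] y by blast
  \<comment> \<open>The corner of the path after j steps: coordinates below j already belong to z,
    the others still to y.\<close>
  define w where "w z j = (\<lambda>i. if i < j then z i else y i)" for z :: "nat \<Rightarrow> real" and j
  \<comment> \<open>Where the j-th step has length 0, the sum leaves the slope free; the partial
    derivative at y is the value that makes the slopes continuous at y.\<close>
  define g where "g z j = (if z j = y j then pderiv_at j f y
    else (f (w z (Suc j)) - f (w z j)) / (z j - y j))" for z j
  have wSuc: "w z (Suc j) = (w z j)(j := z j)" and wj: "(w z j)(j := y j) = w z j" for z j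
    by (auto simp: w_def fun_eq_iff)
  have w0: "w z 0 = y" and wm: "z \<in> EE m \<Longrightarrow> w z m = z" for z
    using yE by (auto simp: w_def fun_eq_iff EE_iff)
  have tele: "f z - f y = (\<Sum>j<m. g z j * (z j - y j))" if "z \<in> EE m" for z
  proof -
    have "g z j * (z j - y j) = f (w z (Suc j)) - f (w z j)" for j
      using wSuc[of z j] wj[of z j] by (auto simp: g_def)
    then show ?thesis
      using sum_lessThan_telescope[of "\<lambda>j. f (w z j)" m] by (simp add: w0 wm[OF that])
  qed
  obtain d where d: "d > 0" "ebox m y d \<subseteq> U" using eopen_contains_ebox[OF U y] .
  have pd: "has_pderiv j f x (pderiv_at j f x)" if "x \<in> U" "j < m" for x j
    using f that U by (auto simp: Ck_on_Suc_iff)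
  have cont: "continuous_on U (pderiv_at j f)" if "j < m" for j
    using f that U by (auto simp: Ck_on_Suc_iff Ck_on_0_iff)
  \<comment> \<open>Not only the corners but all points on the edges of the path stay in the cube,
    so the partial derivatives exist along each edge.\<close>
  have wbox: "(w z j)(j := s) \<in> ebox m y \<delta>"
    if "z \<in> ebox m y \<delta>" "j < m" "\<bar>s - y j\<bar> < \<delta>" for z j s \<delta>
    using that yE by (auto simp: ebox_def w_def EE_iff)
  \<comment> \<open>By the mean value theorem every slope is a partial derivative at a point of the
    same cube. Continuity of the partial derivatives then gives the convergence of slopes.\<close>
  have slope: "\<exists>p\<in>ebox m y \<delta>. g z j = pderiv_at j f p"
    if z: "z \<in> ebox m y \<delta>" and j: "j < m" and \<delta>: "0 < \<delta>" "\<delta> \<le> d" for z j \<delta>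
  proof (cases "z j = y j")
    case True
    then show ?thesis using \<delta> by (intro bexI[of _ y]) (auto simp: g_def ebox_centre[OF yE])
  next
    case False
    define \<phi> where "\<phi> = (\<lambda>s. f ((w z j)(j := s)))"
    have zj: "\<bar>z j - y j\<bar> < \<delta>" using z j by (simp add: ebox_def)
    have der: "(\<phi> has_real_derivative pderiv_at j f ((w z j)(j := s))) (at s)" if "\<bar>s - y j\<bar> < \<delta>" for s
    proof -
      have "(w z j)(j := s) \<in> U" using wbox[OF z j that] ebox_mono[OF \<delta>(2)] d(2) by blast
      from pd[OF this j] show ?thesis by (simp add: has_pderiv_def \<phi>_def)
    qed
    have "\<exists>s. \<bar>s - y j\<bar> < \<delta> \<and> \<phi> (z j) - \<phi> (y j) = (z j - y j) * pderiv_at j f ((w z j)(j := s))"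
    \<comment> \<open>\<open>MVT2\<close> wants its endpoints in order; exchanging them changes the
      sign of both sides.\<close>
    proof (cases "y j < z j")
      case True
      have "\<exists>s. y j < s \<and> s < z j \<and> \<phi> (z j) - \<phi> (y j) = (z j - y j) * pderiv_at j f ((w z j)(j := s))"
        by (rule MVT2[OF True der]) (use zj in auto)
      then obtain s where "y j < s" "s < z j"
        "\<phi> (z j) - \<phi> (y j) = (z j - y j) * pderiv_at j f ((w z j)(j := s))" by blast
      then show ?thesis using zj by (intro exI[of _ s]) auto
    next
      case F: False
      have "\<exists>s. z j < s \<and> s < y j \<and> \<phi> (y j) - \<phi> (z j) = (y j - z j) * pderiv_at j f ((w z j)(j := s))"
        by (rule MVT2[OF _ der]) (use zj F False in auto)
      then obtain s where s: "z j < s" "s < y j"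
        "\<phi> (y j) - \<phi> (z j) = (y j - z j) * pderiv_at j f ((w z j)(j := s))" by blast
      show ?thesis by (rule exI[of _ s]) (use s zj in \<open>auto simp: algebra_simps\<close>)
    qed
    then obtain s where s: "\<bar>s - y j\<bar> < \<delta>"
      "\<phi> (z j) - \<phi> (y j) = (z j - y j) * pderiv_at j f ((w z j)(j := s))" by blast
    have "g z j = pderiv_at j f ((w z j)(j := s))"
      using s(2) False by (simp add: g_def \<phi>_def wSuc wj)
    then show ?thesis using wbox[OF z j s(1)] by blast
  qed
  have "\<exists>\<delta>>0. \<forall>z\<in>ebox m y \<delta>. \<forall>j<m. \<bar>g z j - pderiv_at j f y\<bar> < e" if e: "e > 0" for e
  proof -
    have "\<exists>\<delta>>0. \<forall>z\<in>ebox m y \<delta>. \<bar>pderiv_at j f z - pderiv_at j f y\<bar> < e" if "j < m" for j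
      by (rule continuous_on_ebox[OF U cont[OF that] y e]) blast
    then obtain D where D: "\<And>j. j < m \<Longrightarrow> D j > 0"
      "\<And>j z. j < m \<Longrightarrow> z \<in> ebox m y (D j) \<Longrightarrow> \<bar>pderiv_at j f z - pderiv_at j f y\<bar> < e"
      by metis
    \<comment> \<open>Including \<open>d\<close> keeps the cube inside U, where the slopes are
      controlled, and keeps the set nonempty when m = 0.\<close>
    define \<delta> where "\<delta> = Min (insert d (D ` {..<m}))"
    have \<delta>: "\<delta> > 0" "\<delta> \<le> d" "\<And>j. j < m \<Longrightarrow> \<delta> \<le> D j"
      using D(1) d(1) by (auto simp: \<delta>_def)
    show ?thesis
    proof (intro exI[of _ \<delta>] conjI ballI allI impI)
      fix z j assume "z \<in> ebox m y \<delta>" "j < m"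
      from slope[OF this \<delta>(1,2)] obtain p where "p \<in> ebox m y \<delta>" "g z j = pderiv_at j f p" by blast
      then show "\<bar>g z j - pderiv_at j f y\<bar> < e"
        using D(2)[OF \<open>j < m\<close>, of p] ebox_mono[OF \<delta>(3)[OF \<open>j < m\<close>]] by auto
    qed (rule \<delta>(1))
  qed
  then show ?thesis using that[OF d, of g] tele by (simp add: ebox_def)
qed

text \<open>Insert the slopes along the curve and divide by \<open>r - s\<close>: the slopes tend to
  the partial derivatives because the curve enters every cube around its value, and the coordinate
  quotients tend to \<open>d\<close>.\<close>

lemma C1_chain_curve:
  assumes U: "eopen m U" and f: "Ck_on m (Suc 0) U f" and y: "\<gamma> s \<in> U"
    and ev: "eventually (\<lambda>r. \<gamma> r \<in> EE m) (at s)"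
    and der: "\<And>j. j < m \<Longrightarrow> ((\<lambda>r. \<gamma> r j) has_real_derivative d j) (at s)"
  shows "((\<lambda>r. f (\<gamma> r)) has_real_derivative (\<Sum>j<m. pderiv_at j f (\<gamma> s) * d j)) (at s)"
proof -
  obtain e0 g where g: "e0 > 0" "ebox m (\<gamma> s) e0 \<subseteq> U"
    "\<forall>z\<in>ebox m (\<gamma> s) e0. f z - f (\<gamma> s) = (\<Sum>j<m. g z j * (z j - \<gamma> s j))"
    "\<forall>e>0. \<exists>\<delta>>0. \<forall>z\<in>ebox m (\<gamma> s) \<delta>. \<forall>j<m. \<bar>g z j - pderiv_at j f (\<gamma> s)\<bar> < e"
    using C1_slopes[OF U f y] .
  have box: "eventually (\<lambda>r. \<gamma> r \<in> ebox m (\<gamma> s) e) (at s)" if "e > 0" for e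
  proof -
    have "eventually (\<lambda>r. \<bar>\<gamma> r j - \<gamma> s j\<bar> < e) (at s)" if "j < m" for j
    proof -
      have "isCont (\<lambda>r. \<gamma> r j) s" using der[OF that] by (rule DERIV_isCont)
      then have "((\<lambda>r. \<gamma> r j) \<longlongrightarrow> \<gamma> s j) (at s)" by (simp add: isCont_def)
      from tendstoD[OF this \<open>e > 0\<close>] show ?thesis by (simp add: dist_real_def)
    qed
    then have "eventually (\<lambda>r. \<forall>j\<in>{..<m}. \<bar>\<gamma> r j - \<gamma> s j\<bar> < e) (at s)"
      by (intro eventually_ball_finite) auto
    with ev show ?thesis by eventually_elim (auto simp: ebox_def)
  qed
  have gl: "((\<lambda>r. g (\<gamma> r) j) \<longlongrightarrow> pderiv_at j f (\<gamma> s)) (at s)" if "j < m" for j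
  proof (rule tendstoI)
    fix e :: real assume "e > 0"
    from g(4) this obtain \<delta> where \<delta>: "\<delta> > 0"
      "\<And>z. z \<in> ebox m (\<gamma> s) \<delta> \<Longrightarrow> \<bar>g z j - pderiv_at j f (\<gamma> s)\<bar> < e"
      using \<open>j < m\<close> by metis
    show "eventually (\<lambda>r. dist (g (\<gamma> r) j) (pderiv_at j f (\<gamma> s)) < e) (at s)"
      using box[OF \<delta>(1)] by eventually_elim (simp add: \<delta>(2) dist_real_def)
  qed
  have "((\<lambda>r. \<Sum>j<m. g (\<gamma> r) j * ((\<gamma> r j - \<gamma> s j) / (r - s))) \<longlongrightarrow>
      (\<Sum>j<m. pderiv_at j f (\<gamma> s) * d j)) (at s)"
    using der by (intro tendsto_sum tendsto_mult gl) (auto simp: has_field_derivative_iff)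
  moreover have "eventually (\<lambda>r. (\<Sum>j<m. g (\<gamma> r) j * ((\<gamma> r j - \<gamma> s j) / (r - s)))
      = (f (\<gamma> r) - f (\<gamma> s)) / (r - s)) (at s)"
    using box[OF g(1)] by eventually_elim (simp add: g(3) sum_divide_distrib)
  ultimately show ?thesis
    unfolding has_field_derivative_iff by (rule Lim_transform_eventually)
qed

text \<open>Varying one coordinate of x makes F a curve, which reduces the chain rule to the one for
  curves.\<close>

lemma has_pderiv_compose:
  assumes U: "eopen n U" and V: "eopen m V" and f: "Ck_on m (Suc 0) V f"
    and F: "\<And>x. x \<in> U \<Longrightarrow> F x \<in> V" and x: "x \<in> U" and i: "i < n"
    and der: "\<And>j. j < m \<Longrightarrow> has_pderiv i (\<lambda>x. F x j) x (d j)"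
  shows "has_pderiv i (\<lambda>x. f (F x)) x (\<Sum>j<m. pderiv_at j f (F x) * d j)"
proof -
  have "((\<lambda>r. f (F (x(i := r)))) has_real_derivative (\<Sum>j<m. pderiv_at j f (F (x(i := x i))) * d j)) (at (x i))"
  proof (rule C1_chain_curve[OF V f])
    show "\<forall>\<^sub>F r in at (x i). F (x(i := r)) \<in> EE m"
      using upd_eventually[OF U x i] F eopen_subset[OF V]
      by (auto simp: eventually_at_filter elim!: eventually_mono)
  qed (use F x der in \<open>auto simp: has_pderiv_def\<close>)
  then show ?thesis by (simp add: has_pderiv_def)
qed

text \<open>By the chain rule the partial derivatives of the composite are sums of products of
  \<open>pderiv_at j f \<circ> F\<close> with derivatives of F. The first factor is C^k by induction
  applied to the partial derivatives of f, hence f is arbitrary in the induction.\<close>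

lemma Ck_on_compose:
  assumes U: "eopen n U" and V: "eopen m V" and FV: "\<And>x. x \<in> U \<Longrightarrow> F x \<in> V"
  shows "Ck_on m k V f \<Longrightarrow> (\<And>j. j < m \<Longrightarrow> Ck_on n k U (\<lambda>x. F x j)) \<Longrightarrow> Ck_on n k U (\<lambda>x. f (F x))"
proof (induction k arbitrary: f)
  case (0 f)
  have "continuous_on U (\<lambda>x. F x j)" for j
  proof (cases "j < m")
    case False
    then have "\<And>x. x \<in> U \<Longrightarrow> F x j = 0"
      using FV eopen_subset[OF V] by (auto simp: EE_iff subset_iff)
    then show ?thesis using continuous_on_cong[of U U "\<lambda>x. F x j" "\<lambda>x. 0"] by simp
  qed (use 0 in \<open>simp add: Ck_on_0_iff[OF U]\<close>)
  then have "continuous_on U F" by (rule continuous_on_coordinatewise_then_product)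
  then have "continuous_on U (f \<circ> F)"
    using 0 V FV by (intro continuous_on_compose) (auto simp: Ck_on_0_iff intro: continuous_on_subset)
  then show ?case by (simp add: Ck_on_0_iff[OF U] o_def)
next
  case (Suc k f)
  have f1: "Ck_on m (Suc 0) V f"
    using Suc.prems(1) V Ck_on_continuous[OF V] by (auto simp: Ck_on_Suc_iff[OF V] Ck_on_0_iff[OF V])
  have p: "has_pderiv i (\<lambda>x. f (F x)) x (\<Sum>j<m. pderiv_at j f (F x) * pderiv_at i (\<lambda>x. F x j) x)"
    if "i < n" "x \<in> U" for i x
    by (rule has_pderiv_compose[OF U V f1 FV that(2,1)])
      (use that Suc.prems in \<open>auto simp: Ck_on_Suc_iff[OF U]\<close>)
  have f0: "Ck_on m k V f" using Suc.prems(1) by (rule Ck_on_SucD[OF V])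
  have F0: "Ck_on n k U (\<lambda>x. F x j)" if "j < m" for j
    using Suc.prems(2)[OF that] by (rule Ck_on_SucD[OF U])
  have "Ck_on n k U (\<lambda>x. f (F x))" by (rule Suc.IH[OF f0 F0])
  then have "continuous_on U (\<lambda>x. f (F x))" by (rule Ck_on_continuous[OF U])
  moreover have "Ck_on n k U (pderiv_at i (\<lambda>x. f (F x)))" if "i < n" for i
  proof (rule Ck_on_cong[OF U])
    show "Ck_on n k U (\<lambda>x. \<Sum>j<m. pderiv_at j f (F x) * pderiv_at i (\<lambda>x. F x j) x)"
    proof (intro Ck_on_sum[OF U] Ck_on_mult[OF U])
      fix j assume "j \<in> {..<m}"
      then have j: "j < m" by simp
      show "Ck_on n k U (\<lambda>x. pderiv_at j f (F x))"
        by (rule Suc.IH[OF _ F0]) (use Suc.prems(1) j in \<open>auto simp: Ck_on_Suc_iff[OF V]\<close>)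
      show "Ck_on n k U (pderiv_at i (\<lambda>x. F x j))"
        using Suc.prems(2)[OF j] that by (auto simp: Ck_on_Suc_iff[OF U])
    qed simp
  qed (use has_pderivD[OF p] that in auto)
  ultimately show ?case using has_pderivD[OF p] p by (auto simp: Ck_on_Suc_iff[OF U])
qed

section \<open>Smooth functions and smooth maps between open sets of Euclidean spaces\<close>

definition Cinf_on :: "nat \<Rightarrow> (nat \<Rightarrow> real) set \<Rightarrow> ((nat \<Rightarrow> real) \<Rightarrow> real) \<Rightarrow> bool" where
  "Cinf_on n U f \<longleftrightarrow> (\<forall>k. Ck_on n k U f)"

lemma Cinf_on_cong: "eopen n U \<Longrightarrow> (\<And>x. x \<in> U \<Longrightarrow> f x = g x) \<Longrightarrow> Cinf_on n U f \<Longrightarrow> Cinf_on n U g"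
  unfolding Cinf_on_def using Ck_on_cong by blast

lemma Cinf_on_subset: "eopen n U \<Longrightarrow> eopen n V \<Longrightarrow> V \<subseteq> U \<Longrightarrow> Cinf_on n U f \<Longrightarrow> Cinf_on n V f"
  unfolding Cinf_on_def using Ck_on_subset by blast

lemma Cinf_on_local:
  "eopen n U \<Longrightarrow> (\<And>x. x \<in> U \<Longrightarrow> \<exists>V. eopen n V \<and> x \<in> V \<and> Cinf_on n V f) \<Longrightarrow> Cinf_on n U f"
  unfolding Cinf_on_def by (meson Ck_on_local)

lemma Cinf_on_const: "eopen n U \<Longrightarrow> Cinf_on n U (\<lambda>x. c)"
  by (simp add: Cinf_on_def Ck_on_const)

lemma Cinf_on_coord: "eopen n U \<Longrightarrow> Cinf_on n U (\<lambda>x. x i)"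
  by (simp add: Cinf_on_def Ck_on_coord)

lemma Cinf_on_add: "eopen n U \<Longrightarrow> Cinf_on n U f \<Longrightarrow> Cinf_on n U g \<Longrightarrow> Cinf_on n U (\<lambda>x. f x + g x)"
  by (simp add: Cinf_on_def Ck_on_add)

lemma Cinf_on_mult: "eopen n U \<Longrightarrow> Cinf_on n U f \<Longrightarrow> Cinf_on n U g \<Longrightarrow> Cinf_on n U (\<lambda>x. f x * g x)"
  by (simp add: Cinf_on_def Ck_on_mult)

lemma Cinf_on_diff:
  assumes "eopen n U" "Cinf_on n U f" "Cinf_on n U g" shows "Cinf_on n U (\<lambda>x. f x - g x)"
proof -
  have "Cinf_on n U (\<lambda>x. f x + (- 1) * g x)"
    by (intro Cinf_on_add Cinf_on_mult Cinf_on_const assms)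
  then show ?thesis by simp
qed

lemma Cinf_on_sum:
  "eopen n U \<Longrightarrow> finite I \<Longrightarrow> (\<And>j. j \<in> I \<Longrightarrow> Cinf_on n U (f j)) \<Longrightarrow> Cinf_on n U (\<lambda>x. \<Sum>j\<in>I. f j x)"
  by (simp add: Cinf_on_def Ck_on_sum)

lemma Cinf_on_compose:
  assumes "eopen n U" "eopen m V" "\<And>x. x \<in> U \<Longrightarrow> F x \<in> V" "Cinf_on m V f"
    "\<And>j. j < m \<Longrightarrow> Cinf_on n U (\<lambda>x. F x j)"
  shows "Cinf_on n U (\<lambda>x. f (F x))"
  unfolding Cinf_on_def
proof
  fix k show "Ck_on n k U (\<lambda>x. f (F x))"
    by (rule Ck_on_compose[OF assms(1-3)]) (use assms(4,5) in \<open>auto simp: Cinf_on_def\<close>)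
qed

lemma Cinf_on_has_pderiv:
  "eopen n U \<Longrightarrow> Cinf_on n U f \<Longrightarrow> i < n \<Longrightarrow> x \<in> U \<Longrightarrow> has_pderiv i f x (pderiv_at i f x)"
  unfolding Cinf_on_def using Ck_on_Suc_iff[of n U 0 f] by blast

lemma Cinf_on_pderiv: "eopen n U \<Longrightarrow> Cinf_on n U f \<Longrightarrow> i < n \<Longrightarrow> Cinf_on n U (pderiv_at i f)"
  unfolding Cinf_on_def using Ck_on_Suc_iff by blast

lemma Cinf_on_continuous: "eopen n U \<Longrightarrow> Cinf_on n U f \<Longrightarrow> continuous_on U f"
  unfolding Cinf_on_def using Ck_on_continuous by blast

lemma smooth_between_iff:
  "smooth_between n m U F \<longleftrightarrow> (\<forall>x\<in>U. F x \<in> EE m) \<and> (\<forall>j<m. Cinf_on n U (\<lambda>x. F x j))"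
  by (auto simp: smooth_between_def Cinf_on_def)

lemma smooth_betweenI:
  "(\<And>x. x \<in> U \<Longrightarrow> F x \<in> EE m) \<Longrightarrow> (\<And>j. j < m \<Longrightarrow> Cinf_on n U (\<lambda>x. F x j)) \<Longrightarrow> smooth_between n m U F"
  by (simp add: smooth_between_iff)

lemma smooth_between_EE: "smooth_between n m U F \<Longrightarrow> x \<in> U \<Longrightarrow> F x \<in> EE m"
  by (simp add: smooth_between_iff)

lemma smooth_between_Cinf: "smooth_between n m U F \<Longrightarrow> j < m \<Longrightarrow> Cinf_on n U (\<lambda>x. F x j)"
  by (simp add: smooth_between_iff)

lemma smooth_between_cong:
  assumes "eopen n U" "\<And>x. x \<in> U \<Longrightarrow> F x = G x" "smooth_between n m U F"
  shows "smooth_between n m U G"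
  unfolding smooth_between_iff
proof (intro conjI ballI allI impI)
  fix j assume "j < m"
  show "Cinf_on n U (\<lambda>x. G x j)"
    by (rule Cinf_on_cong[OF assms(1) _ smooth_between_Cinf[OF assms(3) \<open>j < m\<close>]]) (simp add: assms(2))
qed (use assms(2,3) in \<open>auto simp: smooth_between_iff\<close>)

lemma smooth_between_subset:
  "eopen n U \<Longrightarrow> eopen n V \<Longrightarrow> V \<subseteq> U \<Longrightarrow> smooth_between n m U F \<Longrightarrow> smooth_between n m V F"
  unfolding smooth_between_iff using Cinf_on_subset by blast

lemma smooth_between_local:
  assumes "eopen n U" "\<And>x. x \<in> U \<Longrightarrow> \<exists>V. eopen n V \<and> x \<in> V \<and> smooth_between n m V F"
  shows "smooth_between n m U F"
proof (rule smooth_betweenI)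
  fix j assume "j < m"
  show "Cinf_on n U (\<lambda>x. F x j)"
  proof (rule Cinf_on_local[OF assms(1)])
    fix x assume "x \<in> U"
    from assms(2)[OF this] show "\<exists>V. eopen n V \<and> x \<in> V \<and> Cinf_on n V (\<lambda>x. F x j)"
      by (elim exE conjE, intro exI conjI) (assumption+, rule smooth_between_Cinf[OF _ \<open>j < m\<close>])
  qed
next
  fix x assume "x \<in> U"
  from assms(2)[OF this] show "F x \<in> EE m"
    by (elim exE conjE) (rule smooth_between_EE)
qed

lemma smooth_between_compose:
  assumes "eopen n U" "eopen m V" "\<And>x. x \<in> U \<Longrightarrow> F x \<in> V" "smooth_between n m U F" "smooth_between m p V G"
  shows "smooth_between n p U (\<lambda>x. G (F x))"
proof (rule smooth_betweenI)
  fix j assume "j < p"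
  then show "Cinf_on n U (\<lambda>x. G (F x) j)"
    using Cinf_on_compose[where F = F and f = "\<lambda>y. G y j", OF assms(1-3)]
      smooth_between_Cinf[OF assms(5)] smooth_between_Cinf[OF assms(4)] by simp
qed (rule smooth_between_EE[OF assms(5) assms(3)])

lemma smooth_between_preimage:
  assumes "eopen n U" "eopen m V" "smooth_between n m U F"
  shows "eopen n {x \<in> U. F x \<in> V}"
  by (rule eopen_preimage[OF assms(1,2)])
    (use assms Cinf_on_continuous in \<open>auto simp: smooth_between_iff\<close>)

lemma smooth_between_id: "eopen n U \<Longrightarrow> smooth_between n n U (\<lambda>x. x)"
  by (intro smooth_betweenI Cinf_on_coord) (use eopen_subset in auto)

lemma smooth_between_const: "eopen n U \<Longrightarrow> c \<in> EE m \<Longrightarrow> smooth_between n m U (\<lambda>x. c)"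
  by (intro smooth_betweenI Cinf_on_const)

section \<open>Concatenation of coordinate vectors and its two projections\<close>

definition fstE :: "nat \<Rightarrow> (nat \<Rightarrow> real) \<Rightarrow> nat \<Rightarrow> real" where
  "fstE n z = (\<lambda>i. if i < n then z i else 0)"

definition sndE :: "nat \<Rightarrow> (nat \<Rightarrow> real) \<Rightarrow> nat \<Rightarrow> real" where
  "sndE n z = (\<lambda>i. z (n + i))"

lemma cat_fstE_sndE [simp]: "cat n (fstE n z) (sndE n z) = z"
  by (auto simp: cat_def fstE_def sndE_def fun_eq_iff)

lemma fstE_cat [simp]: "x \<in> EE n \<Longrightarrow> fstE n (cat n x y) = x"
  by (auto simp: cat_def fstE_def fun_eq_iff EE_iff)

lemma sndE_cat [simp]: "sndE n (cat n x y) = y"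
  by (auto simp: cat_def sndE_def fun_eq_iff)

lemma cat_in_EE: "y \<in> EE m \<Longrightarrow> cat n x y \<in> EE (n + m)"
  by (auto simp: cat_def EE_iff)

lemma fstE_in_EE [simp]: "fstE n z \<in> EE n"
  by (auto simp: fstE_def EE_iff)

lemma sndE_in_EE: "z \<in> EE (n + m) \<Longrightarrow> sndE n z \<in> EE m"
  by (auto simp: sndE_def EE_iff)

lemma cat_inject: "x \<in> EE n \<Longrightarrow> x' \<in> EE n \<Longrightarrow> cat n x y = cat n x' y' \<longleftrightarrow> x = x' \<and> y = y'"
  by (metis fstE_cat sndE_cat)

lemma smooth_between_cat:
  assumes U: "eopen k U" and "smooth_between k n U F" "smooth_between k m U G"
  shows "smooth_between k (n + m) U (\<lambda>x. cat n (F x) (G x))"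
proof (rule smooth_betweenI)
  fix j assume "j < n + m"
  then show "Cinf_on k U (\<lambda>x. cat n (F x) (G x) j)"
    using smooth_between_Cinf[OF assms(2)] smooth_between_Cinf[OF assms(3)]
    by (cases "j < n") (simp_all add: cat_def)
qed (use assms in \<open>auto simp: smooth_between_iff intro: cat_in_EE\<close>)

lemma smooth_between_fstE: "eopen N U \<Longrightarrow> smooth_between N n U (fstE n)"
  by (intro smooth_betweenI) (auto simp: fstE_def EE_iff Cinf_on_coord)

lemma smooth_between_sndE: "eopen (n + m) U \<Longrightarrow> smooth_between (n + m) m U (sndE n)"
proof (rule smooth_betweenI)
  show "Cinf_on (n + m) U (\<lambda>x. sndE n x j)" if "eopen (n + m) U" for j
    unfolding sndE_def by (rule Cinf_on_coord[OF that])
qed (use eopen_subset sndE_in_EE in blast)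

text \<open>The right side is how the image of a product chart appears; the left side is visibly
  open, being cut out by preimages under the two projections.\<close>

lemma cat_image_eq:
  assumes "U \<subseteq> EE n" "V \<subseteq> EE m"
  shows "{z \<in> EE (n + m). fstE n z \<in> U \<and> sndE n z \<in> V} = {cat n x y | x y. x \<in> U \<and> y \<in> V}"
proof (rule equalityI; rule subsetI)
  fix z assume z: "z \<in> {z \<in> EE (n + m). fstE n z \<in> U \<and> sndE n z \<in> V}"
  have "z = cat n (fstE n z) (sndE n z)" by simp
  then show "z \<in> {cat n x y | x y. x \<in> U \<and> y \<in> V}" using z by blast
next
  fix z assume "z \<in> {cat n x y | x y. x \<in> U \<and> y \<in> V}"
  then show "z \<in> {z \<in> EE (n + m). fstE n z \<in> U \<and> sndE n z \<in> V}"
    using assms cat_in_EE by (auto simp: subset_iff)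
qed

lemma eopen_cat:
  assumes "eopen n U" "eopen m V"
  shows "eopen (n + m) {z \<in> EE (n + m). fstE n z \<in> U \<and> sndE n z \<in> V}"
proof -
  have "eopen (n + m) ({z \<in> EE (n + m). fstE n z \<in> U} \<inter> {z \<in> EE (n + m). sndE n z \<in> V})"
    using assms
    by (intro openin_Int smooth_between_preimage[OF eopen_EE _ smooth_between_fstE[OF eopen_EE]]
        smooth_between_preimage[OF eopen_EE _ smooth_between_sndE[OF eopen_EE]])
  then show ?thesis by (simp add: Collect_conj_eq[symmetric] Int_def conj_ac)
qed

section \<open>Jacobians acting on coordinate vectors\<close>

lemma jacobian_apply_EE [simp]: "jacobian_apply n m F x \<xi> \<in> EE m"
  by (simp add: jacobian_apply_def EE_iff)

lemma jacobian_apply_lincomb: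
  "jacobian_apply n m F x (\<lambda>i. a * \<xi> i + b * \<zeta> i) =
     (\<lambda>i. a * jacobian_apply n m F x \<xi> i + b * jacobian_apply n m F x \<zeta> i)"
  by (auto simp: jacobian_apply_def fun_eq_iff distrib_left sum.distrib sum_distrib_left mult.left_commute)

lemma jacobian_apply_zero [simp]: "jacobian_apply n m F x (\<lambda>i. 0) = (\<lambda>i. 0)"
  by (auto simp: jacobian_apply_def fun_eq_iff)

lemma jacobian_apply_cong:
  assumes "eopen n U" "x \<in> U" "\<And>y. y \<in> U \<Longrightarrow> F y = G y"
  shows "jacobian_apply n m F x \<xi> = jacobian_apply n m G x \<xi>"
proof -
  have "pderiv_at i (\<lambda>y. F y j) x = pderiv_at i (\<lambda>y. G y j) x" if "i < n" for i j
    by (rule pderiv_at_cong[OF assms(1,2) that]) (simp add: assms(3))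
  then show ?thesis by (auto simp: jacobian_apply_def fun_eq_iff intro!: sum.cong)
qed

lemma jacobian_apply_id:
  assumes "eopen n U" "x \<in> U" "\<And>y. y \<in> U \<Longrightarrow> F y = y" "\<xi> \<in> EE n"
  shows "jacobian_apply n n F x \<xi> = \<xi>"
proof (rule EE_eqI[of _ n])
  fix j assume "j < n"
  have "pderiv_at i (\<lambda>y. y j) x = (if i = j then 1 else 0)" for i
    by (rule has_pderivD) (auto simp: has_pderiv_def)
  then have "jacobian_apply n n (\<lambda>y. y) x \<xi> j = (\<Sum>i<n. (if i = j then 1 else 0) * \<xi> i)"
    using \<open>j < n\<close> by (simp add: jacobian_apply_def)
  also have "\<dots> = (\<Sum>i<n. if i = j then \<xi> i else 0)" by (rule sum.cong) auto
  also have "\<dots> = \<xi> j" using \<open>j < n\<close> by simp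
  finally have "jacobian_apply n n (\<lambda>y. y) x \<xi> j = \<xi> j" .
  then show "jacobian_apply n n F x \<xi> j = \<xi> j"
    using jacobian_apply_cong[OF assms(1,2), of F "\<lambda>y. y"] assms(3) by simp
qed (use assms(4) in auto)

lemma jacobian_apply_compose:
  assumes U: "eopen n U" and V: "eopen m V" and FV: "\<And>y. y \<in> U \<Longrightarrow> F y \<in> V" and x: "x \<in> U"
    and F: "smooth_between n m U F" and G: "smooth_between m p V G"
  shows "jacobian_apply n p (\<lambda>y. G (F y)) x \<xi> = jacobian_apply m p G (F x) (jacobian_apply n m F x \<xi>)"
proof -
  have "pderiv_at i (\<lambda>y. G (F y) l) x = (\<Sum>j<m. pderiv_at j (\<lambda>y. G y l) (F x) * pderiv_at i (\<lambda>y. F y j) x)"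
    if "i < n" "l < p" for i l
    by (rule has_pderivD, rule has_pderiv_compose[OF U V _ FV x \<open>i < n\<close>])
      (use smooth_between_Cinf[OF G \<open>l < p\<close>] Cinf_on_has_pderiv[OF U smooth_between_Cinf[OF F] \<open>i < n\<close> x]
       in \<open>auto simp: Cinf_on_def\<close>)
  moreover have "(\<Sum>i<n. (\<Sum>j<m. a j * b i j) * \<xi> i) = (\<Sum>j<m. a j * (\<Sum>i<n. b i j * \<xi> i))" for a b
  proof -
    have "(\<Sum>i<n. (\<Sum>j<m. a j * b i j) * \<xi> i) = (\<Sum>i<n. \<Sum>j<m. a j * (b i j * \<xi> i))"
      by (simp add: sum_distrib_right mult.assoc)
    also have "\<dots> = (\<Sum>j<m. \<Sum>i<n. a j * (b i j * \<xi> i))" by (rule sum.swap)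
    finally show ?thesis by (simp add: sum_distrib_left)
  qed
  ultimately show ?thesis by (auto simp: jacobian_apply_def fun_eq_iff)
qed

text \<open>Base point and vector vary together with z. The matrix entries are partial derivatives
  of F, again smooth, composed with H. This is the local reason why tangent maps are smooth.\<close>

lemma smooth_between_jacobian:
  assumes U: "eopen n U" and W: "eopen k W" and F: "smooth_between n m U F"
    and H: "smooth_between k n W H" "\<And>z. z \<in> W \<Longrightarrow> H z \<in> U" and L: "smooth_between k n W L"
  shows "smooth_between k m W (\<lambda>z. jacobian_apply n m F (H z) (L z))"
proof (rule smooth_betweenI)
  fix j assume j: "j < m"
  have "Cinf_on k W (\<lambda>z. pderiv_at i (\<lambda>y. F y j) (H z))" if "i < n" for i
    by (rule Cinf_on_compose[OF W U H(2)])
      (use smooth_between_Cinf[OF F j] smooth_between_Cinf[OF H(1)] Cinf_on_pderiv[OF U _ that] in auto)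
  then show "Cinf_on k W (\<lambda>z. jacobian_apply n m F (H z) (L z) j)"
    using j smooth_between_Cinf[OF L]
    by (auto simp: jacobian_apply_def intro!: Cinf_on_sum[OF W] Cinf_on_mult[OF W])
qed simp

text \<open>Freezing the first k coordinates leaves the columns from k on, and a vector padded with
  k zeros picks out exactly those. A derivative in x alone thus becomes a full Jacobian, whose
  dependence on y is already understood.\<close>

lemma jacobian_apply_partial:
  "jacobian_apply n m (\<lambda>x. F (cat k y x)) x \<xi> = jacobian_apply (k + n) m F (cat k y x) (cat k (\<lambda>i. 0) \<xi>)"
proof -
  have upd: "cat k y (x(i := s)) = (cat k y x)(k + i := s)" for i s
    by (auto simp: cat_def fun_eq_iff)
  have "pderiv_at i (\<lambda>x. F (cat k y x) j) x = pderiv_at (k + i) (\<lambda>z. F z j) (cat k y x)" for i j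
    by (simp add: pderiv_at_def upd) (simp add: cat_def)
  moreover have "(\<Sum>i<k + n. a i * cat k (\<lambda>i. 0) \<xi> i) = (\<Sum>i<n. a (k + i) * \<xi> i)" for a
  proof -
    have "(\<Sum>i<k + n. a i * cat k (\<lambda>i. 0) \<xi> i) = (\<Sum>i=k..<k + n. a i * \<xi> (i - k))"
      by (rule sum.mono_neutral_cong_right) (auto simp: cat_def)
    also have "\<dots> = (\<Sum>i<n. a (k + i) * \<xi> i)"
      using sum.shift_bounds_nat_ivl[of "\<lambda>i. a i * \<xi> (i - k)" 0 k n]
      by (simp add: add.commute atLeast0LessThan)
    finally show ?thesis .
  qed
  ultimately show ?thesis unfolding jacobian_apply_def by (simp only:)
qed

section \<open>Charts and smooth maps\<close>

text \<open>The part of \<open>is_chart\<close> that does not mention the ambient set, so that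
  charts can be combined before a manifold is named.\<close>

abbreviation chart_ok :: "'a chart \<Rightarrow> bool" where
  "chart_ok \<equiv> is_chart UNIV"

lemma is_chart_iff: "is_chart S c \<longleftrightarrow> chart_ok c \<and> cdom c \<subseteq> S"
  by (auto simp: is_chart_def)

lemma chart_inv_cmap [simp]: "chart_ok c \<Longrightarrow> p \<in> cdom c \<Longrightarrow> chart_inv c (cmap c p) = p"
  by (simp add: chart_inv_def is_chart_def)

lemma chart_eopen: "chart_ok c \<Longrightarrow> eopen (cdim c) (cmap c ` cdom c)"
  by (simp add: is_chart_def)

lemma cmap_in_EE: "chart_ok c \<Longrightarrow> p \<in> cdom c \<Longrightarrow> cmap c p \<in> EE (cdim c)"
  using eopen_subset[OF chart_eopen] by blast

lemma chart_inv_in: "x \<in> cmap c ` cdom c \<Longrightarrow> chart_inv c x \<in> cdom c"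
  unfolding chart_inv_def by (rule inv_into_into)

lemma cmap_chart_inv: "x \<in> cmap c ` cdom c \<Longrightarrow> cmap c (chart_inv c x) = x"
  unfolding chart_inv_def by (rule f_inv_into_f)

lemma chart_inj: "chart_ok c \<Longrightarrow> inj_on (cmap c) (cdom c)"
  by (simp add: is_chart_def)

text \<open>Smoothness at one point for two given charts. The neighbourhood \<open>W\<close> takes
  over the role of a smaller chart: unlike in \<open>smooth_map\<close>, the whole domain of c need
  not be mapped into that of d.\<close>

definition smooth_pt :: "'a chart \<Rightarrow> 'b chart \<Rightarrow> ('a \<Rightarrow> 'b) \<Rightarrow> 'a \<Rightarrow> bool" where
  "smooth_pt c d f p \<longleftrightarrow> p \<in> cdom c \<and> (\<exists>W. eopen (cdim c) W \<and> cmap c p \<in> W \<and> W \<subseteq> cmap c ` cdom c \<and>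
     (\<forall>x\<in>W. f (chart_inv c x) \<in> cdom d) \<and> smooth_between (cdim c) (cdim d) W (local_rep c d f))"

lemma smooth_ptE:
  assumes "smooth_pt c d f p"
  obtains W where "p \<in> cdom c" "eopen (cdim c) W" "cmap c p \<in> W" "W \<subseteq> cmap c ` cdom c"
    "\<forall>x\<in>W. f (chart_inv c x) \<in> cdom d" "smooth_between (cdim c) (cdim d) W (local_rep c d f)"
  using assms unfolding smooth_pt_def by blast

lemma smooth_pt_dom: "smooth_pt c d f p \<Longrightarrow> p \<in> cdom c"
  by (simp add: smooth_pt_def)

lemma smooth_pt_range: "chart_ok c \<Longrightarrow> smooth_pt c d f p \<Longrightarrow> f p \<in> cdom d"
  unfolding smooth_pt_def by (metis chart_inv_cmap)

lemma smooth_pt_cong: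
  assumes "smooth_pt c d f p" "\<And>q. q \<in> cdom c \<Longrightarrow> f q = g q"
  shows "smooth_pt c d g p"
proof -
  from assms(1) obtain W where W: "p \<in> cdom c" "eopen (cdim c) W" "cmap c p \<in> W" "W \<subseteq> cmap c ` cdom c"
    "\<forall>x\<in>W. f (chart_inv c x) \<in> cdom d" "smooth_between (cdim c) (cdim d) W (local_rep c d f)"
    by (rule smooth_ptE)
  have eq: "f (chart_inv c x) = g (chart_inv c x)" if "x \<in> W" for x
    by (rule assms(2), rule chart_inv_in, rule subsetD[OF W(4) that])
  have "smooth_between (cdim c) (cdim d) W (local_rep c d g)"
    by (rule smooth_between_cong[OF W(2) _ W(6)]) (simp add: local_rep_def eq)
  moreover have "g (chart_inv c x) \<in> cdom d" if "x \<in> W" for x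
    using bspec[OF W(5) that] eq[OF that] by simp
  ultimately show ?thesis unfolding smooth_pt_def using W(1-4) by blast
qed

lemma smooth_pt_compose:
  assumes c: "chart_ok c" and d: "chart_ok d" and f: "smooth_pt c d f p" and g: "smooth_pt d e g (f p)"
  shows "smooth_pt c e (\<lambda>x. g (f x)) p"
proof -
  from f obtain W where W: "p \<in> cdom c" "eopen (cdim c) W" "cmap c p \<in> W" "W \<subseteq> cmap c ` cdom c"
    "\<forall>x\<in>W. f (chart_inv c x) \<in> cdom d" "smooth_between (cdim c) (cdim d) W (local_rep c d f)"
    by (rule smooth_ptE)
  from g obtain V where V: "f p \<in> cdom d" "eopen (cdim d) V" "cmap d (f p) \<in> V" "V \<subseteq> cmap d ` cdom d"
    "\<forall>x\<in>V. g (chart_inv d x) \<in> cdom e" "smooth_between (cdim d) (cdim e) V (local_rep d e g)"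
    by (rule smooth_ptE)
  define Y where "Y = {x \<in> W. local_rep c d f x \<in> V}"
  have Y: "eopen (cdim c) Y" unfolding Y_def by (rule smooth_between_preimage[OF W(2) V(2) W(6)])
  have YW: "Y \<subseteq> W" and YV: "x \<in> Y \<Longrightarrow> local_rep c d f x \<in> V" for x by (auto simp: Y_def)
  have gf: "g (f (chart_inv c x)) = g (chart_inv d (local_rep c d f x))" if "x \<in> Y" for x
    using bspec[OF W(5), of x] YW that d by (auto simp: local_rep_def)
  have "smooth_between (cdim c) (cdim e) Y (\<lambda>x. local_rep d e g (local_rep c d f x))"
    by (rule smooth_between_compose[OF Y V(2) YV smooth_between_subset[OF W(2) Y YW W(6)] V(6)])
  then have "smooth_between (cdim c) (cdim e) Y (local_rep c e (\<lambda>x. g (f x)))"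
    by (rule smooth_between_cong[OF Y, rotated]) (use gf in \<open>simp add: local_rep_def[of _ e]\<close>)
  moreover have "cmap c p \<in> Y" using W(1,3) V(3) c by (simp add: Y_def local_rep_def)
  moreover have "g (f (chart_inv c x)) \<in> cdom e" if "x \<in> Y" for x
    using gf[OF that] bspec[OF V(5) YV[OF that]] by simp
  ultimately show ?thesis unfolding smooth_pt_def using Y YW W by (intro conjI exI[of _ Y]) auto
qed

lemma smooth_pt_id:
  assumes "chart_ok c" "p \<in> cdom c" shows "smooth_pt c c id p"
proof -
  have "smooth_between (cdim c) (cdim c) (cmap c ` cdom c) (local_rep c c id)"
    by (rule smooth_between_cong[OF _ _ smooth_between_id])
      (use assms in \<open>auto simp: chart_eopen local_rep_def\<close>)
  then show ?thesis unfolding smooth_pt_def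
    using assms by (intro conjI exI[of _ "cmap c ` cdom c"]) (auto simp: chart_eopen)
qed

lemma smooth_pt_const:
  assumes "chart_ok c" "chart_ok d" "p \<in> cdom c" "q \<in> cdom d" shows "smooth_pt c d (\<lambda>_. q) p"
proof -
  have "smooth_between (cdim c) (cdim d) (cmap c ` cdom c) (local_rep c d (\<lambda>_. q))"
    unfolding local_rep_def by (rule smooth_between_const) (use assms in \<open>auto simp: chart_eopen cmap_in_EE\<close>)
  then show ?thesis unfolding smooth_pt_def
    using assms by (intro conjI exI[of _ "cmap c ` cdom c"]) (auto simp: chart_eopen)
qed

text \<open>For maps known by a coordinate formula H. The set W may exceed the image of the chart,
  often it is all of \<open>EE (cdim c)\<close>, and \<open>chart_inv\<close> does not appear in the
  premises.\<close>

lemma smooth_ptI: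
  assumes "chart_ok c" "chart_ok d" "p \<in> cdom c" "eopen (cdim c) W" "cmap c p \<in> W"
    and "\<And>q. q \<in> cdom c \<Longrightarrow> cmap c q \<in> W \<Longrightarrow> f q \<in> cdom d \<and> cmap d (f q) = H (cmap c q)"
    and "smooth_between (cdim c) (cdim d) W H"
  shows "smooth_pt c d f p"
proof -
  let ?W = "W \<inter> cmap c ` cdom c"
  have W: "eopen (cdim c) ?W" using assms(1,4) by (intro openin_Int chart_eopen)
  have q: "chart_inv c x \<in> cdom c" "cmap c (chart_inv c x) = x" if "x \<in> ?W" for x
    using that by (auto intro: chart_inv_in cmap_chart_inv)
  have "smooth_between (cdim c) (cdim d) ?W H"
    using smooth_between_subset[OF assms(4) W _ assms(7)] by blast
  then have "smooth_between (cdim c) (cdim d) ?W (local_rep c d f)"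
    by (rule smooth_between_cong[OF W, rotated]) (use assms(6) q in \<open>auto simp: local_rep_def\<close>)
  then show ?thesis unfolding smooth_pt_def
    using assms(3,5,6) q W by (intro conjI exI[of _ ?W]) auto
qed

text \<open>The coordinate image of the overlap is the union of the neighbourhoods that witness
  pointwise smoothness, which makes it open; smoothness itself is local.\<close>

lemma smooth_transition_iff:
  assumes c: "chart_ok c" and d: "chart_ok d"
  shows "smooth_transition c d \<longleftrightarrow> (\<forall>p\<in>cdom c \<inter> cdom d. smooth_pt c d id p)"
proof
  assume L: "smooth_transition c d"
  show "\<forall>p\<in>cdom c \<inter> cdom d. smooth_pt c d id p"
  proof
    fix p assume "p \<in> cdom c \<inter> cdom d"
    then show "smooth_pt c d id p"
      unfolding smooth_pt_def using L c
      by (intro conjI exI[of _ "cmap c ` (cdom c \<inter> cdom d)"]) (auto simp: smooth_transition_def)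
  qed
next
  assume R: "\<forall>p\<in>cdom c \<inter> cdom d. smooth_pt c d id p"
  have *: "\<exists>W. eopen (cdim c) W \<and> x \<in> W \<and> W \<subseteq> cmap c ` (cdom c \<inter> cdom d) \<and>
      smooth_between (cdim c) (cdim d) W (local_rep c d id)"
    if x: "x \<in> cmap c ` (cdom c \<inter> cdom d)" for x
  proof -
    from x obtain p where p: "p \<in> cdom c \<inter> cdom d" "x = cmap c p" by blast
    from R p(1) have "smooth_pt c d id p" by (rule bspec)
    then obtain W where W: "p \<in> cdom c" "eopen (cdim c) W" "cmap c p \<in> W" "W \<subseteq> cmap c ` cdom c"
      "\<forall>x\<in>W. id (chart_inv c x) \<in> cdom d" "smooth_between (cdim c) (cdim d) W (local_rep c d id)"
      by (rule smooth_ptE)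
    have "W \<subseteq> cmap c ` (cdom c \<inter> cdom d)"
    proof
      fix y assume y: "y \<in> W"
      then have "chart_inv c y \<in> cdom c \<inter> cdom d" "cmap c (chart_inv c y) = y"
        using W(4) bspec[OF W(5) y] chart_inv_in[of y c] cmap_chart_inv[of y c] by auto
      then show "y \<in> cmap c ` (cdom c \<inter> cdom d)" by (metis imageI)
    qed
    then show ?thesis using W p by blast
  qed
  have o: "eopen (cdim c) (cmap c ` (cdom c \<inter> cdom d))" by (rule eopenI) (use * in blast)
  then show "smooth_transition c d"
    unfolding smooth_transition_def by (intro conjI smooth_between_local[OF o]) (use * in blast)+
qed

lemma compatible_iff:
  assumes "chart_ok c" "chart_ok d"
  shows "compatible c d \<longleftrightarrow> (\<forall>p\<in>cdom c \<inter> cdom d. smooth_pt c d id p \<and> smooth_pt d c id p)"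
  using assms by (auto simp: compatible_def smooth_transition_iff)

lemma compatible_sym: "compatible c d \<Longrightarrow> compatible d c"
  by (simp add: compatible_def)

lemma compatible_smooth_pt:
  "chart_ok c \<Longrightarrow> chart_ok d \<Longrightarrow> compatible c d \<Longrightarrow> p \<in> cdom c \<Longrightarrow> p \<in> cdom d \<Longrightarrow> smooth_pt c d id p"
  by (simp add: compatible_iff)

section \<open>Shrinking charts, compatibility and atlases\<close>

definition restr_chart :: "'a chart \<Rightarrow> (nat \<Rightarrow> real) set \<Rightarrow> 'a chart" where
  "restr_chart c W = \<lparr>cdom = {p \<in> cdom c. cmap c p \<in> W}, cdim = cdim c,
     cmap = restrict (cmap c) {p \<in> cdom c. cmap c p \<in> W}\<rparr>"

lemma restr_chart_simps [simp]:
  "cdom (restr_chart c W) = {p \<in> cdom c. cmap c p \<in> W}" "cdim (restr_chart c W) = cdim c"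
  "p \<in> cdom c \<Longrightarrow> cmap c p \<in> W \<Longrightarrow> cmap (restr_chart c W) p = cmap c p"
  by (auto simp: restr_chart_def)

lemma restr_chart_ok:
  assumes "chart_ok c" "eopen (cdim c) W" shows "chart_ok (restr_chart c W)"
proof -
  have "cmap (restr_chart c W) ` cdom (restr_chart c W) = W \<inter> cmap c ` cdom c"
    by (force simp: restr_chart_def)
  then show ?thesis
    using assms chart_eopen[OF assms(1)] unfolding is_chart_def
    by (auto simp: restr_chart_def inj_on_def)
qed

lemma smooth_pt_restr:
  assumes c: "chart_ok c" and W: "eopen (cdim c) W" and p: "p \<in> cdom c" "cmap c p \<in> W"
  shows "smooth_pt c (restr_chart c W) id p" "smooth_pt (restr_chart c W) c id p"
  by (rule smooth_ptI[OF c restr_chart_ok[OF c W] p(1) W p(2), of _ "\<lambda>x. x"],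
      auto simp: smooth_between_id[OF W])
    (rule smooth_ptI[OF restr_chart_ok[OF c W] c, of _ W _ "\<lambda>x. x"],
      use W p in \<open>auto simp: smooth_between_id\<close>)

text \<open>Compatibility is not transitive in general. It becomes so when an intermediate chart
  surrounds each common point, because near that point the transition factors through it.\<close>

lemma compatible_trans:
  assumes c: "chart_ok c" and d: "chart_ok d"
    and e: "\<And>p. p \<in> cdom c \<inter> cdom d \<Longrightarrow> \<exists>e. chart_ok e \<and> p \<in> cdom e \<and> compatible c e \<and> compatible d e"
  shows "compatible c d"
  unfolding compatible_iff[OF c d]
proof
  fix p assume p: "p \<in> cdom c \<inter> cdom d"
  with e obtain e where e: "chart_ok e" "p \<in> cdom e" "compatible c e" "compatible d e" by blast
  have 1: "smooth_pt c e id p" "smooth_pt e c id p" "smooth_pt d e id p" "smooth_pt e d id p"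
    using compatible_iff[OF c e(1)] compatible_iff[OF d e(1)] e p by auto
  show "smooth_pt c d id p \<and> smooth_pt d c id p"
    using smooth_pt_compose[OF c e(1) 1(1), of d id] smooth_pt_compose[OF d e(1) 1(3), of c id] 1
    by (auto simp: id_def)
qed

lemma restr_chart_compatible:
  assumes c: "chart_ok c" and W: "eopen (cdim c) W" and d: "chart_ok d" "compatible c d"
  shows "compatible (restr_chart c W) d"
proof (rule compatible_trans[OF restr_chart_ok[OF c W] d(1)])
  fix p assume p: "p \<in> cdom (restr_chart c W) \<inter> cdom d"
  have "compatible (restr_chart c W) c"
    unfolding compatible_iff[OF restr_chart_ok[OF c W] c] using smooth_pt_restr[OF c W] by auto
  then show "\<exists>e. chart_ok e \<and> p \<in> cdom e \<and> compatible (restr_chart c W) e \<and> compatible d e"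
    using p d c compatible_sym by auto
qed

text \<open>Of maximality it keeps the closure under shrinking of chart domains, which is what makes
  the image of one chart fit into another.\<close>

definition pre_mfd :: "'a smooth_mfd \<Rightarrow> bool" where
  "pre_mfd M \<longleftrightarrow> (\<forall>c\<in>atlas M. is_chart (points M) c) \<and> \<Union>(cdom ` atlas M) = points M \<and>
     (\<forall>c\<in>atlas M. \<forall>d\<in>atlas M. compatible c d) \<and>
     (\<forall>c\<in>atlas M. \<forall>W. eopen (cdim c) W \<longrightarrow> restr_chart c W \<in> atlas M)"

lemma pre_mfd_chart_ok: "pre_mfd M \<Longrightarrow> c \<in> atlas M \<Longrightarrow> chart_ok c"
  by (simp add: pre_mfd_def is_chart_iff[of "points M"])

lemma pre_mfd_cdom: "pre_mfd M \<Longrightarrow> c \<in> atlas M \<Longrightarrow> cdom c \<subseteq> points M"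
  by (simp add: pre_mfd_def is_chart_iff[of "points M"])

lemma pre_mfd_compatible: "pre_mfd M \<Longrightarrow> c \<in> atlas M \<Longrightarrow> d \<in> atlas M \<Longrightarrow> compatible c d"
  by (simp add: pre_mfd_def)

lemma pre_mfd_restr: "pre_mfd M \<Longrightarrow> c \<in> atlas M \<Longrightarrow> eopen (cdim c) W \<Longrightarrow> restr_chart c W \<in> atlas M"
  by (simp add: pre_mfd_def)

lemma charts_at_iff: "c \<in> charts_at M p \<longleftrightarrow> c \<in> atlas M \<and> p \<in> cdom c"
  by (simp add: charts_at_def)

lemma pre_mfd_charts_at: "pre_mfd M \<Longrightarrow> p \<in> points M \<Longrightarrow> \<exists>c. c \<in> charts_at M p"
  by (auto simp: pre_mfd_def charts_at_def)

lemma charts_at_points: "pre_mfd M \<Longrightarrow> c \<in> charts_at M p \<Longrightarrow> p \<in> points M"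
  using pre_mfd_cdom by (auto simp: charts_at_def)

lemma charts_at_transition:
  "pre_mfd M \<Longrightarrow> c \<in> charts_at M p \<Longrightarrow> d \<in> charts_at M p \<Longrightarrow> smooth_pt c d id p"
  by (simp add: charts_at_def compatible_smooth_pt pre_mfd_chart_ok pre_mfd_compatible)

lemma pre_mfd_maximal:
  assumes "\<forall>c\<in>atlas M. is_chart (points M) c" "\<Union>(cdom ` atlas M) = points M"
    "\<forall>c\<in>atlas M. \<forall>d\<in>atlas M. compatible c d"
    "\<forall>c. is_chart (points M) c \<and> (\<forall>d\<in>atlas M. compatible c d) \<longrightarrow> c \<in> atlas M"
  shows "pre_mfd M"
  unfolding pre_mfd_def
proof (intro conjI assms(1-3) ballI allI impI)
  fix c W assume c: "c \<in> atlas M" and W: "eopen (cdim c) W"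
  have ok: "d \<in> atlas M \<Longrightarrow> chart_ok d" for d using assms(1) by (simp add: is_chart_iff[of "points M"])
  have "is_chart (points M) (restr_chart c W)"
    using restr_chart_ok[OF ok[OF c] W] assms(1) c unfolding is_chart_iff[of "points M"] by auto
  then show "restr_chart c W \<in> atlas M"
    using restr_chart_compatible[OF ok[OF c] W] ok assms(3,4) c by blast
qed

lemma smooth_manifold_pre: "smooth_manifold M \<Longrightarrow> pre_mfd M"
  unfolding smooth_manifold_def by (rule pre_mfd_maximal) blast+

text \<open>\<open>smooth_map\<close> demands that a whole chart domain goes into a chart.
  Restricting the source chart to the neighbourhood \<open>W\<close> of \<open>smooth_pt\<close>
  achieves this.\<close>

lemma smooth_map_iff:
  assumes M: "pre_mfd M" and N: "pre_mfd N"
  shows "smooth_map M N f \<longleftrightarrow> (\<forall>p\<in>points M. f p \<in> points N \<and>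
    (\<exists>c\<in>charts_at M p. \<exists>d\<in>charts_at N (f p). smooth_pt c d f p))"
proof
  assume L: "smooth_map M N f"
  show "\<forall>p\<in>points M. f p \<in> points N \<and> (\<exists>c\<in>charts_at M p. \<exists>d\<in>charts_at N (f p). smooth_pt c d f p)"
  proof
    fix p assume p: "p \<in> points M"
    with L obtain c d where cd: "c \<in> charts_at M p" "d \<in> charts_at N (f p)" "f ` cdom c \<subseteq> cdom d"
      "smooth_between (cdim c) (cdim d) (cmap c ` cdom c) (local_rep c d f)"
      unfolding smooth_map_def by blast
    then have "smooth_pt c d f p"
      unfolding smooth_pt_def using chart_eopen pre_mfd_chart_ok[OF M]
      by (intro conjI exI[of _ "cmap c ` cdom c"]) (auto simp: charts_at_def)
    then show "f p \<in> points N \<and> (\<exists>c\<in>charts_at M p. \<exists>d\<in>charts_at N (f p). smooth_pt c d f p)"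
      using L p cd by (auto simp: smooth_map_def)
  qed
next
  assume R: "\<forall>p\<in>points M. f p \<in> points N \<and> (\<exists>c\<in>charts_at M p. \<exists>d\<in>charts_at N (f p). smooth_pt c d f p)"
  have "\<exists>c\<in>charts_at M p. \<exists>d\<in>charts_at N (f p). f ` cdom c \<subseteq> cdom d \<and>
        smooth_between (cdim c) (cdim d) (cmap c ` cdom c) (local_rep c d f)"
    if p: "p \<in> points M" for p
  proof -
    from R p obtain c d where cd: "c \<in> charts_at M p" "d \<in> charts_at N (f p)" "smooth_pt c d f p" by blast
    from cd(3) obtain W where W: "p \<in> cdom c" "eopen (cdim c) W" "cmap c p \<in> W" "W \<subseteq> cmap c ` cdom c"
      "\<forall>x\<in>W. f (chart_inv c x) \<in> cdom d" "smooth_between (cdim c) (cdim d) W (local_rep c d f)"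
      by (rule smooth_ptE)
    have ok: "chart_ok c" using M cd(1) pre_mfd_chart_ok by (auto simp: charts_at_def)
    let ?c = "restr_chart c W"
    have c: "?c \<in> charts_at M p" "chart_ok ?c"
      using cd(1) W pre_mfd_restr[OF M] restr_chart_ok[OF ok] by (auto simp: charts_at_def)
    have im: "cmap ?c ` cdom ?c = W" using W(4) by (force simp: restr_chart_def)
    have inv: "chart_inv ?c x = chart_inv c x" if "x \<in> W" for x
    proof -
      have "chart_inv c x \<in> cdom c" "cmap c (chart_inv c x) = x"
        using that W(4) by (auto intro: chart_inv_in cmap_chart_inv)
      then show ?thesis using chart_inv_cmap[OF c(2), of "chart_inv c x"] that by simp
    qed
    have "smooth_between (cdim c) (cdim d) W (local_rep ?c d f)"
      by (rule smooth_between_cong[OF W(2) _ W(6)]) (simp add: local_rep_def inv)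
    moreover have "f ` cdom ?c \<subseteq> cdom d"
      using W(5) ok by (auto dest: chart_inv_cmap)
    ultimately show ?thesis using c(1) cd(2) im by (intro bexI[of _ ?c] bexI[of _ d]) simp_all
  qed
  then show "smooth_map M N f" using R unfolding smooth_map_def by blast
qed

text \<open>The target chart is only asked to lie in the atlas, since \<open>smooth_pt\<close>
  already places \<open>f p\<close> in its domain.\<close>

lemma smooth_mapI:
  assumes "pre_mfd M" "pre_mfd N"
    and "\<And>p. p \<in> points M \<Longrightarrow> \<exists>c\<in>charts_at M p. \<exists>d\<in>atlas N. smooth_pt c d f p"
  shows "smooth_map M N f"
  unfolding smooth_map_iff[OF assms(1,2)]
proof
  fix p assume "p \<in> points M"
  from assms(3)[OF this] obtain c d where "c \<in> charts_at M p" "d \<in> atlas N" "smooth_pt c d f p" by blast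
  then show "f p \<in> points N \<and> (\<exists>c\<in>charts_at M p. \<exists>d\<in>charts_at N (f p). smooth_pt c d f p)"
    using smooth_pt_range[of c d f p] pre_mfd_chart_ok[OF assms(1)] pre_mfd_cdom[OF assms(2)]
    by (auto simp: charts_at_def)
qed

lemma smooth_map_points: "smooth_map M N f \<Longrightarrow> p \<in> points M \<Longrightarrow> f p \<in> points N"
  by (auto simp: smooth_map_def)

text \<open>Composing with transitions on both sides passes from the charts supplied by smoothness
  to any others.\<close>

lemma smooth_map_charts:
  assumes M: "pre_mfd M" and N: "pre_mfd N" and f: "smooth_map M N f"
    and c: "c \<in> charts_at M p" and d: "d \<in> charts_at N (f p)"
  shows "smooth_pt c d f p"
proof -
  have "p \<in> points M" using charts_at_points[OF M c] .
  with f obtain c' d' where 1: "c' \<in> charts_at M p" "d' \<in> charts_at N (f p)" "smooth_pt c' d' f p"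
    using smooth_map_iff[OF M N] by blast
  have ok: "chart_ok c" "chart_ok c'" "chart_ok d'"
    using M N c 1 pre_mfd_chart_ok by (auto simp: charts_at_def)
  have "smooth_pt c d' (\<lambda>x. f (id x)) p"
    by (rule smooth_pt_compose[OF ok(1,2) charts_at_transition[OF M c 1(1)]]) (use 1(3) in simp)
  then have "smooth_pt c d (\<lambda>x. id (f (id x))) p"
    by (rule smooth_pt_compose[OF ok(1,3)]) (use charts_at_transition[OF N 1(2) d] in \<open>simp add: id_def\<close>)
  then show ?thesis by (simp add: id_def)
qed

lemma smooth_map_compose:
  assumes M: "pre_mfd M" and N: "pre_mfd N" and P: "pre_mfd P"
    and f: "smooth_map M N f" and g: "smooth_map N P g"
  shows "smooth_map M P (\<lambda>x. g (f x))"
proof (rule smooth_mapI[OF M P])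
  fix p assume p: "p \<in> points M"
  have fp: "f p \<in> points N" and gp: "g (f p) \<in> points P"
    using smooth_map_points[OF f p] smooth_map_points[OF g] by auto
  obtain c d e where c: "c \<in> charts_at M p" and d: "d \<in> charts_at N (f p)" and e: "e \<in> charts_at P (g (f p))"
    using pre_mfd_charts_at p fp gp M N P by metis
  have "smooth_pt c e (\<lambda>x. g (f x)) p"
    by (rule smooth_pt_compose[OF _ _ smooth_map_charts[OF M N f c d] smooth_map_charts[OF N P g d e]])
      (use c d M N pre_mfd_chart_ok in \<open>auto simp: charts_at_def\<close>)
  then show "\<exists>c\<in>charts_at M p. \<exists>e\<in>atlas P. smooth_pt c e (\<lambda>x. g (f x)) p"
    using c e by (auto simp: charts_at_def)
qed

lemma smooth_map_cong:
  assumes "smooth_map M N f" "pre_mfd M" "pre_mfd N" "\<And>p. p \<in> points M \<Longrightarrow> f p = g p"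
  shows "smooth_map M N g"
proof (rule smooth_mapI[OF assms(2,3)])
  fix p assume p: "p \<in> points M"
  then obtain c d where cd: "c \<in> charts_at M p" "d \<in> charts_at N (f p)" "smooth_pt c d f p"
    using assms(1) smooth_map_iff[OF assms(2,3)] by blast
  have "smooth_pt c d g p"
    by (rule smooth_pt_cong[OF cd(3)])
      (use cd(1) assms(4) pre_mfd_cdom[OF assms(2)] in \<open>auto simp: charts_at_def\<close>)
  then show "\<exists>c\<in>charts_at M p. \<exists>d\<in>atlas N. smooth_pt c d g p" using cd by (auto simp: charts_at_def)
qed

lemma smooth_map_id: "pre_mfd M \<Longrightarrow> smooth_map M M (\<lambda>x. x)"
  by (rule smooth_mapI)
    (use pre_mfd_charts_at smooth_pt_id pre_mfd_chart_ok in \<open>fastforce simp: charts_at_def id_def\<close>)+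

lemma smooth_map_const:
  assumes M: "pre_mfd M" and N: "pre_mfd N" and q: "q \<in> points N" shows "smooth_map M N (\<lambda>_. q)"
proof (rule smooth_mapI[OF M N])
  fix p assume "p \<in> points M"
  with q obtain c d where "c \<in> charts_at M p" "d \<in> charts_at N q" using M N pre_mfd_charts_at by metis
  then show "\<exists>c\<in>charts_at M p. \<exists>d\<in>atlas N. smooth_pt c d (\<lambda>_. q) p"
    using smooth_pt_const pre_mfd_chart_ok[OF M] pre_mfd_chart_ok[OF N] by (fastforce simp: charts_at_def)
qed

lemma mfd_generated_points [simp]: "points (mfd_generated S A) = S"
  by (simp add: mfd_generated_def)

text \<open>Two charts compatible with A are compatible with each other because A covers S, by
  \<open>compatible_trans\<close>. The third claim is maximality in the shape that
  \<open>smooth_manifold\<close> asks for.\<close>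

lemma mfd_generated_pre:
  assumes A: "\<And>c. c \<in> A \<Longrightarrow> is_chart S c" and cover: "S \<subseteq> \<Union>(cdom ` A)"
    and comp: "\<And>c d. c \<in> A \<Longrightarrow> d \<in> A \<Longrightarrow> compatible c d"
  shows "pre_mfd (mfd_generated S A)" "A \<subseteq> atlas (mfd_generated S A)"
    "\<forall>c. is_chart S c \<and> (\<forall>d\<in>atlas (mfd_generated S A). compatible c d) \<longrightarrow> c \<in> atlas (mfd_generated S A)"
proof -
  let ?M = "mfd_generated S A"
  show sub: "A \<subseteq> atlas ?M" using A comp by (auto simp: mfd_generated_def)
  then show max: "\<forall>c. is_chart S c \<and> (\<forall>d\<in>atlas ?M. compatible c d) \<longrightarrow> c \<in> atlas ?M"
    by (auto simp: mfd_generated_def)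
  have comp': "compatible c d" if "c \<in> atlas ?M" "d \<in> atlas ?M" for c d
  proof (rule compatible_trans)
    fix p assume "p \<in> cdom c \<inter> cdom d"
    then have "p \<in> S" using that by (auto simp: mfd_generated_def is_chart_def)
    with cover obtain a where "a \<in> A" "p \<in> cdom a" by blast
    then show "\<exists>e. chart_ok e \<and> p \<in> cdom e \<and> compatible c e \<and> compatible d e"
      using that A[of a] is_chart_iff[of S a] by (auto simp: mfd_generated_def)
  qed (use that in \<open>auto simp: mfd_generated_def is_chart_iff[of S]\<close>)
  have un: "\<Union>(cdom ` atlas ?M) = S"
  proof
    show "\<Union>(cdom ` atlas ?M) \<subseteq> S" by (auto simp: mfd_generated_def is_chart_def)
    show "S \<subseteq> \<Union>(cdom ` atlas ?M)" using sub cover by blast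
  qed
  show "pre_mfd ?M"
  proof (rule pre_mfd_maximal)
    show "\<forall>c\<in>atlas ?M. is_chart (points ?M) c" by (simp add: mfd_generated_def)
    show "\<Union>(cdom ` atlas ?M) = points ?M" using un by simp
    show "\<forall>c\<in>atlas ?M. \<forall>d\<in>atlas ?M. compatible c d" using comp' by blast
    show "\<forall>c. is_chart (points ?M) c \<and> (\<forall>d\<in>atlas ?M. compatible c d) \<longrightarrow> c \<in> atlas ?M"
      using max unfolding mfd_generated_points .
  qed
qed

subsection \<open>Products\<close>

lemma prod_chart_simps [simp]:
  "cdom (prod_chart c d) = cdom c \<times> cdom d" "cdim (prod_chart c d) = cdim c + cdim d"
  "p \<in> cdom c \<Longrightarrow> q \<in> cdom d \<Longrightarrow> cmap (prod_chart c d) (p, q) = cat (cdim c) (cmap c p) (cmap d q)"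
  by (auto simp: prod_chart_def)

lemma prod_chart_ok:
  assumes c: "chart_ok c" and d: "chart_ok d" shows "chart_ok (prod_chart c d)"
proof -
  let ?n = "cdim c" and ?m = "cdim d"
  have "cmap (prod_chart c d) ` (cdom c \<times> cdom d) =
      {cat ?n x y | x y. x \<in> cmap c ` cdom c \<and> y \<in> cmap d ` cdom d}"
    by (force simp: prod_chart_def)
  also have "\<dots> = {z \<in> EE (?n + ?m). fstE ?n z \<in> cmap c ` cdom c \<and> sndE ?n z \<in> cmap d ` cdom d}"
    by (rule cat_image_eq[symmetric]) (use chart_eopen c d eopen_subset in blast)+
  finally have "eopen (?n + ?m) (cmap (prod_chart c d) ` (cdom c \<times> cdom d))"
    using eopen_cat[OF chart_eopen[OF c] chart_eopen[OF d]] by simp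
  moreover have "inj_on (cmap (prod_chart c d)) (cdom c \<times> cdom d)"
  proof (rule inj_onI)
    fix x y assume xy: "x \<in> cdom c \<times> cdom d" "y \<in> cdom c \<times> cdom d"
      "cmap (prod_chart c d) x = cmap (prod_chart c d) y"
    obtain p q p' q' where [simp]: "x = (p, q)" "y = (p', q')" by (cases x, cases y) blast
    have "cmap c p = cmap c p' \<and> cmap d q = cmap d q'"
      using xy cat_inject[of "cmap c p" ?n "cmap c p'" "cmap d q" "cmap d q'"] cmap_in_EE[OF c] by simp
    then show "x = y" using xy inj_onD[OF chart_inj[OF c], of p p'] inj_onD[OF chart_inj[OF d], of q q'] by simp
  qed
  ultimately show ?thesis unfolding is_chart_def by (simp add: prod_chart_def)
qed

lemma smooth_pt_fst:
  assumes c: "chart_ok c" and d: "chart_ok d" and "p \<in> cdom c" "q \<in> cdom d"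
  shows "smooth_pt (prod_chart c d) c fst (p, q)"
  by (rule smooth_ptI[OF prod_chart_ok[OF c d] c, where W = "EE (cdim c + cdim d)" and H = "fstE (cdim c)"])
    (use assms in \<open>auto simp: eopen_EE cmap_in_EE cat_in_EE smooth_between_fstE\<close>)

lemma smooth_pt_snd:
  assumes c: "chart_ok c" and d: "chart_ok d" and "p \<in> cdom c" "q \<in> cdom d"
  shows "smooth_pt (prod_chart c d) d snd (p, q)"
  by (rule smooth_ptI[OF prod_chart_ok[OF c d] d, where W = "EE (cdim c + cdim d)" and H = "sndE (cdim c)"])
    (use assms in \<open>auto simp: eopen_EE cmap_in_EE cat_in_EE smooth_between_sndE\<close>)

lemma smooth_pt_Pair:
  assumes c: "chart_ok c" and d: "chart_ok d" and e: "chart_ok e"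
    and f: "smooth_pt c d f p" and g: "smooth_pt c e g p"
  shows "smooth_pt c (prod_chart d e) (\<lambda>x. (f x, g x)) p"
proof -
  from f obtain W where W: "p \<in> cdom c" "eopen (cdim c) W" "cmap c p \<in> W" "W \<subseteq> cmap c ` cdom c"
    "\<forall>x\<in>W. f (chart_inv c x) \<in> cdom d" "smooth_between (cdim c) (cdim d) W (local_rep c d f)"
    by (rule smooth_ptE)
  from g obtain V where V: "p \<in> cdom c" "eopen (cdim c) V" "cmap c p \<in> V" "V \<subseteq> cmap c ` cdom c"
    "\<forall>x\<in>V. g (chart_inv c x) \<in> cdom e" "smooth_between (cdim c) (cdim e) V (local_rep c e g)"
    by (rule smooth_ptE)
  have o: "eopen (cdim c) (W \<inter> V)" using W(2) V(2) by (rule openin_Int)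
  show ?thesis
  proof (rule smooth_ptI[OF c prod_chart_ok[OF d e] W(1) o])
    show "smooth_between (cdim c) (cdim (prod_chart d e)) (W \<inter> V)
        (\<lambda>x. cat (cdim d) (local_rep c d f x) (local_rep c e g x))"
      unfolding prod_chart_simps
      by (rule smooth_between_cat[OF o smooth_between_subset[OF W(2) o _ W(6)]
            smooth_between_subset[OF V(2) o _ V(6)]]) auto
    fix q assume q: "q \<in> cdom c" "cmap c q \<in> W \<inter> V"
    then have "f q \<in> cdom d" "g q \<in> cdom e" using bspec[OF W(5), of "cmap c q"] bspec[OF V(5), of "cmap c q"] c by auto
    then show "(f q, g q) \<in> cdom (prod_chart d e) \<and> cmap (prod_chart d e) (f q, g q) =
        cat (cdim d) (local_rep c d f (cmap c q)) (local_rep c e g (cmap c q))"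
      using q c by (simp add: local_rep_def)
  qed (use W(3) V(3) in simp)
qed

text \<open>Writing the identity as the pair of its projections splits a transition between product
  charts into transitions of the factors.\<close>

lemma smooth_pt_prod_id:
  assumes "chart_ok c" "chart_ok d" "chart_ok c'" "chart_ok d'" "smooth_pt c c' id p" "smooth_pt d d' id q"
  shows "smooth_pt (prod_chart c d) (prod_chart c' d') id (p, q)"
proof -
  have pq: "p \<in> cdom c" "q \<in> cdom d" using assms(5,6) by (auto dest: smooth_pt_dom)
  have 1: "smooth_pt (prod_chart c d) c' (\<lambda>x. id (fst x)) (p, q)"
    by (rule smooth_pt_compose[OF prod_chart_ok[OF assms(1,2)] assms(1) smooth_pt_fst[OF assms(1,2) pq]])
      (use assms in \<open>simp add: id_def\<close>)
  have 2: "smooth_pt (prod_chart c d) d' (\<lambda>x. id (snd x)) (p, q)"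
    by (rule smooth_pt_compose[OF prod_chart_ok[OF assms(1,2)] assms(2) smooth_pt_snd[OF assms(1,2) pq]])
      (use assms in \<open>simp add: id_def\<close>)
  show ?thesis
    using smooth_pt_Pair[OF prod_chart_ok[OF assms(1,2)] assms(3,4) 1 2] by (simp add: id_def)
qed

lemma prod_mfd_generated:
  assumes M: "pre_mfd M" and N: "pre_mfd N"
  shows "pre_mfd (prod_mfd M N)" "c \<in> atlas M \<Longrightarrow> d \<in> atlas N \<Longrightarrow> prod_chart c d \<in> atlas (prod_mfd M N)"
    "\<forall>c. is_chart (points M \<times> points N) c \<and> (\<forall>d\<in>atlas (prod_mfd M N). compatible c d)
       \<longrightarrow> c \<in> atlas (prod_mfd M N)"
proof -
  let ?A = "{prod_chart c d | c d. c \<in> atlas M \<and> d \<in> atlas N}"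
  have 1: "is_chart (points M \<times> points N) e" if "e \<in> ?A" for e
    using that pre_mfd_chart_ok[OF M] pre_mfd_chart_ok[OF N] pre_mfd_cdom[OF M] pre_mfd_cdom[OF N]
    by (auto simp: is_chart_iff[of "points M \<times> points N"] prod_chart_ok) blast+
  have 2: "points M \<times> points N \<subseteq> \<Union>(cdom ` ?A)"
  proof
    fix x assume x: "x \<in> points M \<times> points N"
    obtain p q where pq: "x = (p, q)" "p \<in> points M" "q \<in> points N" using x by blast
    then obtain c d where "c \<in> charts_at M p" "d \<in> charts_at N q" using M N pre_mfd_charts_at by metis
    then have "prod_chart c d \<in> ?A" "x \<in> cdom (prod_chart c d)" using pq by (auto simp: charts_at_def)
    then show "x \<in> \<Union>(cdom ` ?A)" by blast
  qed
  have 3: "compatible e e'" if "e \<in> ?A" "e' \<in> ?A" for e e'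
  proof -
    obtain c d c' d' where e: "e = prod_chart c d" "e' = prod_chart c' d'" "c \<in> atlas M" "c' \<in> atlas M"
      "d \<in> atlas N" "d' \<in> atlas N" using \<open>e \<in> ?A\<close> \<open>e' \<in> ?A\<close> by blast
    have ok: "chart_ok c" "chart_ok c'" "chart_ok d" "chart_ok d'"
      using e pre_mfd_chart_ok[OF M] pre_mfd_chart_ok[OF N] by blast+
    have c: "smooth_pt c c' id p" "smooth_pt c' c id p" if "p \<in> cdom c" "p \<in> cdom c'" for p
      using compatible_smooth_pt[OF ok(1,2) pre_mfd_compatible[OF M e(3,4)] that]
        compatible_smooth_pt[OF ok(2,1) pre_mfd_compatible[OF M e(4,3)] that(2,1)] by simp_all
    have d: "smooth_pt d d' id p" "smooth_pt d' d id p" if "p \<in> cdom d" "p \<in> cdom d'" for p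
      using compatible_smooth_pt[OF ok(3,4) pre_mfd_compatible[OF N e(5,6)] that]
        compatible_smooth_pt[OF ok(4,3) pre_mfd_compatible[OF N e(6,5)] that(2,1)] by simp_all
    show ?thesis
      unfolding e compatible_iff[OF prod_chart_ok[OF ok(1,3)] prod_chart_ok[OF ok(2,4)]]
      by (auto intro!: smooth_pt_prod_id ok c d)
  qed
  note gen = mfd_generated_pre[OF 1 2 3]
  show "pre_mfd (prod_mfd M N)" unfolding prod_mfd_def by (rule gen(1))
  show "c \<in> atlas M \<Longrightarrow> d \<in> atlas N \<Longrightarrow> prod_chart c d \<in> atlas (prod_mfd M N)"
    unfolding prod_mfd_def using gen(2) by blast
  show "\<forall>c. is_chart (points M \<times> points N) c \<and> (\<forall>d\<in>atlas (prod_mfd M N). compatible c d)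
       \<longrightarrow> c \<in> atlas (prod_mfd M N)"
    unfolding prod_mfd_def by (rule gen(3))
qed

lemma prod_mfd_points [simp]: "points (prod_mfd M N) = points M \<times> points N"
  by (simp add: prod_mfd_def)

lemma smooth_map_fst:
  assumes M: "pre_mfd M" and N: "pre_mfd N" shows "smooth_map (prod_mfd M N) M fst"
proof (rule smooth_mapI[OF prod_mfd_generated(1)[OF M N] M])
  fix x assume "x \<in> points (prod_mfd M N)"
  then obtain p q where pq: "x = (p, q)" "p \<in> points M" "q \<in> points N" by auto
  then obtain c d where cd: "c \<in> charts_at M p" "d \<in> charts_at N q" using M N pre_mfd_charts_at by metis
  show "\<exists>c\<in>charts_at (prod_mfd M N) x. \<exists>d\<in>atlas M. smooth_pt c d fst x"
    by (rule bexI[of _ "prod_chart c d"], rule bexI[of _ c])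
      (use cd pq pre_mfd_chart_ok[OF M] pre_mfd_chart_ok[OF N] prod_mfd_generated(2)[OF M N] in
        \<open>auto simp: charts_at_def intro!: smooth_pt_fst\<close>)
qed

lemma smooth_map_snd:
  assumes M: "pre_mfd M" and N: "pre_mfd N" shows "smooth_map (prod_mfd M N) N snd"
proof (rule smooth_mapI[OF prod_mfd_generated(1)[OF M N] N])
  fix x assume "x \<in> points (prod_mfd M N)"
  then obtain p q where pq: "x = (p, q)" "p \<in> points M" "q \<in> points N" by auto
  then obtain c d where cd: "c \<in> charts_at M p" "d \<in> charts_at N q" using M N pre_mfd_charts_at by metis
  show "\<exists>c\<in>charts_at (prod_mfd M N) x. \<exists>d\<in>atlas N. smooth_pt c d snd x"
    by (rule bexI[of _ "prod_chart c d"], rule bexI[of _ d])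
      (use cd pq pre_mfd_chart_ok[OF M] pre_mfd_chart_ok[OF N] prod_mfd_generated(2)[OF M N] in
        \<open>auto simp: charts_at_def intro!: smooth_pt_snd\<close>)
qed

lemma smooth_map_Pair:
  assumes M: "pre_mfd M" and N: "pre_mfd N" and P: "pre_mfd P"
    and f: "smooth_map M N f" and g: "smooth_map M P g"
  shows "smooth_map M (prod_mfd N P) (\<lambda>x. (f x, g x))"
proof (rule smooth_mapI[OF M prod_mfd_generated(1)[OF N P]])
  fix p assume p: "p \<in> points M"
  obtain c where c: "c \<in> charts_at M p" using M p pre_mfd_charts_at by metis
  obtain d where d: "d \<in> charts_at N (f p)" using N smooth_map_points[OF f p] pre_mfd_charts_at by metis
  obtain e where e: "e \<in> charts_at P (g p)" using P smooth_map_points[OF g p] pre_mfd_charts_at by metis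
  have "smooth_pt c (prod_chart d e) (\<lambda>x. (f x, g x)) p"
    by (rule smooth_pt_Pair[OF _ _ _ smooth_map_charts[OF M N f c d] smooth_map_charts[OF M P g c e]])
      (use c d e M N P pre_mfd_chart_ok in \<open>auto simp: charts_at_def\<close>)
  moreover have "prod_chart d e \<in> atlas (prod_mfd N P)"
    using d e prod_mfd_generated(2)[OF N P] by (simp add: charts_at_def)
  ultimately show "\<exists>c\<in>charts_at M p. \<exists>d\<in>atlas (prod_mfd N P). smooth_pt c d (\<lambda>x. (f x, g x)) p"
    using c by blast
qed

subsection \<open>The topology of a manifold\<close>

text \<open>\<open>topology\<close> returns the intended open sets only once they are known to form
  a topology. Intersections pass through the coordinate maps because these are injective.\<close>

lemma openin_mtop:
  assumes M: "pre_mfd M"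
  shows "openin (mtop M) W \<longleftrightarrow> W \<subseteq> points M \<and> (\<forall>c\<in>atlas M. eopen (cdim c) (cmap c ` (W \<inter> cdom c)))"
proof -
  let ?L = "\<lambda>W. W \<subseteq> points M \<and> (\<forall>c\<in>atlas M. eopen (cdim c) (cmap c ` (W \<inter> cdom c)))"
  have "istopology ?L"
    unfolding istopology_def
  proof (rule conjI; intro allI impI)
    fix S T assume S: "?L S" and T: "?L T"
    have "cmap c ` (S \<inter> T \<inter> cdom c) = cmap c ` (S \<inter> cdom c) \<inter> cmap c ` (T \<inter> cdom c)" if "c \<in> atlas M" for c
      using inj_on_image_Int[OF chart_inj[OF pre_mfd_chart_ok[OF M that]], of "S \<inter> cdom c" "T \<inter> cdom c"]
      by (simp add: Int_ac)
    then show "?L (S \<inter> T)" using S T by (auto intro!: openin_Int)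
  next
    fix K assume K: "\<forall>S\<in>K. ?L S"
    have eq: "cmap c ` (\<Union>K \<inter> cdom c) = \<Union>((\<lambda>S. cmap c ` (S \<inter> cdom c)) ` K)" for c by blast
    have "eopen (cdim c) (cmap c ` (\<Union>K \<inter> cdom c))" if "c \<in> atlas M" for c
      unfolding eq by (rule openin_Union) (use K that in auto)
    then show "?L (\<Union>K)" using K by blast
  qed
  then show ?thesis by (simp add: mtop_def topology_inverse')
qed

text \<open>One chart per point suffices: a neighbourhood seen in c is carried to any other chart d
  by pulling it back along the transition.\<close>

lemma openin_mtopI:
  assumes M: "pre_mfd M" and W: "W \<subseteq> points M"
    and loc: "\<And>p. p \<in> W \<Longrightarrow> \<exists>c\<in>charts_at M p. \<exists>V. eopen (cdim c) V \<and> cmap c p \<in> V \<and>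
      (\<forall>q\<in>cdom c. cmap c q \<in> V \<longrightarrow> q \<in> W)"
  shows "openin (mtop M) W"
  unfolding openin_mtop[OF M]
proof (intro conjI ballI W)
  fix d assume d: "d \<in> atlas M"
  have dok: "chart_ok d" using pre_mfd_chart_ok[OF M d] .
  show "eopen (cdim d) (cmap d ` (W \<inter> cdom d))"
  proof (rule eopenI)
    fix x assume "x \<in> cmap d ` (W \<inter> cdom d)"
    then obtain p where p: "p \<in> W" "p \<in> cdom d" "x = cmap d p" by blast
    from loc[OF p(1)] obtain c V where c: "c \<in> charts_at M p" and V: "eopen (cdim c) V" "cmap c p \<in> V"
      "\<forall>q\<in>cdom c. cmap c q \<in> V \<longrightarrow> q \<in> W" by blast
    have "smooth_pt d c id p" using charts_at_transition[OF M _ c] d p by (simp add: charts_at_def)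
    then obtain Y where Y: "p \<in> cdom d" "eopen (cdim d) Y" "cmap d p \<in> Y" "Y \<subseteq> cmap d ` cdom d"
      "\<forall>x\<in>Y. id (chart_inv d x) \<in> cdom c" "smooth_between (cdim d) (cdim c) Y (local_rep d c id)"
      by (rule smooth_ptE)
    show "\<exists>V'. eopen (cdim d) V' \<and> x \<in> V' \<and> V' \<subseteq> cmap d ` (W \<inter> cdom d)"
    proof (intro exI conjI)
      show "eopen (cdim d) {x \<in> Y. local_rep d c id x \<in> V}"
        by (rule smooth_between_preimage[OF Y(2) V(1) Y(6)])
      show "x \<in> {x \<in> Y. local_rep d c id x \<in> V}"
        using p V(2) Y(3) dok by (simp add: local_rep_def)
      show "{x \<in> Y. local_rep d c id x \<in> V} \<subseteq> cmap d ` (W \<inter> cdom d)"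
      proof
        fix y assume y: "y \<in> {x \<in> Y. local_rep d c id x \<in> V}"
        then have 1: "chart_inv d y \<in> cdom d" "cmap d (chart_inv d y) = y"
          using Y(4) by (auto intro: chart_inv_in cmap_chart_inv)
        have "chart_inv d y \<in> cdom c" "cmap c (chart_inv d y) \<in> V"
          using y bspec[OF Y(5), of y] by (auto simp: local_rep_def)
        then have "chart_inv d y \<in> W" using V(3) by blast
        with 1 show "y \<in> cmap d ` (W \<inter> cdom d)" by (metis IntI imageI)
      qed
    qed
  qed
qed

lemma openin_mtop_points: "pre_mfd M \<Longrightarrow> openin (mtop M) (points M)"
  by (auto simp: openin_mtop chart_eopen pre_mfd_chart_ok pre_mfd_cdom Int_absorb1)

lemma topspace_mtop: "pre_mfd M \<Longrightarrow> topspace (mtop M) = points M"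
  by (metis openin_mtop openin_mtop_points openin_topspace openin_subset subset_antisym)

lemma smooth_map_continuous:
  assumes M: "pre_mfd M" and N: "pre_mfd N" and f: "smooth_map M N f"
  shows "continuous_map (mtop M) (mtop N) f"
  unfolding continuous_map_def topspace_mtop[OF M] topspace_mtop[OF N]
proof (intro conjI allI impI)
  show "f \<in> points M \<rightarrow> points N" using f by (simp add: smooth_map_def)
  fix V assume V: "openin (mtop N) V"
  show "openin (mtop M) {x \<in> points M. f x \<in> V}"
  proof (rule openin_mtopI[OF M])
    fix p assume p: "p \<in> {x \<in> points M. f x \<in> V}"
    then obtain c d where cd: "c \<in> charts_at M p" "d \<in> charts_at N (f p)" "smooth_pt c d f p"
      using f smooth_map_iff[OF M N] by blast
    from cd(3) obtain W where W: "p \<in> cdom c" "eopen (cdim c) W" "cmap c p \<in> W" "W \<subseteq> cmap c ` cdom c"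
      "\<forall>x\<in>W. f (chart_inv c x) \<in> cdom d" "smooth_between (cdim c) (cdim d) W (local_rep c d f)"
      by (rule smooth_ptE)
    have cok: "chart_ok c" and dok: "chart_ok d" using cd M N pre_mfd_chart_ok by (auto simp: charts_at_def)
    have oV: "eopen (cdim d) (cmap d ` (V \<inter> cdom d))"
      using V cd(2) by (simp add: openin_mtop[OF N] charts_at_def)
    have inV: "q \<in> V" if "q \<in> cdom d" "cmap d q \<in> cmap d ` (V \<inter> cdom d)" for q
    proof -
      from that(2) obtain q' where q': "q' \<in> V" "q' \<in> cdom d" "cmap d q = cmap d q'" by blast
      then show ?thesis using inj_onD[OF chart_inj[OF dok], of q q'] that(1) by simp
    qed
    let ?V = "{x \<in> W. local_rep c d f x \<in> cmap d ` (V \<inter> cdom d)}"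
    have "eopen (cdim c) ?V" by (rule smooth_between_preimage[OF W(2) oV W(6)])
    moreover have "cmap c p \<in> ?V"
      using p W(1,3) bspec[OF W(5), of "cmap c p"] cok by (simp add: local_rep_def)
    moreover have "q \<in> {x \<in> points M. f x \<in> V}" if q: "q \<in> cdom c" "cmap c q \<in> ?V" for q
    proof -
      have "f q \<in> cdom d" using bspec[OF W(5), of "cmap c q"] q cok by simp
      moreover have "cmap d (f q) \<in> cmap d ` (V \<inter> cdom d)" using q cok by (simp add: local_rep_def)
      ultimately have "f q \<in> V" by (rule inV)
      then show ?thesis using q(1) pre_mfd_cdom[OF M, of c] cd(1) by (auto simp: charts_at_def)
    qed
    ultimately show "\<exists>c\<in>charts_at M p. \<exists>V'. eopen (cdim c) V' \<and> cmap c p \<in> V' \<and>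
        (\<forall>q\<in>cdom c. cmap c q \<in> V' \<longrightarrow> q \<in> {x \<in> points M. f x \<in> V})"
      using cd(1) by blast
  qed simp
qed

lemma chart_preimage_open:
  assumes M: "pre_mfd M" and c: "c \<in> atlas M" and V: "eopen (cdim c) V"
  shows "openin (mtop M) {p \<in> cdom c. cmap c p \<in> V}"
proof (rule openin_mtopI[OF M])
  fix p assume "p \<in> {p \<in> cdom c. cmap c p \<in> V}"
  then show "\<exists>c'\<in>charts_at M p. \<exists>V'. eopen (cdim c') V' \<and> cmap c' p \<in> V' \<and>
      (\<forall>q\<in>cdom c'. cmap c' q \<in> V' \<longrightarrow> q \<in> {p \<in> cdom c. cmap c p \<in> V})"
    using V c by (intro bexI[of _ c] exI[of _ V]) (auto simp: charts_at_def)
qed (use pre_mfd_cdom[OF M c] in auto)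

text \<open>One inclusion is continuity of the projections, the other compares cubes in a product
  chart with rectangles. It lets the Hausdorff property and second countability of a product
  manifold be read off from the product topology.\<close>

lemma mtop_prod:
  assumes M: "pre_mfd M" and N: "pre_mfd N"
  shows "mtop (prod_mfd M N) = prod_topology (mtop M) (mtop N)"
proof -
  have P: "pre_mfd (prod_mfd M N)" by (rule prod_mfd_generated[OF M N])
  have "continuous_map (mtop (prod_mfd M N)) (prod_topology (mtop M) (mtop N)) (\<lambda>x. (fst x, snd x))"
    unfolding continuous_map_pairwise o_def fst_conv snd_conv
    using smooth_map_continuous[OF P M smooth_map_fst[OF M N]] smooth_map_continuous[OF P N smooth_map_snd[OF M N]]
    by simp
  then have 1: "openin (mtop (prod_mfd M N)) W" if "openin (prod_topology (mtop M) (mtop N)) W" for W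
    using openin_continuous_map_preimage[OF _ that] that openin_subset[OF that]
    by (fastforce simp: topspace_mtop[OF P] topspace_mtop[OF M] topspace_mtop[OF N] Collect_conj_eq Int_absorb1)
  have 2: "openin (prod_topology (mtop M) (mtop N)) W" if W: "openin (mtop (prod_mfd M N)) W" for W
    unfolding openin_prod_topology_alt
  proof (intro allI impI)
    fix p q assume pq: "(p, q) \<in> W"
    have WP: "W \<subseteq> points M \<times> points N" using W by (simp add: openin_mtop[OF P])
    obtain c where c: "c \<in> charts_at M p" using M pq WP pre_mfd_charts_at by (metis SigmaD1 subsetD)
    obtain d where d: "d \<in> charts_at N q" using N pq WP pre_mfd_charts_at by (metis SigmaD2 subsetD)
    have ok: "chart_ok c" "chart_ok d" and cat: "c \<in> atlas M" "p \<in> cdom c" and dat: "d \<in> atlas N" "q \<in> cdom d"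
      using c d M N pre_mfd_chart_ok by (auto simp: charts_at_def)
    let ?e = "prod_chart c d" let ?n = "cdim c" let ?m = "cdim d"
    have e: "?e \<in> atlas (prod_mfd M N)" by (rule prod_mfd_generated(2)[OF M N cat(1) dat(1)])
    then have "eopen (?n + ?m) (cmap ?e ` (W \<inter> cdom ?e))"
      using W unfolding openin_mtop[OF P] prod_chart_simps(2)[symmetric] by blast
    moreover have z: "cat ?n (cmap c p) (cmap d q) \<in> cmap ?e ` (W \<inter> cdom ?e)"
      by (rule image_eqI[of _ _ "(p, q)"]) (use pq cat dat in auto)
    ultimately obtain r where r: "r > 0" "ebox (?n + ?m) (cat ?n (cmap c p) (cmap d q)) r \<subseteq> cmap ?e ` (W \<inter> cdom ?e)"
      by (rule eopen_contains_ebox)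
    let ?U = "{x \<in> cdom c. cmap c x \<in> ebox ?n (cmap c p) r}"
    let ?V = "{y \<in> cdom d. cmap d y \<in> ebox ?m (cmap d q) r}"
    \<comment> \<open>Two coordinate vectors in cubes of radius r concatenate to a vector in the
      cube of radius r, and injectivity of the product chart brings this back to W.\<close>
    have "?U \<times> ?V \<subseteq> W"
    proof
      fix w assume w: "w \<in> ?U \<times> ?V"
      obtain x y where xy: "w = (x, y)" by (cases w)
      have "cmap ?e (x, y) \<in> ebox (?n + ?m) (cat ?n (cmap c p) (cmap d q)) r"
        using w xy by (auto simp: ebox_def cat_in_EE) (auto simp: cat_def)
      then obtain w' where w': "w' \<in> W" "w' \<in> cdom ?e" "cmap ?e (x, y) = cmap ?e w'" using r(2) by blast
      have "(x, y) = w'"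
        by (rule inj_onD[OF chart_inj[OF prod_chart_ok[OF ok]] w'(3)]) (use w xy w' in auto)
      then show "w \<in> W" using w' xy by simp
    qed
    then show "\<exists>U V. openin (mtop M) U \<and> openin (mtop N) V \<and> p \<in> U \<and> q \<in> V \<and> U \<times> V \<subseteq> W"
      using chart_preimage_open[OF M cat(1) eopen_ebox] chart_preimage_open[OF N dat(1) eopen_ebox]
        cat dat ebox_centre[OF cmap_in_EE[OF ok(1) cat(2)] r(1)] ebox_centre[OF cmap_in_EE[OF ok(2) dat(2)] r(1)]
      by (intro exI[of _ ?U] exI[of _ ?V]) auto
  qed
  show ?thesis unfolding topology_eq using 1 2 by blast
qed

lemma second_countable_prod_topology:
  assumes "second_countable X" "second_countable Y" shows "second_countable (prod_topology X Y)"
proof -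
  obtain A where A: "countable A" "\<And>V. V \<in> A \<Longrightarrow> openin X V"
    "\<And>U x. openin X U \<and> x \<in> U \<longrightarrow> (\<exists>V \<in> A. x \<in> V \<and> V \<subseteq> U)"
    using assms(1) by (auto simp: second_countable_def)
  obtain B where B: "countable B" "\<And>V. V \<in> B \<Longrightarrow> openin Y V"
    "\<And>U x. openin Y U \<and> x \<in> U \<longrightarrow> (\<exists>V \<in> B. x \<in> V \<and> V \<subseteq> U)"
    using assms(2) by (auto simp: second_countable_def)
  show ?thesis
    unfolding second_countable_def
  proof (intro exI conjI allI impI ballI)
    show "countable ((\<lambda>(U, V). U \<times> V) ` (A \<times> B))" using A B by auto
    show "openin (prod_topology X Y) V" if "V \<in> (\<lambda>(U, V). U \<times> V) ` (A \<times> B)" for V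
      using that A(2) B(2) by (auto simp: openin_prod_Times_iff)
    fix W z assume Wz: "openin (prod_topology X Y) W \<and> z \<in> W"
    obtain x y where z: "z = (x, y)" by (cases z)
    from Wz z obtain U V where UV: "openin X U" "openin Y V" "x \<in> U" "y \<in> V" "U \<times> V \<subseteq> W"
      unfolding openin_prod_topology_alt by blast
    obtain U' V' where "U' \<in> A" "x \<in> U'" "U' \<subseteq> U" "V' \<in> B" "y \<in> V'" "V' \<subseteq> V"
      using A(3)[of U x] B(3)[of V y] UV by blast
    then have "U' \<times> V' \<in> (\<lambda>(U, V). U \<times> V) ` (A \<times> B)" "z \<in> U' \<times> V'" "U' \<times> V' \<subseteq> W"
      using UV z by auto
    then show "\<exists>V\<in>(\<lambda>(U, V). U \<times> V) ` (A \<times> B). z \<in> V \<and> V \<subseteq> W" by blast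
  qed
qed

lemma smooth_manifoldI:
  assumes "pre_mfd M" "\<forall>c. is_chart (points M) c \<and> (\<forall>d\<in>atlas M. compatible c d) \<longrightarrow> c \<in> atlas M"
    and "Hausdorff_space (mtop M)" "second_countable (mtop M)"
  shows "smooth_manifold M"
  unfolding smooth_manifold_def using assms(1)[unfolded pre_mfd_def]
  by (elim conjE) (intro conjI assms(2-4); assumption)

lemma smooth_manifold_prod:
  assumes "smooth_manifold M" "smooth_manifold N" shows "smooth_manifold (prod_mfd M N)"
proof -
  note M = smooth_manifold_pre[OF assms(1)] and N = smooth_manifold_pre[OF assms(2)]
  have P: "pre_mfd (prod_mfd M N)" by (rule prod_mfd_generated[OF M N])
  have "Hausdorff_space (mtop (prod_mfd M N))" "second_countable (mtop (prod_mfd M N))"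
    unfolding mtop_prod[OF M N]
    using assms by (auto simp: smooth_manifold_def Hausdorff_space_prod_topology intro: second_countable_prod_topology)
  then show ?thesis
    by (rule smooth_manifoldI[OF P, rotated]) (simp add: prod_mfd_generated(3)[OF M N])
qed

lemma second_countable_Euclidean_space: "second_countable (Euclidean_space n)"
proof -
  obtain \<B> :: "(nat \<Rightarrow> real) set set" where B: "countable \<B>" "\<And>C. C \<in> \<B> \<Longrightarrow> open C"
    "\<And>S. open S \<Longrightarrow> \<exists>U. U \<subseteq> \<B> \<and> S = \<Union>U"
    using univ_second_countable by blast
  have "second_countable (euclidean :: (nat \<Rightarrow> real) topology)"
    unfolding second_countable_def
  proof (intro exI[of _ \<B>] conjI B(1) allI impI ballI)
    fix U x assume "openin euclidean U \<and> (x :: nat \<Rightarrow> real) \<in> U"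
    then show "\<exists>V\<in>\<B>. x \<in> V \<and> V \<subseteq> U" using B(3)[of U] by auto
  qed (use B in auto)
  then show ?thesis
    unfolding Euclidean_space_def euclidean_product_topology by (rule second_countable_subtopology)
qed

text \<open>A chart onto all of \<open>EE (cdim c)\<close> is a homeomorphism, so the topological
  axioms are those of Euclidean space. Tangent spaces are of this kind.\<close>

lemma smooth_manifold_global_chart:
  assumes "pre_mfd M" "\<forall>c. is_chart (points M) c \<and> (\<forall>d\<in>atlas M. compatible c d) \<longrightarrow> c \<in> atlas M"
    and c: "c \<in> atlas M" "cdom c = points M" "cmap c ` points M = EE (cdim c)"
  shows "smooth_manifold M"
proof -
  note M = assms(1)
  have ok: "chart_ok c" using pre_mfd_chart_ok[OF M c(1)] .
  have "homeomorphic_maps (mtop M) (Euclidean_space (cdim c)) (cmap c) (chart_inv c)"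
    unfolding homeomorphic_maps_def
  proof (intro conjI ballI)
    show "continuous_map (mtop M) (Euclidean_space (cdim c)) (cmap c)"
      unfolding continuous_map_def topspace_mtop[OF M]
      using c cmap_in_EE[OF ok] chart_preimage_open[OF M c(1)] by auto
    show "continuous_map (Euclidean_space (cdim c)) (mtop M) (chart_inv c)"
      unfolding continuous_map_def topspace_mtop[OF M]
    proof (intro conjI allI impI)
      show "chart_inv c \<in> EE (cdim c) \<rightarrow> points M" using c chart_inv_in[of _ c] by auto
      fix W assume "openin (mtop M) W"
      then have W: "W \<subseteq> points M" "eopen (cdim c) (cmap c ` W)"
        using c by (auto simp: openin_mtop[OF M] Int_absorb2)
      have "{x \<in> EE (cdim c). chart_inv c x \<in> W} = cmap c ` W"
      proof (rule equalityI; rule subsetI)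
        fix x assume x: "x \<in> {x \<in> EE (cdim c). chart_inv c x \<in> W}"
        then have "cmap c (chart_inv c x) = x" using c by (intro cmap_chart_inv) auto
        then show "x \<in> cmap c ` W" using x by (metis (mono_tags, lifting) imageI mem_Collect_eq)
      next
        fix x assume "x \<in> cmap c ` W"
        then show "x \<in> {x \<in> EE (cdim c). chart_inv c x \<in> W}"
          using W ok c cmap_in_EE[OF ok] by auto
      qed
      then show "eopen (cdim c) {x \<in> EE (cdim c). chart_inv c x \<in> W}" using W by simp
    qed
    fix p assume "p \<in> topspace (mtop M)"
    then show "chart_inv c (cmap c p) = p" using ok c topspace_mtop[OF M] by simp
  next
    fix x assume "x \<in> EE (cdim c)"
    then show "cmap c (chart_inv c x) = x" using c by (intro cmap_chart_inv) auto
  qed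
  then have "mtop M homeomorphic_space Euclidean_space (cdim c)" unfolding homeomorphic_space_def by blast
  then have "Hausdorff_space (mtop M)" "second_countable (mtop M)"
    using homeomorphic_Hausdorff_space homeomorphic_space_second_countability
      Hausdorff_Euclidean_space second_countable_Euclidean_space by blast+
  then show ?thesis by (rule smooth_manifoldI[OF assms(1,2)])
qed

subsection \<open>Open submanifolds\<close>

lemma open_submfd_simps [simp]:
  "points (open_submfd M U) = U" "c \<in> atlas (open_submfd M U) \<longleftrightarrow> c \<in> atlas M \<and> cdom c \<subseteq> U"
  by (simp_all add: open_submfd_def)

text \<open>Restrict a chart of M to the coordinate image of U, which is open by the description of
  \<open>mtop\<close>.\<close>

lemma open_submfd_chart:
  assumes M: "pre_mfd M" and U: "openin (mtop M) U" and p: "p \<in> U"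
  shows "\<exists>c. c \<in> charts_at (open_submfd M U) p"
proof -
  have "p \<in> points M" using U p by (auto simp: openin_mtop[OF M])
  then obtain c where c: "c \<in> atlas M" "p \<in> cdom c" using M pre_mfd_charts_at by (metis charts_at_iff)
  let ?W = "cmap c ` (U \<inter> cdom c)"
  have "restr_chart c ?W \<in> atlas M"
    using U c(1) by (intro pre_mfd_restr[OF M]) (auto simp: openin_mtop[OF M])
  moreover have "cdom (restr_chart c ?W) \<subseteq> U"
    using inj_onD[OF chart_inj[OF pre_mfd_chart_ok[OF M c(1)]]] by auto
  moreover have "p \<in> cdom (restr_chart c ?W)" using c p by simp
  ultimately have "restr_chart c ?W \<in> charts_at (open_submfd M U) p"
    unfolding charts_at_iff open_submfd_simps by blast
  then show ?thesis ..
qed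

lemma open_submfd_pre:
  assumes M: "pre_mfd M" and U: "openin (mtop M) U" shows "pre_mfd (open_submfd M U)"
  unfolding pre_mfd_def
proof (intro conjI ballI allI impI)
  show "\<Union>(cdom ` atlas (open_submfd M U)) = points (open_submfd M U)"
  proof (rule equalityI; rule subsetI)
    fix p assume "p \<in> points (open_submfd M U)"
    then obtain c where "c \<in> charts_at (open_submfd M U) p" using open_submfd_chart[OF M U, of p] by auto
    then show "p \<in> \<Union>(cdom ` atlas (open_submfd M U))" unfolding charts_at_iff by blast
  qed auto
next
  fix c assume c: "c \<in> atlas (open_submfd M U)"
  then have ok: "chart_ok c" and sub: "cdom c \<subseteq> U" using pre_mfd_chart_ok[OF M] by auto
  then show "is_chart (points (open_submfd M U)) c" by (simp add: is_chart_iff[of U])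
  show "compatible c d" if "d \<in> atlas (open_submfd M U)" for d
    using c that pre_mfd_compatible[OF M] by simp
  show "restr_chart c W \<in> atlas (open_submfd M U)" if "eopen (cdim c) W" for W
    using c pre_mfd_restr[OF M _ that] by auto
qed

lemma smooth_map_open_submfd_incl:
  assumes M: "pre_mfd M" and U: "openin (mtop M) U" shows "smooth_map (open_submfd M U) M (\<lambda>x. x)"
proof (rule smooth_mapI[OF open_submfd_pre[OF M U] M])
  fix p assume "p \<in> points (open_submfd M U)"
  then obtain c where c: "c \<in> charts_at (open_submfd M U) p" using open_submfd_chart[OF M U] by auto
  then have "smooth_pt c c (\<lambda>x. x) p"
    using smooth_pt_id[of c p] pre_mfd_chart_ok[OF M] by (simp add: charts_at_def id_def)
  then show "\<exists>c\<in>charts_at (open_submfd M U) p. \<exists>d\<in>atlas M. smooth_pt c d (\<lambda>x. x) p"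
    using c by (auto simp: charts_at_def)
qed

lemma smooth_map_into_open_submfd:
  assumes M: "pre_mfd M" and N: "pre_mfd N" and U: "openin (mtop N) U"
    and f: "smooth_map M N f" and fU: "\<And>p. p \<in> points M \<Longrightarrow> f p \<in> U"
  shows "smooth_map M (open_submfd N U) f"
proof (rule smooth_mapI[OF M open_submfd_pre[OF N U]])
  fix p assume p: "p \<in> points M"
  obtain c where c: "c \<in> charts_at M p" using M p pre_mfd_charts_at by metis
  obtain d where d: "d \<in> charts_at (open_submfd N U) (f p)" using open_submfd_chart[OF N U fU[OF p]] by blast
  then have "d \<in> charts_at N (f p)" by (simp add: charts_at_def)
  then have "smooth_pt c d f p" by (rule smooth_map_charts[OF M N f c])
  then show "\<exists>c\<in>charts_at M p. \<exists>d\<in>atlas (open_submfd N U). smooth_pt c d f p"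
    by (intro bexI[of _ c] bexI[of _ d]) (use c d in \<open>simp_all add: charts_at_iff\<close>)
qed

lemma smooth_map_restrict_open:
  assumes M: "pre_mfd M" and N: "pre_mfd N" and U: "openin (mtop M) U" and f: "smooth_map M N f"
  shows "smooth_map (open_submfd M U) N f"
  by (rule smooth_map_compose[OF open_submfd_pre[OF M U] M N smooth_map_open_submfd_incl[OF M U] f])

lemma smooth_map_open_cover:
  assumes M: "pre_mfd M" and N: "pre_mfd N"
    and loc: "\<And>p. p \<in> points M \<Longrightarrow> \<exists>U. openin (mtop M) U \<and> p \<in> U \<and> smooth_map (open_submfd M U) N f"
  shows "smooth_map M N f"
proof (rule smooth_mapI[OF M N])
  fix p assume "p \<in> points M"
  from loc[OF this] obtain U where U: "openin (mtop M) U" "p \<in> U" "smooth_map (open_submfd M U) N f" by blast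
  obtain c where c: "c \<in> charts_at (open_submfd M U) p" using open_submfd_chart[OF M U(1,2)] by blast
  obtain d where d: "d \<in> charts_at N (f p)"
    using smooth_map_points[OF U(3), of p] U(2) N pre_mfd_charts_at by (metis open_submfd_simps(1))
  have "smooth_pt c d f p" by (rule smooth_map_charts[OF open_submfd_pre[OF M U(1)] N U(3) c d])
  then show "\<exists>c\<in>charts_at M p. \<exists>d\<in>atlas N. smooth_pt c d f p" using c d by (auto simp: charts_at_def)
qed

subsection \<open>Transport of structure\<close>

definition trans_chart :: "'s set \<Rightarrow> ('s \<Rightarrow> 'a) \<Rightarrow> 'a chart \<Rightarrow> 's chart" where
  "trans_chart S f c = \<lparr>cdom = {s \<in> S. f s \<in> cdom c}, cdim = cdim c,
     cmap = restrict (cmap c \<circ> f) {s \<in> S. f s \<in> cdom c}\<rparr>"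

lemma trans_chart_simps [simp]:
  "cdom (trans_chart S f c) = {s \<in> S. f s \<in> cdom c}" "cdim (trans_chart S f c) = cdim c"
  "s \<in> S \<Longrightarrow> f s \<in> cdom c \<Longrightarrow> cmap (trans_chart S f c) s = cmap c (f s)"
  by (auto simp: trans_chart_def)

lemma transport_mfd_eq: "transport_mfd S f M = \<lparr>points = S, atlas = trans_chart S f ` atlas M\<rparr>"
  by (auto simp: transport_mfd_def trans_chart_def)

text \<open>The inverse is named, so that the situation is symmetric: interpreting the locale with
  the two sides exchanged carries charts back.\<close>

locale bij_pair =
  fixes S :: "'s set" and P :: "'a set" and f :: "'s \<Rightarrow> 'a" and g :: "'a \<Rightarrow> 's"
  assumes fP: "s \<in> S \<Longrightarrow> f s \<in> P" and gS: "p \<in> P \<Longrightarrow> g p \<in> S"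
    and gf: "s \<in> S \<Longrightarrow> g (f s) = s" and fg: "p \<in> P \<Longrightarrow> f (g p) = p"
begin

lemma trans_image:
  assumes "cdom c \<subseteq> P" shows "cmap (trans_chart S f c) ` cdom (trans_chart S f c) = cmap c ` cdom c"
proof (rule equalityI; rule subsetI)
  fix x assume "x \<in> cmap c ` cdom c"
  then obtain p where p: "p \<in> cdom c" "x = cmap c p" by blast
  then show "x \<in> cmap (trans_chart S f c) ` cdom (trans_chart S f c)"
    using assms gS[of p] fg[of p] by (intro image_eqI[of _ _ "g p"]) auto
qed auto

lemma trans_chart_ok:
  assumes c: "chart_ok c" "cdom c \<subseteq> P" shows "chart_ok (trans_chart S f c)"
proof -
  have "inj_on (cmap (trans_chart S f c)) (cdom (trans_chart S f c))"
  proof (rule inj_onI)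
    fix s s' assume s: "s \<in> cdom (trans_chart S f c)" "s' \<in> cdom (trans_chart S f c)"
      "cmap (trans_chart S f c) s = cmap (trans_chart S f c) s'"
    then have "f s = f s'" using inj_onD[OF chart_inj[OF c(1)], of "f s" "f s'"] by simp
    then show "s = s'" using s gf by (metis (no_types, lifting) mem_Collect_eq trans_chart_simps(1))
  qed
  moreover have "cmap (trans_chart S f c) \<in> extensional (cdom (trans_chart S f c))"
    by (simp add: trans_chart_def)
  ultimately show ?thesis
    unfolding is_chart_def trans_image[OF c(2)] using chart_eopen[OF c(1)] by simp
qed

lemma smooth_pt_trans:
  assumes c: "chart_ok c" "cdom c \<subseteq> P" and s: "s \<in> S" "f s \<in> cdom c"
  shows "smooth_pt (trans_chart S f c) c f s"
  by (rule smooth_ptI[OF trans_chart_ok[OF c] c(1), where W = "EE (cdim c)" and H = "\<lambda>x. x"])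
    (use s c in \<open>auto simp: eopen_EE cmap_in_EE smooth_between_id\<close>)

lemma smooth_pt_trans_inv:
  assumes c: "chart_ok c" "cdom c \<subseteq> P" and p: "p \<in> cdom c"
  shows "smooth_pt c (trans_chart S f c) g p"
proof (rule smooth_ptI[OF c(1) trans_chart_ok[OF c] p, where W = "EE (cdim c)" and H = "\<lambda>x. x"])
  fix q assume "q \<in> cdom c"
  then show "g q \<in> cdom (trans_chart S f c) \<and> cmap (trans_chart S f c) (g q) = cmap c q"
    using c(2) gS[of q] fg[of q] by auto
qed (use p c in \<open>auto simp: eopen_EE cmap_in_EE smooth_between_id\<close>)

lemma trans_compatible:
  assumes c: "chart_ok c" "cdom c \<subseteq> P" and d: "chart_ok d" "cdom d \<subseteq> P" and cd: "compatible c d"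
  shows "compatible (trans_chart S f c) (trans_chart S f d)"
proof -
  have *: "smooth_pt (trans_chart S f c) (trans_chart S f d) id s"
    if s: "s \<in> S" "f s \<in> cdom c" "f s \<in> cdom d" and c: "chart_ok c" "cdom c \<subseteq> P"
      and d: "chart_ok d" "cdom d \<subseteq> P" and cd: "compatible c d" for s c d
  proof -
    have "smooth_pt c d id (f s)" by (rule compatible_smooth_pt[OF c(1) d(1) cd s(2,3)])
    then have "smooth_pt (trans_chart S f c) d (\<lambda>x. id (f x)) s"
      by (rule smooth_pt_compose[OF trans_chart_ok[OF c] c(1) smooth_pt_trans[OF c s(1,2)]])
    then have "smooth_pt (trans_chart S f c) (trans_chart S f d) (\<lambda>x. g (id (f x))) s"
      by (rule smooth_pt_compose[OF trans_chart_ok[OF c] d(1)]) (use smooth_pt_trans_inv[OF d s(3)] in simp)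
    then show ?thesis by (rule smooth_pt_cong) (simp add: gf)
  qed
  show ?thesis
    unfolding compatible_iff[OF trans_chart_ok[OF c] trans_chart_ok[OF d]]
    using *[OF _ _ _ c d cd] *[OF _ _ _ d c compatible_sym[OF cd]] by simp
qed

end

context bij_pair begin

text \<open>Transport of charts along f respects compatibility and commutes with shrinking.
  Maximality follows because transport along g undoes it.\<close>

lemma transport_pre_max:
  assumes M: "pre_mfd M" and P: "points M = P"
  shows "pre_mfd (transport_mfd S f M)"
    "(\<forall>c. is_chart P c \<and> (\<forall>d\<in>atlas M. compatible c d) \<longrightarrow> c \<in> atlas M) \<Longrightarrow>
      \<forall>c. is_chart S c \<and> (\<forall>d\<in>atlas (transport_mfd S f M). compatible c d) \<longrightarrow> c \<in> atlas (transport_mfd S f M)"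
proof -
  have dom: "c \<in> atlas M \<Longrightarrow> cdom c \<subseteq> P" for c using pre_mfd_cdom[OF M] P by blast
  note ok = pre_mfd_chart_ok[OF M]
  show "pre_mfd (transport_mfd S f M)"
    unfolding pre_mfd_def transport_mfd_eq smooth_mfd.simps
  proof (intro conjI ballI allI impI)
    fix c' assume "c' \<in> trans_chart S f ` atlas M"
    then obtain c where c: "c \<in> atlas M" "c' = trans_chart S f c" by blast
    show "is_chart S c'"
      unfolding is_chart_iff[of S] c(2) using trans_chart_ok[OF ok[OF c(1)] dom[OF c(1)]] by auto
    show "compatible c' d'" if d': "d' \<in> trans_chart S f ` atlas M" for d'
    proof -
      obtain d where d: "d \<in> atlas M" "d' = trans_chart S f d" using d' by blast
      show ?thesis
        unfolding c(2) d(2) using trans_compatible[OF ok[OF c(1)] dom[OF c(1)] ok[OF d(1)] dom[OF d(1)]]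
          pre_mfd_compatible[OF M c(1) d(1)] by blast
    qed
    show "restr_chart c' W \<in> trans_chart S f ` atlas M" if "eopen (cdim c') W" for W
    proof (rule image_eqI)
      show "restr_chart c W \<in> atlas M" using that c by (intro pre_mfd_restr[OF M]) auto
      have "{s \<in> S. f s \<in> cdom c \<and> cmap (trans_chart S f c) s \<in> W} = {s \<in> S. f s \<in> cdom c \<and> cmap c (f s) \<in> W}"
        by auto
      then show "restr_chart c' W = trans_chart S f (restr_chart c W)"
        unfolding c(2) by (simp add: restr_chart_def trans_chart_def fun_eq_iff)
    qed
  next
    show "\<Union>(cdom ` trans_chart S f ` atlas M) = S"
    proof (rule equalityI; rule subsetI)
      fix s assume s: "s \<in> S"
      then obtain c where "c \<in> charts_at M (f s)" using pre_mfd_charts_at[OF M] fP P by metis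
      then show "s \<in> \<Union>(cdom ` trans_chart S f ` atlas M)" using s by (auto simp: charts_at_def)
    qed auto
  qed
  assume max: "\<forall>c. is_chart P c \<and> (\<forall>d\<in>atlas M. compatible c d) \<longrightarrow> c \<in> atlas M"
  \<comment> \<open>A chart e compatible with the transported atlas is moved to the side of M, where
    maximality applies; moving the result back along f returns e.\<close>
  interpret inv: bij_pair P S g f by unfold_locales (auto simp: fP gS gf fg)
  show "\<forall>c. is_chart S c \<and> (\<forall>d\<in>atlas (transport_mfd S f M). compatible c d) \<longrightarrow> c \<in> atlas (transport_mfd S f M)"
  proof (intro allI impI)
    fix e assume e: "is_chart S e \<and> (\<forall>d\<in>atlas (transport_mfd S f M). compatible e d)"
    then have eok: "chart_ok e" "cdom e \<subseteq> S" by (auto simp: is_chart_iff[of S])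
    let ?c = "trans_chart P g e"
    have cok: "chart_ok ?c" by (rule inv.trans_chart_ok[OF eok])
    have "?c \<in> atlas M"
    proof (rule max[rule_format], intro conjI ballI)
      show "is_chart P ?c" using cok by (auto simp: is_chart_iff[of P])
      fix d assume d: "d \<in> atlas M"
      have td: "trans_chart P g (trans_chart S f d) = d"
      proof (rule chart.equality)
        have dd: "cdom (trans_chart P g (trans_chart S f d)) = cdom d" using dom[OF d] gS fg by auto
        then show "cdom (trans_chart P g (trans_chart S f d)) = cdom d" .
        show "cmap (trans_chart P g (trans_chart S f d)) = cmap d"
        proof (rule extensionalityI)
          show "cmap (trans_chart P g (trans_chart S f d)) \<in> extensional (cdom d)"
            unfolding dd[symmetric] by (simp add: trans_chart_def)
          show "cmap d \<in> extensional (cdom d)" using ok[OF d] by (simp add: is_chart_def)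
          show "cmap (trans_chart P g (trans_chart S f d)) p = cmap d p" if "p \<in> cdom d" for p
            using that dom[OF d] gS[of p] fg[of p] by auto
        qed
      qed simp_all
      have "compatible e (trans_chart S f d)" using e d by (simp add: transport_mfd_eq)
      then have "compatible ?c (trans_chart P g (trans_chart S f d))"
        by (rule inv.trans_compatible[OF eok trans_chart_ok[OF ok[OF d] dom[OF d]], rotated]) auto
      then show "compatible ?c d" by (simp only: td)
    qed
    moreover have "e = trans_chart S f ?c"
    proof (rule chart.equality)
      have ee: "cdom e = cdom (trans_chart S f ?c)" using eok(2) fP gf by auto
      then show "cdom e = cdom (trans_chart S f ?c)" .
      show "cmap e = cmap (trans_chart S f ?c)"
      proof (rule extensionalityI)
        show "cmap (trans_chart S f ?c) \<in> extensional (cdom e)"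
          unfolding ee by (simp add: trans_chart_def)
        show "cmap e \<in> extensional (cdom e)" using eok by (simp add: is_chart_def)
        show "cmap e s = cmap (trans_chart S f ?c) s" if "s \<in> cdom e" for s
          using that eok(2) fP[of s] gf[of s] by auto
      qed
    qed simp_all
    ultimately show "e \<in> atlas (transport_mfd S f M)" by (simp add: transport_mfd_eq)
  qed
qed

lemma transport_points [simp]: "points (transport_mfd S f M) = S"
  by (simp add: transport_mfd_def)

lemma smooth_map_transport:
  assumes M: "pre_mfd M" and P: "points M = P" shows "smooth_map (transport_mfd S f M) M f"
proof (rule smooth_mapI[OF transport_pre_max(1)[OF M P] M])
  fix s assume "s \<in> points (transport_mfd S f M)"
  then have s: "s \<in> S" by simp
  then obtain c where c: "c \<in> atlas M" "f s \<in> cdom c"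
    using pre_mfd_charts_at[OF M] fP P by (metis charts_at_iff)
  then have "smooth_pt (trans_chart S f c) c f s"
    using smooth_pt_trans pre_mfd_chart_ok[OF M] pre_mfd_cdom[OF M] P s by blast
  then show "\<exists>c\<in>charts_at (transport_mfd S f M) s. \<exists>d\<in>atlas M. smooth_pt c d f s"
    using c s by (auto simp: charts_at_def transport_mfd_eq)
qed

lemma smooth_map_transport_inv:
  assumes M: "pre_mfd M" and P: "points M = P" shows "smooth_map M (transport_mfd S f M) g"
proof (rule smooth_mapI[OF M transport_pre_max(1)[OF M P]])
  fix p assume "p \<in> points M"
  then obtain c where c: "c \<in> atlas M" "p \<in> cdom c"
    using pre_mfd_charts_at[OF M] by (metis charts_at_iff)
  then have "smooth_pt c (trans_chart S f c) g p"
    using smooth_pt_trans_inv pre_mfd_chart_ok[OF M] pre_mfd_cdom[OF M] P by blast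
  then show "\<exists>c\<in>charts_at M p. \<exists>d\<in>atlas (transport_mfd S f M). smooth_pt c d g p"
    using c by (auto simp: charts_at_def transport_mfd_eq)
qed

lemma smooth_manifold_transport:
  assumes M: "smooth_manifold M" and P: "points M = P" shows "smooth_manifold (transport_mfd S f M)"
proof -
  note pM = smooth_manifold_pre[OF M]
  note pT = transport_pre_max(1)[OF pM P]
  have "homeomorphic_maps (mtop (transport_mfd S f M)) (mtop M) f g"
    unfolding homeomorphic_maps_def topspace_mtop[OF pM] topspace_mtop[OF pT] transport_points P
    by (intro conjI ballI smooth_map_continuous[OF pT pM smooth_map_transport[OF pM P]]
        smooth_map_continuous[OF pM pT smooth_map_transport_inv[OF pM P]] gf fg)
  then have h: "mtop (transport_mfd S f M) homeomorphic_space mtop M" unfolding homeomorphic_space_def by blast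
  show ?thesis
  proof (rule smooth_manifoldI[OF pT])
    have "\<forall>c. is_chart P c \<and> (\<forall>d\<in>atlas M. compatible c d) \<longrightarrow> c \<in> atlas M"
      unfolding P[symmetric] using M unfolding smooth_manifold_def by (elim conjE)
    then show "\<forall>c. is_chart (points (transport_mfd S f M)) c \<and>
        (\<forall>d\<in>atlas (transport_mfd S f M). compatible c d) \<longrightarrow> c \<in> atlas (transport_mfd S f M)"
      unfolding transport_points by (rule transport_pre_max(2)[OF pM P])
    show "Hausdorff_space (mtop (transport_mfd S f M))" "second_countable (mtop (transport_mfd S f M))"
      using homeomorphic_Hausdorff_space[OF h] homeomorphic_space_second_countability[OF h] M
      by (simp_all add: smooth_manifold_def)
  qed
qed

end

section \<open>Tangent vectors\<close>

text \<open>The derivative of f at p as a matrix in the charts c and d, applied to a coordinate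
  vector.\<close>

definition jrep :: "'a chart \<Rightarrow> 'b chart \<Rightarrow> ('a \<Rightarrow> 'b) \<Rightarrow> 'a \<Rightarrow> (nat \<Rightarrow> real) \<Rightarrow> nat \<Rightarrow> real" where
  "jrep c d f p = jacobian_apply (cdim c) (cdim d) (local_rep c d f) (cmap c p)"

lemma jrep_EE [simp]: "jrep c d f p \<xi> \<in> EE (cdim d)"
  by (simp add: jrep_def)

lemma jrep_compose:
  assumes c: "chart_ok c" and d: "chart_ok d" and f: "smooth_pt c d f p" and g: "smooth_pt d e g (f p)"
  shows "jrep c e (\<lambda>x. g (f x)) p \<xi> = jrep d e g (f p) (jrep c d f p \<xi>)"
proof -
  from f obtain W where W: "p \<in> cdom c" "eopen (cdim c) W" "cmap c p \<in> W" "W \<subseteq> cmap c ` cdom c"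
    "\<forall>x\<in>W. f (chart_inv c x) \<in> cdom d" "smooth_between (cdim c) (cdim d) W (local_rep c d f)"
    by (rule smooth_ptE)
  from g obtain V where V: "f p \<in> cdom d" "eopen (cdim d) V" "cmap d (f p) \<in> V" "V \<subseteq> cmap d ` cdom d"
    "\<forall>x\<in>V. g (chart_inv d x) \<in> cdom e" "smooth_between (cdim d) (cdim e) V (local_rep d e g)"
    by (rule smooth_ptE)
  define Y where "Y = {x \<in> W. local_rep c d f x \<in> V}"
  have Y: "eopen (cdim c) Y" unfolding Y_def by (rule smooth_between_preimage[OF W(2) V(2) W(6)])
  have YW: "Y \<subseteq> W" and YV: "\<And>x. x \<in> Y \<Longrightarrow> local_rep c d f x \<in> V" by (auto simp: Y_def)
  have rp: "local_rep c d f (cmap c p) = cmap d (f p)" using c W(1) by (simp add: local_rep_def)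
  have pY: "cmap c p \<in> Y" using W(3) V(3) by (simp add: Y_def rp)
  have gf: "local_rep c e (\<lambda>x. g (f x)) x = local_rep d e g (local_rep c d f x)" if "x \<in> Y" for x
    using bspec[OF W(5), of x] YW that d by (auto simp: local_rep_def)
  show ?thesis
    using jacobian_apply_cong[OF Y pY gf]
      jacobian_apply_compose[OF Y V(2) YV pY smooth_between_subset[OF W(2) Y YW W(6)] V(6)]
    by (simp only: jrep_def rp)
qed

lemma jrep_id:
  assumes "chart_ok c" "p \<in> cdom c" "\<xi> \<in> EE (cdim c)" shows "jrep c c id p \<xi> = \<xi>"
  unfolding jrep_def
  by (rule jacobian_apply_id[OF chart_eopen[OF assms(1)]]) (use assms in \<open>auto simp: local_rep_def\<close>)

text \<open>A tangent vector is a family indexed by all charts at p; this prescribes it in one chart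
  and fills in the others by Jacobians of transitions.\<close>

definition tvec_of :: "'a smooth_mfd \<Rightarrow> 'a \<Rightarrow> 'a chart \<Rightarrow> (nat \<Rightarrow> real) \<Rightarrow> 'a tvec" where
  "tvec_of M p c \<xi> = (\<lambda>d. if d \<in> charts_at M p then jrep c d id p \<xi> else (\<lambda>_. 0))"

lemma tangent_space_iff:
  "v \<in> tangent_space M p \<longleftrightarrow> (\<forall>c. c \<notin> charts_at M p \<longrightarrow> v c = (\<lambda>_. 0)) \<and>
     (\<forall>c\<in>charts_at M p. v c \<in> EE (cdim c)) \<and>
     (\<forall>c\<in>charts_at M p. \<forall>d\<in>charts_at M p. v d = jrep c d id p (v c))"
  unfolding tangent_space_def jrep_def by (rule mem_Collect_eq)

lemma tangent_space_EE: "v \<in> tangent_space M p \<Longrightarrow> c \<in> charts_at M p \<Longrightarrow> v c \<in> EE (cdim c)"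
  unfolding tangent_space_iff by blast

lemma tangent_space_change:
  "v \<in> tangent_space M p \<Longrightarrow> c \<in> charts_at M p \<Longrightarrow> d \<in> charts_at M p \<Longrightarrow> v d = jrep c d id p (v c)"
  unfolding tangent_space_iff by blast

lemma tangent_space_out: "v \<in> tangent_space M p \<Longrightarrow> c \<notin> charts_at M p \<Longrightarrow> v c = (\<lambda>_. 0)"
  unfolding tangent_space_iff by blast

lemma tangent_space_eqI:
  assumes "v \<in> tangent_space M p" "w \<in> tangent_space M p" "c \<in> charts_at M p" "v c = w c"
  shows "v = w"
proof
  fix d show "v d = w d"
  proof (cases "d \<in> charts_at M p")
    case True
    then show ?thesis using tangent_space_change[OF assms(1,3)] tangent_space_change[OF assms(2,3)] assms(4) by simp
  qed (simp add: tangent_space_out[OF assms(1)] tangent_space_out[OF assms(2)])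
qed

text \<open>The transformation law between charts d and e is the chain rule for the transitions from
  c to d and from d to e.\<close>

lemma tvec_of_tangent:
  assumes M: "pre_mfd M" and c: "c \<in> charts_at M p"
  shows "tvec_of M p c \<xi> \<in> tangent_space M p"
  unfolding tangent_space_iff
proof (intro conjI ballI allI impI)
  fix d e assume d: "d \<in> charts_at M p" and e: "e \<in> charts_at M p"
  have ok: "chart_ok c" "chart_ok d" using c d pre_mfd_chart_ok[OF M] by (auto simp: charts_at_iff)
  have "jrep c e (\<lambda>x. id (id x)) p \<xi> = jrep d e id (id p) (jrep c d id p \<xi>)"
    by (rule jrep_compose[OF ok charts_at_transition[OF M c d]]) (use charts_at_transition[OF M d e] in \<open>simp add: id_def\<close>)
  then show "tvec_of M p c \<xi> e = jrep d e id p (tvec_of M p c \<xi> d)"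
    using d e by (simp add: tvec_of_def id_def)
qed (simp_all add: tvec_of_def)

lemma tvec_of_apply:
  assumes M: "pre_mfd M" and c: "c \<in> charts_at M p" and "\<xi> \<in> EE (cdim c)"
  shows "tvec_of M p c \<xi> c = \<xi>"
  using assms jrep_id[of c p \<xi>] pre_mfd_chart_ok[OF M] by (simp add: tvec_of_def charts_at_iff)

text \<open>\<open>pushforward\<close> computes in a chart picked by \<open>SOME\<close>. The chain
  rule through the transition shows that any other chart at p gives the same component.\<close>

lemma pushforward_apply:
  assumes M: "pre_mfd M" and c: "c \<in> charts_at M p" and d: "d \<in> charts_at N (f p)" "chart_ok d"
    and f: "smooth_pt c d f p" and v: "v \<in> tangent_space M p"
  shows "pushforward M N f p v d = jrep c d f p (v c)"
proof -
  define c0 where "c0 = (SOME c. c \<in> charts_at M p)"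
  have c0: "c0 \<in> charts_at M p" unfolding c0_def using c by (rule someI)
  have ok: "chart_ok c" "chart_ok c0" using c c0 pre_mfd_chart_ok[OF M] by (auto simp: charts_at_iff)
  have "smooth_pt c0 d (\<lambda>x. f (id x)) p"
    by (rule smooth_pt_compose[OF ok(2,1) charts_at_transition[OF M c0 c]]) (use f in \<open>simp add: id_def\<close>)
  then have f0: "smooth_pt c0 d f (id p)" by (simp add: id_def)
  have "jrep c d (\<lambda>x. f (id x)) p (v c) = jrep c0 d f (id p) (jrep c c0 id p (v c))"
    by (rule jrep_compose[OF ok charts_at_transition[OF M c c0] f0])
  then show ?thesis
    using d tangent_space_change[OF v c c0]
    by (simp add: pushforward_def c0_def[symmetric] Let_def jrep_def id_def)
qed

lemma pushforward_tangent:
  assumes M: "pre_mfd M" and N: "pre_mfd N" and c: "c \<in> charts_at M p" and d: "d \<in> charts_at N (f p)"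
    and f: "smooth_pt c d f p" and v: "v \<in> tangent_space M p"
  shows "pushforward M N f p v \<in> tangent_space N (f p)"
  unfolding tangent_space_iff
proof (intro conjI ballI allI impI)
  fix e e' assume e: "e \<in> charts_at N (f p)" and e': "e' \<in> charts_at N (f p)"
  note okN = pre_mfd_chart_ok[OF N]
  have ok: "chart_ok c" "chart_ok d" "chart_ok e" "chart_ok e'"
    using c d e e' pre_mfd_chart_ok[OF M] okN by (auto simp: charts_at_iff)
  have fe: "smooth_pt c e f p" if "e \<in> charts_at N (f p)" for e
    using smooth_pt_compose[OF ok(1,2) f charts_at_transition[OF N d that]] by simp
  have "jrep c e' (\<lambda>x. id (f x)) p (v c) = jrep e e' id (f p) (jrep c e f p (v c))"
    by (rule jrep_compose[OF ok(1,3) fe[OF e] charts_at_transition[OF N e e']])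
  then show "pushforward M N f p v e' = jrep e e' id (f p) (pushforward M N f p v e)"
    using pushforward_apply[of M c p e N f v, OF M c e ok(3) fe[OF e] v]
      pushforward_apply[of M c p e' N f v, OF M c e' ok(4) fe[OF e'] v] by simp
qed (simp_all add: pushforward_def Let_def)

lemma pushforward_compose:
  assumes M: "pre_mfd M" and N: "pre_mfd N" and P: "pre_mfd P"
    and f: "smooth_map M N f" and g: "smooth_map N P g" and p: "p \<in> points M" and v: "v \<in> tangent_space M p"
  shows "pushforward N P g (f p) (pushforward M N f p v) = pushforward M P (\<lambda>x. g (f x)) p v"
proof -
  have fp: "f p \<in> points N" and gp: "g (f p) \<in> points P"
    by (rule smooth_map_points[OF f p], rule smooth_map_points[OF g smooth_map_points[OF f p]])
  obtain c where c: "c \<in> charts_at M p" using pre_mfd_charts_at[OF M p] by blast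
  obtain d where d: "d \<in> charts_at N (f p)" using pre_mfd_charts_at[OF N fp] by blast
  note sf = smooth_map_charts[OF M N f c d]
  note pf = pushforward_tangent[OF M N c d sf v]
  show ?thesis
  proof
    fix e show "pushforward N P g (f p) (pushforward M N f p v) e = pushforward M P (\<lambda>x. g (f x)) p v e"
    proof (cases "e \<in> charts_at P (g (f p))")
      case True
      have ok: "chart_ok c" "chart_ok d" "chart_ok e"
        using c d True pre_mfd_chart_ok M N P by (auto simp: charts_at_iff)
      note sg = smooth_map_charts[OF N P g d True]
      show ?thesis
        unfolding pushforward_apply[of N d "f p" e P g, OF N d True ok(3) sg pf]
          pushforward_apply[of M c p d N f, OF M c d ok(2) sf v]
          pushforward_apply[of M c p e P "\<lambda>x. g (f x)", OF M c True ok(3) smooth_pt_compose[OF ok(1,2) sf sg] v]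
        by (rule jrep_compose[OF ok(1,2) sf sg, symmetric])
    qed (simp add: pushforward_def)
  qed
qed

lemma pushforward_id:
  assumes M: "pre_mfd M" and p: "p \<in> points M" and v: "v \<in> tangent_space M p"
  shows "pushforward M M (\<lambda>x. x) p v = v"
proof -
  obtain c where c: "c \<in> charts_at M p" using pre_mfd_charts_at[OF M p] by blast
  then have ok: "chart_ok c" "p \<in> cdom c" using pre_mfd_chart_ok[OF M] by (auto simp: charts_at_iff)
  have s: "smooth_pt c c (\<lambda>x. x) p" using smooth_pt_id[OF ok] by (simp add: id_def)
  show ?thesis
  proof (rule tangent_space_eqI[OF _ v c])
    show "pushforward M M (\<lambda>x. x) p v \<in> tangent_space M p"
      using pushforward_tangent[of M M c p c "\<lambda>x. x", OF M M c c s v] .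
    show "pushforward M M (\<lambda>x. x) p v c = v c"
      using pushforward_apply[of M c p c M "\<lambda>x. x", OF M c c ok(1) s v]
        jrep_id[OF ok tangent_space_EE[OF v c]] by (simp add: id_def)
  qed
qed

text \<open>Both sides compute with the same chosen chart, whose domain lies in
  \<open>points M\<close>, so the two local representatives agree on an open set and have equal
  Jacobians.\<close>

lemma pushforward_cong:
  assumes M: "pre_mfd M" and p: "p \<in> points M" and "\<And>x. x \<in> points M \<Longrightarrow> f x = g x"
  shows "pushforward M N f p v = pushforward M N g p v"
proof -
  have c: "(SOME c. c \<in> charts_at M p) \<in> charts_at M p"
    using pre_mfd_charts_at[OF M p] by (rule someI_ex)
  then have ok: "chart_ok (SOME c. c \<in> charts_at M p)" "p \<in> cdom (SOME c. c \<in> charts_at M p)"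
    and sub: "cdom (SOME c. c \<in> charts_at M p) \<subseteq> points M"
    using pre_mfd_chart_ok[OF M] pre_mfd_cdom[OF M] by (auto simp: charts_at_iff)
  have "jrep (SOME c. c \<in> charts_at M p) d f p \<xi> = jrep (SOME c. c \<in> charts_at M p) d g p \<xi>" for d \<xi>
    unfolding jrep_def
    by (rule jacobian_apply_cong[OF chart_eopen[OF ok(1)]])
      (use ok sub assms(3) chart_inv_in[of _ "SOME c. c \<in> charts_at M p"] in \<open>auto simp: local_rep_def subset_iff\<close>)
  then show ?thesis using assms(3)[OF p] by (simp add: pushforward_def jrep_def Let_def fun_eq_iff)
qed

subsection \<open>Complexified tangent spaces\<close>

lemma jrep_lincomb:
  "jrep c d f p (\<lambda>i. a * \<xi> i + b * \<zeta> i) = (\<lambda>i. a * jrep c d f p \<xi> i + b * jrep c d f p \<zeta> i)"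
  unfolding jrep_def by (rule jacobian_apply_lincomb)

text \<open>Real combinations cover both complex operations: a = b = 1 gives sums, and the
  coefficients \<open>Re z\<close> and \<open>- Im z\<close> or \<open>Im z\<close> give the two
  parts of a complex multiple.\<close>

lemma tangent_space_lincomb:
  assumes "v \<in> tangent_space M p" "w \<in> tangent_space M p"
  shows "(\<lambda>c i. a * v c i + b * w c i) \<in> tangent_space M p"
  unfolding tangent_space_iff
proof (intro conjI ballI allI impI)
  fix c d assume c: "c \<in> charts_at M p" and d: "d \<in> charts_at M p"
  show "(\<lambda>i. a * v d i + b * w d i) = jrep c d id p (\<lambda>i. a * v c i + b * w c i)"
    unfolding jrep_lincomb tangent_space_change[OF assms(1) c d, symmetric]
      tangent_space_change[OF assms(2) c d, symmetric] ..
next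
  fix c assume "c \<in> charts_at M p"
  then show "(\<lambda>i. a * v c i + b * w c i) \<in> EE (cdim c)"
    using tangent_space_EE[OF assms(1), of c] tangent_space_EE[OF assms(2), of c] by (simp add: EE_iff)
qed (simp add: tangent_space_out[OF assms(1)] tangent_space_out[OF assms(2)])

lemma ct_add_in:
  assumes "\<alpha> \<in> ctangent_space M p" "\<beta> \<in> ctangent_space M p" shows "ct_add \<alpha> \<beta> \<in> ctangent_space M p"
  using assms tangent_space_lincomb[of "fst \<alpha>" M p "fst \<beta>" 1 1] tangent_space_lincomb[of "snd \<alpha>" M p "snd \<beta>" 1 1]
  by (auto simp: ct_add_def ctangent_space_def)

lemma ct_scale_in:
  assumes "\<alpha> \<in> ctangent_space M p" shows "ct_scale z \<alpha> \<in> ctangent_space M p"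
  using assms tangent_space_lincomb[of "fst \<alpha>" M p "snd \<alpha>" "Re z" "- Im z"]
    tangent_space_lincomb[of "snd \<alpha>" M p "fst \<alpha>" "Re z" "Im z"]
  by (auto simp: ct_scale_def ctangent_space_def)

lemma ct_zero_in: "ct_zero \<in> ctangent_space M p"
  by (simp add: ct_zero_def ctangent_space_def tangent_space_iff jrep_def EE_iff)

lemma ct_add_zero [simp]: "ct_add \<alpha> ct_zero = \<alpha>" "ct_add ct_zero \<alpha> = \<alpha>"
  by (simp_all add: ct_add_def ct_zero_def)

lemma ct_add_commute: "ct_add \<alpha> \<beta> = ct_add \<beta> \<alpha>"
  by (simp add: ct_add_def add.commute)

lemma ct_add_assoc: "ct_add (ct_add \<alpha> \<beta>) \<gamma> = ct_add \<alpha> (ct_add \<beta> \<gamma>)"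
  by (simp add: ct_add_def add.assoc)

lemma ct_add_left_commute: "ct_add \<alpha> (ct_add \<beta> \<gamma>) = ct_add \<beta> (ct_add \<alpha> \<gamma>)"
  by (simp add: ct_add_def add.left_commute)

lemma ct_scale_zero [simp]: "ct_scale a ct_zero = ct_zero"
  by (simp add: ct_scale_def ct_zero_def)

lemma ct_scale_one [simp]: "ct_scale 1 \<alpha> = \<alpha>"
  by (simp add: ct_scale_def)

lemma ct_scale_add: "ct_scale a (ct_add \<alpha> \<beta>) = ct_add (ct_scale a \<alpha>) (ct_scale a \<beta>)"
  by (simp add: ct_scale_def ct_add_def fun_eq_iff algebra_simps)

lemma ct_scale_add_left: "ct_scale (a + b) \<alpha> = ct_add (ct_scale a \<alpha>) (ct_scale b \<alpha>)"
  by (simp add: ct_scale_def ct_add_def fun_eq_iff algebra_simps)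

lemma ct_scale_mult: "ct_scale (a * b) \<alpha> = ct_scale a (ct_scale b \<alpha>)"
  by (simp add: ct_scale_def fun_eq_iff algebra_simps)

lemma ct_add_uminus: "ct_add \<alpha> (ct_scale (- 1) \<alpha>) = ct_zero"
  by (simp add: ct_scale_def ct_add_def ct_zero_def)

lemma pushforward_lincomb:
  "pushforward M N f p (\<lambda>c i. a * v c i + b * w c i) =
    (\<lambda>d i. a * pushforward M N f p v d i + b * pushforward M N f p w d i)"
  by (auto simp: pushforward_def Let_def jacobian_apply_lincomb fun_eq_iff)

lemma ct_push_add: "ct_push M N f p (ct_add \<alpha> \<beta>) = ct_add (ct_push M N f p \<alpha>) (ct_push M N f p \<beta>)"
  using pushforward_lincomb[of M N f p 1 "fst \<alpha>" 1 "fst \<beta>"] pushforward_lincomb[of M N f p 1 "snd \<alpha>" 1 "snd \<beta>"]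
  by (cases \<alpha>, cases \<beta>) (simp add: ct_push_def ct_add_def)

lemma ct_push_scale: "ct_push M N f p (ct_scale z \<alpha>) = ct_scale z (ct_push M N f p \<alpha>)"
  using pushforward_lincomb[of M N f p "Re z" "fst \<alpha>" "- Im z" "snd \<alpha>"]
    pushforward_lincomb[of M N f p "Re z" "snd \<alpha>" "Im z" "fst \<alpha>"]
  by (cases \<alpha>) (simp add: ct_push_def ct_scale_def)

lemma ct_push_zero [simp]: "ct_push M N f p ct_zero = ct_zero"
  by (simp add: ct_push_def ct_zero_def pushforward_def Let_def fun_eq_iff)

lemma ct_push_in:
  assumes M: "pre_mfd M" and N: "pre_mfd N" and f: "smooth_map M N f" and p: "p \<in> points M"
    and \<alpha>: "\<alpha> \<in> ctangent_space M p"
  shows "ct_push M N f p \<alpha> \<in> ctangent_space N (f p)"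
proof -
  obtain c where c: "c \<in> charts_at M p" using pre_mfd_charts_at[OF M p] by blast
  obtain d where d: "d \<in> charts_at N (f p)" using pre_mfd_charts_at[OF N smooth_map_points[OF f p]] by blast
  show ?thesis
    using pushforward_tangent[OF M N c d smooth_map_charts[OF M N f c d], of "fst \<alpha>"]
      pushforward_tangent[OF M N c d smooth_map_charts[OF M N f c d], of "snd \<alpha>"] \<alpha>
    by (simp add: ctangent_space_def ct_push_def mem_Times_iff)
qed

lemma ct_push_compose:
  assumes "pre_mfd M" "pre_mfd N" "pre_mfd P" "smooth_map M N f" "smooth_map N P g"
    "p \<in> points M" "\<alpha> \<in> ctangent_space M p"
  shows "ct_push N P g (f p) (ct_push M N f p \<alpha>) = ct_push M P (\<lambda>x. g (f x)) p \<alpha>"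
  using pushforward_compose[OF assms(1-6)] assms(7) by (auto simp: ctangent_space_def ct_push_def)

lemma ct_push_id:
  assumes "pre_mfd M" "p \<in> points M" "\<alpha> \<in> ctangent_space M p" shows "ct_push M M (\<lambda>x. x) p \<alpha> = \<alpha>"
  using pushforward_id[OF assms(1,2)] assms(3) by (auto simp: ctangent_space_def ct_push_def)

lemma ct_push_cong:
  assumes "pre_mfd M" "p \<in> points M" "\<And>x. x \<in> points M \<Longrightarrow> f x = g x"
  shows "ct_push M N f p \<alpha> = ct_push M N g p \<alpha>"
  by (cases \<alpha>) (simp add: ct_push_def pushforward_cong[where f = f and g = g, OF assms])

text \<open>Names a generating chart of \<open>ctangent_mfd\<close>. Coordinates come in the order
  base point, real part, imaginary part.\<close>

definition tchart :: "'a smooth_mfd \<Rightarrow> 'a chart \<Rightarrow> ('a \<times> 'a ctvec) chart" where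
  "tchart M c = \<lparr>cdom = Sigma (cdom c) (ctangent_space M), cdim = cdim c + (cdim c + cdim c),
     cmap = restrict (\<lambda>(p, \<alpha>). cat (cdim c) (cmap c p) (cat (cdim c) (fst \<alpha> c) (snd \<alpha> c)))
              (Sigma (cdom c) (ctangent_space M))\<rparr>"

definition vchart :: "'a smooth_mfd \<Rightarrow> 'a \<Rightarrow> 'a chart \<Rightarrow> 'a ctvec chart" where
  "vchart M p c = \<lparr>cdom = ctangent_space M p, cdim = cdim c + cdim c,
     cmap = restrict (\<lambda>\<alpha>. cat (cdim c) (fst \<alpha> c) (snd \<alpha> c)) (ctangent_space M p)\<rparr>"

lemma tchart_simps [simp]:
  "cdom (tchart M c) = Sigma (cdom c) (ctangent_space M)" "cdim (tchart M c) = cdim c + (cdim c + cdim c)"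
  "p \<in> cdom c \<Longrightarrow> \<alpha> \<in> ctangent_space M p \<Longrightarrow>
     cmap (tchart M c) (p, \<alpha>) = cat (cdim c) (cmap c p) (cat (cdim c) (fst \<alpha> c) (snd \<alpha> c))"
  by (auto simp: tchart_def)

lemma vchart_simps [simp]:
  "cdom (vchart M p c) = ctangent_space M p" "cdim (vchart M p c) = cdim c + cdim c"
  "\<alpha> \<in> ctangent_space M p \<Longrightarrow> cmap (vchart M p c) \<alpha> = cat (cdim c) (fst \<alpha> c) (snd \<alpha> c)"
  by (auto simp: vchart_def)

lemma ctangent_EE:
  assumes "\<alpha> \<in> ctangent_space M p" "c \<in> charts_at M p"
  shows "fst \<alpha> c \<in> EE (cdim c)" "snd \<alpha> c \<in> EE (cdim c)"
  using assms tangent_space_EE[of _ M p c] by (auto simp: ctangent_space_def)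

lemma vchart_inj:
  assumes c: "c \<in> charts_at M p" and \<alpha>: "\<alpha> \<in> ctangent_space M p" and \<beta>: "\<beta> \<in> ctangent_space M p"
    and eq: "cat (cdim c) (fst \<alpha> c) (snd \<alpha> c) = cat (cdim c) (fst \<beta> c) (snd \<beta> c)"
  shows "\<alpha> = \<beta>"
proof -
  have e: "fst \<alpha> c = fst \<beta> c" "snd \<alpha> c = snd \<beta> c"
    using cat_inject[OF ctangent_EE(1)[OF \<alpha> c] ctangent_EE(1)[OF \<beta> c]] eq by auto
  show ?thesis
    using tangent_space_eqI[of "fst \<alpha>" M p "fst \<beta>" c] tangent_space_eqI[of "snd \<alpha>" M p "snd \<beta>" c] c e \<alpha> \<beta>
    by (simp add: ctangent_space_def mem_Times_iff prod_eq_iff)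
qed

text \<open>The halves of z are the coordinates of real and imaginary part; \<open>tvec_of\<close>
  spreads each of them over all charts.\<close>

lemma vchart_surj:
  assumes M: "pre_mfd M" and c: "c \<in> charts_at M p" and z: "z \<in> EE (cdim c + cdim c)"
  shows "\<exists>\<alpha>\<in>ctangent_space M p. cat (cdim c) (fst \<alpha> c) (snd \<alpha> c) = z"
  by (rule bexI[of _ "(tvec_of M p c (fstE (cdim c) z), tvec_of M p c (sndE (cdim c) z))"])
    (use z tvec_of_apply[OF M c] tvec_of_tangent[OF M c] sndE_in_EE in \<open>simp_all add: ctangent_space_def\<close>)

lemma vchart_image:
  assumes M: "pre_mfd M" and c: "c \<in> charts_at M p"
  shows "cmap (vchart M p c) ` ctangent_space M p = EE (cdim c + cdim c)"
proof (rule equalityI; rule subsetI)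
  fix z assume "z \<in> cmap (vchart M p c) ` ctangent_space M p"
  then show "z \<in> EE (cdim c + cdim c)" using ctangent_EE[OF _ c] by (auto intro: cat_in_EE)
next
  fix z assume "z \<in> EE (cdim c + cdim c)"
  from vchart_surj[OF M c this] show "z \<in> cmap (vchart M p c) ` ctangent_space M p" by force
qed

lemma vchart_ok:
  assumes M: "pre_mfd M" and c: "c \<in> charts_at M p" shows "chart_ok (vchart M p c)"
proof -
  have "inj_on (cmap (vchart M p c)) (ctangent_space M p)"
    by (rule inj_onI) (use vchart_inj[OF c] in auto)
  then show ?thesis
    using vchart_image[OF M c] eopen_EE unfolding is_chart_def by (simp add: vchart_def)
qed

lemma tchart_ok:
  assumes M: "pre_mfd M" and c: "c \<in> atlas M" shows "chart_ok (tchart M c)"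
proof -
  let ?n = "cdim c"
  have ok: "chart_ok c" using pre_mfd_chart_ok[OF M c] .
  have at: "c \<in> charts_at M p" if "p \<in> cdom c" for p using c that by (simp add: charts_at_iff)
  have "inj_on (cmap (tchart M c)) (Sigma (cdom c) (ctangent_space M))"
  proof (rule inj_onI)
    fix x y assume xy: "x \<in> Sigma (cdom c) (ctangent_space M)" "y \<in> Sigma (cdom c) (ctangent_space M)"
      "cmap (tchart M c) x = cmap (tchart M c) y"
    obtain p \<alpha> q \<beta> where e: "x = (p, \<alpha>)" "y = (q, \<beta>)" by (cases x, cases y) blast
    have in': "p \<in> cdom c" "q \<in> cdom c" "\<alpha> \<in> ctangent_space M p" "\<beta> \<in> ctangent_space M q"
      using xy e by auto
    have "cmap c p = cmap c q \<and> cat ?n (fst \<alpha> c) (snd \<alpha> c) = cat ?n (fst \<beta> c) (snd \<beta> c)"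
      using xy(3) in' cat_inject[OF cmap_in_EE[OF ok in'(1)] cmap_in_EE[OF ok in'(2)]] by (simp add: e)
    moreover from this have "p = q" using inj_onD[OF chart_inj[OF ok]] in' by blast
    ultimately show "x = y" using vchart_inj[OF at[OF in'(1)] in'(3)] in'(4) e by simp
  qed
  moreover have "cmap (tchart M c) ` Sigma (cdom c) (ctangent_space M) =
      {cat ?n x y | x y. x \<in> cmap c ` cdom c \<and> y \<in> EE (?n + ?n)}"
  proof (rule equalityI; rule subsetI)
    fix z assume "z \<in> cmap (tchart M c) ` Sigma (cdom c) (ctangent_space M)"
    then obtain p \<alpha> where p: "p \<in> cdom c" "\<alpha> \<in> ctangent_space M p" "z = cmap (tchart M c) (p, \<alpha>)" by auto
    then show "z \<in> {cat ?n x y | x y. x \<in> cmap c ` cdom c \<and> y \<in> EE (?n + ?n)}"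
      using cat_in_EE[OF ctangent_EE(2)[OF p(2) at[OF p(1)]]] by fastforce
  next
    fix z assume "z \<in> {cat ?n x y | x y. x \<in> cmap c ` cdom c \<and> y \<in> EE (?n + ?n)}"
    then obtain p y where p: "p \<in> cdom c" "y \<in> EE (?n + ?n)" "z = cat ?n (cmap c p) y" by auto
    then obtain \<alpha> where "\<alpha> \<in> ctangent_space M p" "cat ?n (fst \<alpha> c) (snd \<alpha> c) = y"
      using vchart_surj[OF M at] by blast
    then show "z \<in> cmap (tchart M c) ` Sigma (cdom c) (ctangent_space M)"
      using p by (intro image_eqI[of _ _ "(p, \<alpha>)"]) auto
  qed
  moreover have "eopen (?n + (?n + ?n)) {cat ?n x y | x y. x \<in> cmap c ` cdom c \<and> y \<in> EE (?n + ?n)}"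
    using eopen_cat[OF chart_eopen[OF ok] eopen_EE, of "?n + ?n"]
      cat_image_eq[OF eopen_subset[OF chart_eopen[OF ok]] subset_refl, of "?n + ?n"] by simp
  ultimately show ?thesis unfolding is_chart_def by (simp add: tchart_def)
qed

text \<open>Coordinate form of a complexified tangent map: F moves the base point, its Jacobian acts
  separately on real and imaginary part.\<close>

lemma smooth_between_tangent:
  assumes "eopen n U" "eopen k W" "smooth_between n m U F" "smooth_between k n W H" "\<And>z. z \<in> W \<Longrightarrow> H z \<in> U"
    and "smooth_between k n W L1" "smooth_between k n W L2"
  shows "smooth_between k (m + (m + m)) W (\<lambda>z. cat m (F (H z))
    (cat m (jacobian_apply n m F (H z) (L1 z)) (jacobian_apply n m F (H z) (L2 z))))"
  by (rule smooth_between_cat[OF assms(2) smooth_between_compose[OF assms(2,1,5,4,3)]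
    smooth_between_cat[OF assms(2) smooth_between_jacobian[OF assms(1-5,6)] smooth_between_jacobian[OF assms(1-5,7)]]])

lemma ct_push_chart:
  assumes M: "pre_mfd M" and c: "c \<in> charts_at M p" and N: "pre_mfd N" and d: "d \<in> charts_at N (f p)"
    and f: "smooth_pt c d f p" and \<alpha>: "\<alpha> \<in> ctangent_space M p"
  shows "ct_push M N f p \<alpha> \<in> ctangent_space N (f p)"
    "fst (ct_push M N f p \<alpha>) d = jrep c d f p (fst \<alpha> c)" "snd (ct_push M N f p \<alpha>) d = jrep c d f p (snd \<alpha> c)"
proof -
  have v: "fst \<alpha> \<in> tangent_space M p" "snd \<alpha> \<in> tangent_space M p" using \<alpha> by (auto simp: ctangent_space_def)
  have "chart_ok d" using d pre_mfd_chart_ok[OF N] by (simp add: charts_at_iff)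
  note a = pushforward_apply[of M c p d N f, OF M c d this f]
  note b = pushforward_tangent[of M N c p d f, OF M N c d f]
  show "ct_push M N f p \<alpha> \<in> ctangent_space N (f p)"
    "fst (ct_push M N f p \<alpha>) d = jrep c d f p (fst \<alpha> c)" "snd (ct_push M N f p \<alpha>) d = jrep c d f p (snd \<alpha> c)"
    using a[OF v(1)] a[OF v(2)] b[OF v(1)] b[OF v(2)] by (simp_all add: ct_push_def ctangent_space_def mem_Times_iff)
qed

text \<open>Only x is differentiated, yet the outcome has to be smooth in the parameter y too. In
  coordinates the derivative in x is the Jacobian of the joint map on a vector padded with zeros in
  the parameter slots, so joint smoothness reduces to that of a full Jacobian.\<close>

lemma smooth_pt_param_tangent:
  assumes a: "chart_ok a" and M: "pre_mfd M" and N: "pre_mfd N" and c: "c \<in> charts_at M p"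
    and d: "d \<in> atlas N" and f: "smooth_pt (prod_chart a c) d f (q, p)" and \<alpha>: "\<alpha> \<in> ctangent_space M p"
  shows "smooth_pt (prod_chart a (tchart M c)) (tchart N d)
    (\<lambda>(y, (x, \<alpha>)). (f (y, x), ct_push M N (\<lambda>x. f (y, x)) x \<alpha>)) (q, (p, \<alpha>))"
proof -
  let ?k = "cdim a" and ?n = "cdim c" and ?m = "cdim d" and ?e = "prod_chart a c"
  have ok: "chart_ok c" "chart_ok d" and cat: "c \<in> atlas M" "p \<in> cdom c"
    using c d pre_mfd_chart_ok[OF M] pre_mfd_chart_ok[OF N] by (auto simp: charts_at_iff)
  have eok: "chart_ok ?e" by (rule prod_chart_ok[OF a ok(1)])
  from f obtain W where W: "(q, p) \<in> cdom ?e" "eopen (cdim ?e) W" "cmap ?e (q, p) \<in> W" "W \<subseteq> cmap ?e ` cdom ?e"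
    "\<forall>x\<in>W. f (chart_inv ?e x) \<in> cdom d" "smooth_between (cdim ?e) (cdim d) W (local_rep ?e d f)"
    by (rule smooth_ptE)
  have q: "q \<in> cdom a" using W(1) by simp
  define F where "F = local_rep ?e d f"
  let ?N = "?k + (?n + (?n + ?n))"
  \<comment> \<open>From the coordinates of (y, (x, \<beta>)), \<open>H\<close> extracts those of
    (y, x), while \<open>L1\<close> and \<open>L2\<close> extract real and imaginary part of \<beta>
    with zeros in front.\<close>
  define H where "H z = cat ?k (fstE ?k z) (fstE ?n (sndE ?k z))" for z
  define L1 where "L1 z = cat ?k (\<lambda>_. 0) (fstE ?n (sndE ?n (sndE ?k z)))" for z
  define L2 where "L2 z = cat ?k (\<lambda>_. 0) (sndE ?n (sndE ?n (sndE ?k z)))" for z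
  define Y where "Y = {z \<in> EE ?N. H z \<in> W}"
  have s1: "smooth_between ?N (?n + (?n + ?n)) (EE ?N) (sndE ?k)" by (rule smooth_between_sndE[OF eopen_EE])
  have comp: "smooth_between ?N j (EE ?N) (\<lambda>z. G (F z))"
    if "smooth_between ?N i (EE ?N) F" "smooth_between i j (EE i) G" for F G i j
    by (rule smooth_between_compose[OF eopen_EE eopen_EE _ that]) (use that(1) in \<open>simp add: smooth_between_iff\<close>)
  have z0: "smooth_between ?N ?k (EE ?N) (\<lambda>z. (\<lambda>_. 0))" by (rule smooth_between_const[OF eopen_EE]) (simp add: EE_iff)
  have H: "smooth_between ?N (?k + ?n) (EE ?N) H"
    unfolding H_def by (rule smooth_between_cat[OF eopen_EE smooth_between_fstE[OF eopen_EE]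
      comp[OF s1 smooth_between_fstE[OF eopen_EE]]])
  have s2: "smooth_between ?N (?n + ?n) (EE ?N) (\<lambda>z. sndE ?n (sndE ?k z))"
    by (rule comp[OF s1 smooth_between_sndE[OF eopen_EE]])
  have L1: "smooth_between ?N (?k + ?n) (EE ?N) L1"
    unfolding L1_def by (rule smooth_between_cat[OF eopen_EE z0 comp[OF s2 smooth_between_fstE[OF eopen_EE]]])
  have L2: "smooth_between ?N (?k + ?n) (EE ?N) L2"
    unfolding L2_def by (rule smooth_between_cat[OF eopen_EE z0 comp[OF s2 smooth_between_sndE[OF eopen_EE]]])
  have We: "eopen (?k + ?n) W" using W(2) by simp
  have Fs: "smooth_between (?k + ?n) ?m W F" using W(6) by (simp add: F_def)
  have Yo: "eopen ?N Y" unfolding Y_def by (rule smooth_between_preimage[OF eopen_EE We H])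
  have YE: "Y \<subseteq> EE ?N" by (auto simp: Y_def)
  note sub = smooth_between_subset[OF eopen_EE Yo YE]
  have smooth: "smooth_between ?N (?m + (?m + ?m)) Y (\<lambda>z. cat ?m (F (H z))
      (cat ?m (jacobian_apply (?k + ?n) ?m F (H z) (L1 z)) (jacobian_apply (?k + ?n) ?m F (H z) (L2 z))))"
    by (rule smooth_between_tangent[OF We Yo Fs sub[OF H] _ sub[OF L1] sub[OF L2]]) (simp add: Y_def)
  have coords: "cmap (prod_chart a (tchart M c)) (y, x, \<beta>) = cat ?k (cmap a y) (cat ?n (cmap c x) (cat ?n (fst \<beta> c) (snd \<beta> c)))"
    "H (cmap (prod_chart a (tchart M c)) (y, x, \<beta>)) = cat ?k (cmap a y) (cmap c x)"
    "L1 (cmap (prod_chart a (tchart M c)) (y, x, \<beta>)) = cat ?k (\<lambda>_. 0) (fst \<beta> c)"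
    "L2 (cmap (prod_chart a (tchart M c)) (y, x, \<beta>)) = cat ?k (\<lambda>_. 0) (snd \<beta> c)"
    "cmap (prod_chart a (tchart M c)) (y, x, \<beta>) \<in> EE ?N"
    if "y \<in> cdom a" "x \<in> cdom c" "\<beta> \<in> ctangent_space M x" for y x \<beta>
  proof -
    have "c \<in> charts_at M x" using cat that by (simp add: charts_at_iff)
    note ee = ctangent_EE[OF that(3) this]
    show "cmap (prod_chart a (tchart M c)) (y, x, \<beta>) = cat ?k (cmap a y) (cat ?n (cmap c x) (cat ?n (fst \<beta> c) (snd \<beta> c)))"
      "H (cmap (prod_chart a (tchart M c)) (y, x, \<beta>)) = cat ?k (cmap a y) (cmap c x)"
      "L1 (cmap (prod_chart a (tchart M c)) (y, x, \<beta>)) = cat ?k (\<lambda>_. 0) (fst \<beta> c)"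
      "L2 (cmap (prod_chart a (tchart M c)) (y, x, \<beta>)) = cat ?k (\<lambda>_. 0) (snd \<beta> c)"
      "cmap (prod_chart a (tchart M c)) (y, x, \<beta>) \<in> EE ?N"
      using that ee cmap_in_EE[OF a that(1)] cmap_in_EE[OF ok(1) that(2)]
      by (simp_all add: H_def L1_def L2_def cat_in_EE)
  qed
  show ?thesis
  proof (rule smooth_ptI[OF prod_chart_ok[OF a tchart_ok[OF M cat(1)]] tchart_ok[OF N d], where W = Y])
    show "(q, p, \<alpha>) \<in> cdom (prod_chart a (tchart M c))" using q cat \<alpha> by simp
    show "eopen (cdim (prod_chart a (tchart M c))) Y" using Yo by simp
    show "cmap (prod_chart a (tchart M c)) (q, p, \<alpha>) \<in> Y"
      using coords(2,5)[OF q cat(2) \<alpha>] W(3) q cat(2) by (simp add: Y_def)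
    show "smooth_between (cdim (prod_chart a (tchart M c))) (cdim (tchart N d)) Y (\<lambda>z. cat ?m (F (H z))
      (cat ?m (jacobian_apply (?k + ?n) ?m F (H z) (L1 z)) (jacobian_apply (?k + ?n) ?m F (H z) (L2 z))))"
      using smooth by simp
    fix w assume w: "w \<in> cdom (prod_chart a (tchart M c))" "cmap (prod_chart a (tchart M c)) w \<in> Y"
    obtain y x \<beta> where e: "w = (y, (x, \<beta>))" by (cases w) auto
    have yx: "y \<in> cdom a" "x \<in> cdom c" "\<beta> \<in> ctangent_space M x" using w e by auto
    note co = coords[OF yx]
    have inW: "cat ?k (cmap a y) (cmap c x) \<in> W" using w(2) e co(2) by (simp add: Y_def)
    have ex: "cmap ?e (y, x) = cat ?k (cmap a y) (cmap c x)" using yx by simp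
    \<comment> \<open>The witness W found at (q, p) serves every point whose coordinates lie in it,
      so f is smooth at (y, x) as well and its derivative there can be computed in the same
      charts.\<close>
    have fyx: "smooth_pt ?e d f (y, x)"
      unfolding smooth_pt_def using W(2,4,5,6) inW ex yx by (intro conjI exI[of _ W]) auto
    have fd: "f (y, x) \<in> cdom d" by (rule smooth_pt_range[OF eok fyx])
    have xc: "c \<in> charts_at M x" using cat yx by (simp add: charts_at_iff)
    have sp: "smooth_pt c d (\<lambda>x. f (y, x)) x"
      using smooth_pt_compose[OF ok(1) eok smooth_pt_Pair[OF ok(1) a ok(1)
          smooth_pt_const[OF ok(1) a yx(2,1)] smooth_pt_id[OF ok(1) yx(2), unfolded id_def]] fyx] .
    have at: "d \<in> charts_at N (f (y, x))" using fd d by (simp add: charts_at_iff)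
    note cp = ct_push_chart[of M c x N d "\<lambda>x. f (y, x)", OF M xc N at sp yx(3)]
    have Fxy: "F (cat ?k (cmap a y) (cmap c x')) = cmap d (f (y, x'))" if "x' \<in> cdom c" for x'
      using chart_inv_cmap[OF eok, of "(y, x')"] that yx by (simp add: F_def local_rep_def)
    \<comment> \<open>The freezing of y: \<open>jacobian_apply_partial\<close> turns the derivative
      of the slice into the padded Jacobian of F.\<close>
    have jr: "jrep c d (\<lambda>x. f (y, x)) x \<xi> =
        jacobian_apply (?k + ?n) ?m F (cat ?k (cmap a y) (cmap c x)) (cat ?k (\<lambda>_. 0) \<xi>)" for \<xi>
      unfolding jrep_def jacobian_apply_partial[symmetric]
      by (rule jacobian_apply_cong[OF chart_eopen[OF ok(1)]])
        (use yx Fxy ok in \<open>auto simp: local_rep_def\<close>)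
    show "(case w of (y, x, \<alpha>) \<Rightarrow> (f (y, x), ct_push M N (\<lambda>x. f (y, x)) x \<alpha>)) \<in> cdom (tchart N d) \<and>
      cmap (tchart N d) (case w of (y, x, \<alpha>) \<Rightarrow> (f (y, x), ct_push M N (\<lambda>x. f (y, x)) x \<alpha>)) =
      cat ?m (F (H (cmap (prod_chart a (tchart M c)) w)))
       (cat ?m (jacobian_apply (?k + ?n) ?m F (H (cmap (prod_chart a (tchart M c)) w)) (L1 (cmap (prod_chart a (tchart M c)) w)))
         (jacobian_apply (?k + ?n) ?m F (H (cmap (prod_chart a (tchart M c)) w)) (L2 (cmap (prod_chart a (tchart M c)) w))))"
      unfolding e prod.case co(2-4) Fxy[OF yx(2)] jr[symmetric] using fd cp by simp
  qed
qed

text \<open>A transition of the tangent bundle is the tangent map of the identity read in two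
  charts.\<close>

lemma smooth_pt_tchart_id:
  assumes M: "pre_mfd M" and c: "c \<in> charts_at M p" and d: "d \<in> charts_at M p" and \<alpha>: "\<alpha> \<in> ctangent_space M p"
  shows "smooth_pt (tchart M c) (tchart M d) id (p, \<alpha>)"
proof -
  have cd: "c \<in> atlas M" "d \<in> atlas M" "p \<in> cdom c" "p \<in> cdom d" using c d by (auto simp: charts_at_iff)
  note ok = pre_mfd_chart_ok[OF M cd(1)] pre_mfd_chart_ok[OF M cd(2)]
  note tok = tchart_ok[OF M cd(1)] tchart_ok[OF M cd(2)]
  have t: "(p, \<alpha>) \<in> cdom (tchart M c)" using cd \<alpha> by simp
  text \<open>Apply the parametrized statement to \<open>snd : M \<times> M \<rightarrow> M\<close>; the parameter plays no role.\<close>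
  have "smooth_pt (prod_chart c c) d (\<lambda>x. id (snd x)) (p, p)"
    by (rule smooth_pt_compose[OF prod_chart_ok[OF ok(1) ok(1)] ok(1) smooth_pt_snd[OF ok(1) ok(1) cd(3) cd(3)]])
      (use charts_at_transition[OF M c d] in \<open>simp add: id_def\<close>)
  note * = smooth_pt_param_tangent[OF ok(1) M M c cd(2) this \<alpha>]
  have "smooth_pt (tchart M c) (prod_chart c (tchart M c)) (\<lambda>x. (p, id x)) (p, \<alpha>)"
    by (rule smooth_pt_Pair[OF tok(1) ok(1) tok(1) smooth_pt_const[OF tok(1) ok(1) t cd(3)] smooth_pt_id[OF tok(1) t]])
  note smooth_pt_compose[OF tok(1) prod_chart_ok[OF ok(1) tok(1)] this, unfolded id_def, OF *[unfolded id_def]]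
  then show ?thesis
  proof (rule smooth_pt_cong)
    fix x assume x: "x \<in> cdom (tchart M c)"
    then have "fst x \<in> points M" "snd x \<in> ctangent_space M (fst x)" using pre_mfd_cdom[OF M cd(1)] by auto
    from ct_push_id[OF M this]
    show "(case (p, x) of (y, x, \<alpha>) \<Rightarrow> (snd (y, x), ct_push M M (\<lambda>x. snd (y, x)) x \<alpha>)) = id x"
      by (cases x) simp
  qed
qed

section \<open>The complexified tangent bundle and the single tangent spaces as manifolds\<close>

lemma ctangent_mfd_eq: "ctangent_mfd M = mfd_generated (Sigma (points M) (ctangent_space M)) (tchart M ` atlas M)"
  unfolding ctangent_mfd_def tchart_def by (rule arg_cong[where f = "mfd_generated _"]) blast

lemma ctangent_mfd_points [simp]: "points (ctangent_mfd M) = Sigma (points M) (ctangent_space M)"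
  by (simp add: ctangent_mfd_def)

lemma ctangent_mfd_pre:
  assumes M: "pre_mfd M"
  shows "pre_mfd (ctangent_mfd M)" "c \<in> atlas M \<Longrightarrow> tchart M c \<in> atlas (ctangent_mfd M)"
proof -
  have 1: "is_chart (Sigma (points M) (ctangent_space M)) t" if t: "t \<in> tchart M ` atlas M" for t
  proof -
    obtain c where c: "c \<in> atlas M" "t = tchart M c" using t by blast
    then show ?thesis
      using tchart_ok[OF M c(1)] pre_mfd_cdom[OF M c(1)]
      by (auto simp: is_chart_iff[of "Sigma (points M) (ctangent_space M)"])
  qed
  have 2: "Sigma (points M) (ctangent_space M) \<subseteq> \<Union>(cdom ` tchart M ` atlas M)"
  proof
    fix x assume x: "x \<in> Sigma (points M) (ctangent_space M)"
    obtain p \<alpha> where pa: "x = (p, \<alpha>)" "p \<in> points M" "\<alpha> \<in> ctangent_space M p" using x by blast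
    obtain c where "c \<in> charts_at M p" using pre_mfd_charts_at[OF M pa(2)] by blast
    then have "tchart M c \<in> tchart M ` atlas M" "x \<in> cdom (tchart M c)" using pa by (auto simp: charts_at_iff)
    then show "x \<in> \<Union>(cdom ` tchart M ` atlas M)" by blast
  qed
  have 3: "compatible t t'" if t: "t \<in> tchart M ` atlas M" and t': "t' \<in> tchart M ` atlas M" for t t'
  proof -
    obtain c where c: "c \<in> atlas M" "t = tchart M c" using t by blast
    obtain d where d: "d \<in> atlas M" "t' = tchart M d" using t' by blast
    show ?thesis
      unfolding c(2) d(2) compatible_iff[OF tchart_ok[OF M c(1)] tchart_ok[OF M d(1)]]
      using c(1) d(1) by (auto intro!: smooth_pt_tchart_id[OF M] simp: charts_at_iff)
  qed
  note gen = mfd_generated_pre[OF 1 2 3]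
  show "pre_mfd (ctangent_mfd M)" unfolding ctangent_mfd_eq by (rule gen(1))
  show "c \<in> atlas M \<Longrightarrow> tchart M c \<in> atlas (ctangent_mfd M)" unfolding ctangent_mfd_eq using gen(2) by blast
qed

lemma tchart_charts_at:
  "pre_mfd M \<Longrightarrow> c \<in> charts_at M p \<Longrightarrow> \<alpha> \<in> ctangent_space M p \<Longrightarrow> tchart M c \<in> charts_at (ctangent_mfd M) (p, \<alpha>)"
  using ctangent_mfd_pre(2)[of M c] by (simp add: charts_at_iff)

lemma smooth_map_param_tangent:
  assumes Q: "pre_mfd Q" and M: "pre_mfd M" and N: "pre_mfd N" and f: "smooth_map (prod_mfd Q M) N f"
  shows "smooth_map (prod_mfd Q (ctangent_mfd M)) (ctangent_mfd N)
    (\<lambda>(y, (x, \<alpha>)). (f (y, x), ct_push M N (\<lambda>x. f (y, x)) x \<alpha>))"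
proof (rule smooth_mapI[OF prod_mfd_generated(1)[OF Q ctangent_mfd_pre(1)[OF M]] ctangent_mfd_pre(1)[OF N]])
  fix z assume z: "z \<in> points (prod_mfd Q (ctangent_mfd M))"
  obtain y x \<alpha> where e: "z = (y, (x, \<alpha>))" by (cases z) auto
  have in': "y \<in> points Q" "x \<in> points M" "\<alpha> \<in> ctangent_space M x" using z e by auto
  obtain a where a: "a \<in> charts_at Q y" using pre_mfd_charts_at[OF Q in'(1)] by blast
  obtain c where c: "c \<in> charts_at M x" using pre_mfd_charts_at[OF M in'(2)] by blast
  have "f (y, x) \<in> points N" using smooth_map_points[OF f] in' by simp
  then obtain d where d: "d \<in> charts_at N (f (y, x))" using pre_mfd_charts_at[OF N] by blast
  have ac: "prod_chart a c \<in> charts_at (prod_mfd Q M) (y, x)"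
    using a c prod_mfd_generated(2)[OF Q M] by (simp add: charts_at_iff)
  have aok: "chart_ok a" and da: "d \<in> atlas N" using a d pre_mfd_chart_ok[OF Q] by (auto simp: charts_at_iff)
  have "smooth_pt (prod_chart a (tchart M c)) (tchart N d)
      (\<lambda>(y, (x, \<alpha>)). (f (y, x), ct_push M N (\<lambda>x. f (y, x)) x \<alpha>)) z"
    unfolding e
    by (rule smooth_pt_param_tangent[OF aok M N c da smooth_map_charts[OF prod_mfd_generated(1)[OF Q M] N f ac d] in'(3)])
  moreover have "prod_chart a (tchart M c) \<in> charts_at (prod_mfd Q (ctangent_mfd M)) z"
    using a tchart_charts_at[OF M c in'(3)] prod_mfd_generated(2)[OF Q ctangent_mfd_pre(1)[OF M]] e
    by (simp add: charts_at_iff)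
  ultimately show "\<exists>c\<in>charts_at (prod_mfd Q (ctangent_mfd M)) z. \<exists>d\<in>atlas (ctangent_mfd N). smooth_pt c d
      (\<lambda>(y, (x, \<alpha>)). (f (y, x), ct_push M N (\<lambda>x. f (y, x)) x \<alpha>)) z"
    using ctangent_mfd_pre(2)[OF N da] by blast
qed

lemma ctangent_space_mfd_eq:
  "ctangent_space_mfd M p = mfd_generated (ctangent_space M p) (vchart M p ` charts_at M p)"
  unfolding ctangent_space_mfd_def vchart_def by (rule arg_cong[where f = "mfd_generated _"]) blast

lemma ctangent_space_mfd_points [simp]: "points (ctangent_space_mfd M p) = ctangent_space M p"
  by (simp add: ctangent_space_mfd_def)

text \<open>With the base point held constant, the transition is one fixed Jacobian acting on real
  and imaginary part.\<close>

lemma smooth_pt_vchart_id: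
  assumes M: "pre_mfd M" and c: "c \<in> charts_at M p" and d: "d \<in> charts_at M p" and \<alpha>: "\<alpha> \<in> ctangent_space M p"
  shows "smooth_pt (vchart M p c) (vchart M p d) id \<alpha>"
proof -
  let ?n = "cdim c" and ?m = "cdim d"
  define J where "J = jacobian_apply ?n ?m (local_rep c d id) (cmap c p)"
  from charts_at_transition[OF M c d] obtain W where
    W: "p \<in> cdom c" "eopen (cdim c) W" "cmap c p \<in> W" "W \<subseteq> cmap c ` cdom c"
    "\<forall>x\<in>W. id (chart_inv c x) \<in> cdom d" "smooth_between (cdim c) (cdim d) W (local_rep c d id)"
    by (rule smooth_ptE)
  have cst: "smooth_between (?n + ?n) ?n (EE (?n + ?n)) (\<lambda>z. cmap c p)"
    by (rule smooth_between_const[OF eopen_EE]) (use W eopen_subset in blast)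
  have "smooth_between (?n + ?n) (?m + ?m) (EE (?n + ?n)) (\<lambda>z. cat ?m (J (fstE ?n z)) (J (sndE ?n z)))"
    unfolding J_def
    by (rule smooth_between_cat[OF eopen_EE
        smooth_between_jacobian[OF W(2) eopen_EE W(6) cst W(3) smooth_between_fstE[OF eopen_EE]]
        smooth_between_jacobian[OF W(2) eopen_EE W(6) cst W(3) smooth_between_sndE[OF eopen_EE]]])
  moreover have "cat ?m (fst \<beta> d) (snd \<beta> d) = cat ?m (J (fst \<beta> c)) (J (snd \<beta> c))" if "\<beta> \<in> ctangent_space M p" for \<beta>
    using that tangent_space_change[OF _ c d] by (simp add: J_def ctangent_space_def jrep_def[symmetric] mem_Times_iff)
  ultimately show ?thesis
    using \<alpha> vchart_image[OF M c]
    by (intro smooth_ptI[OF vchart_ok[OF M c] vchart_ok[OF M d], where W = "EE (?n + ?n)"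
          and H = "\<lambda>z. cat ?m (J (fstE ?n z)) (J (sndE ?n z))"])
      (auto simp: eopen_EE ctangent_EE[OF _ c] cat_in_EE)
qed

text \<open>Any single \<open>vchart\<close> already covers the whole space and maps onto a full
  Euclidean space, which settles the topology.\<close>

lemma ctangent_space_mfd_pre:
  assumes M: "pre_mfd M" and p: "p \<in> points M"
  shows "pre_mfd (ctangent_space_mfd M p)" "c \<in> charts_at M p \<Longrightarrow> vchart M p c \<in> atlas (ctangent_space_mfd M p)"
    "smooth_manifold (ctangent_space_mfd M p)"
proof -
  obtain c0 where c0: "c0 \<in> charts_at M p" using pre_mfd_charts_at[OF M p] by blast
  have 1: "is_chart (ctangent_space M p) t" if t: "t \<in> vchart M p ` charts_at M p" for t
    using t vchart_ok[OF M] by (auto simp: is_chart_iff[of "ctangent_space M p"])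
  have 2: "ctangent_space M p \<subseteq> \<Union>(cdom ` vchart M p ` charts_at M p)" using c0 by auto
  have 3: "compatible t t'" if t: "t \<in> vchart M p ` charts_at M p" and t': "t' \<in> vchart M p ` charts_at M p" for t t'
  proof -
    obtain c where c: "c \<in> charts_at M p" "t = vchart M p c" using t by blast
    obtain d where d: "d \<in> charts_at M p" "t' = vchart M p d" using t' by blast
    show ?thesis
      unfolding c(2) d(2) compatible_iff[OF vchart_ok[OF M c(1)] vchart_ok[OF M d(1)]]
      using smooth_pt_vchart_id[OF M c(1) d(1)] smooth_pt_vchart_id[OF M d(1) c(1)] by simp
  qed
  note gen = mfd_generated_pre[OF 1 2 3]
  show pre: "pre_mfd (ctangent_space_mfd M p)" unfolding ctangent_space_mfd_eq by (rule gen(1))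
  show at: "vchart M p c \<in> atlas (ctangent_space_mfd M p)" if "c \<in> charts_at M p" for c
    unfolding ctangent_space_mfd_eq using gen(2) that by blast
  show "smooth_manifold (ctangent_space_mfd M p)"
  proof (rule smooth_manifold_global_chart[OF pre _ at[OF c0]])
    show "\<forall>c. is_chart (points (ctangent_space_mfd M p)) c \<and> (\<forall>d\<in>atlas (ctangent_space_mfd M p). compatible c d) \<longrightarrow>
      c \<in> atlas (ctangent_space_mfd M p)"
      unfolding ctangent_space_mfd_eq mfd_generated_points by (rule gen(3))
  qed (use vchart_image[OF M c0] in simp_all)
qed

lemma smooth_map_into_ctangent:
  assumes M: "pre_mfd M" and p: "p \<in> points M"
  shows "smooth_map (ctangent_space_mfd M p) (ctangent_mfd M) (\<lambda>\<alpha>. (p, \<alpha>))"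
proof (rule smooth_mapI[OF ctangent_space_mfd_pre(1)[OF M p] ctangent_mfd_pre(1)[OF M]])
  fix \<alpha> assume "\<alpha> \<in> points (ctangent_space_mfd M p)"
  then have \<alpha>: "\<alpha> \<in> ctangent_space M p" by simp
  obtain c where c: "c \<in> charts_at M p" using pre_mfd_charts_at[OF M p] by blast
  then have ca: "c \<in> atlas M" "p \<in> cdom c" and ok: "chart_ok c" using pre_mfd_chart_ok[OF M] by (auto simp: charts_at_iff)
  let ?n = "cdim c"
  have "smooth_pt (vchart M p c) (tchart M c) (\<lambda>\<alpha>. (p, \<alpha>)) \<alpha>"
  proof (rule smooth_ptI[OF vchart_ok[OF M c] tchart_ok[OF M ca(1)], where W = "EE (?n + ?n)"])
    show "smooth_between (cdim (vchart M p c)) (cdim (tchart M c)) (EE (?n + ?n)) (\<lambda>z. cat ?n (cmap c p) z)"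
      unfolding vchart_simps tchart_simps
      by (rule smooth_between_cat[OF eopen_EE smooth_between_const[OF eopen_EE cmap_in_EE[OF ok ca(2)]]
            smooth_between_id[OF eopen_EE]])
  qed (use \<alpha> ca ctangent_EE[OF _ c] in \<open>auto simp: eopen_EE cat_in_EE\<close>)
  then show "\<exists>c\<in>charts_at (ctangent_space_mfd M p) \<alpha>. \<exists>d\<in>atlas (ctangent_mfd M). smooth_pt c d (\<lambda>\<alpha>. (p, \<alpha>)) \<alpha>"
    using ctangent_space_mfd_pre(2)[OF M p c] ctangent_mfd_pre(2)[OF M ca(1)] \<alpha>
    by (intro bexI[of _ "vchart M p c"] bexI[of _ "tchart M c"]) (auto simp: charts_at_iff)
qed

text \<open>Tangent maps with parameters land in the whole tangent bundle; when the base point does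
  not move, dropping its coordinates gives smoothness into the single fibre. This is how maps into
  the Lie algebra are obtained.\<close>

lemma smooth_map_ctangent_fibre:
  assumes Q: "pre_mfd Q" and M: "pre_mfd M" and p: "p \<in> points M"
    and F: "smooth_map Q (ctangent_mfd M) F" and fp: "\<And>y. y \<in> points Q \<Longrightarrow> fst (F y) = p"
  shows "smooth_map Q (ctangent_space_mfd M p) (\<lambda>y. snd (F y))"
proof (rule smooth_mapI[OF Q ctangent_space_mfd_pre(1)[OF M p]])
  fix y assume y: "y \<in> points Q"
  obtain e where e: "e \<in> charts_at Q y" using pre_mfd_charts_at[OF Q y] by blast
  obtain c where c: "c \<in> charts_at M p" using pre_mfd_charts_at[OF M p] by blast
  let ?n = "cdim c"
  have "F y \<in> Sigma (points M) (ctangent_space M)" using smooth_map_points[OF F y] by simp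
  then have "tchart M c \<in> charts_at (ctangent_mfd M) (F y)"
    using tchart_charts_at[OF M c] fp[OF y] by (cases "F y") auto
  from smooth_map_charts[OF Q ctangent_mfd_pre(1)[OF M] F e this]
  obtain W where W: "y \<in> cdom e" "eopen (cdim e) W" "cmap e y \<in> W" "W \<subseteq> cmap e ` cdom e"
    "\<forall>x\<in>W. F (chart_inv e x) \<in> cdom (tchart M c)" "smooth_between (cdim e) (cdim (tchart M c)) W (local_rep e (tchart M c) F)"
    by (rule smooth_ptE)
  have eok: "chart_ok e" and eQ: "cdom e \<subseteq> points Q" and ok: "chart_ok c"
    using e c pre_mfd_chart_ok[OF Q] pre_mfd_chart_ok[OF M] pre_mfd_cdom[OF Q] by (auto simp: charts_at_iff)
  have "smooth_pt e (vchart M p c) (\<lambda>y. snd (F y)) y"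
  proof (rule smooth_ptI[OF eok vchart_ok[OF M c] W(1-3)])
    show "smooth_between (cdim e) (cdim (vchart M p c)) W (\<lambda>x. sndE ?n (local_rep e (tchart M c) F x))"
      by (rule smooth_between_compose[OF W(2) eopen_EE _ W(6)])
        (use W(6) smooth_between_sndE[OF eopen_EE] in \<open>auto simp: smooth_between_iff[of "cdim e" "?n + (?n + ?n)"]\<close>)
    fix x assume x: "x \<in> cdom e" "cmap e x \<in> W"
    have "F x \<in> cdom (tchart M c)" using bspec[OF W(5) x(2)] eok x(1) by simp
    then have "p \<in> cdom c" "snd (F x) \<in> ctangent_space M p" "F x = (p, snd (F x))"
      using fp[of x] x(1) eQ by auto
    moreover have "local_rep e (tchart M c) F (cmap e x) = cmap (tchart M c) (F x)"
      using eok x(1) by (simp add: local_rep_def)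
    ultimately show "snd (F x) \<in> cdom (vchart M p c) \<and>
      cmap (vchart M p c) (snd (F x)) = sndE ?n (local_rep e (tchart M c) F (cmap e x))"
      using tchart_simps(3)[of p c "snd (F x)" M] by simp
  qed
  then show "\<exists>c\<in>charts_at Q y. \<exists>d\<in>atlas (ctangent_space_mfd M p). smooth_pt c d (\<lambda>y. snd (F y)) y"
    using e ctangent_space_mfd_pre(2)[OF M p c] by blast
qed

lemma smooth_map_ct_add:
  assumes M: "pre_mfd M" and p: "p \<in> points M"
  shows "smooth_map (prod_mfd (ctangent_space_mfd M p) (ctangent_space_mfd M p)) (ctangent_space_mfd M p)
    (\<lambda>x. ct_add (fst x) (snd x))"
proof (rule smooth_mapI)
  note V = ctangent_space_mfd_pre(1)[OF M p]
  show "pre_mfd (prod_mfd (ctangent_space_mfd M p) (ctangent_space_mfd M p))" by (rule prod_mfd_generated(1)[OF V V])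
  show "pre_mfd (ctangent_space_mfd M p)" by (rule V)
  fix x assume x: "x \<in> points (prod_mfd (ctangent_space_mfd M p) (ctangent_space_mfd M p))"
  obtain c where c: "c \<in> charts_at M p" using pre_mfd_charts_at[OF M p] by blast
  let ?v = "vchart M p c" and ?N = "cdim c + cdim c"
  note vok = vchart_ok[OF M c]
  have "smooth_pt (prod_chart ?v ?v) ?v (\<lambda>x. ct_add (fst x) (snd x)) x"
  proof (rule smooth_ptI[OF prod_chart_ok[OF vok vok] vok, where W = "EE (?N + ?N)"])
    \<comment> \<open>Below ?N this adds the two halves of z. From ?N on the subtraction cancels
      \<open>z i\<close>, and \<open>z (?N + i)\<close> is 0 on \<open>EE (?N + ?N)\<close>, so the
      result lies in \<open>EE ?N\<close>.\<close>
    show "smooth_between (cdim (prod_chart ?v ?v)) (cdim ?v) (EE (?N + ?N)) (\<lambda>z i. z i + z (?N + i) - (if i < ?N then 0 else z i))"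
      unfolding vchart_simps prod_chart_simps
    proof (rule smooth_betweenI)
      fix j assume "j < ?N"
      then show "Cinf_on (?N + ?N) (EE (?N + ?N)) (\<lambda>z. z j + z (?N + j) - (if j < ?N then 0 else z j))"
        by (simp add: Cinf_on_add Cinf_on_coord eopen_EE)
    qed (auto simp: EE_iff)
    fix q assume q: "q \<in> cdom (prod_chart ?v ?v)"
    obtain \<alpha> \<beta> where e: "q = (\<alpha>, \<beta>)" by (cases q)
    have ab: "\<alpha> \<in> ctangent_space M p" "\<beta> \<in> ctangent_space M p" using q e by auto
    have "cat (cdim c) (fst (ct_add \<alpha> \<beta>) c) (snd (ct_add \<alpha> \<beta>) c) i =
      cat ?N (cat (cdim c) (fst \<alpha> c) (snd \<alpha> c)) (cat (cdim c) (fst \<beta> c) (snd \<beta> c)) i +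
      cat ?N (cat (cdim c) (fst \<alpha> c) (snd \<alpha> c)) (cat (cdim c) (fst \<beta> c) (snd \<beta> c)) (?N + i) -
      (if i < ?N then 0 else cat ?N (cat (cdim c) (fst \<alpha> c) (snd \<alpha> c)) (cat (cdim c) (fst \<beta> c) (snd \<beta> c)) i)" for i
      using ctangent_EE[OF ab(1) c] ctangent_EE[OF ab(2) c] by (auto simp: cat_def ct_add_def EE_iff)
    then show "ct_add (fst q) (snd q) \<in> cdom ?v \<and> cmap ?v (ct_add (fst q) (snd q)) =
      (\<lambda>i. cmap (prod_chart ?v ?v) q i + cmap (prod_chart ?v ?v) q (?N + i) - (if i < ?N then 0 else cmap (prod_chart ?v ?v) q i))"
      using ab by (auto simp: e ct_add_in)
  qed (use x ctangent_EE[OF _ c] in \<open>auto simp: eopen_EE cat_in_EE\<close>)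
  moreover have "prod_chart ?v ?v \<in> charts_at (prod_mfd (ctangent_space_mfd M p) (ctangent_space_mfd M p)) x"
    using prod_mfd_generated(2)[OF V V] ctangent_space_mfd_pre(2)[OF M p c] x by (auto simp: charts_at_iff)
  ultimately show "\<exists>c\<in>charts_at (prod_mfd (ctangent_space_mfd M p) (ctangent_space_mfd M p)) x.
      \<exists>d\<in>atlas (ctangent_space_mfd M p). smooth_pt c d (\<lambda>x. ct_add (fst x) (snd x)) x"
    using ctangent_space_mfd_pre(2)[OF M p c] by blast
qed

subsection \<open>Complex coordinate spaces\<close>

definition Cvec :: "nat \<Rightarrow> (nat \<Rightarrow> complex) set" where
  "Cvec r = {z. \<forall>i\<ge>r. z i = 0}"

definition cchart :: "nat \<Rightarrow> (nat \<Rightarrow> complex) chart" where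
  "cchart r = \<lparr>cdom = Cvec r, cdim = r + r, cmap = restrict (\<lambda>z. cat r (Re \<circ> z) (Im \<circ> z)) (Cvec r)\<rparr>"

lemma cchart_simps [simp]:
  "cdom (cchart r) = Cvec r" "cdim (cchart r) = r + r"
  "z \<in> Cvec r \<Longrightarrow> cmap (cchart r) z = cat r (Re \<circ> z) (Im \<circ> z)"
  by (auto simp: cchart_def)

lemma cchart_ok: "chart_ok (cchart r)"
proof -
  have EE: "Re \<circ> z \<in> EE r" "Im \<circ> z \<in> EE r" if "z \<in> Cvec r" for z
    using that by (auto simp: Cvec_def EE_iff)
  have "inj_on (cmap (cchart r)) (Cvec r)"
  proof (rule inj_onI)
    fix z w assume zw: "z \<in> Cvec r" "w \<in> Cvec r" "cmap (cchart r) z = cmap (cchart r) w"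
    then have "Re \<circ> z = Re \<circ> w \<and> Im \<circ> z = Im \<circ> w"
      using cat_inject[OF EE(1)[OF zw(1)] EE(1)[OF zw(2)]] by simp
    then show "z = w" by (auto simp: fun_eq_iff complex_eq_iff)
  qed
  moreover have "cmap (cchart r) ` Cvec r = EE (r + r)"
  proof (rule equalityI; rule subsetI)
    fix x assume x: "x \<in> EE (r + r)"
    let ?z = "\<lambda>i. Complex (fstE r x i) (sndE r x i)"
    have "?z \<in> Cvec r" using x by (auto simp: Cvec_def fstE_def sndE_def EE_iff complex_eq_iff)
    moreover have "Re \<circ> ?z = fstE r x" "Im \<circ> ?z = sndE r x" by auto
    ultimately show "x \<in> cmap (cchart r) ` Cvec r" by (intro image_eqI[of _ _ ?z]) simp_all
  qed (use EE in \<open>auto intro: cat_in_EE\<close>)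
  ultimately show ?thesis unfolding is_chart_def using eopen_EE by (simp add: cchart_def)
qed

lemma complex_space_eq: "complex_space r = mfd_generated (Cvec r) {cchart r}"
  by (simp add: complex_space_def cchart_def Cvec_def Let_def)

lemma complex_space_points [simp]: "points (complex_space r) = Cvec r"
  by (simp add: complex_space_eq)

lemma complex_space_pre: "pre_mfd (complex_space r)" "cchart r \<in> atlas (complex_space r)"
proof -
  have "compatible (cchart r) (cchart r)"
    using smooth_pt_id[OF cchart_ok] by (simp add: compatible_iff[OF cchart_ok cchart_ok])
  then have "pre_mfd (mfd_generated (Cvec r) {cchart r}) \<and> cchart r \<in> atlas (mfd_generated (Cvec r) {cchart r})"
    using mfd_generated_pre[of "{cchart r}" "Cvec r"] cchart_ok is_chart_iff[of "Cvec r"] by auto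
  then show "pre_mfd (complex_space r)" "cchart r \<in> atlas (complex_space r)" by (simp_all add: complex_space_eq)
qed

lemma smooth_pt_cchart:
  assumes e: "chart_ok e" and q: "q \<in> cdom e" and F: "\<And>x. x \<in> cdom e \<Longrightarrow> F x \<in> Cvec s"
    and h: "\<And>i. i < s \<Longrightarrow> Cinf_on (cdim e) (EE (cdim e)) (hr i)" "\<And>i. i < s \<Longrightarrow> Cinf_on (cdim e) (EE (cdim e)) (hi i)"
    and Fh: "\<And>x i. x \<in> cdom e \<Longrightarrow> i < s \<Longrightarrow> F x i = Complex (hr i (cmap e x)) (hi i (cmap e x))"
  shows "smooth_pt e (cchart s) F q"
proof (rule smooth_ptI[OF e cchart_ok q eopen_EE])
  let ?hr = "\<lambda>z i. if i < s then hr i z else 0" and ?hi = "\<lambda>z i. if i < s then hi i z else 0"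
  show "cmap e q \<in> EE (cdim e)" by (rule cmap_in_EE[OF e q])
  show "smooth_between (cdim e) (cdim (cchart s)) (EE (cdim e)) (\<lambda>z. cat s (?hr z) (?hi z))"
    unfolding cchart_simps
    by (rule smooth_between_cat[OF eopen_EE]; rule smooth_betweenI) (auto simp: h EE_iff)
  fix x assume x: "x \<in> cdom e"
  have "Re (F x i) = ?hr (cmap e x) i \<and> Im (F x i) = ?hi (cmap e x) i" for i
    using F[OF x] Fh[OF x, of i] by (auto simp: Cvec_def)
  then have "Re \<circ> F x = ?hr (cmap e x)" "Im \<circ> F x = ?hi (cmap e x)" by (auto simp: fun_eq_iff)
  then show "F x \<in> cdom (cchart s) \<and> cmap (cchart s) (F x) = cat s (?hr (cmap e x)) (?hi (cmap e x))"
    using F[OF x] by simp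
qed

text \<open>Complex counterpart of \<open>cat\<close>. It puts coordinates of the Lie algebra in
  front of fibre coordinates of E when the sum bundle is trivialized.\<close>

definition cjoin :: "nat \<Rightarrow> (nat \<Rightarrow> complex) \<Rightarrow> (nat \<Rightarrow> complex) \<Rightarrow> nat \<Rightarrow> complex" where
  "cjoin n z w = (\<lambda>i. if i < n then z i else w (i - n))"

definition csplit1 :: "nat \<Rightarrow> (nat \<Rightarrow> complex) \<Rightarrow> nat \<Rightarrow> complex" where
  "csplit1 n z = (\<lambda>i. if i < n then z i else 0)"

definition csplit2 :: "nat \<Rightarrow> (nat \<Rightarrow> complex) \<Rightarrow> nat \<Rightarrow> complex" where
  "csplit2 n z = (\<lambda>i. z (n + i))"

lemma cjoin_in: "w \<in> Cvec r \<Longrightarrow> cjoin n z w \<in> Cvec (n + r)"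
  and csplit1_in: "csplit1 n z \<in> Cvec n"
  and csplit2_in: "z \<in> Cvec (n + r) \<Longrightarrow> csplit2 n z \<in> Cvec r"
  and csplit1_cjoin: "z \<in> Cvec n \<Longrightarrow> csplit1 n (cjoin n z w) = z"
  and csplit2_cjoin: "csplit2 n (cjoin n z w) = w"
  and cjoin_csplit: "cjoin n (csplit1 n z) (csplit2 n z) = z"
  by (auto simp: cjoin_def csplit1_def csplit2_def Cvec_def fun_eq_iff)

lemma smooth_map_cjoin:
  "smooth_map (prod_mfd (complex_space n) (complex_space r)) (complex_space (n + r)) (\<lambda>x. cjoin n (fst x) (snd x))"
proof (rule smooth_mapI[OF prod_mfd_generated(1)[OF complex_space_pre(1) complex_space_pre(1)] complex_space_pre(1)])
  fix x assume x: "x \<in> points (prod_mfd (complex_space n) (complex_space r))"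
  let ?e = "prod_chart (cchart n) (cchart r)"
  \<comment> \<open>The product chart lists Re z, Im z, Re w, Im w, whereas
    \<open>cchart (n + r)\<close> lists Re z, Re w, Im z, Im w. The two index functions do the
    resorting.\<close>
  let ?hr = "\<lambda>i (x :: nat \<Rightarrow> real). x (if i < n then i else (n + n) + (i - n))"
  let ?hi = "\<lambda>i (x :: nat \<Rightarrow> real). x (if i < n then n + i else (n + n) + (r + (i - n)))"
  have "smooth_pt ?e (cchart (n + r)) (\<lambda>x. cjoin n (fst x) (snd x)) x"
  proof (rule smooth_pt_cchart[where hr = ?hr and hi = ?hi])
    fix x i assume "x \<in> cdom ?e" "i < n + r"
    then show "cjoin n (fst x) (snd x) i = Complex (?hr i (cmap ?e x)) (?hi i (cmap ?e x))"
      by (cases x) (auto simp: cjoin_def cat_def)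
  qed (use x in \<open>auto simp: prod_chart_ok cchart_ok cjoin_in Cinf_on_coord eopen_EE\<close>)
  moreover have "?e \<in> charts_at (prod_mfd (complex_space n) (complex_space r)) x"
    using prod_mfd_generated(2)[OF complex_space_pre(1) complex_space_pre(1) complex_space_pre(2) complex_space_pre(2)] x
    by (auto simp: charts_at_iff)
  ultimately show "\<exists>c\<in>charts_at (prod_mfd (complex_space n) (complex_space r)) x. \<exists>d\<in>atlas (complex_space (n + r)).
      smooth_pt c d (\<lambda>x. cjoin n (fst x) (snd x)) x"
    using complex_space_pre(2) by blast
qed

lemma smooth_map_complex_space:
  assumes "\<And>i. i < s \<Longrightarrow> Cinf_on (r + r) (EE (r + r)) (hr i)" "\<And>i. i < s \<Longrightarrow> Cinf_on (r + r) (EE (r + r)) (hi i)"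
    and "\<And>x i. x \<in> Cvec r \<Longrightarrow> i < s \<Longrightarrow> F x i = Complex (hr i (cat r (Re \<circ> x) (Im \<circ> x))) (hi i (cat r (Re \<circ> x) (Im \<circ> x)))"
    and F: "\<And>x. x \<in> Cvec r \<Longrightarrow> F x \<in> Cvec s"
  shows "smooth_map (complex_space r) (complex_space s) F"
proof (rule smooth_mapI[OF complex_space_pre(1) complex_space_pre(1)])
  fix x assume "x \<in> points (complex_space r)"
  then have x: "x \<in> Cvec r" by simp
  have "smooth_pt (cchart r) (cchart s) F x"
    by (rule smooth_pt_cchart[where hr = hr and hi = hi]) (use assms x in \<open>auto simp: cchart_ok\<close>)
  then show "\<exists>c\<in>charts_at (complex_space r) x. \<exists>d\<in>atlas (complex_space s). smooth_pt c d F x"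
    using x complex_space_pre(2) by (intro bexI[of _ "cchart r"] bexI[of _ "cchart s"]) (auto simp: charts_at_iff)
qed

lemma smooth_map_csplit1: "smooth_map (complex_space (n + r)) (complex_space n) (csplit1 n)"
  by (rule smooth_map_complex_space[where hr = "\<lambda>i x. x i" and hi = "\<lambda>i x. x ((n + r) + i)"])
    (auto simp: Cinf_on_coord eopen_EE csplit1_in, auto simp: csplit1_def cat_def)

lemma smooth_map_csplit2: "smooth_map (complex_space (n + r)) (complex_space r) (csplit2 n)"
  by (rule smooth_map_complex_space[where hr = "\<lambda>i x. x (n + i)" and hi = "\<lambda>i x. x ((n + r) + (n + i))"])
    (auto simp: Cinf_on_coord eopen_EE csplit2_in, auto simp: csplit2_def cat_def)

lemma smooth_map_cscale: "smooth_map (complex_space r) (complex_space r) (\<lambda>z i. a * z i)"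
proof (rule smooth_map_complex_space[where hr = "\<lambda>i x. Re a * x i - Im a * x (r + i)"
      and hi = "\<lambda>i x. Re a * x (r + i) + Im a * x i"])
  show "Cinf_on (r + r) (EE (r + r)) (\<lambda>x. Re a * x i - Im a * x (r + i))"
    "Cinf_on (r + r) (EE (r + r)) (\<lambda>x. Re a * x (r + i) + Im a * x i)" for i
    by (intro Cinf_on_diff Cinf_on_add Cinf_on_mult Cinf_on_const Cinf_on_coord eopen_EE)+
qed (auto simp: Cvec_def cat_def complex_eq_iff)

text \<open>A trivialization must be complex linear, so the real coordinates of real and imaginary
  part are recombined into one complex vector.\<close>

definition ccoord :: "'a chart \<Rightarrow> 'a ctvec \<Rightarrow> nat \<Rightarrow> complex" where
  "ccoord c \<alpha> = (\<lambda>i. Complex (fst \<alpha> c i) (snd \<alpha> c i))"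

definition ccoord_inv :: "'a smooth_mfd \<Rightarrow> 'a \<Rightarrow> 'a chart \<Rightarrow> (nat \<Rightarrow> complex) \<Rightarrow> 'a ctvec" where
  "ccoord_inv M p c z = (tvec_of M p c (Re \<circ> z), tvec_of M p c (Im \<circ> z))"

lemma ccoord_add: "ccoord c (ct_add \<alpha> \<beta>) = (\<lambda>i. ccoord c \<alpha> i + ccoord c \<beta> i)"
  by (simp add: ccoord_def ct_add_def fun_eq_iff complex_eq_iff)

lemma ccoord_scale: "ccoord c (ct_scale a \<alpha>) = (\<lambda>i. a * ccoord c \<alpha> i)"
  by (simp add: ccoord_def ct_scale_def fun_eq_iff complex_eq_iff)

lemma ccoord_Re_Im: "Re \<circ> ccoord c \<alpha> = fst \<alpha> c" "Im \<circ> ccoord c \<alpha> = snd \<alpha> c"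
  by (auto simp: ccoord_def)

lemma ccoord_in: "\<alpha> \<in> ctangent_space M p \<Longrightarrow> c \<in> charts_at M p \<Longrightarrow> ccoord c \<alpha> \<in> Cvec (cdim c)"
  using ctangent_EE[of \<alpha> M p c] by (auto simp: ccoord_def Cvec_def EE_iff complex_eq_iff)

lemma ccoord_inv_in: "pre_mfd M \<Longrightarrow> c \<in> charts_at M p \<Longrightarrow> ccoord_inv M p c z \<in> ctangent_space M p"
  by (simp add: ccoord_inv_def ctangent_space_def tvec_of_tangent)

lemma ccoord_ccoord_inv:
  assumes "pre_mfd M" "c \<in> charts_at M p" "z \<in> Cvec (cdim c)" shows "ccoord c (ccoord_inv M p c z) = z"
proof -
  have "Re \<circ> z \<in> EE (cdim c)" "Im \<circ> z \<in> EE (cdim c)" using assms(3) by (auto simp: Cvec_def EE_iff)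
  then show ?thesis
    using tvec_of_apply[OF assms(1,2)] by (simp add: ccoord_def ccoord_inv_def)
qed

lemma ccoord_inv_ccoord:
  assumes M: "pre_mfd M" and c: "c \<in> charts_at M p" and \<alpha>: "\<alpha> \<in> ctangent_space M p"
  shows "ccoord_inv M p c (ccoord c \<alpha>) = \<alpha>"
proof (rule vchart_inj[OF c ccoord_inv_in[OF M c] \<alpha>])
  show "cat (cdim c) (fst (ccoord_inv M p c (ccoord c \<alpha>)) c) (snd (ccoord_inv M p c (ccoord c \<alpha>)) c) =
    cat (cdim c) (fst \<alpha> c) (snd \<alpha> c)"
    using tvec_of_apply[OF M c] ctangent_EE[OF \<alpha> c] by (simp add: ccoord_inv_def ccoord_Re_Im)
qed

lemma smooth_map_ccoord:
  assumes M: "pre_mfd M" and c: "c \<in> charts_at M p"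
  shows "smooth_map (ctangent_space_mfd M p) (complex_space (cdim c)) (ccoord c)"
    "smooth_map (complex_space (cdim c)) (ctangent_space_mfd M p) (ccoord_inv M p c)"
proof -
  have p: "p \<in> points M" by (rule charts_at_points[OF M c])
  let ?n = "cdim c" and ?v = "vchart M p c"
  note vok = vchart_ok[OF M c] and V = ctangent_space_mfd_pre[OF M p]
  have v: "?v \<in> atlas (ctangent_space_mfd M p)" by (rule V(2)[OF c])
  show "smooth_map (ctangent_space_mfd M p) (complex_space ?n) (ccoord c)"
  proof (rule smooth_mapI[OF V(1) complex_space_pre(1)])
    fix \<alpha> assume \<alpha>: "\<alpha> \<in> points (ctangent_space_mfd M p)"
    have "smooth_pt ?v (cchart ?n) (ccoord c) \<alpha>"
      by (rule smooth_ptI[OF vok cchart_ok, where W = "EE (?n + ?n)" and H = "\<lambda>x. x"])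
        (use \<alpha> c ctangent_EE[OF _ c] in \<open>auto simp: eopen_EE cat_in_EE smooth_between_id ccoord_in ccoord_Re_Im\<close>)
    then show "\<exists>c'\<in>charts_at (ctangent_space_mfd M p) \<alpha>. \<exists>d\<in>atlas (complex_space ?n). smooth_pt c' d (ccoord c) \<alpha>"
      using v \<alpha> complex_space_pre(2) by (intro bexI[of _ ?v] bexI[of _ "cchart ?n"]) (auto simp: charts_at_iff)
  qed
  show "smooth_map (complex_space ?n) (ctangent_space_mfd M p) (ccoord_inv M p c)"
  proof (rule smooth_mapI[OF complex_space_pre(1) V(1)])
    fix z assume z: "z \<in> points (complex_space ?n)"
    have "smooth_pt (cchart ?n) ?v (ccoord_inv M p c) z"
    proof (rule smooth_ptI[OF cchart_ok vok, where W = "EE (?n + ?n)" and H = "\<lambda>x. x"])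
      fix q assume "q \<in> cdom (cchart ?n)"
      then have q: "q \<in> Cvec ?n" by simp
      have "cmap ?v (ccoord_inv M p c q) = cat ?n (Re \<circ> q) (Im \<circ> q)"
        using ccoord_inv_in[OF M c] ccoord_ccoord_inv[OF M c q] ccoord_Re_Im[of c "ccoord_inv M p c q"] by simp
      then show "ccoord_inv M p c q \<in> cdom ?v \<and> cmap ?v (ccoord_inv M p c q) = cmap (cchart ?n) q"
        using q ccoord_inv_in[OF M c] by simp
    qed (use z in \<open>auto simp: eopen_EE smooth_between_id Cvec_def EE_iff cat_def\<close>)
    then show "\<exists>c'\<in>charts_at (complex_space ?n) z. \<exists>d\<in>atlas (ctangent_space_mfd M p). smooth_pt c' d (ccoord_inv M p c) z"
      using v z complex_space_pre(2) by (intro bexI[of _ "cchart ?n"] bexI[of _ ?v]) (auto simp: charts_at_iff)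
  qed
qed

section \<open>Lie groups\<close>

locale lie_grp =
  fixes G :: "'g lie_group" (structure)
  assumes lie: "is_lie_group G"
begin

sublocale group G
  using lie by (simp add: is_lie_group_def)

abbreviation "GG \<equiv> mfd G"
abbreviation "TG \<equiv> ctangent_mfd (mfd G)"
abbreviation "LG \<equiv> ctangent_space_mfd (mfd G) \<one>"

lemma points_G [simp]: "points GG = carrier G"
  using lie by (simp add: is_lie_group_def)

lemma pre_G: "pre_mfd GG"
  using lie by (simp add: is_lie_group_def smooth_manifold_pre)

lemma pre_TG: "pre_mfd TG"
  by (rule ctangent_mfd_pre(1)[OF pre_G])

lemma pre_LG: "pre_mfd LG"
  by (rule ctangent_space_mfd_pre(1)[OF pre_G]) simp

lemma smooth_mult:
  assumes M: "pre_mfd M" and f: "smooth_map M GG f" and g: "smooth_map M GG g"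
  shows "smooth_map M GG (\<lambda>x. f x \<otimes> g x)"
proof -
  have m: "smooth_map (prod_mfd GG GG) GG (\<lambda>(g, h). g \<otimes> h)" using lie by (simp add: is_lie_group_def)
  show ?thesis
    using smooth_map_compose[OF M prod_mfd_generated(1)[OF pre_G pre_G] pre_G
        smooth_map_Pair[OF M pre_G pre_G f g] m] by simp
qed

lemma smooth_inv:
  assumes M: "pre_mfd M" and f: "smooth_map M GG f" shows "smooth_map M GG (\<lambda>x. inv (f x))"
  using smooth_map_compose[OF M pre_G pre_G f] lie by (simp add: is_lie_group_def)

lemma smooth_const: "pre_mfd M \<Longrightarrow> g \<in> carrier G \<Longrightarrow> smooth_map M GG (\<lambda>x. g)"
  by (rule smooth_map_const[OF _ pre_G]) simp_all

lemma smooth_left: "g \<in> carrier G \<Longrightarrow> smooth_map GG GG (\<lambda>h. g \<otimes> h)"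
  by (rule smooth_mult[OF pre_G smooth_const[OF pre_G] smooth_map_id[OF pre_G]])

lemma smooth_right: "g \<in> carrier G \<Longrightarrow> smooth_map GG GG (\<lambda>h. h \<otimes> g)"
  by (rule smooth_mult[OF pre_G smooth_map_id[OF pre_G] smooth_const[OF pre_G]])

lemma smooth_conj: "g \<in> carrier G \<Longrightarrow> smooth_map GG GG (\<lambda>h. g \<otimes> h \<otimes> inv g)"
  by (rule smooth_mult[OF pre_G smooth_left smooth_const[OF pre_G]]) simp_all

abbreviation "TT p \<equiv> ctangent_space GG p"
abbreviation "PP f p \<equiv> ct_push GG GG f p"

lemma push_in: "smooth_map GG GG f \<Longrightarrow> p \<in> carrier G \<Longrightarrow> \<alpha> \<in> TT p \<Longrightarrow> f p = q \<Longrightarrow> PP f p \<alpha> \<in> TT q"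
  using ct_push_in[OF pre_G pre_G, of f p \<alpha>] by simp

text \<open>Identities between translated or conjugated vectors thereby become identities between
  maps of the group, checked point by point. The intermediate base point is a separate variable q so
  that it may be given in simplified form.\<close>

lemma push_push:
  assumes "smooth_map GG GG f" "smooth_map GG GG g" "p \<in> carrier G" "\<alpha> \<in> TT p" "f p = q"
    and "\<And>x. x \<in> carrier G \<Longrightarrow> g (f x) = h x"
  shows "PP g q (PP f p \<alpha>) = PP h p \<alpha>"
proof -
  have "PP g q (PP f p \<alpha>) = PP (\<lambda>x. g (f x)) p \<alpha>"
    using ct_push_compose[OF pre_G pre_G pre_G assms(1,2), of p \<alpha>] assms by simp
  also have "\<dots> = PP h p \<alpha>" by (rule ct_push_cong[OF pre_G]) (use assms in simp_all)
  finally show ?thesis .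
qed

lemma push_ident:
  assumes "p \<in> carrier G" "\<alpha> \<in> TT p" "\<And>x. x \<in> carrier G \<Longrightarrow> f x = x" shows "PP f p \<alpha> = \<alpha>"
proof -
  have "PP f p \<alpha> = PP (\<lambda>x. x) p \<alpha>" by (rule ct_push_cong[OF pre_G]) (use assms in simp_all)
  also have "\<dots> = \<alpha>" by (rule ct_push_id[OF pre_G]) (use assms in simp_all)
  finally show ?thesis .
qed

section \<open>The group \<open>TC G\<close>, the adjoint representation and right translation to
  the identity\<close>

lemma carrier_TC: "carrier (TC G) = Sigma (carrier G) TT"
  by (simp add: TC_def)

lemma one_TC: "\<one>\<^bsub>TC G\<^esub> = (\<one>, ct_zero)"
  by (simp add: TC_def)

lemma mult_TC: "(g, v) \<otimes>\<^bsub>TC G\<^esub> (h, w) =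
    (g \<otimes> h, ct_add (PP (\<lambda>k. g \<otimes> k) h w) (PP (\<lambda>k. k \<otimes> h) g v))"
  by (simp add: TC_def)

lemma TC_closed:
  assumes "x \<in> carrier (TC G)" "y \<in> carrier (TC G)" shows "x \<otimes>\<^bsub>TC G\<^esub> y \<in> carrier (TC G)"
proof -
  obtain g v h w where e: "x = (g, v)" "y = (h, w)" by (cases x, cases y) blast
  have in': "g \<in> carrier G" "h \<in> carrier G" "v \<in> TT g" "w \<in> TT h" using assms e by (auto simp: carrier_TC)
  show ?thesis
    using push_in[OF smooth_left[OF in'(1)] in'(2,4) refl] push_in[OF smooth_right[OF in'(2)] in'(1,3) refl] in'
    by (simp add: e mult_TC carrier_TC ct_add_in)
qed

lemma one_TC_in: "(\<one>, ct_zero) \<in> carrier (TC G)"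
  by (simp add: carrier_TC ct_zero_in)

lemma zero_in_TC: "g \<in> carrier G \<Longrightarrow> (g, ct_zero) \<in> carrier (TC G)"
  by (simp add: carrier_TC ct_zero_in)

lemma gC_in_TC: "\<alpha> \<in> lie_gC G \<Longrightarrow> (\<one>, \<alpha>) \<in> carrier (TC G)"
  by (simp add: carrier_TC lie_gC_def)

lemma Ad_in: "g \<in> carrier G \<Longrightarrow> \<alpha> \<in> lie_gC G \<Longrightarrow> Ad G g \<alpha> \<in> lie_gC G"
  unfolding Ad_def lie_gC_def by (rule push_in[OF smooth_conj]) simp_all

lemma right_transport_in: "(g, v) \<in> carrier (TC G) \<Longrightarrow> right_transport G (g, v) \<in> lie_gC G"
  unfolding right_transport_def lie_gC_def prod.case
  by (rule push_in[OF smooth_right]) (simp_all add: carrier_TC)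

lemma Ad_add: "Ad G g (ct_add \<alpha> \<beta>) = ct_add (Ad G g \<alpha>) (Ad G g \<beta>)"
  and Ad_scale: "Ad G g (ct_scale a \<alpha>) = ct_scale a (Ad G g \<alpha>)"
  and Ad_zero: "Ad G g ct_zero = ct_zero"
  by (simp_all add: Ad_def ct_push_add ct_push_scale)

lemma right_transport_add: "right_transport G (g, ct_add v w) = ct_add (right_transport G (g, v)) (right_transport G (g, w))"
  and right_transport_scale: "right_transport G (g, ct_scale a v) = ct_scale a (right_transport G (g, v))"
  and right_transport_zero: "right_transport G (g, ct_zero) = ct_zero"
  by (simp_all add: right_transport_def ct_push_add ct_push_scale)

lemma Ad_one: "\<alpha> \<in> lie_gC G \<Longrightarrow> Ad G \<one> \<alpha> = \<alpha>"
  unfolding Ad_def lie_gC_def by (rule push_ident) simp_all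

lemma right_transport_one: "\<alpha> \<in> lie_gC G \<Longrightarrow> right_transport G (\<one>, \<alpha>) = \<alpha>"
  unfolding right_transport_def lie_gC_def prod.case by (rule push_ident) simp_all

lemma Ad_mult:
  assumes "g \<in> carrier G" "h \<in> carrier G" "\<alpha> \<in> lie_gC G"
  shows "Ad G (g \<otimes> h) \<alpha> = Ad G g (Ad G h \<alpha>)"
  unfolding Ad_def
  by (rule push_push[symmetric, OF smooth_conj smooth_conj])
    (use assms in \<open>simp_all add: lie_gC_def inv_mult_group m_assoc\<close>)

text \<open>Right translation to the identity turns \<open>TC G\<close> into a semidirect product of
  the Lie algebra with G; this is the Lie algebra component of its multiplication.\<close>

lemma right_transport_mult:
  assumes g: "g \<in> carrier G" and h: "h \<in> carrier G" and v: "v \<in> TT g" and w: "w \<in> TT h"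
  shows "right_transport G ((g, v) \<otimes>\<^bsub>TC G\<^esub> (h, w)) = ct_add (Ad G g (right_transport G (h, w))) (right_transport G (g, v))"
proof -
  let ?r = "\<lambda>k. k \<otimes> inv (g \<otimes> h)"
  have gh: "g \<otimes> h \<in> carrier G" using g h by simp
  have 1: "PP ?r (g \<otimes> h) (PP (\<lambda>k. g \<otimes> k) h w) = PP (\<lambda>k. g \<otimes> k \<otimes> inv (g \<otimes> h)) h w"
    by (rule push_push[OF smooth_left smooth_right]) (use g h w in simp_all)
  have 2: "Ad G g (right_transport G (h, w)) = PP (\<lambda>k. g \<otimes> k \<otimes> inv (g \<otimes> h)) h w"
    unfolding Ad_def right_transport_def prod.case
    by (rule push_push[OF smooth_right smooth_conj]) (use g h w in \<open>simp_all add: inv_mult_group m_assoc\<close>)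
  have 3: "PP ?r (g \<otimes> h) (PP (\<lambda>k. k \<otimes> h) g v) = right_transport G (g, v)"
    unfolding right_transport_def prod.case
    by (rule push_push[OF smooth_right smooth_right]) (use g h v in \<open>simp_all add: inv_mult_group m_assoc\<close>, simp add: m_assoc[symmetric])
  show ?thesis
    unfolding 2 3[symmetric] 1[symmetric] by (simp add: mult_TC right_transport_def ct_push_add)
qed

lemma gC_mult_zero:
  assumes "\<alpha> \<in> lie_gC G" "g \<in> carrier G"
  shows "(\<one>, \<alpha>) \<otimes>\<^bsub>TC G\<^esub> (g, ct_zero) = (g, PP (\<lambda>k. k \<otimes> g) \<one> \<alpha>)"
  using assms by (simp add: mult_TC)

text \<open>Put into the shape of \<open>gC_mult_zero\<close>, so that rewriting with both
  identifies the two factorizations of one element; the equivariance of the counit rests on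
  this.\<close>

lemma TC_mult_gC:
  assumes "\<alpha> \<in> lie_gC G" "g \<in> carrier G" "v \<in> TT g"
  shows "(g, v) \<otimes>\<^bsub>TC G\<^esub> (\<one>, \<alpha>) = (g, PP (\<lambda>k. k \<otimes> g) \<one> (ct_add (Ad G g \<alpha>) (right_transport G (g, v))))"
proof -
  have 1: "PP (\<lambda>k. k \<otimes> g) \<one> (Ad G g \<alpha>) = PP (\<lambda>k. g \<otimes> k) \<one> \<alpha>"
    unfolding Ad_def
    by (rule push_push[OF smooth_conj smooth_right]) (use assms in \<open>simp_all add: lie_gC_def m_assoc\<close>)
  have "PP (\<lambda>k. k \<otimes> g) \<one> (right_transport G (g, v)) = PP (\<lambda>k. k) g v"
    unfolding right_transport_def prod.case
    by (rule push_push[OF smooth_right smooth_right]) (use assms in \<open>simp_all add: m_assoc\<close>)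
  also have "\<dots> = v" by (rule push_ident) (use assms in simp_all)
  finally have 2: "PP (\<lambda>k. k \<otimes> g) \<one> (right_transport G (g, v)) = v" .
  have 3: "PP (\<lambda>k. k \<otimes> \<one>) g v = v" by (rule push_ident) (use assms in simp_all)
  show ?thesis using assms by (simp add: mult_TC ct_push_add 1 2 3)
qed

lemma zero_mult_zero:
  assumes "g \<in> carrier G" "h \<in> carrier G"
  shows "(g, ct_zero) \<otimes>\<^bsub>TC G\<^esub> (h, ct_zero) = (g \<otimes> h, ct_zero)"
  by (simp add: mult_TC)

text \<open>\<open>Ad\<close> and the right translation to the identity are restrictions of parametrized tangent maps.\<close>

lemma smooth_push_param:
  assumes Q: "pre_mfd Q" and f: "smooth_map (prod_mfd GG GG) GG f"
    and a: "smooth_map Q GG a" and b: "smooth_map Q TG b"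
    and one: "\<And>y. y \<in> points Q \<Longrightarrow> f (a y, fst (b y)) = \<one>"
  shows "smooth_map Q LG (\<lambda>y. PP (\<lambda>x. f (a y, x)) (fst (b y)) (snd (b y)))"
proof -
  have P: "smooth_map (prod_mfd GG TG) TG (\<lambda>(y, (x, \<alpha>)). (f (y, x), PP (\<lambda>x. f (y, x)) x \<alpha>))"
    by (rule smooth_map_param_tangent[OF pre_G pre_G pre_G f])
  have "smooth_map Q TG (\<lambda>z. (case (a z, b z) of (y, x, \<alpha>) \<Rightarrow> (f (y, x), PP (\<lambda>x. f (y, x)) x \<alpha>)))"
    by (rule smooth_map_compose[OF Q prod_mfd_generated(1)[OF pre_G pre_TG] pre_TG
          smooth_map_Pair[OF Q pre_G pre_TG a b] P])
  then have "smooth_map Q LG (\<lambda>z. snd (case (a z, b z) of (y, x, \<alpha>) \<Rightarrow> (f (y, x), PP (\<lambda>x. f (y, x)) x \<alpha>)))"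
    by (rule smooth_map_ctangent_fibre[OF Q pre_G, rotated]) (use one in \<open>auto simp: split_beta\<close>)
  then show ?thesis by (simp add: split_beta)
qed

lemma smooth_map_into_TG: "smooth_map LG TG (\<lambda>\<alpha>. (\<one>, \<alpha>))"
  by (rule smooth_map_into_ctangent[OF pre_G]) simp

lemma smooth_map_fst_snd_G:
  "smooth_map (prod_mfd GG GG) GG fst" "smooth_map (prod_mfd GG GG) GG snd"
  by (rule smooth_map_fst[OF pre_G pre_G], rule smooth_map_snd[OF pre_G pre_G])

lemma smooth_Ad:
  assumes Q: "pre_mfd Q" and a: "smooth_map Q GG a" and b: "smooth_map Q LG b"
  shows "smooth_map Q LG (\<lambda>y. Ad G (a y) (b y))"
proof -
  have PG: "pre_mfd (prod_mfd GG GG)" by (rule prod_mfd_generated(1)[OF pre_G pre_G])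
  have f: "smooth_map (prod_mfd GG GG) GG (\<lambda>x. fst x \<otimes> snd x \<otimes> inv (fst x))"
    by (intro smooth_mult[OF PG] smooth_inv[OF PG] smooth_map_fst_snd_G)
  have b': "smooth_map Q TG (\<lambda>y. (\<one>, b y))" by (rule smooth_map_compose[OF Q pre_LG pre_TG b smooth_map_into_TG])
  \<comment> \<open>Conjugation fixes the identity, so all values stay over one base point, as
    \<open>smooth_push_param\<close> requires.\<close>
  have "smooth_map Q LG (\<lambda>y. PP (\<lambda>x. fst (a y, x) \<otimes> snd (a y, x) \<otimes> inv (fst (a y, x))) (fst (\<one>, b y)) (snd (\<one>, b y)))"
    by (rule smooth_push_param[OF Q f a b']) (use smooth_map_points[OF a] in auto)
  then show ?thesis by (simp add: Ad_def)
qed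

lemma smooth_fst_TG: "smooth_map TG GG fst"
proof (rule smooth_mapI[OF pre_TG pre_G])
  fix x assume x: "x \<in> points TG"
  obtain p \<alpha> where e: "x = (p, \<alpha>)" by (cases x)
  have p: "p \<in> carrier G" "\<alpha> \<in> TT p" using x e by auto
  then obtain c where c: "c \<in> charts_at GG p" using pre_mfd_charts_at[OF pre_G, of p] by auto
  then have ca: "c \<in> atlas GG" "p \<in> cdom c" and ok: "chart_ok c" using pre_mfd_chart_ok[OF pre_G] by (auto simp: charts_at_iff)
  let ?n = "cdim c"
  have "smooth_pt (tchart GG c) c fst x"
  proof (rule smooth_ptI[OF tchart_ok[OF pre_G ca(1)] ok, where W = "EE (?n + (?n + ?n))" and H = "fstE ?n"])
    show "cmap (tchart GG c) x \<in> EE (?n + (?n + ?n))"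
      using ca p e cmap_in_EE[OF tchart_ok[OF pre_G ca(1)], of x] by simp
  qed (use ca p e cmap_in_EE[OF ok] in \<open>auto simp: eopen_EE smooth_between_fstE\<close>)
  then show "\<exists>c\<in>charts_at TG x. \<exists>d\<in>atlas GG. smooth_pt c d fst x"
    using tchart_charts_at[OF pre_G c p(2)] ca e by blast
qed

lemma smooth_right_transport: "smooth_map TG LG (right_transport G)"
proof -
  have PG: "pre_mfd (prod_mfd GG GG)" by (rule prod_mfd_generated(1)[OF pre_G pre_G])
  have f: "smooth_map (prod_mfd GG GG) GG (\<lambda>x. snd x \<otimes> inv (fst x))"
    by (intro smooth_mult[OF PG] smooth_inv[OF PG] smooth_map_fst_snd_G)
  \<comment> \<open>The group element enters twice: as the parameter, which is not differentiated,
    and as the base point of the vector.\<close>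
  have "smooth_map TG LG (\<lambda>y. PP (\<lambda>x. snd (fst y, x) \<otimes> inv (fst (fst y, x))) (fst y) (snd y))"
    by (rule smooth_push_param[OF pre_TG f smooth_fst_TG smooth_map_id[OF pre_TG]]) auto
  then show ?thesis by (simp add: right_transport_def case_prod_beta')
qed

lemma smooth_zero_section: "smooth_map GG TG (\<lambda>g. (g, ct_zero))"
proof (rule smooth_mapI[OF pre_G pre_TG])
  fix p assume "p \<in> points GG"
  then obtain c where c: "c \<in> charts_at GG p" using pre_mfd_charts_at[OF pre_G, of p] by auto
  then have ca: "c \<in> atlas GG" "p \<in> cdom c" and ok: "chart_ok c" using pre_mfd_chart_ok[OF pre_G] by (auto simp: charts_at_iff)
  let ?n = "cdim c" and ?o = "\<lambda>_ :: nat. 0 :: real"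
  have "smooth_pt c (tchart GG c) (\<lambda>g. (g, ct_zero)) p"
  proof (rule smooth_ptI[OF ok tchart_ok[OF pre_G ca(1)] ca(2) eopen_EE, where H = "\<lambda>x. cat ?n x (cat ?n ?o ?o)"])
    show "smooth_between ?n (cdim (tchart GG c)) (EE ?n) (\<lambda>x. cat ?n x (cat ?n ?o ?o))"
      unfolding tchart_simps
      by (rule smooth_between_cat[OF eopen_EE smooth_between_id[OF eopen_EE] smooth_between_const[OF eopen_EE cat_in_EE]])
        (simp add: EE_iff)
  next
    have "fst ct_zero c = ?o" "snd ct_zero c = ?o" by (simp_all add: ct_zero_def)
    then show "(q, ct_zero) \<in> cdom (tchart GG c) \<and> cmap (tchart GG c) (q, ct_zero) = cat ?n (cmap c q) (cat ?n ?o ?o)"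
      if "q \<in> cdom c" for q using that ct_zero_in[of GG q] by simp
  qed (use ca cmap_in_EE[OF ok] in auto)
  then show "\<exists>c\<in>charts_at GG p. \<exists>d\<in>atlas TG. smooth_pt c d (\<lambda>g. (g, ct_zero)) p"
    using c ctangent_mfd_pre(2)[OF pre_G ca(1)] by blast
qed

lemma smooth_gC_add:
  assumes Q: "pre_mfd Q" and a: "smooth_map Q LG a" and b: "smooth_map Q LG b"
  shows "smooth_map Q LG (\<lambda>y. ct_add (a y) (b y))"
proof -
  have "smooth_map (prod_mfd LG LG) LG (\<lambda>x. ct_add (fst x) (snd x))"
    by (rule smooth_map_ct_add[OF pre_G]) simp
  from smooth_map_compose[OF Q prod_mfd_generated(1)[OF pre_LG pre_LG] pre_LG smooth_map_Pair[OF Q pre_LG pre_LG a b] this]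
  show ?thesis by simp
qed

end

section \<open>Vector bundles\<close>

lemma diffeomorphismI:
  assumes M: "pre_mfd M" and N: "pre_mfd N" and f: "smooth_map M N f" and g: "smooth_map N M g"
    and gf: "\<And>p. p \<in> points M \<Longrightarrow> g (f p) = p" and fg: "\<And>q. q \<in> points N \<Longrightarrow> f (g q) = q"
  shows "diffeomorphism M N f"
proof -
  have bij: "bij_betw f (points M) (points N)"
    by (rule bij_betw_byWitness[where f' = g])
      (use gf fg smooth_map_points[OF f] smooth_map_points[OF g] in auto)
  have "smooth_map N M (inv_into (points M) f)"
  proof (rule smooth_map_cong[OF g N M])
    fix q assume "q \<in> points N"
    then show "g q = inv_into (points M) f q"
      using inv_into_f_f[OF bij_betw_imp_inj_on[OF bij] smooth_map_points[OF g, of q]] fg by simp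
  qed
  then show ?thesis using bij f by (simp add: diffeomorphism_def)
qed

lemma complex_vector_spaceD:
  assumes "complex_vector_space V add z smul"
  shows "z \<in> V" "\<And>u v. u \<in> V \<Longrightarrow> v \<in> V \<Longrightarrow> add u v \<in> V" "\<And>a u. u \<in> V \<Longrightarrow> smul a u \<in> V"
    "\<And>u v w. u \<in> V \<Longrightarrow> v \<in> V \<Longrightarrow> w \<in> V \<Longrightarrow> add (add u v) w = add u (add v w)"
    "\<And>u v. u \<in> V \<Longrightarrow> v \<in> V \<Longrightarrow> add u v = add v u" "\<And>u. u \<in> V \<Longrightarrow> add z u = u"
    "\<And>u. u \<in> V \<Longrightarrow> \<exists>v\<in>V. add u v = z"
    "\<And>a u v. u \<in> V \<Longrightarrow> v \<in> V \<Longrightarrow> smul a (add u v) = add (smul a u) (smul a v)"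
    "\<And>a b u. u \<in> V \<Longrightarrow> smul (a + b) u = add (smul a u) (smul b u)"
    "\<And>a b u. u \<in> V \<Longrightarrow> smul (a * b) u = smul a (smul b u)" "\<And>u. u \<in> V \<Longrightarrow> smul 1 u = u"
  using assms unfolding complex_vector_space_def by meson+

locale cvb =
  fixes X :: "'x smooth_mfd" and E :: "('x, 'p) cbundle"
  assumes E: "complex_vector_bundle X E" and pre_X: "pre_mfd X"
begin

abbreviation "PE \<equiv> points (tot E)"

lemma pre_E: "pre_mfd (tot E)"
  using E by (simp add: complex_vector_bundle_def smooth_manifold_pre)

lemma smooth_proj: "smooth_map (tot E) X (proj E)"
  using E by (simp add: complex_vector_bundle_def)

lemma proj_in: "e \<in> PE \<Longrightarrow> proj E e \<in> points X"
  by (rule smooth_map_points[OF smooth_proj])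

lemma vs: "x \<in> points X \<Longrightarrow> complex_vector_space (fibre E x) (vadd E) (vzero E x) (vscale E)"
  using E by (simp add: complex_vector_bundle_def)

lemma in_fibre: "e \<in> PE \<Longrightarrow> e \<in> fibre E (proj E e)"
  by (simp add: fibre_def)

lemma vadd_fibre: "x \<in> points X \<Longrightarrow> e \<in> fibre E x \<Longrightarrow> f \<in> fibre E x \<Longrightarrow> vadd E e f \<in> fibre E x"
  and vscale_fibre: "x \<in> points X \<Longrightarrow> e \<in> fibre E x \<Longrightarrow> vscale E a e \<in> fibre E x"
  and vzero_fibre: "x \<in> points X \<Longrightarrow> vzero E x \<in> fibre E x"
  using complex_vector_spaceD(1-3)[OF vs] by blast+

lemma vadd_in:
  assumes "e \<in> PE" "f \<in> PE" "proj E e = proj E f"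
  shows "vadd E e f \<in> PE" "proj E (vadd E e f) = proj E f"
  using vadd_fibre[OF proj_in[OF assms(2)], of e f] assms by (auto simp: fibre_def)

lemma vscale_in:
  assumes "e \<in> PE" shows "vscale E a e \<in> PE" "proj E (vscale E a e) = proj E e"
  using vscale_fibre[OF proj_in[OF assms] in_fibre[OF assms]] by (auto simp: fibre_def)

lemma vzero_in: "x \<in> points X \<Longrightarrow> vzero E x \<in> PE" "x \<in> points X \<Longrightarrow> proj E (vzero E x) = x"
  using vzero_fibre by (auto simp: fibre_def)

lemma vzero_add: "e \<in> PE \<Longrightarrow> vadd E (vzero E (proj E e)) e = e"
  by (rule complex_vector_spaceD(6)[OF vs[OF proj_in] in_fibre])

lemma vadd_comm: "e \<in> PE \<Longrightarrow> f \<in> PE \<Longrightarrow> proj E e = proj E f \<Longrightarrow> vadd E e f = vadd E f e"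
  using complex_vector_spaceD(5)[OF vs[OF proj_in] in_fibre, of e f] in_fibre[of f] by simp

text \<open>Add an additive inverse of e to both sides. The vector space axioms give such inverses
  only by existence.\<close>

lemma idempotent_zero:
  assumes e: "e \<in> PE" and ee: "vadd E e e = e" shows "e = vzero E (proj E e)"
proof -
  note V = vs[OF proj_in[OF e]] and ef = in_fibre[OF e]
  obtain f where f: "f \<in> fibre E (proj E e)" "vadd E e f = vzero E (proj E e)"
    using complex_vector_spaceD(7)[OF V ef] by blast
  have "vadd E (vadd E e e) f = vadd E e (vadd E e f)"
    by (rule complex_vector_spaceD(4)[OF V ef ef f(1)])
  then have "vzero E (proj E e) = vadd E e (vzero E (proj E e))" using f(2) ee by simp
  also have "\<dots> = e"
    using vzero_add[OF e] vadd_comm[OF e vzero_in(1)[OF proj_in[OF e]]] vzero_in(2)[OF proj_in[OF e]] by simp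
  finally show ?thesis by simp
qed

lemma vscale_zero:
  assumes e: "e \<in> PE" shows "vscale E 0 e = vzero E (proj E e)"
proof -
  have "vscale E (0 + 0) e = vadd E (vscale E 0 e) (vscale E 0 e)"
    by (rule complex_vector_spaceD(9)[OF vs[OF proj_in[OF e]] in_fibre[OF e]])
  then show ?thesis using idempotent_zero[OF vscale_in(1)[OF e, of 0]] vscale_in(2)[OF e] by simp
qed

lemma trivialization:
  assumes x: "x \<in> points X"
  obtains U r \<Phi> where "x \<in> U" "local_trivialization X E U r \<Phi>"
  using E x unfolding complex_vector_bundle_def by blast

end

locale triv = cvb X E for X :: "'x smooth_mfd" and E :: "('x, 'p) cbundle" +
  fixes U r \<Phi>
  assumes triv: "local_trivialization X E U r \<Phi>"
begin

definition "V = {e \<in> points (tot E). proj E e \<in> U}"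
definition "\<Psi> = inv_into V \<Phi>"

abbreviation "EV \<equiv> open_submfd (tot E) V"
abbreviation "XU \<equiv> open_submfd X U"

lemma open_U: "openin (mtop X) U"
  using triv by (simp add: local_trivialization_def)

lemma open_V: "openin (mtop (tot E)) V"
  using openin_continuous_map_preimage[OF smooth_map_continuous[OF pre_E pre_X smooth_proj] open_U]
  by (simp add: V_def topspace_mtop[OF pre_E])

lemma pre_EV: "pre_mfd EV" by (rule open_submfd_pre[OF pre_E open_V])
lemma pre_XU: "pre_mfd XU" by (rule open_submfd_pre[OF pre_X open_U])
lemma pre_XUC: "pre_mfd (prod_mfd XU (complex_space r))"
  by (rule prod_mfd_generated(1)[OF pre_XU complex_space_pre(1)])

lemma diffeo: "diffeomorphism EV (prod_mfd XU (complex_space r)) \<Phi>"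
  using triv by (simp add: local_trivialization_def V_def)

lemma smooth_\<Phi>: "smooth_map EV (prod_mfd XU (complex_space r)) \<Phi>"
  and smooth_\<Psi>: "smooth_map (prod_mfd XU (complex_space r)) EV \<Psi>"
  and bij_\<Phi>: "bij_betw \<Phi> V (U \<times> Cvec r)"
  using diffeo by (simp_all add: diffeomorphism_def \<Psi>_def)

lemma \<Psi>\<Phi>: "e \<in> V \<Longrightarrow> \<Psi> (\<Phi> e) = e"
  unfolding \<Psi>_def by (rule inv_into_f_f[OF bij_betw_imp_inj_on[OF bij_\<Phi>]])

lemma \<Phi>\<Psi>: "x \<in> U \<Longrightarrow> z \<in> Cvec r \<Longrightarrow> \<Phi> (\<Psi> (x, z)) = (x, z)"
  unfolding \<Psi>_def by (rule bij_betw_inv_into_right[OF bij_\<Phi>]) simp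

lemma \<Psi>_in: "x \<in> U \<Longrightarrow> z \<in> Cvec r \<Longrightarrow> \<Psi> (x, z) \<in> V"
  using smooth_map_points[OF smooth_\<Psi>, of "(x, z)"] by simp

lemma fst_\<Phi>: "e \<in> V \<Longrightarrow> fst (\<Phi> e) = proj E e"
  and \<Phi>_scale: "e \<in> V \<Longrightarrow> snd (\<Phi> (vscale E a e)) = (\<lambda>i. a * snd (\<Phi> e) i)"
  and \<Phi>_add: "e \<in> V \<Longrightarrow> e' \<in> V \<Longrightarrow> proj E e = proj E e' \<Longrightarrow>
    snd (\<Phi> (vadd E e e')) = (\<lambda>i. snd (\<Phi> e) i + snd (\<Phi> e') i)"
  using triv in_fibre unfolding local_trivialization_def V_def fibre_def by auto

lemma proj_\<Psi>: "x \<in> U \<Longrightarrow> z \<in> Cvec r \<Longrightarrow> proj E (\<Psi> (x, z)) = x"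
  using fst_\<Phi>[OF \<Psi>_in] \<Phi>\<Psi> by simp

text \<open>Smooth scalar multiplication is not among the bundle axioms. In a trivialization it
  becomes multiplication in the complex factor, which is smooth.\<close>

lemma smooth_vscale_local: "smooth_map EV (tot E) (vscale E a)"
proof -
  have 1: "smooth_map EV XU (\<lambda>e. fst (\<Phi> e))"
    by (rule smooth_map_compose[OF pre_EV pre_XUC pre_XU smooth_\<Phi> smooth_map_fst[OF pre_XU complex_space_pre(1)]])
  have 2: "smooth_map EV (complex_space r) (\<lambda>e. snd (\<Phi> e))"
    by (rule smooth_map_compose[OF pre_EV pre_XUC complex_space_pre(1) smooth_\<Phi> smooth_map_snd[OF pre_XU complex_space_pre(1)]])
  have 3: "smooth_map EV (complex_space r) (\<lambda>e i. a * snd (\<Phi> e) i)"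
    by (rule smooth_map_compose[OF pre_EV complex_space_pre(1) complex_space_pre(1) 2 smooth_map_cscale])
  have "smooth_map EV EV (\<lambda>e. \<Psi> (fst (\<Phi> e), \<lambda>i. a * snd (\<Phi> e) i))"
    by (rule smooth_map_compose[OF pre_EV pre_XUC pre_EV smooth_map_Pair[OF pre_EV pre_XU complex_space_pre(1) 1 3] smooth_\<Psi>])
  then have "smooth_map EV (tot E) (\<lambda>e. \<Psi> (fst (\<Phi> e), \<lambda>i. a * snd (\<Phi> e) i))"
    by (rule smooth_map_compose[OF pre_EV pre_EV pre_E _ smooth_map_open_submfd_incl[OF pre_E open_V]])
  then show ?thesis
  proof (rule smooth_map_cong[OF _ pre_EV pre_E])
    fix e assume "e \<in> points EV"
    then have e: "e \<in> V" by simp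
    then have s: "vscale E a e \<in> V" "fst (\<Phi> e) = proj E e" using vscale_in[of e a] fst_\<Phi> by (auto simp: V_def)
    have "\<Phi> (vscale E a e) = (fst (\<Phi> e), \<lambda>i. a * snd (\<Phi> e) i)"
      using fst_\<Phi>[OF s(1)] \<Phi>_scale[OF e] s vscale_in(2)[of e a] e by (simp add: prod_eq_iff V_def)
    then show "\<Psi> (fst (\<Phi> e), \<lambda>i. a * snd (\<Phi> e) i) = vscale E a e" using \<Psi>\<Phi>[OF s(1)] by simp
  qed
qed

end

context cvb begin

lemma smooth_vscale: "smooth_map (tot E) (tot E) (vscale E a)"
proof (rule smooth_map_open_cover[OF pre_E pre_E])
  fix e assume e: "e \<in> points (tot E)"
  obtain U r \<Phi> where U: "proj E e \<in> U" "local_trivialization X E U r \<Phi>" by (rule trivialization[OF proj_in[OF e]])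
  interpret triv X E U r \<Phi> by unfold_locales (rule U(2))
  show "\<exists>U. openin (mtop (tot E)) U \<and> e \<in> U \<and> smooth_map (open_submfd (tot E) U) (tot E) (vscale E a)"
    using open_V smooth_vscale_local e U(1) by (intro exI[of _ V]) (simp add: V_def)
qed

end

subsection \<open>The bundle \<open>(\<gg>\<^sub>\<complex>)\<^sub>X \<oplus> E\<close>\<close>

definition pal :: "('x, 'g, 'a) pt \<Rightarrow> 'g ctvec" where
  "pal p = (case p of Plus u e \<Rightarrow> snd u | Pt _ \<Rightarrow> undefined)"

definition pel :: "('x, 'g, 'a) pt \<Rightarrow> ('x, 'g, 'a) pt" where
  "pel p = (case p of Plus u e \<Rightarrow> e | Pt _ \<Rightarrow> undefined)"

text \<open>A free point repeats the base point of its second component. Building points this way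
  keeps the repetition consistent and leaves just the pair (\<alpha>, e) to reason about.\<close>

definition plus_pt :: "('x, ('x, 'g, 'a) pt) cbundle \<Rightarrow> 'g ctvec \<Rightarrow> ('x, 'g, 'a) pt \<Rightarrow> ('x, 'g, 'a) pt" where
  "plus_pt E \<alpha> e = Plus (proj E e, \<alpha>) e"

lemma pal_plus_pt [simp]: "pal (plus_pt E \<alpha> e) = \<alpha>" and pel_plus_pt [simp]: "pel (plus_pt E \<alpha> e) = e"
  by (simp_all add: plus_pt_def pal_def pel_def)

lemma plus_pt_eq [simp]: "plus_pt E \<alpha> e = plus_pt E \<beta> f \<longleftrightarrow> \<alpha> = \<beta> \<and> e = f"
  by (auto simp: plus_pt_def)

locale free_bundle = lie_grp G + cvb X E
  for G :: "'g lie_group" (structure) and X :: "'x smooth_mfd" and E :: "('x, ('x, 'g, 'a) pt) cbundle"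
begin

abbreviation "FE \<equiv> free_cbundle G X E"
abbreviation "FP \<equiv> free_points G E"

abbreviation "mk \<equiv> plus_pt E"

lemma FP_iff: "p \<in> FP \<longleftrightarrow> (\<exists>\<alpha> e. p = mk \<alpha> e \<and> \<alpha> \<in> lie_gC G \<and> e \<in> PE)"
  by (auto simp: free_points_def plus_pt_def)

lemma FP_E:
  assumes "p \<in> FP" obtains \<alpha> e where "p = mk \<alpha> e" "\<alpha> \<in> lie_gC G" "e \<in> PE"
  using assms FP_iff by blast

lemma mk_in [simp]: "mk \<alpha> e \<in> FP \<longleftrightarrow> \<alpha> \<in> lie_gC G \<and> e \<in> PE"
  by (simp add: FP_iff)

lemma points_FE [simp]: "points (tot FE) = FP"
  by (simp add: free_cbundle_def transport_mfd_def)

lemma proj_mk [simp]: "\<alpha> \<in> lie_gC G \<Longrightarrow> e \<in> PE \<Longrightarrow> proj FE (mk \<alpha> e) = proj E e"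
  using mk_in[of \<alpha> e] by (simp add: free_cbundle_def plus_pt_def)

lemma vadd_mk [simp]:
  assumes "\<alpha> \<in> lie_gC G" "e \<in> PE" "\<beta> \<in> lie_gC G" "f \<in> PE" "proj E e = proj E f"
  shows "vadd FE (mk \<alpha> e) (mk \<beta> f) = mk (ct_add \<alpha> \<beta>) (vadd E e f)"
  using assms mk_in[of \<alpha> e] mk_in[of \<beta> f] vadd_in(2)[of e f] by (simp add: free_cbundle_def plus_pt_def)

lemma vscale_mk [simp]:
  assumes "\<alpha> \<in> lie_gC G" "e \<in> PE" shows "vscale FE a (mk \<alpha> e) = mk (ct_scale a \<alpha>) (vscale E a e)"
  using assms mk_in[of \<alpha> e] vscale_in(2)[of e a] by (simp add: free_cbundle_def plus_pt_def)

lemma vzero_FE: "x \<in> points X \<Longrightarrow> vzero FE x = mk ct_zero (vzero E x)"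
  using vzero_in(2)[of x] by (simp add: free_cbundle_def plus_pt_def)

lemma gC_add: "\<alpha> \<in> lie_gC G \<Longrightarrow> \<beta> \<in> lie_gC G \<Longrightarrow> ct_add \<alpha> \<beta> \<in> lie_gC G"
  and gC_scale: "\<alpha> \<in> lie_gC G \<Longrightarrow> ct_scale a \<alpha> \<in> lie_gC G"
  and gC_zero: "ct_zero \<in> lie_gC G"
  by (simp_all add: lie_gC_def ct_add_in ct_scale_in ct_zero_in)

definition tr :: "('x, 'g, 'a) pt \<Rightarrow> 'g ctvec \<times> ('x, 'g, 'a) pt" where
  "tr = (\<lambda>p. case p of Plus (x, \<alpha>) e \<Rightarrow> (\<alpha>, e) | Pt _ \<Rightarrow> undefined)"

lemma tr_mk [simp]: "tr (mk \<alpha> e) = (\<alpha>, e)"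
  by (simp add: tr_def plus_pt_def)

lemma tot_FE: "tot FE = transport_mfd FP tr (prod_mfd LG (tot E))"
  by (simp add: free_cbundle_def tr_def)

sublocale bp: bij_pair FP "lie_gC G \<times> PE" tr "\<lambda>(\<alpha>, e). mk \<alpha> e"
  by unfold_locales (auto simp: FP_iff)

lemma pre_LE: "pre_mfd (prod_mfd LG (tot E))"
  by (rule prod_mfd_generated(1)[OF pre_LG pre_E])

lemma points_LE: "points (prod_mfd LG (tot E)) = lie_gC G \<times> PE"
  by (simp add: lie_gC_def)

lemma smooth_manifold_FE: "smooth_manifold (tot FE)"
proof -
  have "smooth_manifold LG" by (rule ctangent_space_mfd_pre(3)[OF pre_G]) simp
  moreover have "smooth_manifold (tot E)" using E by (simp add: complex_vector_bundle_def)
  ultimately show ?thesis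
    unfolding tot_FE by (rule bp.smooth_manifold_transport[OF smooth_manifold_prod points_LE])
qed

lemma pre_FE: "pre_mfd (tot FE)"
  by (rule smooth_manifold_pre[OF smooth_manifold_FE])

lemma smooth_tr: "smooth_map (tot FE) (prod_mfd LG (tot E)) tr"
  unfolding tot_FE by (rule bp.smooth_map_transport[OF pre_LE points_LE])

lemma smooth_pal: "smooth_map (tot FE) LG pal"
  by (rule smooth_map_cong[OF smooth_map_compose[OF pre_FE pre_LE pre_LG smooth_tr smooth_map_fst[OF pre_LG pre_E]] pre_FE pre_LG])
    (auto simp: FP_iff)

lemma smooth_pel: "smooth_map (tot FE) (tot E) pel"
  by (rule smooth_map_cong[OF smooth_map_compose[OF pre_FE pre_LE pre_E smooth_tr smooth_map_snd[OF pre_LG pre_E]] pre_FE pre_E])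
    (auto simp: FP_iff)

lemma smooth_mk:
  assumes Q: "pre_mfd Q" and a: "smooth_map Q LG a" and b: "smooth_map Q (tot E) b"
  shows "smooth_map Q (tot FE) (\<lambda>y. mk (a y) (b y))"
proof -
  have "smooth_map (prod_mfd LG (tot E)) (tot FE) (\<lambda>(\<alpha>, e). mk \<alpha> e)"
    unfolding tot_FE by (rule bp.smooth_map_transport_inv[OF pre_LE points_LE])
  from smooth_map_compose[OF Q pre_LE pre_FE smooth_map_Pair[OF Q pre_LG pre_E a b] this]
  show ?thesis by simp
qed

lemma smooth_proj_FE: "smooth_map (tot FE) X (proj FE)"
  by (rule smooth_map_cong[OF smooth_map_compose[OF pre_FE pre_E pre_X smooth_pel smooth_proj] pre_FE pre_X])
    (auto simp: FP_iff)

lemma fibre_FE: "fibre FE x = {mk \<alpha> e | \<alpha> e. \<alpha> \<in> lie_gC G \<and> e \<in> fibre E x}"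
  unfolding fibre_def by (auto simp: FP_iff)

lemma fibre_FE_vs:
  assumes x: "x \<in> points X"
  shows "complex_vector_space (fibre FE x) (vadd FE) (vzero FE x) (vscale FE)"
proof -
  note V = vs[OF x]
  note cl = complex_vector_spaceD(2,3,1)[OF V] and as = complex_vector_spaceD(4)[OF V]
    and co = complex_vector_spaceD(5)[OF V] and ze = complex_vector_spaceD(6)[OF V] and ne = complex_vector_spaceD(7)[OF V]
    and s1 = complex_vector_spaceD(8)[OF V] and s2 = complex_vector_spaceD(9)[OF V]
    and s3 = complex_vector_spaceD(10)[OF V] and s4 = complex_vector_spaceD(11)[OF V]
  have add: "vadd FE (mk \<alpha> e) (mk \<beta> f) = mk (ct_add \<alpha> \<beta>) (vadd E e f)"
    if "\<alpha> \<in> lie_gC G" "e \<in> fibre E x" "\<beta> \<in> lie_gC G" "f \<in> fibre E x" for \<alpha> \<beta> e f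
    using that by (simp add: fibre_def)
  have scale: "vscale FE a (mk \<alpha> e) = mk (ct_scale a \<alpha>) (vscale E a e)"
    if "\<alpha> \<in> lie_gC G" "e \<in> fibre E x" for \<alpha> a e
    using that by (simp add: fibre_def)
  note zero = vzero_FE[OF x]
  have mem: "mk \<alpha> e \<in> fibre FE x" if "\<alpha> \<in> lie_gC G" "e \<in> fibre E x" for \<alpha> e using that fibre_FE by blast
  have neg: "\<exists>v\<in>fibre FE x. vadd FE u v = vzero FE x" if u_in: "u \<in> fibre FE x" for u
  proof -
    obtain \<alpha> e where u: "u = mk \<alpha> e" "\<alpha> \<in> lie_gC G" "e \<in> fibre E x" using u_in fibre_FE by blast
    obtain f where f: "f \<in> fibre E x" "vadd E e f = vzero E x" using ne[OF u(3)] by blast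
    have "vadd FE u (mk (ct_scale (- 1) \<alpha>) f) = vzero FE x"
      using u f by (simp add: add gC_scale zero ct_add_uminus)
    then show ?thesis using mem[OF gC_scale[OF u(2)] f(1)] by blast
  qed
  show ?thesis
    unfolding complex_vector_space_def
  proof (intro conjI ballI allI)
    show "vzero FE x \<in> fibre FE x" unfolding zero by (rule mem[OF gC_zero cl(3)])
    fix u assume "u \<in> fibre FE x"
    then obtain \<alpha> e where u: "u = mk \<alpha> e" "\<alpha> \<in> lie_gC G" "e \<in> fibre E x" using fibre_FE by blast
    show "vscale FE a u \<in> fibre FE x" for a using u by (simp add: scale mem gC_scale cl)
    show "vadd FE (vzero FE x) u = u" using u by (simp add: zero add gC_zero cl ze)
    show "\<exists>v\<in>fibre FE x. vadd FE u v = vzero FE x" by (rule neg) fact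
    show "vscale FE (a + b) u = vadd FE (vscale FE a u) (vscale FE b u)" for a b
      using u by (simp add: scale add gC_scale cl s2 ct_scale_add_left)
    show "vscale FE (a * b) u = vscale FE a (vscale FE b u)" for a b
      using u by (simp add: scale gC_scale cl s3 ct_scale_mult)
    show "vscale FE 1 u = u" using u by (simp add: scale s4)
    fix v assume "v \<in> fibre FE x"
    then obtain \<beta> f where v: "v = mk \<beta> f" "\<beta> \<in> lie_gC G" "f \<in> fibre E x" using fibre_FE by blast
    show "vadd FE u v \<in> fibre FE x" using u v by (simp add: add mem gC_add cl)
    show "vadd FE u v = vadd FE v u" using u v co[of e f] by (simp add: add ct_add_commute)
    show "vscale FE a (vadd FE u v) = vadd FE (vscale FE a u) (vscale FE a v)" for a
      using u v by (simp add: add scale gC_add gC_scale cl s1 ct_scale_add)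
    fix w assume "w \<in> fibre FE x"
    then obtain \<gamma> h where w: "w = mk \<gamma> h" "\<gamma> \<in> lie_gC G" "h \<in> fibre E x" using fibre_FE by blast
    show "vadd FE (vadd FE u v) w = vadd FE u (vadd FE v w)"
      using u v w by (simp add: add gC_add cl as ct_add_assoc)
  qed
qed

text \<open>The first summand is a product bundle, so the open set of a trivialization of E can be
  kept. Its fibre coordinates come from one chart of G at the identity, and the rank grows by the
  dimension of that chart.\<close>

lemma free_trivialization:
  assumes x: "x \<in> points X"
  shows "\<exists>U r \<Phi>. x \<in> U \<and> local_trivialization X FE U r \<Phi>"
proof -
  obtain U r \<Phi> where U: "x \<in> U" "local_trivialization X E U r \<Phi>" by (rule trivialization[OF x])
  interpret t: triv X E U r \<Phi> by unfold_locales (rule U(2))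
  obtain c where c: "c \<in> charts_at GG \<one>" using pre_mfd_charts_at[OF pre_G, of \<one>] by auto
  define n where "n = cdim c"
  define W where "W = {p \<in> points (tot FE). proj FE p \<in> U}"
  let ?FW = "open_submfd (tot FE) W" and ?XU = "open_submfd X U" and ?C = "complex_space (n + r)"
  \<comment> \<open>Lie algebra coordinates in front, fibre coordinates of E behind;
    \<open>?\<Psi>\<close> takes them apart again.\<close>
  let ?\<Phi> = "\<lambda>p. (proj FE p, cjoin n (ccoord c (pal p)) (snd (\<Phi> (pel p))))"
  let ?\<Psi> = "\<lambda>y. mk (ccoord_inv GG \<one> c (csplit1 n (snd y))) (t.\<Psi> (fst y, csplit2 n (snd y)))"
  have W_iff: "p \<in> W \<longleftrightarrow> (\<exists>\<alpha> e. p = mk \<alpha> e \<and> \<alpha> \<in> lie_gC G \<and> e \<in> t.V)" for p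
    unfolding W_def t.V_def by (auto simp: FP_iff)
  have open_W: "openin (mtop (tot FE)) W"
    using openin_continuous_map_preimage[OF smooth_map_continuous[OF pre_FE pre_X smooth_proj_FE] t.open_U]
    by (simp add: W_def topspace_mtop[OF pre_FE])
  note pFW = open_submfd_pre[OF pre_FE open_W]
  note pC = complex_space_pre(1)
  have pXC: "pre_mfd (prod_mfd ?XU ?C)" by (rule prod_mfd_generated(1)[OF t.pre_XU pC])
  have pXr: "pre_mfd (prod_mfd ?XU (complex_space r))" by (rule t.pre_XUC)
  have gC: "\<alpha> \<in> lie_gC G \<Longrightarrow> \<alpha> \<in> ctangent_space GG \<one>" for \<alpha> by (simp add: lie_gC_def)
  have smooth1: "smooth_map ?FW (prod_mfd ?XU ?C) ?\<Phi>"
  proof (rule smooth_map_Pair[OF pFW t.pre_XU pC])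
    show "smooth_map ?FW ?XU (proj FE)"
      by (rule smooth_map_into_open_submfd[OF pFW pre_X t.open_U smooth_map_restrict_open[OF pre_FE pre_X open_W smooth_proj_FE]])
        (simp add: W_def)
    have a: "smooth_map ?FW (complex_space n) (\<lambda>p. ccoord c (pal p))"
      unfolding n_def by (rule smooth_map_compose[OF pFW pre_LG pC smooth_map_restrict_open[OF pre_FE pre_LG open_W smooth_pal] smooth_map_ccoord(1)[OF pre_G c]])
    have b: "smooth_map ?FW t.EV pel"
      by (rule smooth_map_into_open_submfd[OF pFW pre_E t.open_V smooth_map_restrict_open[OF pre_FE pre_E open_W smooth_pel]])
        (auto simp: W_iff)
    have d: "smooth_map ?FW (complex_space r) (\<lambda>p. snd (\<Phi> (pel p)))"
      by (rule smooth_map_compose[OF pFW pXr pC smooth_map_compose[OF pFW t.pre_EV pXr b t.smooth_\<Phi>] smooth_map_snd[OF t.pre_XU pC]])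
    from smooth_map_compose[OF pFW prod_mfd_generated(1)[OF pC pC] pC smooth_map_Pair[OF pFW pC pC a d] smooth_map_cjoin]
    show "smooth_map ?FW ?C (\<lambda>p. cjoin n (ccoord c (pal p)) (snd (\<Phi> (pel p))))" by simp
  qed
  have fs: "smooth_map (prod_mfd ?XU ?C) ?XU fst" "smooth_map (prod_mfd ?XU ?C) ?C snd"
    by (rule smooth_map_fst[OF t.pre_XU pC], rule smooth_map_snd[OF t.pre_XU pC])
  have smooth2: "smooth_map (prod_mfd ?XU ?C) ?FW ?\<Psi>"
  proof (rule smooth_map_into_open_submfd[OF pXC pre_FE open_W])
    show "smooth_map (prod_mfd ?XU ?C) (tot FE) ?\<Psi>"
    proof (rule smooth_mk[OF pXC])
      have "smooth_map (prod_mfd ?XU ?C) (complex_space n) (\<lambda>y. csplit1 n (snd y))"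
        by (rule smooth_map_compose[OF pXC pC pC fs(2) smooth_map_csplit1])
      from smooth_map_compose[OF pXC pC pre_LG this smooth_map_ccoord(2)[OF pre_G c, folded n_def]]
      show "smooth_map (prod_mfd ?XU ?C) LG (\<lambda>y. ccoord_inv GG \<one> c (csplit1 n (snd y)))" .
      have "smooth_map (prod_mfd ?XU ?C) (complex_space r) (\<lambda>y. csplit2 n (snd y))"
        by (rule smooth_map_compose[OF pXC pC pC fs(2) smooth_map_csplit2])
      from smooth_map_compose[OF pXC pXr t.pre_EV smooth_map_Pair[OF pXC t.pre_XU pC fs(1) this] t.smooth_\<Psi>]
      show "smooth_map (prod_mfd ?XU ?C) (tot E) (\<lambda>y. t.\<Psi> (fst y, csplit2 n (snd y)))"
        by (rule smooth_map_compose[OF pXC t.pre_EV pre_E _ smooth_map_open_submfd_incl[OF pre_E t.open_V]])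
    qed
    fix y assume "y \<in> points (prod_mfd ?XU ?C)"
    then have "fst y \<in> U" "csplit2 n (snd y) \<in> Cvec r" by (auto simp: csplit2_in)
    then show "?\<Psi> y \<in> W"
      using ccoord_inv_in[OF pre_G c] t.\<Psi>_in unfolding W_iff lie_gC_def by blast
  qed
  have inv1: "?\<Psi> (?\<Phi> p) = p" if p: "p \<in> points ?FW" for p
  proof -
    obtain \<alpha> e where e: "p = mk \<alpha> e" "\<alpha> \<in> lie_gC G" "e \<in> t.V" using p W_iff by auto
    then have eP: "e \<in> PE" by (simp add: t.V_def)
    have "csplit1 n (cjoin n (ccoord c \<alpha>) (snd (\<Phi> e))) = ccoord c \<alpha>"
      unfolding n_def by (rule csplit1_cjoin[OF ccoord_in[OF gC[OF e(2)] c]])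
    then show ?thesis
      using e eP ccoord_inv_ccoord[OF pre_G c gC[OF e(2)]] t.\<Psi>\<Phi>[OF e(3)] t.fst_\<Phi>[OF e(3), symmetric]
      by (simp add: csplit2_cjoin)
  qed
  have inv2: "?\<Phi> (?\<Psi> y) = y" if y: "y \<in> points (prod_mfd ?XU ?C)" for y
  proof -
    have y': "fst y \<in> U" "snd y \<in> Cvec (n + r)" "csplit2 n (snd y) \<in> Cvec r"
      using y by (auto simp: csplit2_in)
    have 1: "ccoord_inv GG \<one> c (csplit1 n (snd y)) \<in> lie_gC G"
      unfolding lie_gC_def by (rule ccoord_inv_in[OF pre_G c])
    have 2: "t.\<Psi> (fst y, csplit2 n (snd y)) \<in> PE" using t.\<Psi>_in[OF y'(1,3)] by (simp add: t.V_def)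
    have 3: "ccoord c (ccoord_inv GG \<one> c (csplit1 n (snd y))) = csplit1 n (snd y)"
      by (rule ccoord_ccoord_inv[OF pre_G c]) (simp add: n_def csplit1_in)
    show ?thesis
      using 1 2 3 t.proj_\<Psi>[OF y'(1,3)] t.\<Phi>\<Psi>[OF y'(1,3)] by (simp add: cjoin_csplit prod_eq_iff)
  qed
  have diff: "diffeomorphism ?FW (prod_mfd ?XU ?C) ?\<Phi>"
    by (rule diffeomorphismI[OF pFW pXC smooth1 smooth2 inv1 inv2])
  have fib: "fst (?\<Phi> e) = y \<and> (\<forall>a. snd (?\<Phi> (vscale FE a e)) = (\<lambda>i. a * snd (?\<Phi> e) i)) \<and>
      (\<forall>e'\<in>fibre FE y. snd (?\<Phi> (vadd FE e e')) = (\<lambda>i. snd (?\<Phi> e) i + snd (?\<Phi> e') i))"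
    if y: "y \<in> U" and e: "e \<in> fibre FE y" for y e
  proof -
    obtain \<alpha> u where u: "e = mk \<alpha> u" "\<alpha> \<in> lie_gC G" "u \<in> PE" "proj E u = y" "u \<in> t.V"
      using e y unfolding fibre_FE by (auto simp: fibre_def t.V_def)
    have "snd (?\<Phi> (vadd FE e e')) = (\<lambda>i. snd (?\<Phi> e) i + snd (?\<Phi> e') i)" if e': "e' \<in> fibre FE y" for e'
    proof -
      obtain \<beta> w where w: "e' = mk \<beta> w" "\<beta> \<in> lie_gC G" "w \<in> PE" "proj E w = y" "w \<in> t.V"
        using e' y unfolding fibre_FE by (auto simp: fibre_def t.V_def)
      show ?thesis using u w t.\<Phi>_add[OF u(5) w(5)] by (simp add: ccoord_add cjoin_def fun_eq_iff)
    qed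
    then show ?thesis
      using u t.\<Phi>_scale[OF u(5)] by (simp add: ccoord_scale cjoin_def fun_eq_iff)
  qed
  have "local_trivialization X FE U (n + r) ?\<Phi>"
    unfolding local_trivialization_def W_def[symmetric] using t.open_U diff fib by blast
  then show ?thesis using U(1) by blast
qed

lemma free_cvb: "complex_vector_bundle X FE"
  unfolding complex_vector_bundle_def
proof (intro conjI ballI allI impI)
  show "proj FE \<in> extensional (points (tot FE))" by (simp add: free_cbundle_def transport_mfd_def)
  show "vzero FE \<in> extensional (points X)" by (simp add: free_cbundle_def)
  show "vscale FE a e = undefined" if "e \<notin> points (tot FE)" for a e
    using that by (simp add: free_cbundle_def transport_mfd_def)
  fix e e' assume n: "\<not> (e \<in> points (tot FE) \<and> e' \<in> points (tot FE) \<and> proj FE e = proj FE e')"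
  show "vadd FE e e' = undefined"
  proof (cases "e \<in> FP \<and> e' \<in> FP")
    case True
    then obtain \<alpha> u \<beta> w where uw: "e = mk \<alpha> u" "\<alpha> \<in> lie_gC G" "u \<in> PE" "e' = mk \<beta> w" "\<beta> \<in> lie_gC G" "w \<in> PE"
      by (metis FP_iff)
    then have "proj E u \<noteq> proj E w" using n by simp
    then show ?thesis using uw by (simp add: free_cbundle_def plus_pt_def)
  qed (auto simp: free_cbundle_def)
qed (use smooth_manifold_FE smooth_proj_FE fibre_FE_vs free_trivialization in simp_all)

end

section \<open>Algebras and the comparison functor\<close>

lemma is_functor_comp:
  assumes "is_functor C D F" "is_functor D E S" shows "is_functor C E (func_comp S F)"
  using assms unfolding is_functor_def func_comp_def by simp

lemma algebras_category:
  assumes C: "is_category C" and T: "is_functor C C T"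
  shows "is_category (algebras C T \<eta> \<mu>)"
proof -
  let ?A = "algebras C T \<eta> \<mu>"
  have idH: "\<And>A. A \<in> Obj C \<Longrightarrow> Ident C A \<in> Hom C A A"
    and cmpH: "\<And>A B D f g. \<lbrakk>A \<in> Obj C; B \<in> Obj C; D \<in> Obj C; f \<in> Hom C A B; g \<in> Hom C B D\<rbrakk> \<Longrightarrow> Cmp C A B D g f \<in> Hom C A D"
    and idr: "\<And>A B f. \<lbrakk>A \<in> Obj C; B \<in> Obj C; f \<in> Hom C A B\<rbrakk> \<Longrightarrow> Cmp C A A B f (Ident C A) = f"
    and idl: "\<And>A B f. \<lbrakk>A \<in> Obj C; B \<in> Obj C; f \<in> Hom C A B\<rbrakk> \<Longrightarrow> Cmp C A B B (Ident C B) f = f"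
    and assoc: "\<And>A B D E f g h. \<lbrakk>A \<in> Obj C; B \<in> Obj C; D \<in> Obj C; E \<in> Obj C; f \<in> Hom C A B; g \<in> Hom C B D; h \<in> Hom C D E\<rbrakk>
      \<Longrightarrow> Cmp C A D E h (Cmp C A B D g f) = Cmp C A B E (Cmp C B D E h g) f"
    using C unfolding is_category_def by blast+
  have TO: "\<And>A. A \<in> Obj C \<Longrightarrow> fob T A \<in> Obj C"
    and TH: "\<And>A B f. \<lbrakk>A \<in> Obj C; B \<in> Obj C; f \<in> Hom C A B\<rbrakk> \<Longrightarrow> fmor T A B f \<in> Hom C (fob T A) (fob T B)"
    and TI: "\<And>A. A \<in> Obj C \<Longrightarrow> fmor T A A (Ident C A) = Ident C (fob T A)"
    and TC: "\<And>A B E f g. \<lbrakk>A \<in> Obj C; B \<in> Obj C; E \<in> Obj C; f \<in> Hom C A B; g \<in> Hom C B E\<rbrakk> \<Longrightarrow>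
        fmor T A E (Cmp C A B E g f) = Cmp C (fob T A) (fob T B) (fob T E) (fmor T B E g) (fmor T A B f)"
    using T unfolding is_functor_def by blast+
  have obj: "A \<in> Obj C \<and> h \<in> Hom C (fob T A) A" if "(A, h) \<in> Obj ?A" for A h
    using that by (simp add: algebras_def)
  have hom: "f \<in> Hom ?A (A, h) (B, k) \<longleftrightarrow> f \<in> Hom C A B \<and> Cmp C (fob T A) A B f h = Cmp C (fob T A) (fob T B) B k (fmor T A B f)"
    for A h B k f by (simp add: algebras_def)
  have simps: "Ident ?A (A, h) = Ident C A" "Cmp ?A (A, h) (B, k) (D, l) = Cmp C A B D" for A h B k D l
    by (simp_all add: algebras_def)
  show ?thesis
    unfolding is_category_def
  proof (intro conjI ballI)
    fix X assume X: "X \<in> Obj ?A"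
    obtain A h where [simp]: "X = (A, h)" by (cases X)
    have A: "A \<in> Obj C" "h \<in> Hom C (fob T A) A" using obj X by auto
    show "Ident ?A X \<in> Hom ?A X X"
      using A by (simp add: hom simps idH TI idr[OF TO] idl[OF TO])
    fix Y assume Y: "Y \<in> Obj ?A"
    obtain B k where [simp]: "Y = (B, k)" by (cases Y)
    have B: "B \<in> Obj C" "k \<in> Hom C (fob T B) B" using obj Y by auto
    show "Cmp ?A X X Y f (Ident ?A X) = f" "Cmp ?A X Y Y (Ident ?A Y) f = f" if "f \<in> Hom ?A X Y" for f
      using that A B by (simp_all add: hom simps idr idl)
    fix Z assume Z: "Z \<in> Obj ?A"
    obtain D l where [simp]: "Z = (D, l)" by (cases Z)
    have D: "D \<in> Obj C" "l \<in> Hom C (fob T D) D" using obj Z by auto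
    show "Cmp ?A X Y Z g f \<in> Hom ?A X Z" if f: "f \<in> Hom ?A X Y" and g: "g \<in> Hom ?A Y Z" for f g
    proof -
      have f': "f \<in> Hom C A B" "Cmp C (fob T A) A B f h = Cmp C (fob T A) (fob T B) B k (fmor T A B f)"
        and g': "g \<in> Hom C B D" "Cmp C (fob T B) B D g k = Cmp C (fob T B) (fob T D) D l (fmor T B D g)"
        using f g by (simp_all add: hom)
      have "Cmp C (fob T A) A D (Cmp C A B D g f) h = Cmp C (fob T A) B D g (Cmp C (fob T A) A B f h)"
        by (rule assoc[symmetric]) (use A B D f' g' TO in auto)
      also have "\<dots> = Cmp C (fob T A) B D g (Cmp C (fob T A) (fob T B) B k (fmor T A B f))" by (simp only: f'(2))
      also have "\<dots> = Cmp C (fob T A) (fob T B) D (Cmp C (fob T B) B D g k) (fmor T A B f)"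
        by (rule assoc) (use A B D f' g' TO TH in auto)
      also have "\<dots> = Cmp C (fob T A) (fob T B) D (Cmp C (fob T B) (fob T D) D l (fmor T B D g)) (fmor T A B f)" by (simp only: g'(2))
      also have "\<dots> = Cmp C (fob T A) (fob T D) D l (Cmp C (fob T A) (fob T B) (fob T D) (fmor T B D g) (fmor T A B f))"
        by (rule assoc[symmetric]) (use A B D f' g' TO TH in auto)
      also have "\<dots> = Cmp C (fob T A) (fob T D) D l (fmor T A D (Cmp C A B D g f))"
        using TC[OF A(1) B(1) D(1) f'(1) g'(1)] by simp
      finally show ?thesis using cmpH[OF A(1) B(1) D(1) f'(1) g'(1)] by (simp add: hom simps)
    qed
    fix W assume W: "W \<in> Obj ?A"
    obtain E m where [simp]: "W = (E, m)" by (cases W)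
    show "Cmp ?A X Z W h' (Cmp ?A X Y Z g f) = Cmp ?A X Y W (Cmp ?A Y Z W h' g) f"
      if "f \<in> Hom ?A X Y" "g \<in> Hom ?A Y Z" "h' \<in> Hom ?A Z W" for f g h'
      using that A B D obj W by (simp add: hom simps assoc)
  qed
qed

text \<open>Everything comes from naturality of \<epsilon> carried through U: at \<epsilon> B itself
  it is the associativity law of the algebra, at f it says that U f is an algebra map. The unit law
  is a triangle identity.\<close>

lemma comparison_functor:
  assumes adj: "adjunction C D F U \<eta> \<epsilon>"
  shows "is_functor D (algebras C (func_comp U F) \<eta> (\<lambda>A. fmor U (fob F (fob U (fob F A))) (fob F A) (\<epsilon> (fob F A))))
    (comparison F U \<epsilon>)"
proof -
  have F: "is_functor C D F" and U: "is_functor D C U"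
    and neps: "natural_transformation D D (func_comp F U) func_id \<epsilon>"
    and tri: "\<And>B. B \<in> Obj D \<Longrightarrow> Cmp C (fob U B) (fob U (fob F (fob U B))) (fob U B)
          (fmor U (fob F (fob U B)) B (\<epsilon> B)) (\<eta> (fob U B)) = Ident C (fob U B)"
    using adj unfolding adjunction_def by blast+
  have C: "is_category C" and D: "is_category D" using F by (auto simp: is_functor_def)
  have eps: "\<And>B. B \<in> Obj D \<Longrightarrow> \<epsilon> B \<in> Hom D (fob F (fob U B)) B"
    and nat: "\<And>A B f. \<lbrakk>A \<in> Obj D; B \<in> Obj D; f \<in> Hom D A B\<rbrakk> \<Longrightarrow>
        Cmp D (fob F (fob U A)) (fob F (fob U B)) B (\<epsilon> B) (fmor F (fob U A) (fob U B) (fmor U A B f)) =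
        Cmp D (fob F (fob U A)) A B f (\<epsilon> A)"
    using neps unfolding natural_transformation_def func_comp_def func_id_def by simp_all
  have FO: "\<And>A. A \<in> Obj C \<Longrightarrow> fob F A \<in> Obj D"
    and FH: "\<And>A B f. \<lbrakk>A \<in> Obj C; B \<in> Obj C; f \<in> Hom C A B\<rbrakk> \<Longrightarrow> fmor F A B f \<in> Hom D (fob F A) (fob F B)"
    using F unfolding is_functor_def by blast+
  have UO: "\<And>A. A \<in> Obj D \<Longrightarrow> fob U A \<in> Obj C"
    and UH: "\<And>A B f. \<lbrakk>A \<in> Obj D; B \<in> Obj D; f \<in> Hom D A B\<rbrakk> \<Longrightarrow> fmor U A B f \<in> Hom C (fob U A) (fob U B)"
    and UI: "\<And>A. A \<in> Obj D \<Longrightarrow> fmor U A A (Ident D A) = Ident C (fob U A)"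
    and UC: "\<And>A B E f g. \<lbrakk>A \<in> Obj D; B \<in> Obj D; E \<in> Obj D; f \<in> Hom D A B; g \<in> Hom D B E\<rbrakk> \<Longrightarrow>
        fmor U A E (Cmp D A B E g f) = Cmp C (fob U A) (fob U B) (fob U E) (fmor U B E g) (fmor U A B f)"
    using U unfolding is_functor_def by blast+
  have algC: "is_category (algebras C (func_comp U F) \<eta> (\<lambda>A. fmor U (fob F (fob U (fob F A))) (fob F A) (\<epsilon> (fob F A))))"
    by (rule algebras_category[OF C is_functor_comp[OF F U]])
  have unat: "Cmp C (fob U (fob F (fob U A))) (fob U (fob F (fob U B))) (fob U B) (fmor U (fob F (fob U B)) B (\<epsilon> B))
        (fmor U (fob F (fob U A)) (fob F (fob U B)) (fmor F (fob U A) (fob U B) (fmor U A B f)))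
      = Cmp C (fob U (fob F (fob U A))) (fob U A) (fob U B) (fmor U A B f) (fmor U (fob F (fob U A)) A (\<epsilon> A))"
    if "A \<in> Obj D" "B \<in> Obj D" "f \<in> Hom D A B" for A B f
    using arg_cong[OF nat[OF that], of "fmor U (fob F (fob U A)) B"] that
    by (simp add: UC[of "fob F (fob U A)"] FO UO UH FH eps)
  show ?thesis
    unfolding is_functor_def
  proof (intro conjI ballI algC D)
    fix B assume B: "B \<in> Obj D"
    have "Cmp C (fob U (fob F (fob U (fob F (fob U B))))) (fob U (fob F (fob U B))) (fob U B) (fmor U (fob F (fob U B)) B (\<epsilon> B))
        (fmor U (fob F (fob U (fob F (fob U B)))) (fob F (fob U B)) (fmor F (fob U (fob F (fob U B))) (fob U B) (fmor U (fob F (fob U B)) B (\<epsilon> B))))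
      = Cmp C (fob U (fob F (fob U (fob F (fob U B))))) (fob U (fob F (fob U B))) (fob U B) (fmor U (fob F (fob U B)) B (\<epsilon> B))
        (fmor U (fob F (fob U (fob F (fob U B)))) (fob F (fob U B)) (\<epsilon> (fob F (fob U B))))"
      by (rule unat) (use B FO UO eps in auto)
    then show "fob (comparison F U \<epsilon>) B \<in> Obj (algebras C (func_comp U F) \<eta> (\<lambda>A. fmor U (fob F (fob U (fob F A))) (fob F A) (\<epsilon> (fob F A))))"
      using B UO UH FO eps tri by (simp add: comparison_def algebras_def func_comp_def)
  next
    fix A B f assume "A \<in> Obj D" "B \<in> Obj D" "f \<in> Hom D A B"
    then show "fmor (comparison F U \<epsilon>) A B f \<in> Hom (algebras C (func_comp U F) \<eta> (\<lambda>A. fmor U (fob F (fob U (fob F A))) (fob F A) (\<epsilon> (fob F A))))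
        (fob (comparison F U \<epsilon>) A) (fob (comparison F U \<epsilon>) B)"
      using unat UH by (simp add: comparison_def algebras_def func_comp_def)
  qed (simp_all add: comparison_def algebras_def UI UC)
qed

section \<open>The categories of equivariant bundles and of affine actions\<close>

lemma equivariant_morphisms_iff:
  "\<psi> \<in> equivariant_morphisms H (E, a) (E', a') \<longleftrightarrow>
     \<psi> \<in> extensional (points (tot E)) \<and> cbundle_morphism E E' id \<psi> \<and>
     (\<forall>g\<in>carrier H. \<forall>e\<in>points (tot E). \<psi> (a (g, e)) = a' (g, \<psi> e))"
  by (simp add: equivariant_morphisms_def)

lemma cbundle_morphismD:
  assumes "cbundle_morphism E E' f \<psi>"
  shows "smooth_map (tot E) (tot E') \<psi>" "\<And>e. e \<in> points (tot E) \<Longrightarrow> proj E' (\<psi> e) = f (proj E e)"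
    "\<And>e e'. e \<in> points (tot E) \<Longrightarrow> e' \<in> points (tot E) \<Longrightarrow> proj E e = proj E e' \<Longrightarrow>
      \<psi> (vadd E e e') = vadd E' (\<psi> e) (\<psi> e')"
    "\<And>a e. e \<in> points (tot E) \<Longrightarrow> \<psi> (vscale E a e) = vscale E' a (\<psi> e)"
    "\<And>e. e \<in> points (tot E) \<Longrightarrow> \<psi> e \<in> points (tot E')"
  using assms unfolding cbundle_morphism_def by (auto simp: smooth_map_def)

lemma cbundle_morphismI:
  assumes "smooth_map (tot E) (tot E') \<psi>" "\<And>e. e \<in> points (tot E) \<Longrightarrow> proj E' (\<psi> e) = f (proj E e)"
    "\<And>e e'. e \<in> points (tot E) \<Longrightarrow> e' \<in> points (tot E) \<Longrightarrow> proj E e = proj E e' \<Longrightarrow>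
      \<psi> (vadd E e e') = vadd E' (\<psi> e) (\<psi> e')"
    "\<And>a e. e \<in> points (tot E) \<Longrightarrow> \<psi> (vscale E a e) = vscale E' a (\<psi> e)"
  shows "cbundle_morphism E E' f \<psi>"
  using assms unfolding cbundle_morphism_def by simp

text \<open>Allows a morphism to be replaced by its restriction to the total space, as membership in
  the hom-sets demands.\<close>

lemma cbundle_morphism_cong:
  assumes E: "cvb X E" and E': "cvb X E'" and m: "cbundle_morphism E E' f \<psi>"
    and eq: "\<And>e. e \<in> points (tot E) \<Longrightarrow> \<psi> e = \<phi> e"
  shows "cbundle_morphism E E' f \<phi>"
proof (rule cbundle_morphismI)
  interpret E: cvb X E by (rule E)
  interpret E': cvb X E' by (rule E')
  note D = cbundle_morphismD[OF m]
  show "smooth_map (tot E) (tot E') \<phi>" by (rule smooth_map_cong[OF D(1) E.pre_E E'.pre_E eq])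
  show "proj E' (\<phi> e) = f (proj E e)" if "e \<in> points (tot E)" for e using D(2) eq that by metis
  show "\<phi> (vadd E e e') = vadd E' (\<phi> e) (\<phi> e')"
    if "e \<in> points (tot E)" "e' \<in> points (tot E)" "proj E e = proj E e'" for e e'
    using D(3)[OF that] eq that E.vadd_in(1)[OF that] by metis
  show "\<phi> (vscale E a e) = vscale E' a (\<phi> e)" if "e \<in> points (tot E)" for a e
    using D(4)[OF that] eq that E.vscale_in(1)[OF that] by metis
qed

lemma cbundle_morphism_compose:
  assumes E: "cvb X E" and E': "cvb X E'" and E'': "cvb X E''"
    and m: "cbundle_morphism E E' id \<psi>" and n: "cbundle_morphism E' E'' id \<phi>"
  shows "cbundle_morphism E E'' id (\<lambda>e. \<phi> (\<psi> e))"
proof (rule cbundle_morphismI)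
  interpret E: cvb X E by (rule E)
  interpret E': cvb X E' by (rule E')
  interpret E'': cvb X E'' by (rule E'')
  note D = cbundle_morphismD[OF m] and D' = cbundle_morphismD[OF n]
  show "smooth_map (tot E) (tot E'') (\<lambda>e. \<phi> (\<psi> e))"
    by (rule smooth_map_compose[OF E.pre_E E'.pre_E E''.pre_E D(1) D'(1)])
qed (use cbundle_morphismD[OF m] cbundle_morphismD[OF n] in simp_all)

lemma cbundle_morphism_id:
  assumes E: "cvb X E" shows "cbundle_morphism E E id (\<lambda>e. e)"
proof (rule cbundle_morphismI)
  interpret E: cvb X E by (rule E)
  show "smooth_map (tot E) (tot E) (\<lambda>e. e)" by (rule smooth_map_id[OF E.pre_E])
qed simp_all

text \<open>Serves both categories at once, with H equal to G for equivariant bundles and to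
  \<open>TC G\<close> for affine actions.\<close>

lemma bundle_category:
  assumes X: "pre_mfd X"
    and Ob: "\<And>E a. (E, a) \<in> Ob \<Longrightarrow> complex_vector_bundle X E \<and> a \<in> carrier H \<times> points (tot E) \<rightarrow> points (tot E)"
  shows "is_category \<lparr>Obj = Ob, Hom = equivariant_morphisms H, Ident = (\<lambda>(E, _). restrict id (points (tot E))),
    Cmp = (\<lambda>(E, _) _ _ g f. compose (points (tot E)) g f)\<rparr>"
    (is "is_category ?C")
proof -
  have cv: "cvb X E" if "(E, a) \<in> Ob" for E a using Ob[OF that] X by unfold_locales auto
  have act: "a (g, e) \<in> points (tot E)" if "(E, a) \<in> Ob" "g \<in> carrier H" "e \<in> points (tot E)" for E a g e
    using Ob[OF that(1)] that by auto
  \<comment> \<open>Composition with the restricted identity changes nothing because morphisms are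
    undefined off the total space; this makes the unit law an equality of functions.\<close>
  have ext: "compose (points (tot E)) f (restrict id (points (tot E))) = f"
    if "f \<in> extensional (points (tot E))" for f :: "'b \<Rightarrow> 'b" and E :: "('a, 'b) cbundle"
    using that by (auto simp: compose_def extensional_def fun_eq_iff)
  show ?thesis
    unfolding is_category_def
  proof (intro conjI ballI)
    fix A assume A: "A \<in> Obj ?C"
    obtain E a where [simp]: "A = (E, a)" by (cases A)
    have A': "(E, a) \<in> Ob" using A by simp
    show "Ident ?C A \<in> Hom ?C A A"
      using cbundle_morphism_cong[OF cv[OF A'] cv[OF A'] cbundle_morphism_id[OF cv[OF A']], of "restrict id (points (tot E))"]
        act[OF A'] by (simp add: equivariant_morphisms_iff)
    fix B assume B: "B \<in> Obj ?C"
    obtain E' a' where [simp]: "B = (E', a')" by (cases B)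
    have B': "(E', a') \<in> Ob" using B by simp
    show "Cmp ?C A A B f (Ident ?C A) = f" if "f \<in> Hom ?C A B" for f
      using that ext by (simp add: equivariant_morphisms_iff)
    show "Cmp ?C A B B (Ident ?C B) f = f" if "f \<in> Hom ?C A B" for f
      using that cbundle_morphismD(5)[of E E' id f]
      by (auto simp: equivariant_morphisms_iff compose_def extensional_def fun_eq_iff)
    fix D assume D: "D \<in> Obj ?C"
    obtain E'' a'' where [simp]: "D = (E'', a'')" by (cases D)
    have D': "(E'', a'') \<in> Ob" using D by simp
    show "Cmp ?C A B D g f \<in> Hom ?C A D" if f: "f \<in> Hom ?C A B" and g: "g \<in> Hom ?C B D" for f g
    proof -
      have f': "cbundle_morphism E E' id f" "\<And>h e. h \<in> carrier H \<Longrightarrow> e \<in> points (tot E) \<Longrightarrow> f (a (h, e)) = a' (h, f e)"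
        and g': "cbundle_morphism E' E'' id g" "\<And>h e. h \<in> carrier H \<Longrightarrow> e \<in> points (tot E') \<Longrightarrow> g (a' (h, e)) = a'' (h, g e)"
        using f g by (simp_all add: equivariant_morphisms_iff)
      have "cbundle_morphism E E'' id (compose (points (tot E)) g f)"
        by (rule cbundle_morphism_cong[OF cv[OF A'] cv[OF D'] cbundle_morphism_compose[OF cv[OF A'] cv[OF B'] cv[OF D'] f'(1) g'(1)]])
          (simp add: compose_def)
      then show ?thesis
        using f'(2) g'(2) act[OF A'] cbundle_morphismD(5)[OF f'(1)] by (simp add: equivariant_morphisms_iff compose_def)
    qed
    fix F assume "F \<in> Obj ?C"
    show "Cmp ?C A D F h (Cmp ?C A B D g f) = Cmp ?C A B F (Cmp ?C B D F h g) f"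
      if "f \<in> Hom ?C A B" for f g h
      using that cbundle_morphismD(5)[of E E' id f]
      by (auto simp: equivariant_morphisms_iff compose_def fun_eq_iff)
  qed
qed

section \<open>Equivariant bundles with their free and their trivial affine action\<close>

locale g_manifold = lie_grp G for G :: "'g lie_group" (structure) +
  fixes X :: "'x smooth_mfd" and t :: "'g \<times> 'x \<Rightarrow> 'x"
  assumes X: "G_manifold G X t"
begin

lemma pre_X: "pre_mfd X"
  using X by (simp add: G_manifold_def smooth_manifold_pre)

lemma free_bundleI: "complex_vector_bundle X E \<Longrightarrow> free_bundle G X E"
  using pre_X by unfold_locales

end

locale G_bdl = g_manifold G X t + free_bundle G X E
  for G :: "'g lie_group" (structure) and X :: "'x smooth_mfd" and t and E :: "('x, ('x, 'g, 'a) pt) cbundle" +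
  fixes \<rho>
  assumes rho: "is_G_bundle G X t E \<rho>"
begin

lemma act_in: "g \<in> carrier G \<Longrightarrow> e \<in> PE \<Longrightarrow> \<rho> (g, e) \<in> PE"
  and act_one: "e \<in> PE \<Longrightarrow> \<rho> (\<one>, e) = e"
  and act_mult: "g \<in> carrier G \<Longrightarrow> h \<in> carrier G \<Longrightarrow> e \<in> PE \<Longrightarrow> \<rho> (g \<otimes> h, e) = \<rho> (g, \<rho> (h, e))"
  and act_proj: "g \<in> carrier G \<Longrightarrow> e \<in> PE \<Longrightarrow> proj E (\<rho> (g, e)) = t (g, proj E e)"
  and act_add: "g \<in> carrier G \<Longrightarrow> e \<in> PE \<Longrightarrow> e' \<in> PE \<Longrightarrow> proj E e = proj E e' \<Longrightarrow>
        \<rho> (g, vadd E e e') = vadd E (\<rho> (g, e)) (\<rho> (g, e'))"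
  and act_scale: "g \<in> carrier G \<Longrightarrow> e \<in> PE \<Longrightarrow> \<rho> (g, vscale E a e) = vscale E a (\<rho> (g, e))"
  and act_smooth: "smooth_map (prod_mfd GG (tot E)) (tot E) \<rho>"
  and act_ext: "\<rho> \<in> extensional (carrier G \<times> PE)"
  using rho unfolding is_G_bundle_def left_action_def by (simp_all add: Pi_iff)

lemma smooth_act:
  assumes Q: "pre_mfd Q" and a: "smooth_map Q GG a" and b: "smooth_map Q (tot E) b"
  shows "smooth_map Q (tot E) (\<lambda>y. \<rho> (a y, b y))"
  by (rule smooth_map_compose[OF Q prod_mfd_generated(1)[OF pre_G pre_E] pre_E smooth_map_Pair[OF Q pre_G pre_E a b] act_smooth])

definition FA :: "('g \<times> 'g ctvec) \<times> ('x, 'g, 'a) pt \<Rightarrow> ('x, 'g, 'a) pt" where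
  "FA = restrict (\<lambda>((g, v), p). case p of
             Plus (x, \<alpha>) e \<Rightarrow> Plus (t (g, x), ct_add (Ad G g \<alpha>) (right_transport G (g, v))) (\<rho> (g, e))
           | Pt _ \<Rightarrow> undefined) (carrier (TC G) \<times> FP)"

text \<open>The base point \<open>t (g, x)\<close> written into the result agrees with the
  projection of \<open>\<rho> (g, e)\<close>, so the result is again a consistent free
  point.\<close>

lemma FA_mk:
  assumes "(g, v) \<in> carrier (TC G)" "\<alpha> \<in> lie_gC G" "e \<in> PE"
  shows "FA ((g, v), mk \<alpha> e) = mk (ct_add (Ad G g \<alpha>) (right_transport G (g, v))) (\<rho> (g, e))"
proof -
  have "g \<in> carrier G" using assms(1) by (simp add: carrier_TC)
  then show ?thesis
    using assms mk_in[of \<alpha> e] act_proj[of g e] by (simp add: FA_def plus_pt_def)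
qed

lemma FA_in:
  assumes "(g, v) \<in> carrier (TC G)" "\<alpha> \<in> lie_gC G"
  shows "ct_add (Ad G g \<alpha>) (right_transport G (g, v)) \<in> lie_gC G"
  using assms Ad_in right_transport_in gC_add by (simp add: carrier_TC)

text \<open>Compatibility with products combines the semidirect rule
  \<open>right_transport_mult\<close> with multiplicativity of \<open>Ad\<close>.\<close>

lemma left_action_FA: "left_action (TC G) FP FA"
  unfolding left_action_def
proof (intro conjI ballI)
  show "FA \<in> carrier (TC G) \<times> FP \<rightarrow> FP"
  proof
    fix w assume w: "w \<in> carrier (TC G) \<times> FP"
    obtain g v p where e: "w = ((g, v), p)" by (cases w) auto
    obtain \<alpha> e where p: "p = mk \<alpha> e" "\<alpha> \<in> lie_gC G" "e \<in> PE" using w e by (auto elim: FP_E)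
    show "FA w \<in> FP" using w e p FA_in act_in by (auto simp: FA_mk carrier_TC)
  qed
  fix p assume "p \<in> FP"
  then obtain \<alpha> e where p: "p = mk \<alpha> e" "\<alpha> \<in> lie_gC G" "e \<in> PE" by (rule FP_E)
  show "FA (\<one>\<^bsub>TC G\<^esub>, p) = p"
    using p one_TC_in by (simp add: one_TC FA_mk Ad_one right_transport_zero act_one)
  fix x y assume xy: "x \<in> carrier (TC G)" "y \<in> carrier (TC G)"
  obtain g v h w where e: "x = (g, v)" "y = (h, w)" by (cases x, cases y) blast
  have in': "g \<in> carrier G" "h \<in> carrier G" "v \<in> TT g" "w \<in> TT h" using xy e by (auto simp: carrier_TC)
  obtain u where u: "(g, v) \<otimes>\<^bsub>TC G\<^esub> (h, w) = (g \<otimes> h, u)" by (simp add: mult_TC)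
  have ghu: "(g \<otimes> h, u) \<in> carrier (TC G)" using TC_closed[OF xy] e u by simp
  have rt: "right_transport G (g \<otimes> h, u) = ct_add (Ad G g (right_transport G (h, w))) (right_transport G (g, v))"
    using right_transport_mult[OF in'] u by simp
  show "FA (x \<otimes>\<^bsub>TC G\<^esub> y, p) = FA (x, FA (y, p))"
    using p in' xy[unfolded e] ghu FA_in act_in
    by (simp add: e u FA_mk rt Ad_mult Ad_add act_mult ct_add_assoc)
qed

lemma smooth_FA: "smooth_map (prod_mfd TG (tot FE)) (tot FE) FA"
proof -
  let ?Q = "prod_mfd TG (tot FE)"
  have Q: "pre_mfd ?Q" by (rule prod_mfd_generated(1)[OF pre_TG pre_FE])
  note f = smooth_map_fst[OF pre_TG pre_FE] and s = smooth_map_snd[OF pre_TG pre_FE]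
  note g = smooth_map_compose[OF Q pre_TG pre_G f smooth_fst_TG]
  note pa = smooth_map_compose[OF Q pre_FE pre_LG s smooth_pal]
  note pe = smooth_map_compose[OF Q pre_FE pre_E s smooth_pel]
  note rt = smooth_map_compose[OF Q pre_TG pre_LG f smooth_right_transport]
  have "smooth_map ?Q (tot FE) (\<lambda>w. mk (ct_add (Ad G (fst (fst w)) (pal (snd w))) (right_transport G (fst w)))
      (\<rho> (fst (fst w), pel (snd w))))"
    by (rule smooth_mk[OF Q smooth_gC_add[OF Q smooth_Ad[OF Q g pa] rt] smooth_act[OF Q g pe]])
  then show ?thesis
  proof (rule smooth_map_cong[OF _ Q pre_FE])
    fix w assume w: "w \<in> points ?Q"
    obtain g v p where e: "w = ((g, v), p)" by (cases w) auto
    obtain \<alpha> u where p: "p = mk \<alpha> u" "\<alpha> \<in> lie_gC G" "u \<in> PE" using w e by (auto elim: FP_E)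
    have "(g, v) \<in> carrier (TC G)" using w e by (simp add: carrier_TC)
    then show "mk (ct_add (Ad G (fst (fst w)) (pal (snd w))) (right_transport G (fst w))) (\<rho> (fst (fst w), pel (snd w))) = FA w"
      using p e by (simp add: FA_mk)
  qed
qed

lemma affine_FA: "is_affine_action G X t FE FA"
  unfolding is_affine_action_def
proof (intro conjI)
  show "complex_vector_bundle X FE" by (rule free_cvb)
  show "FA \<in> extensional (carrier (TC G) \<times> points (tot FE))" by (simp add: FA_def)
  show "left_action (TC G) (points (tot FE)) FA" using left_action_FA by simp
  let ?P = "prod_cbundle (ctangent_cbundle GG) FE"
  have pts: "points (tot ?P) = carrier (TC G) \<times> FP"
    by (simp add: prod_cbundle_def ctangent_cbundle_def carrier_TC)
  show "cbundle_morphism ?P FE t FA"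
  proof (rule cbundle_morphismI)
    show "smooth_map (tot ?P) (tot FE) FA" using smooth_FA by (simp add: prod_cbundle_def ctangent_cbundle_def)
    fix w assume w: "w \<in> points (tot ?P)"
    obtain g v p where e: "w = ((g, v), p)" by (cases w) auto
    obtain \<alpha> u where p: "p = mk \<alpha> u" "\<alpha> \<in> lie_gC G" "u \<in> PE" using w e pts by (auto elim: FP_E)
    have gv: "(g, v) \<in> carrier (TC G)" using w e pts by simp
    then have g: "g \<in> carrier G" by (simp add: carrier_TC)
    have v: "v \<in> TT g" using gv by (simp add: carrier_TC)
    show "proj FE (FA w) = t (proj ?P w)"
      using gv g p act_in act_proj FA_in by (simp add: e FA_mk prod_cbundle_def ctangent_cbundle_def)
    show "FA (vscale ?P a w) = vscale FE a (FA w)" for a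
    proof -
      have "(g, ct_scale a v) \<in> carrier (TC G)" using g v by (simp add: carrier_TC ct_scale_in)
      then show ?thesis
        using gv g p act_in FA_in vscale_in act_scale
        by (simp add: e FA_mk prod_cbundle_def ctangent_cbundle_def gC_scale Ad_scale right_transport_scale ct_scale_add)
    qed
    fix w' assume w': "w' \<in> points (tot ?P)" and pr: "proj ?P w = proj ?P w'"
    obtain g' v' p' where e': "w' = ((g', v'), p')" by (cases w') auto
    obtain \<beta> u' where p': "p' = mk \<beta> u'" "\<beta> \<in> lie_gC G" "u' \<in> PE" using w' e' pts by (auto elim: FP_E)
    have eq: "g' = g" "proj E u = proj E u'" using pr e e' p p' by (simp_all add: prod_cbundle_def ctangent_cbundle_def)
    have gv': "(g, v') \<in> carrier (TC G)" using w' e' pts eq by simp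
    then have gvv: "(g, ct_add v v') \<in> carrier (TC G)" using g v by (simp add: carrier_TC ct_add_in)
    \<comment> \<open>Addition in the product bundle adds the group vectors v, v' along with the
      fibre vectors, so the translation term is additive too and the four terms only have to be
      regrouped.\<close>
    have "ct_add (Ad G g (ct_add \<alpha> \<beta>)) (right_transport G (g, ct_add v v')) =
      ct_add (ct_add (Ad G g \<alpha>) (right_transport G (g, v))) (ct_add (Ad G g \<beta>) (right_transport G (g, v')))"
      by (simp add: Ad_add right_transport_add ct_add_assoc ct_add_commute ct_add_left_commute)
    then show "FA (vadd ?P w w') = vadd FE (FA w) (FA w')"
      using gv gv' gvv g p p' eq act_in FA_in vadd_in act_proj act_add
      by (simp add: e e' FA_mk prod_cbundle_def ctangent_cbundle_def gC_add)
  qed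
qed

definition SA :: "('g \<times> 'g ctvec) \<times> ('x, 'g, 'a) pt \<Rightarrow> ('x, 'g, 'a) pt" where
  "SA = restrict (\<lambda>((g, v), e). \<rho> (g, e)) (carrier (TC G) \<times> PE)"

lemma SA_apply: "(g, v) \<in> carrier (TC G) \<Longrightarrow> e \<in> PE \<Longrightarrow> SA ((g, v), e) = \<rho> (g, e)"
  by (simp add: SA_def)

lemma affine_SA: "is_affine_action G X t E SA"
  unfolding is_affine_action_def
proof (intro conjI)
  show "complex_vector_bundle X E" by (rule E)
  show "SA \<in> extensional (carrier (TC G) \<times> PE)" by (simp add: SA_def)
  show "left_action (TC G) PE SA"
    unfolding left_action_def
  proof (intro conjI ballI)
    show "SA \<in> carrier (TC G) \<times> PE \<rightarrow> PE" using act_in by (auto simp: SA_apply carrier_TC)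
    fix e assume e: "e \<in> PE"
    show "SA (\<one>\<^bsub>TC G\<^esub>, e) = e" using e one_TC_in by (simp add: one_TC SA_apply act_one)
    fix x y assume xy: "x \<in> carrier (TC G)" "y \<in> carrier (TC G)"
    obtain g v h w where xy': "x = (g, v)" "y = (h, w)" by (cases x, cases y) blast
    obtain u where u: "(g, v) \<otimes>\<^bsub>TC G\<^esub> (h, w) = (g \<otimes> h, u)" by (simp add: mult_TC)
    have "(g \<otimes> h, u) \<in> carrier (TC G)" using TC_closed[OF xy] xy' u by simp
    then show "SA (x \<otimes>\<^bsub>TC G\<^esub> y, e) = SA (x, SA (y, e))"
      using xy xy' u e act_in by (simp add: SA_apply act_mult carrier_TC)
  qed
  let ?P = "prod_cbundle (ctangent_cbundle GG) E"
  have pts: "points (tot ?P) = carrier (TC G) \<times> PE"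
    by (simp add: prod_cbundle_def ctangent_cbundle_def carrier_TC)
  show "cbundle_morphism ?P E t SA"
  proof (rule cbundle_morphismI)
    let ?Q = "prod_mfd TG (tot E)"
    have Q: "pre_mfd ?Q" by (rule prod_mfd_generated(1)[OF pre_TG pre_E])
    have "smooth_map ?Q (tot E) (\<lambda>w. \<rho> (fst (fst w), snd w))"
      by (rule smooth_act[OF Q smooth_map_compose[OF Q pre_TG pre_G smooth_map_fst[OF pre_TG pre_E] smooth_fst_TG]
            smooth_map_snd[OF pre_TG pre_E]])
    then have "smooth_map ?Q (tot E) SA"
      by (rule smooth_map_cong[OF _ Q pre_E]) (auto simp: SA_apply carrier_TC)
    then show "smooth_map (tot ?P) (tot E) SA" by (simp add: prod_cbundle_def ctangent_cbundle_def)
    fix w assume w: "w \<in> points (tot ?P)"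
    obtain g v u where e: "w = ((g, v), u)" by (cases w) auto
    have gv: "(g, v) \<in> carrier (TC G)" "u \<in> PE" using w e pts by simp_all
    then have g: "g \<in> carrier G" and v: "v \<in> TT g" by (simp_all add: carrier_TC)
    show "proj E (SA w) = t (proj ?P w)"
      using gv g by (simp add: e SA_apply act_proj prod_cbundle_def ctangent_cbundle_def)
    have "(g, ct_scale a v) \<in> carrier (TC G)" for a using g v by (simp add: carrier_TC ct_scale_in)
    then show "SA (vscale ?P a w) = vscale E a (SA w)" for a
      using gv g vscale_in by (simp add: e SA_apply act_scale prod_cbundle_def ctangent_cbundle_def)
    fix w' assume w': "w' \<in> points (tot ?P)" and pr: "proj ?P w = proj ?P w'"
    obtain g' v' u' where e': "w' = ((g', v'), u')" by (cases w') auto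
    have eq: "g' = g" "proj E u = proj E u'" using pr e e' by (simp_all add: prod_cbundle_def ctangent_cbundle_def)
    have gv': "(g, v') \<in> carrier (TC G)" "u' \<in> PE" using w' e' pts eq by simp_all
    then have "(g, ct_add v v') \<in> carrier (TC G)" using g v by (simp add: carrier_TC ct_add_in)
    then show "SA (vadd ?P w w') = vadd E (SA w) (SA w')"
      using gv gv' g eq vadd_in by (simp add: e e' SA_apply act_add prod_cbundle_def ctangent_cbundle_def)
  qed
qed

text \<open>The test morphism for uniqueness of the section. Taking zero as scaling by 0 lets
  smoothness and linearity come from \<open>vscale\<close>.\<close>

lemma zero_morphism: "restrict (vscale E 0) PE \<in> equivariant_morphisms G (E, \<rho>) (E, \<rho>)"
  unfolding equivariant_morphisms_iff
proof (intro conjI ballI)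
  show "cbundle_morphism E E id (restrict (vscale E 0) PE)"
  proof (rule cbundle_morphism_cong[OF cvb_axioms cvb_axioms])
    show "cbundle_morphism E E id (vscale E 0)"
    proof (rule cbundle_morphismI)
      show "vscale E 0 (vadd E e e') = vadd E (vscale E 0 e) (vscale E 0 e')"
        if "e \<in> PE" "e' \<in> PE" "proj E e = proj E e'" for e e'
        using complex_vector_spaceD(8)[OF vs[OF proj_in[OF that(1)]] in_fibre[OF that(1)], of e'] that in_fibre[of e'] by simp
      show "vscale E 0 (vscale E a e) = vscale E a (vscale E 0 e)" if "e \<in> PE" for a e
        using complex_vector_spaceD(10)[OF vs[OF proj_in[OF that]] in_fibre[OF that], of 0 a]
          complex_vector_spaceD(10)[OF vs[OF proj_in[OF that]] in_fibre[OF that], of a 0] by simp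
    qed (simp_all add: smooth_vscale vscale_in)
  qed simp
qed (simp_all add: act_in act_scale vscale_in)

end

section \<open>Affine actions, their underlying equivariant bundle and the counit\<close>

locale affine_bdl = g_manifold G X t + free_bundle G X E
  for G :: "'g lie_group" (structure) and X :: "'x smooth_mfd" and t and E :: "('x, ('x, 'g, 'a) pt) cbundle" +
  fixes A
  assumes aff: "is_affine_action G X t E A"
begin

lemma aff_left: "left_action (TC G) PE A"
  and aff_mor: "cbundle_morphism (prod_cbundle (ctangent_cbundle GG) E) E t A"
  and aff_ext: "A \<in> extensional (carrier (TC G) \<times> PE)"
  using aff by (simp_all add: is_affine_action_def)

lemma aff_in: "w \<in> carrier (TC G) \<Longrightarrow> e \<in> PE \<Longrightarrow> A (w, e) \<in> PE"
  and aff_one: "e \<in> PE \<Longrightarrow> A ((\<one>, ct_zero), e) = e"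
  and aff_mult: "w \<in> carrier (TC G) \<Longrightarrow> w' \<in> carrier (TC G) \<Longrightarrow> e \<in> PE \<Longrightarrow> A (w \<otimes>\<^bsub>TC G\<^esub> w', e) = A (w, A (w', e))"
  using aff_left unfolding left_action_def by (auto simp: one_TC Pi_iff)

lemma aff_smooth: "smooth_map (prod_mfd TG (tot E)) (tot E) A"
  using cbundle_morphismD(1)[OF aff_mor] by (simp add: prod_cbundle_def ctangent_cbundle_def)

lemma aff_proj: "(g, v) \<in> carrier (TC G) \<Longrightarrow> e \<in> PE \<Longrightarrow> proj E (A ((g, v), e)) = t (g, proj E e)"
  using cbundle_morphismD(2)[OF aff_mor, of "((g, v), e)"] by (simp add: prod_cbundle_def ctangent_cbundle_def carrier_TC)

lemma aff_add:
  assumes "(g, v) \<in> carrier (TC G)" "(g, w) \<in> carrier (TC G)" "e \<in> PE" "f \<in> PE" "proj E e = proj E f"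
  shows "A ((g, ct_add v w), vadd E e f) = vadd E (A ((g, v), e)) (A ((g, w), f))"
  using cbundle_morphismD(3)[OF aff_mor, of "((g, v), e)" "((g, w), f)"] assms
  by (simp add: prod_cbundle_def ctangent_cbundle_def carrier_TC)

lemma aff_scale:
  assumes "(g, v) \<in> carrier (TC G)" "e \<in> PE"
  shows "A ((g, ct_scale a v), vscale E a e) = vscale E a (A ((g, v), e))"
  using cbundle_morphismD(4)[OF aff_mor, of "((g, v), e)" a] assms
  by (simp add: prod_cbundle_def ctangent_cbundle_def carrier_TC)

lemma smooth_aff:
  assumes Q: "pre_mfd Q" and a: "smooth_map Q TG a" and b: "smooth_map Q (tot E) b"
  shows "smooth_map Q (tot E) (\<lambda>y. A (a y, b y))"
  by (rule smooth_map_compose[OF Q prod_mfd_generated(1)[OF pre_TG pre_E] pre_E smooth_map_Pair[OF Q pre_TG pre_E a b] aff_smooth])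

definition UA :: "'g \<times> ('x, 'g, 'a) pt \<Rightarrow> ('x, 'g, 'a) pt" where
  "UA = restrict (\<lambda>(g, e). A ((g, ct_zero), e)) (carrier G \<times> PE)"

lemma UA_apply: "g \<in> carrier G \<Longrightarrow> e \<in> PE \<Longrightarrow> UA (g, e) = A ((g, ct_zero), e)"
  by (simp add: UA_def)

text \<open>The zero section g \<mapsto> 0_g is a smooth homomorphism into \<open>TC G\<close>.
  Since zero vectors are stable under sums and multiples, the affine laws along it become fibrewise
  linearity.\<close>

lemma G_bundle_UA: "is_G_bundle G X t E UA"
  unfolding is_G_bundle_def
proof (intro conjI ballI allI impI)
  show "complex_vector_bundle X E" by (rule E)
  show "UA \<in> extensional (carrier G \<times> PE)" by (simp add: UA_def)
  show "left_action G PE UA"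
    unfolding left_action_def
  proof (intro conjI ballI)
    show "UA \<in> carrier G \<times> PE \<rightarrow> PE" by (auto simp: UA_apply intro!: aff_in zero_in_TC)
    show "UA (\<one>, e) = e" if "e \<in> PE" for e using that by (simp add: UA_apply aff_one)
    show "UA (g \<otimes> h, e) = UA (g, UA (h, e))" if "g \<in> carrier G" "h \<in> carrier G" "e \<in> PE" for g h e
      using that zero_in_TC aff_in aff_mult[of "(g, ct_zero)" "(h, ct_zero)" e]
      by (simp add: UA_apply zero_mult_zero)
  qed
  let ?Q = "prod_mfd GG (tot E)"
  have Q: "pre_mfd ?Q" by (rule prod_mfd_generated(1)[OF pre_G pre_E])
  have "smooth_map ?Q (tot E) (\<lambda>w. A ((fst w, ct_zero), snd w))"
    by (rule smooth_aff[OF Q smooth_map_compose[OF Q pre_G pre_TG smooth_map_fst[OF pre_G pre_E] smooth_zero_section]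
          smooth_map_snd[OF pre_G pre_E]])
  then show "smooth_map ?Q (tot E) UA"
    by (rule smooth_map_cong[OF _ Q pre_E]) (auto simp: UA_apply)
  fix g e assume ge: "g \<in> carrier G" "e \<in> PE"
  show "proj E (UA (g, e)) = t (g, proj E e)" using ge zero_in_TC by (simp add: UA_apply aff_proj)
  show "UA (g, vscale E a e) = vscale E a (UA (g, e))" for a
    using ge vscale_in(1) aff_scale[OF zero_in_TC, of g e a] by (simp add: UA_apply)
  show "UA (g, vadd E e e') = vadd E (UA (g, e)) (UA (g, e'))" if "e' \<in> PE" "proj E e = proj E e'" for e'
    using ge that vadd_in(1) aff_add[OF zero_in_TC zero_in_TC, of g e e'] by (simp add: UA_apply)
qed

text \<open>The counit \<open>((x, \<alpha>), e) \<mapsto> \<phi>(x, \<alpha>) + e\<close>, written as \<open>\<alpha> \<cdot> e\<close> because the action is affine.\<close>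

definition eps :: "('x, 'g, 'a) pt \<Rightarrow> ('x, 'g, 'a) pt" where
  "eps = restrict (\<lambda>p. A ((\<one>, pal p), pel p)) FP"

lemma eps_mk: "\<alpha> \<in> lie_gC G \<Longrightarrow> e \<in> PE \<Longrightarrow> eps (mk \<alpha> e) = A ((\<one>, \<alpha>), e)"
  by (simp add: eps_def)

lemma proj_act_one: "e \<in> PE \<Longrightarrow> t (\<one>, proj E e) = proj E e"
  using X proj_in by (simp add: G_manifold_def left_action_def)

lemma smooth_eps: "smooth_map (tot FE) (tot E) eps"
proof -
  have "smooth_map (tot FE) (tot E) (\<lambda>p. A ((\<one>, pal p), pel p))"
    by (rule smooth_aff[OF pre_FE smooth_map_compose[OF pre_FE pre_LG pre_TG smooth_pal smooth_map_into_TG] smooth_pel])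
  then show ?thesis by (rule smooth_map_cong[OF _ pre_FE pre_E]) (simp add: eps_def)
qed

text \<open>For vectors at the identity of G the affine laws say that the action is linear in the
  pair (\<alpha>, e), which is linearity on the direct sum. The identity fixes base points, so the
  map covers \<open>id\<close>.\<close>

lemma morphism_eps: "cbundle_morphism FE E id eps"
proof (rule cbundle_morphismI[OF smooth_eps])
  fix p assume "p \<in> points (tot FE)"
  then obtain \<alpha> e where p: "p = mk \<alpha> e" "\<alpha> \<in> lie_gC G" "e \<in> PE" by (auto elim: FP_E)
  show "proj E (eps p) = id (proj FE p)" using p gC_in_TC by (simp add: eps_mk aff_proj proj_act_one)
  show "eps (vscale FE a p) = vscale E a (eps p)" for a
    using p aff_scale[OF gC_in_TC, of \<alpha> e a] by (simp add: eps_mk gC_scale vscale_in)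
  fix q assume "q \<in> points (tot FE)" and pq: "proj FE p = proj FE q"
  then obtain \<beta> f where q: "q = mk \<beta> f" "\<beta> \<in> lie_gC G" "f \<in> PE" by (auto elim: FP_E)
  show "eps (vadd FE p q) = vadd E (eps p) (eps q)"
    using p q pq aff_add[OF gC_in_TC gC_in_TC, of \<alpha> \<beta> e f] by (simp add: eps_mk gC_add vadd_in)
qed

end

lemma natural_from_id:
  assumes "natural_transformation C C func_id S \<tau>"
  shows "A \<in> Obj C \<Longrightarrow> \<tau> A \<in> Hom C A (fob S A)"
    "A \<in> Obj C \<Longrightarrow> B \<in> Obj C \<Longrightarrow> f \<in> Hom C A B \<Longrightarrow>
      Cmp C A B (fob S B) (\<tau> B) f = Cmp C A (fob S A) (fob S B) (fmor S A B f) (\<tau> A)"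
  using assms unfolding natural_transformation_def func_id_def by simp_all

lemma natural_to_id:
  assumes "natural_transformation C C S func_id \<tau>"
  shows "A \<in> Obj C \<Longrightarrow> \<tau> A \<in> Hom C (fob S A) A"
    "A \<in> Obj C \<Longrightarrow> B \<in> Obj C \<Longrightarrow> f \<in> Hom C A B \<Longrightarrow>
      Cmp C (fob S A) (fob S B) B (\<tau> B) (fmor S A B f) = Cmp C (fob S A) A B f (\<tau> A)"
  using assms unfolding natural_transformation_def func_id_def by simp_all

lemma VectG_simps [simp]:
  "(E, \<rho>) \<in> Obj (VectG T G X t) \<longleftrightarrow> is_G_bundle G X t E \<rho>"
  "Hom (VectG T G X t) = equivariant_morphisms G"
  "Ident (VectG T G X t) (E, \<rho>) = restrict id (points (tot E))"
  "Cmp (VectG T G X t) (E, \<rho>) B D g f = compose (points (tot E)) g f"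
  by (simp_all add: VectG_def)

lemma VectAff_simps [simp]:
  "(E, A) \<in> Obj (VectAff T G X t) \<longleftrightarrow> is_affine_action G X t E A"
  "Hom (VectAff T G X t) = equivariant_morphisms (TC G)"
  "Ident (VectAff T G X t) (E, A) = restrict id (points (tot E))"
  "Cmp (VectAff T G X t) (E, A) B D g f = compose (points (tot E)) g f"
  by (simp_all add: VectAff_def)

lemma fmor_UC [simp]: "fmor (UC T G) A B f = f"
  by (simp add: UC_def)

lemma fmor_sigmaC [simp]: "fmor (sigmaC T G) A B f = f"
  by (simp add: sigmaC_def)

lemma fob_UC: "fob (UC T G) (E, A) = (E, restrict (\<lambda>(g, e). A ((g, ct_zero), e)) (carrier G \<times> points (tot E)))"
  by (simp add: UC_def)

lemma (in affine_bdl) fob_UC_UA: "fob (UC T G) (E, A) = (E, UA)"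
  by (simp add: UC_def UA_def)

lemma (in G_bdl) fob_FC_FA: "fob (FC T G X t) (E, \<rho>) = (FE, FA)"
  by (simp add: FC_def FA_def)

lemma (in G_bdl) fob_sigmaC_SA: "fob (sigmaC T G) (E, \<rho>) = (E, SA)"
  by (simp add: sigmaC_def SA_def)

lemma fmor_FC: "fmor (FC T G X t) (E, \<rho>) B f =
    restrict (\<lambda>p. case p of Plus u e \<Rightarrow> Plus u (f e) | Pt _ \<Rightarrow> undefined) (free_points G E)"
  by (simp add: FC_def)

lemma compose_eqD: "compose S g f = compose S g' f' \<Longrightarrow> x \<in> S \<Longrightarrow> g (f x) = g' (f' x)"
  by (metis compose_eq)

lemma equivariant_morphismsD:
  assumes "\<psi> \<in> equivariant_morphisms H (E, a) (E', a')"
  shows "cbundle_morphism E E' id \<psi>" "\<psi> \<in> extensional (points (tot E))"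
    "\<And>g e. g \<in> carrier H \<Longrightarrow> e \<in> points (tot E) \<Longrightarrow> \<psi> (a (g, e)) = a' (g, \<psi> e)"
    "\<And>e. e \<in> points (tot E) \<Longrightarrow> \<psi> e \<in> points (tot E')"
  using assms cbundle_morphismD(5)[of E E' id \<psi>] by (auto simp: equivariant_morphisms_iff)

section \<open>The functors, the adjunction and the sections of the forgetful functor\<close>

context g_manifold begin

lemma G_bdlI: "is_G_bundle G X t E \<rho> \<Longrightarrow> G_bdl G X t E \<rho>"
  using pre_X by unfold_locales (simp_all add: is_G_bundle_def)

lemma affine_bdlI: "is_affine_action G X t E A \<Longrightarrow> affine_bdl G X t E A"
  using pre_X by unfold_locales (simp_all add: is_affine_action_def)

lemma category_VectG: "is_category (VectG T G X t)"
  unfolding VectG_def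
  by (rule bundle_category[OF pre_X]) (auto simp: is_G_bundle_def left_action_def)

lemma category_VectAff: "is_category (VectAff T G X t)"
  unfolding VectAff_def
  by (rule bundle_category[OF pre_X]) (auto simp: is_affine_action_def left_action_def)

lemma functor_UC: "is_functor (VectAff T G X t) (VectG T G X t) (UC T G)"
  unfolding is_functor_def
proof (intro conjI ballI category_VectG category_VectAff)
  fix Y assume Y: "Y \<in> Obj (VectAff T G X t)"
  obtain E A where [simp]: "Y = (E, A)" by (cases Y)
  interpret E: affine_bdl G X t E A by (rule affine_bdlI) (use Y in simp)
  show "fob (UC T G) Y \<in> Obj (VectG T G X t)" using E.G_bundle_UA by (simp add: E.fob_UC_UA)
  show "fmor (UC T G) Y Y (Ident (VectAff T G X t) Y) = Ident (VectG T G X t) (fob (UC T G) Y)"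
    by (simp add: fob_UC)
  fix Z assume Z: "Z \<in> Obj (VectAff T G X t)"
  obtain E' A' where [simp]: "Z = (E', A')" by (cases Z)
  interpret E': affine_bdl G X t E' A' by (rule affine_bdlI) (use Z in simp)
  show "fmor (UC T G) Y Z f \<in> Hom (VectG T G X t) (fob (UC T G) Y) (fob (UC T G) Z)"
    if "f \<in> Hom (VectAff T G X t) Y Z" for f
  proof -
    have f: "f \<in> equivariant_morphisms (TC G) (E, A) (E', A')" using that by simp
    note D = equivariant_morphismsD[OF f]
    show ?thesis
      using D(1,2,4) D(3)[OF zero_in_TC]
      by (simp add: E.fob_UC_UA E'.fob_UC_UA equivariant_morphisms_iff E.UA_apply E'.UA_apply)
  qed
  show "fmor (UC T G) Y W (Cmp (VectAff T G X t) Y Z W g f) =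
      Cmp (VectG T G X t) (fob (UC T G) Y) (fob (UC T G) Z) (fob (UC T G) W) (fmor (UC T G) Z W g) (fmor (UC T G) Y Z f)"
    for W f g by (simp add: fob_UC)
qed

lemma functor_sigmaC: "is_functor (VectG T G X t) (VectAff T G X t) (sigmaC T G)"
  unfolding is_functor_def
proof (intro conjI ballI category_VectG category_VectAff)
  fix Y assume Y: "Y \<in> Obj (VectG T G X t)"
  obtain E \<rho> where [simp]: "Y = (E, \<rho>)" by (cases Y)
  interpret E: G_bdl G X t E \<rho> by (rule G_bdlI) (use Y in simp)
  show "fob (sigmaC T G) Y \<in> Obj (VectAff T G X t)" using E.affine_SA by (simp add: E.fob_sigmaC_SA)
  show "fmor (sigmaC T G) Y Y (Ident (VectG T G X t) Y) = Ident (VectAff T G X t) (fob (sigmaC T G) Y)"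
    by (simp add: E.fob_sigmaC_SA)
  fix Z assume Z: "Z \<in> Obj (VectG T G X t)"
  obtain E' \<rho>' where [simp]: "Z = (E', \<rho>')" by (cases Z)
  interpret E': G_bdl G X t E' \<rho>' by (rule G_bdlI) (use Z in simp)
  show "fmor (sigmaC T G) Y Z f \<in> Hom (VectAff T G X t) (fob (sigmaC T G) Y) (fob (sigmaC T G) Z)"
    if "f \<in> Hom (VectG T G X t) Y Z" for f
  proof -
    have f: "f \<in> equivariant_morphisms G (E, \<rho>) (E', \<rho>')" using that by simp
    note D = equivariant_morphismsD[OF f]
    have "f (E.SA (w, e)) = E'.SA (w, f e)" if w: "w \<in> carrier (TC G)" and e: "e \<in> points (tot E)" for w e
    proof -
      obtain g v where gv: "w = (g, v)" by (cases w)
      then have "g \<in> carrier G" using w by (simp add: carrier_TC)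
      then show ?thesis using w e gv D(3,4) by (simp add: E.SA_apply E'.SA_apply)
    qed
    then show ?thesis using D(1,2) by (simp add: E.fob_sigmaC_SA E'.fob_sigmaC_SA equivariant_morphisms_iff)
  qed
  show "fmor (sigmaC T G) Y W (Cmp (VectG T G X t) Y Z W g f) =
      Cmp (VectAff T G X t) (fob (sigmaC T G) Y) (fob (sigmaC T G) Z) (fob (sigmaC T G) W) (fmor (sigmaC T G) Z W g) (fmor (sigmaC T G) Y Z f)"
    for W f g by (simp add: E.fob_sigmaC_SA)
qed

text \<open>Since f covers the identity, the base point stored in the \<open>Plus\<close> node
  remains the right one.\<close>

lemma fmor_FC_apply:
  assumes "cbundle_morphism E E' id f" "\<alpha> \<in> lie_gC G" "e \<in> points (tot E)"
  shows "fmor (FC T G X t) (E, \<rho>) B f (plus_pt E \<alpha> e) = plus_pt E' \<alpha> (f e)"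
proof -
  have "plus_pt E \<alpha> e \<in> free_points G E"
    unfolding free_points_def plus_pt_def using assms(2,3) by blast
  then show ?thesis using cbundle_morphismD(2)[OF assms(1,3)] by (simp add: fmor_FC plus_pt_def)
qed

lemma fmor_FC_morphism:
  assumes E: "complex_vector_bundle X E" and E': "complex_vector_bundle X E'" and f: "cbundle_morphism E E' id f"
  shows "cbundle_morphism (free_cbundle G X E) (free_cbundle G X E') id (fmor (FC T G X t) (E, \<rho>) B f)"
proof -
  interpret E: free_bundle G X E by (rule free_bundleI[OF E])
  interpret E': free_bundle G X E' by (rule free_bundleI[OF E'])
  let ?f = "fmor (FC T G X t) (E, \<rho>) B f"
  note D = cbundle_morphismD[OF f] and ap = fmor_FC_apply[OF f]
  show ?thesis
  proof (rule cbundle_morphismI)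
    have "smooth_map (tot E.FE) (tot E'.FE) (\<lambda>p. plus_pt E' (pal p) (f (pel p)))"
      by (rule E'.smooth_mk[OF E.pre_FE E.smooth_pal smooth_map_compose[OF E.pre_FE E.pre_E E'.pre_E E.smooth_pel D(1)]])
    then show "smooth_map (tot E.FE) (tot E'.FE) ?f"
      by (rule smooth_map_cong[OF _ E.pre_FE E'.pre_FE]) (auto simp: ap elim: E.FP_E)
    fix p assume "p \<in> points (tot E.FE)"
    then obtain \<alpha> e where p: "p = plus_pt E \<alpha> e" "\<alpha> \<in> lie_gC G" "e \<in> points (tot E)" by (auto elim: E.FP_E)
    show "proj E'.FE (?f p) = id (proj E.FE p)" using p D by (simp add: ap)
    show "?f (vscale E.FE a p) = vscale E'.FE a (?f p)" for a
      using p D by (simp add: ap E.gC_scale E.vscale_in)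
    fix q assume "q \<in> points (tot E.FE)" and pq: "proj E.FE p = proj E.FE q"
    then obtain \<beta> u where q: "q = plus_pt E \<beta> u" "\<beta> \<in> lie_gC G" "u \<in> points (tot E)" by (auto elim: E.FP_E)
    show "?f (vadd E.FE p q) = vadd E'.FE (?f p) (?f q)"
      using p q pq D by (simp add: ap E.gC_add E.vadd_in)
  qed
qed

lemma functor_FC: "is_functor (VectG T G X t) (VectAff T G X t) (FC T G X t)"
  unfolding is_functor_def
proof (intro conjI ballI category_VectG category_VectAff)
  let ?F = "FC T G X t" and ?C = "VectG T G X t" and ?D = "VectAff T G X t"
  fix Y assume Y: "Y \<in> Obj ?C"
  obtain E \<rho> where [simp]: "Y = (E, \<rho>)" by (cases Y)
  interpret E: G_bdl G X t E \<rho> by (rule G_bdlI) (use Y in simp)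
  show "fob ?F Y \<in> Obj ?D" using E.affine_FA by (simp add: E.fob_FC_FA)
  have ext: "fmor ?F (E, \<rho>) B f \<in> extensional E.FP" for B f by (simp add: fmor_FC)
  show "fmor ?F Y Y (Ident ?C Y) = Ident ?D (fob ?F Y)"
  proof (rule extensionalityI[of _ E.FP])
    have m: "cbundle_morphism E E id (restrict id (points (tot E)))"
      by (rule cbundle_morphism_cong[OF E.cvb_axioms E.cvb_axioms cbundle_morphism_id[OF E.cvb_axioms]]) simp
    fix p assume "p \<in> E.FP"
    then show "fmor ?F Y Y (Ident ?C Y) p = Ident ?D (fob ?F Y) p"
      using fmor_FC_apply[OF m] by (auto simp: E.fob_FC_FA elim!: E.FP_E)
  qed (use ext in \<open>simp_all add: E.fob_FC_FA\<close>)
  fix Z assume Z: "Z \<in> Obj ?C"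
  obtain E' \<rho>' where [simp]: "Z = (E', \<rho>')" by (cases Z)
  interpret E': G_bdl G X t E' \<rho>' by (rule G_bdlI) (use Z in simp)
  show "fmor ?F Y Z f \<in> Hom ?D (fob ?F Y) (fob ?F Z)" if "f \<in> Hom ?C Y Z" for f
  proof -
    have f: "f \<in> equivariant_morphisms G (E, \<rho>) (E', \<rho>')" using that by simp
    note D = equivariant_morphismsD[OF f]
    note ap = fmor_FC_apply[OF D(1)]
    have "fmor ?F (E, \<rho>) (E', \<rho>') f (E.FA (w, p)) = E'.FA (w, fmor ?F (E, \<rho>) (E', \<rho>') f p)"
      if w: "w \<in> carrier (TC G)" and p: "p \<in> E.FP" for w p
    proof -
      obtain g v where gv: "w = (g, v)" by (cases w)
      then have g: "g \<in> carrier G" using w by (simp add: carrier_TC)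
      obtain \<alpha> e where p': "p = plus_pt E \<alpha> e" "\<alpha> \<in> lie_gC G" "e \<in> points (tot E)" using p by (rule E.FP_E)
      show ?thesis
        using w gv g p' D(3,4) E.FA_in E.act_in by (simp add: ap E.FA_mk E'.FA_mk)
    qed
    then show ?thesis
      using fmor_FC_morphism[OF E.E E'.E D(1)] ext
      by (simp add: E.fob_FC_FA E'.fob_FC_FA equivariant_morphisms_iff)
  qed
  fix W f g assume W: "W \<in> Obj ?C" and f: "f \<in> Hom ?C Y Z" and g: "g \<in> Hom ?C Z W"
  obtain E'' \<rho>'' where [simp]: "W = (E'', \<rho>'')" by (cases W)
  interpret E'': G_bdl G X t E'' \<rho>'' by (rule G_bdlI) (use W in simp)
  have f': "f \<in> equivariant_morphisms G (E, \<rho>) (E', \<rho>')" and g': "g \<in> equivariant_morphisms G (E', \<rho>') (E'', \<rho>'')"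
    using f g by simp_all
  note Df = equivariant_morphismsD[OF f'] and Dg = equivariant_morphismsD[OF g']
  have gf: "cbundle_morphism E E'' id (compose (points (tot E)) g f)"
    by (rule cbundle_morphism_cong[OF E.cvb_axioms E''.cvb_axioms
          cbundle_morphism_compose[OF E.cvb_axioms E'.cvb_axioms E''.cvb_axioms Df(1) Dg(1)]]) (simp add: compose_eq)
  show "fmor ?F Y W (Cmp ?C Y Z W g f) = Cmp ?D (fob ?F Y) (fob ?F Z) (fob ?F W) (fmor ?F Z W g) (fmor ?F Y Z f)"
  proof (rule extensionalityI[of _ E.FP])
    fix p assume p: "p \<in> E.FP"
    then obtain \<alpha> e where p': "p = plus_pt E \<alpha> e" "\<alpha> \<in> lie_gC G" "e \<in> points (tot E)" by (rule E.FP_E)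
    show "fmor ?F Y W (Cmp ?C Y Z W g f) p = Cmp ?D (fob ?F Y) (fob ?F Z) (fob ?F W) (fmor ?F Z W g) (fmor ?F Y Z f) p"
      using p p' Df(4) fmor_FC_apply[OF gf] fmor_FC_apply[OF Df(1)] fmor_FC_apply[OF Dg(1)]
      by (simp add: E.fob_FC_FA compose_eq)
  qed (use ext in \<open>simp_all add: E.fob_FC_FA compose_def\<close>)
qed

text \<open>The zero of the first summand is preserved by the vectors 0_g, because \<open>Ad\<close>
  and right translation are linear. A vector with nonzero right translate moves it, so equivariance
  is claimed under G only.\<close>

lemma unit_natural:
  "natural_transformation (VectG T G X t) (VectG T G X t) func_id (func_comp (UC T G) (FC T G X t))
     (\<lambda>(E, \<rho>). restrict (plus_pt E ct_zero) (points (tot E)))"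
  (is "natural_transformation ?C ?C func_id ?UF ?\<eta>")
  unfolding natural_transformation_def
proof (intro conjI ballI is_functor_comp[OF functor_FC functor_UC])
  show "is_functor ?C ?C func_id" using category_VectG by (simp add: is_functor_def func_id_def)
  fix Y assume Y: "Y \<in> Obj ?C"
  obtain E \<rho> where [simp]: "Y = (E, \<rho>)" by (cases Y)
  interpret E: G_bdl G X t E \<rho> by (rule G_bdlI) (use Y in simp)
  interpret FE: affine_bdl G X t E.FE E.FA by (rule affine_bdlI[OF E.affine_FA])
  have UF: "fob ?UF Y = (E.FE, FE.UA)" by (simp add: func_comp_def E.fob_FC_FA FE.fob_UC_UA)
  have "cbundle_morphism E E.FE id (plus_pt E ct_zero)"
  proof (rule cbundle_morphismI)
    have "smooth_map (tot E) LG (\<lambda>e. ct_zero)"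
      by (rule smooth_map_const[OF E.pre_E pre_LG]) (simp add: ct_zero_in)
    from E.smooth_mk[OF E.pre_E this smooth_map_id[OF E.pre_E]]
    show "smooth_map (tot E) (tot E.FE) (plus_pt E ct_zero)" by simp
  qed (simp_all add: E.gC_zero)
  then have "cbundle_morphism E E.FE id (restrict (plus_pt E ct_zero) (points (tot E)))"
    by (rule cbundle_morphism_cong[OF E.cvb_axioms FE.cvb_axioms]) simp
  moreover have "E.mk ct_zero (\<rho> (g, e)) = FE.UA (g, E.mk ct_zero e)" if "g \<in> carrier G" "e \<in> points (tot E)" for g e
    using that zero_in_TC by (simp add: FE.UA_apply E.gC_zero E.FA_mk Ad_zero right_transport_zero)
  ultimately show "?\<eta> Y \<in> Hom ?C (fob func_id Y) (fob ?UF Y)"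
    unfolding UF using E.act_in by (simp add: func_id_def equivariant_morphisms_iff)
  fix Z f assume Z: "Z \<in> Obj ?C" and f: "f \<in> Hom ?C Y Z"
  obtain E' \<rho>' where [simp]: "Z = (E', \<rho>')" by (cases Z)
  have f': "f \<in> equivariant_morphisms G (E, \<rho>) (E', \<rho>')" using f by simp
  note D = equivariant_morphismsD[OF f']
  show "Cmp ?C (fob func_id Y) (fob func_id Z) (fob ?UF Z) (?\<eta> Z) (fmor func_id Y Z f) =
        Cmp ?C (fob func_id Y) (fob ?UF Y) (fob ?UF Z) (fmor ?UF Y Z f) (?\<eta> Y)"
    using D(4) fmor_FC_apply[OF D(1) E.gC_zero]
    by (auto simp: func_id_def func_comp_def compose_def fun_eq_iff)
qed

lemma counit_natural:
  "natural_transformation (VectAff T G X t) (VectAff T G X t) (func_comp (FC T G X t) (UC T G)) func_id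
     (\<lambda>(E, A). affine_bdl.eps G E A)"
  (is "natural_transformation ?D ?D ?FU func_id ?\<epsilon>")
  unfolding natural_transformation_def
proof (intro conjI ballI is_functor_comp[OF functor_UC functor_FC])
  show "is_functor ?D ?D func_id" using category_VectAff by (simp add: is_functor_def func_id_def)
  fix Y assume Y: "Y \<in> Obj ?D"
  obtain E A where [simp]: "Y = (E, A)" by (cases Y)
  interpret E: affine_bdl G X t E A by (rule affine_bdlI) (use Y in simp)
  interpret U: G_bdl G X t E E.UA by (rule G_bdlI[OF E.G_bundle_UA])
  have FU: "fob ?FU Y = (E.FE, U.FA)" by (simp add: func_comp_def E.fob_UC_UA U.fob_FC_FA)
  have "E.eps (U.FA (w, p)) = A (w, E.eps p)" if w: "w \<in> carrier (TC G)" and p: "p \<in> E.FP" for w p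
  proof -
    obtain g v where gv: "w = (g, v)" by (cases w)
    then have g: "g \<in> carrier G" "v \<in> TT g" using w by (simp_all add: carrier_TC)
    obtain \<alpha> e where p': "p = plus_pt E \<alpha> e" "\<alpha> \<in> lie_gC G" "e \<in> points (tot E)" using p by (rule E.FP_E)
    let ?\<beta> = "ct_add (Ad G g \<alpha>) (right_transport G (g, v))"
    have b: "?\<beta> \<in> lie_gC G" using U.FA_in w p' gv by simp
    \<comment> \<open>The free action is built on the underlying G-bundle, hence g acts on e through
      0_g. Two successive affine actions appear, which are then merged and factored the other way
      round.\<close>
    have "E.eps (U.FA (w, p)) = A ((\<one>, ?\<beta>), A ((g, ct_zero), e))"
      using w p' gv g b E.aff_in[OF zero_in_TC] by (simp add: U.FA_mk E.eps_mk E.UA_apply)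
    also have "\<dots> = A ((\<one>, ?\<beta>) \<otimes>\<^bsub>TC G\<^esub> (g, ct_zero), e)"
      by (rule E.aff_mult[symmetric]) (use b g p' gC_in_TC zero_in_TC in auto)
    also have "\<dots> = A ((g, v) \<otimes>\<^bsub>TC G\<^esub> (\<one>, \<alpha>), e)"
      using g b p' by (simp only: gC_mult_zero TC_mult_gC)
    also have "\<dots> = A (w, E.eps p)"
      using E.aff_mult[of "(g, v)" "(\<one>, \<alpha>)" e] w gv p' gC_in_TC by (simp add: E.eps_mk)
    finally show ?thesis .
  qed
  then show "?\<epsilon> Y \<in> Hom ?D (fob ?FU Y) (fob func_id Y)"
    unfolding FU using E.morphism_eps by (simp add: func_id_def equivariant_morphisms_iff E.eps_def)
  fix Z f assume Z: "Z \<in> Obj ?D" and f: "f \<in> Hom ?D Y Z"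
  obtain E' A' where [simp]: "Z = (E', A')" by (cases Z)
  interpret E': affine_bdl G X t E' A' by (rule affine_bdlI) (use Z in simp)
  have f': "f \<in> equivariant_morphisms (TC G) (E, A) (E', A')" using f by simp
  note D = equivariant_morphismsD[OF f']
  have "E'.eps (fmor (FC T G X t) (E, E.UA) (E', E'.UA) f p) = f (E.eps p)" if "p \<in> E.FP" for p
    using that D(3)[OF gC_in_TC] D(4) fmor_FC_apply[OF D(1)]
    by (auto simp: E.eps_mk E'.eps_mk elim!: E.FP_E)
  then show "Cmp ?D (fob ?FU Y) (fob ?FU Z) (fob func_id Z) (?\<epsilon> Z) (fmor ?FU Y Z f) =
        Cmp ?D (fob ?FU Y) (fob func_id Y) (fob func_id Z) (fmor func_id Y Z f) (?\<epsilon> Y)"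
    unfolding FU by (auto simp: func_id_def func_comp_def E.fob_UC_UA E'.fob_UC_UA compose_def fun_eq_iff)
qed

lemma adjunction_FC_UC:
  "adjunction (VectG T G X t) (VectAff T G X t) (FC T G X t) (UC T G)
     (\<lambda>(E, \<rho>). restrict (plus_pt E ct_zero) (points (tot E))) (\<lambda>(E, A). affine_bdl.eps G E A)"
  (is "adjunction ?C ?D ?F ?U ?\<eta> ?\<epsilon>")
  unfolding adjunction_def
proof (intro conjI ballI functor_FC functor_UC unit_natural counit_natural)
  fix Y assume Y: "Y \<in> Obj ?C"
  obtain E \<rho> where [simp]: "Y = (E, \<rho>)" by (cases Y)
  interpret E: G_bdl G X t E \<rho> by (rule G_bdlI) (use Y in simp)
  interpret FE: affine_bdl G X t E.FE E.FA by (rule affine_bdlI[OF E.affine_FA])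
  let ?\<eta>E = "restrict (plus_pt E ct_zero) (points (tot E))"
  from natural_from_id(1)[OF unit_natural[of T] Y] have m: "cbundle_morphism E E.FE id ?\<eta>E"
    by (simp add: func_comp_def E.fob_FC_FA FE.fob_UC_UA equivariant_morphisms_iff)
  \<comment> \<open>At (\<alpha>, e) the unit inserts a zero, and \<alpha> acts on (0, e) by
    \<open>Ad\<close> of the identity applied to 0 plus \<alpha> itself, giving back (\<alpha>,
    e).\<close>
  have "FE.eps (fmor ?F (E, \<rho>) (E.FE, FE.UA) ?\<eta>E p) = p" if "p \<in> E.FP" for p
    using that fmor_FC_apply[OF m] gC_in_TC
    by (auto simp: FE.eps_mk E.gC_zero E.FA_mk Ad_zero right_transport_one E.act_one elim!: E.FP_E)
  then show "Cmp ?D (fob ?F Y) (fob ?F (fob ?U (fob ?F Y))) (fob ?F Y)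
      (?\<epsilon> (fob ?F Y)) (fmor ?F Y (fob ?U (fob ?F Y)) (?\<eta> Y)) = Ident ?D (fob ?F Y)"
    by (auto simp: E.fob_FC_FA FE.fob_UC_UA compose_def fun_eq_iff)
next
  fix Y assume Y: "Y \<in> Obj ?D"
  obtain E A where [simp]: "Y = (E, A)" by (cases Y)
  interpret E: affine_bdl G X t E A by (rule affine_bdlI) (use Y in simp)
  show "Cmp ?C (fob ?U Y) (fob ?U (fob ?F (fob ?U Y))) (fob ?U Y)
      (fmor ?U (fob ?F (fob ?U Y)) Y (?\<epsilon> Y)) (?\<eta> (fob ?U Y)) = Ident ?C (fob ?U Y)"
    by (auto simp: E.fob_UC_UA compose_def fun_eq_iff E.eps_mk E.gC_zero E.aff_one)
qed

text \<open>A section of the forgetful functor makes every \<open>G\<close>-morphism equivariant under the affine actions;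
  applied to the zero endomorphism this forces \<open>v \<cdot> 0 = 0\<close>.\<close>

lemma section_unique:
  assumes S: "is_functor (VectG T G X t) (VectAff T G X t) S"
    and US: "func_eq (VectG T G X t) (func_comp (UC T G) S) func_id"
  shows "func_eq (VectG T G X t) S (sigmaC T G)"
  unfolding func_eq_def
proof (intro conjI ballI)
  let ?C = "VectG T G X t" and ?D = "VectAff T G X t"
  \<comment> \<open>\<open>UC\<close> leaves the underlying map of a morphism unchanged, so a
    section has to do the same.\<close>
  have S_mor: "fmor S Y Z f = f" if "Y \<in> Obj ?C" "Z \<in> Obj ?C" "f \<in> Hom ?C Y Z" for Y Z f
    using US that unfolding func_eq_def func_comp_def func_id_def by simp
  show "fmor S Y Z f = fmor (sigmaC T G) Y Z f" if "Y \<in> Obj ?C" "Z \<in> Obj ?C" "f \<in> Hom ?C Y Z" for Y Z f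
    using S_mor[OF that] by simp
  fix Y assume Y: "Y \<in> Obj ?C"
  obtain E \<rho> where Y': "Y = (E, \<rho>)" by (cases Y)
  interpret E: G_bdl G X t E \<rho> by (rule G_bdlI) (use Y Y' in simp)
  obtain E1 A where SY: "fob S Y = (E1, A)" by (cases "fob S Y")
  have "fob (UC T G) (fob S Y) = Y" using US Y unfolding func_eq_def func_comp_def func_id_def by simp
  then have eq: "(E1, restrict (\<lambda>(g, e). A ((g, ct_zero), e)) (carrier G \<times> points (tot E1))) = Y"
    unfolding SY fob_UC .
  \<comment> \<open>\<open>UC\<close> keeps the bundle and restricts the action to zero vectors;
    hence the chosen affine action lives on E itself and extends \<rho> along the zero
    section.\<close>
  then have E1: "E1 = E" unfolding Y' by simp
  have res: "restrict (\<lambda>(g, e). A ((g, ct_zero), e)) (carrier G \<times> points (tot E)) = \<rho>"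
    using eq unfolding E1 Y' by simp
  have SE: "fob S Y = (E, A)" using SY E1 by simp
  have "fob S Y \<in> Obj ?D" using S Y unfolding is_functor_def by blast
  then interpret A: affine_bdl G X t E A using SE by (intro affine_bdlI) simp
  let ?z = "restrict (vscale E 0) (points (tot E))"
  have "?z \<in> Hom ?C Y Y" using E.zero_morphism Y' by simp
  then have "fmor S Y Y ?z \<in> Hom ?D (fob S Y) (fob S Y)" and "fmor S Y Y ?z = ?z"
    using S Y S_mor[OF Y Y] unfolding is_functor_def by blast+
  then have z: "?z \<in> equivariant_morphisms (TC G) (E, A) (E, A)" by (simp add: SE)
  have "A = E.SA"
  proof (rule extensionalityI[OF A.aff_ext])
    show "E.SA \<in> extensional (carrier (TC G) \<times> points (tot E))" by (simp add: E.SA_def)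
    fix x assume x: "x \<in> carrier (TC G) \<times> points (tot E)"
    obtain g v e where x': "x = ((g, v), e)" by (cases x) auto
    have gv: "(g, v) \<in> carrier (TC G)" and e: "e \<in> points (tot E)" and g: "g \<in> carrier G"
      using x x' by (simp_all add: carrier_TC)
    let ?o = "vzero E (proj E e)"
    note p = E.proj_in[OF e]
    have o: "?o \<in> points (tot E)" "proj E ?o = proj E e" using E.vzero_in[OF p] by simp_all
    have "vscale E 0 e = ?o" using E.vscale_zero[OF e] .
    then have "A ((g, v), ?o) = vscale E 0 (A ((g, v), e))"
      using equivariant_morphismsD(3)[OF z gv e] e A.aff_in[OF gv e] by simp
    \<comment> \<open>All vectors at g move base points alike. Expressing the zero over the base
      point of 0_g acting on e prepares for \<open>vzero_add\<close>.\<close>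
    also have "\<dots> = vzero E (proj E (A ((g, ct_zero), e)))"
      using E.vscale_zero[OF A.aff_in[OF gv e]] A.aff_proj[OF gv e] A.aff_proj[OF zero_in_TC[OF g] e] by simp
    finally have Ao: "A ((g, v), ?o) = vzero E (proj E (A ((g, ct_zero), e)))" .
    have "A ((g, v), e) = A ((g, ct_add v ct_zero), vadd E ?o e)" using E.vzero_add[OF e] by simp
    also have "\<dots> = vadd E (A ((g, v), ?o)) (A ((g, ct_zero), e))"
      by (rule A.aff_add[OF gv zero_in_TC[OF g] o(1) e o(2)])
    also have "\<dots> = A ((g, ct_zero), e)" unfolding Ao by (rule E.vzero_add[OF A.aff_in[OF zero_in_TC[OF g] e]])
    also have "\<dots> = \<rho> (g, e)" using res g e by (metis (no_types, lifting) SigmaI case_prod_conv restrict_apply')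
    finally show "A x = E.SA x" using x' gv e by (simp add: E.SA_apply)
  qed
  then show "fob S Y = fob (sigmaC T G) Y" using SE by (simp add: Y' E.fob_sigmaC_SA)
qed

lemma sigmaC_section: "func_eq (VectG T G X t) (func_comp (UC T G) (sigmaC T G)) func_id"
  unfolding func_eq_def
proof (intro conjI ballI)
  fix Y assume Y: "Y \<in> Obj (VectG T G X t)"
  obtain E \<rho> where Y': "Y = (E, \<rho>)" by (cases Y)
  interpret E: G_bdl G X t E \<rho> by (rule G_bdlI) (use Y Y' in simp)
  interpret S: affine_bdl G X t E E.SA by (rule affine_bdlI[OF E.affine_SA])
  have "S.UA = \<rho>"
    by (rule extensionalityI[of _ "carrier G \<times> points (tot E)"])
      (use E.act_ext zero_in_TC in \<open>auto simp: S.UA_def E.SA_apply\<close>)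
  then show "fob (func_comp (UC T G) (sigmaC T G)) Y = fob func_id Y"
    by (simp add: Y' func_comp_def func_id_def E.fob_sigmaC_SA S.fob_UC_UA)
qed (simp add: func_comp_def func_id_def)

end

section \<open>Monadicity\<close>

lemma algebras_simps:
  "Hom (algebras C S \<eta> \<mu>) (Y, h) (Z, k) =
     {f \<in> Hom C Y Z. Cmp C (fob S Y) Y Z f h = Cmp C (fob S Y) (fob S Z) Z k (fmor S Y Z f)}"
  "Ident (algebras C S \<eta> \<mu>) (Y, h) = Ident C Y"
  "Cmp (algebras C S \<eta> \<mu>) (Y, h) (Z, k) (W, l) = Cmp C Y Z W"
  by (simp_all add: algebras_def)

text \<open>Unit and counit are arbitrary here: all that may be used of them is naturality and the
  triangle identities, not the formulas of \<open>unit_natural\<close> and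
  \<open>counit_natural\<close>.\<close>

locale bundle_adjunction = g_manifold G X t
  for G :: "'g lie_group" (structure) and X :: "'x smooth_mfd" and t +
  fixes T :: "'a itself"
    and \<eta> :: "('x, 'g, 'a) G_bundle \<Rightarrow> ('x, 'g, 'a) bundle_map"
    and \<epsilon> :: "('x, 'g, 'a) affine_bundle \<Rightarrow> ('x, 'g, 'a) bundle_map"
  assumes adj: "adjunction (VectG T G X t) (VectAff T G X t) (FC T G X t) (UC T G) \<eta> \<epsilon>"
begin

abbreviation "C \<equiv> VectG T G X t"
abbreviation "D \<equiv> VectAff T G X t"
abbreviation "F \<equiv> FC T G X t"
abbreviation "U \<equiv> UC T G"
abbreviation "\<mu> \<equiv> \<lambda>A. fmor U (fob F (fob U (fob F A))) (fob F A) (\<epsilon> (fob F A))"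
abbreviation "K \<equiv> comparison F U \<epsilon>"
abbreviation "Alg \<equiv> algebras C (func_comp U F) \<eta> \<mu>"

lemma unit_hom: "Y \<in> Obj C \<Longrightarrow> \<eta> Y \<in> Hom C Y (fob U (fob F Y))"
  and unit_nat: "Y \<in> Obj C \<Longrightarrow> Z \<in> Obj C \<Longrightarrow> f \<in> Hom C Y Z \<Longrightarrow>
    Cmp C Y Z (fob U (fob F Z)) (\<eta> Z) f = Cmp C Y (fob U (fob F Y)) (fob U (fob F Z)) (fmor F Y Z f) (\<eta> Y)"
proof -
  have n: "natural_transformation C C func_id (func_comp U F) \<eta>"
    using adj unfolding adjunction_def by (elim conjE)
  show "Y \<in> Obj C \<Longrightarrow> \<eta> Y \<in> Hom C Y (fob U (fob F Y))"
    and "Y \<in> Obj C \<Longrightarrow> Z \<in> Obj C \<Longrightarrow> f \<in> Hom C Y Z \<Longrightarrow>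
      Cmp C Y Z (fob U (fob F Z)) (\<eta> Z) f = Cmp C Y (fob U (fob F Y)) (fob U (fob F Z)) (fmor F Y Z f) (\<eta> Y)"
    using natural_from_id[OF n] by (simp_all add: func_comp_def)
qed

lemma counit_hom: "Y \<in> Obj D \<Longrightarrow> \<epsilon> Y \<in> Hom D (fob F (fob U Y)) Y"
  and counit_nat: "Y \<in> Obj D \<Longrightarrow> Z \<in> Obj D \<Longrightarrow> f \<in> Hom D Y Z \<Longrightarrow>
    Cmp D (fob F (fob U Y)) (fob F (fob U Z)) Z (\<epsilon> Z) (fmor F (fob U Y) (fob U Z) f) =
    Cmp D (fob F (fob U Y)) Y Z f (\<epsilon> Y)"
proof -
  have n: "natural_transformation D D (func_comp F U) func_id \<epsilon>"
    using adj unfolding adjunction_def by (elim conjE)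
  show "Y \<in> Obj D \<Longrightarrow> \<epsilon> Y \<in> Hom D (fob F (fob U Y)) Y"
    and "Y \<in> Obj D \<Longrightarrow> Z \<in> Obj D \<Longrightarrow> f \<in> Hom D Y Z \<Longrightarrow>
      Cmp D (fob F (fob U Y)) (fob F (fob U Z)) Z (\<epsilon> Z) (fmor F (fob U Y) (fob U Z) f) =
      Cmp D (fob F (fob U Y)) Y Z f (\<epsilon> Y)"
    using natural_to_id[OF n] by (simp_all add: func_comp_def)
qed

lemma triangle_F: "Y \<in> Obj C \<Longrightarrow> Cmp D (fob F Y) (fob F (fob U (fob F Y))) (fob F Y)
      (\<epsilon> (fob F Y)) (fmor F Y (fob U (fob F Y)) (\<eta> Y)) = Ident D (fob F Y)"
  and triangle_U: "Z \<in> Obj D \<Longrightarrow> Cmp C (fob U Z) (fob U (fob F (fob U Z))) (fob U Z)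
      (fmor U (fob F (fob U Z)) Z (\<epsilon> Z)) (\<eta> (fob U Z)) = Ident C (fob U Z)"
proof -
  have "\<forall>Y\<in>Obj C. Cmp D (fob F Y) (fob F (fob U (fob F Y))) (fob F Y)
      (\<epsilon> (fob F Y)) (fmor F Y (fob U (fob F Y)) (\<eta> Y)) = Ident D (fob F Y)"
    using adj unfolding adjunction_def by (elim conjE)
  then show "Y \<in> Obj C \<Longrightarrow> Cmp D (fob F Y) (fob F (fob U (fob F Y))) (fob F Y)
      (\<epsilon> (fob F Y)) (fmor F Y (fob U (fob F Y)) (\<eta> Y)) = Ident D (fob F Y)" by (rule bspec)
  have "\<forall>Z\<in>Obj D. Cmp C (fob U Z) (fob U (fob F (fob U Z))) (fob U Z)
      (fmor U (fob F (fob U Z)) Z (\<epsilon> Z)) (\<eta> (fob U Z)) = Ident C (fob U Z)"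
    using adj unfolding adjunction_def by (elim conjE)
  then show "Z \<in> Obj D \<Longrightarrow> Cmp C (fob U Z) (fob U (fob F (fob U Z))) (fob U Z)
      (fmor U (fob F (fob U Z)) Z (\<epsilon> Z)) (\<eta> (fob U Z)) = Ident C (fob U Z)" by (rule bspec)
qed

end

text \<open>Forced by \<open>e = h (\<eta> e)\<close> once \<open>h\<close> is to be equivariant.\<close>

definition alg_act ::
  "'g lie_group \<Rightarrow> 'x smooth_mfd \<Rightarrow> ('g \<times> 'x \<Rightarrow> 'x) \<Rightarrow> (('x, 'g, 'a) G_bundle \<Rightarrow> ('x, 'g, 'a) bundle_map) \<Rightarrow>
     ('x, ('x, 'g, 'a) pt) cbundle \<Rightarrow> ('g \<times> ('x, 'g, 'a) pt \<Rightarrow> ('x, 'g, 'a) pt) \<Rightarrow> ('x, 'g, 'a) bundle_map \<Rightarrow>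
     ('g \<times> 'g ctvec) \<times> ('x, 'g, 'a) pt \<Rightarrow> ('x, 'g, 'a) pt" where
  "alg_act G X t \<eta> E \<rho> h = restrict (\<lambda>(w, e). h (snd (fob (FC TYPE('a) G X t) (E, \<rho>)) (w, \<eta> (E, \<rho>) e)))
     (carrier (TC G) \<times> points (tot E))"

locale bundle_algebra = bundle_adjunction G X t T \<eta> \<epsilon> + G_bdl G X t E \<rho>
  for G :: "'g lie_group" (structure) and X :: "'x smooth_mfd" and t and T :: "'a itself" and \<eta> \<epsilon>
    and E :: "('x, ('x, 'g, 'a) pt) cbundle" and \<rho> +
  fixes h
  assumes h: "((E, \<rho>), h) \<in> Obj Alg"
begin

text \<open>The stages F E, U F E and F U F E, called \<open>FE\<close>, \<open>UF\<close> and
  \<open>FUF\<close>. The multiplication law of an algebra lives on the last of them.\<close>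

sublocale FE: affine_bdl G X t FE FA
  by (rule affine_bdlI[OF affine_FA])

sublocale UF: G_bdl G X t FE FE.UA
  by (rule G_bdlI[OF FE.G_bundle_UA])

sublocale FUF: affine_bdl G X t FE.FE UF.FA
  by (rule affine_bdlI[OF UF.affine_FA])

lemma fobs: "fob F (E, \<rho>) = (FE, FA)" "fob U (FE, FA) = (FE, FE.UA)" "fob F (FE, FE.UA) = (FE.FE, UF.FA)"
    "fob U (FE.FE, UF.FA) = (FE.FE, FUF.UA)"
  by (rule fob_FC_FA, rule FE.fob_UC_UA, rule UF.fob_FC_FA, rule FUF.fob_UC_UA)

lemma E_obj: "(E, \<rho>) \<in> Obj C" using rho by simp
lemma FE_obj: "(FE, FA) \<in> Obj D" using affine_FA by simp
lemma UF_obj: "(FE, FE.UA) \<in> Obj C" using FE.G_bundle_UA by simp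

lemma h_mor: "h \<in> equivariant_morphisms G (FE, FE.UA) (E, \<rho>)"
  using h by (simp add: algebras_def func_comp_def fobs)

lemmas hD = equivariant_morphismsD[OF h_mor]

lemma eta_mor: "\<eta> (E, \<rho>) \<in> equivariant_morphisms G (E, \<rho>) (FE, FE.UA)"
  using unit_hom[OF E_obj] by (simp add: fobs)

lemmas etaD = equivariant_morphismsD[OF eta_mor]

lemma eta_UF_mor: "\<eta> (FE, FE.UA) \<in> equivariant_morphisms G (FE, FE.UA) (FE.FE, FUF.UA)"
  using unit_hom[OF UF_obj] by (simp add: fobs)

lemmas eta_UFD = equivariant_morphismsD[OF eta_UF_mor]

lemma eps_FE_mor: "\<epsilon> (FE, FA) \<in> equivariant_morphisms (TC G) (FE.FE, UF.FA) (FE, FA)"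
  using counit_hom[OF FE_obj] by (simp add: fobs)

lemmas eps_FED = equivariant_morphismsD[OF eps_FE_mor]

lemma h_eta: "e \<in> PE \<Longrightarrow> h (\<eta> (E, \<rho>) e) = e"
proof -
  assume e: "e \<in> PE"
  have "compose PE h (\<eta> (E, \<rho>)) = restrict id PE"
    using h by (simp add: algebras_def func_comp_def fobs)
  from fun_cong[OF this, of e] show ?thesis using e by (simp add: compose_eq)
qed

lemma h_mult: "w \<in> FE.FP \<Longrightarrow> h (fmor F (FE, FE.UA) (E, \<rho>) h w) = h (\<epsilon> (FE, FA) w)"
proof -
  assume w: "w \<in> FE.FP"
  have "compose FE.FP h (fmor F (FE, FE.UA) (E, \<rho>) h) = compose FE.FP h (\<epsilon> (FE, FA))"
    using h by (simp add: algebras_def func_comp_def fobs)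
  from compose_eqD[OF this w] show ?thesis .
qed

text \<open>Naturality of \<eta> at h itself, regarded as a morphism from U F E to E.\<close>

lemma eta_h: "p \<in> FP \<Longrightarrow> \<eta> (E, \<rho>) (h p) = fmor F (FE, FE.UA) (E, \<rho>) h (\<eta> (FE, FE.UA) p)"
proof -
  assume p: "p \<in> FP"
  have "compose FP (\<eta> (E, \<rho>)) h = compose FP (fmor F (FE, FE.UA) (E, \<rho>) h) (\<eta> (FE, FE.UA))"
    using unit_nat[OF UF_obj E_obj, of h] h_mor by (simp add: fobs)
  from compose_eqD[OF this p] show ?thesis .
qed

text \<open>The triangle identity for U, taken at the free object F E.\<close>

lemma eps_eta: "p \<in> FP \<Longrightarrow> \<epsilon> (FE, FA) (\<eta> (FE, FE.UA) p) = p"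
proof -
  assume p: "p \<in> FP"
  have "compose FP (\<epsilon> (FE, FA)) (\<eta> (FE, FE.UA)) = restrict id FP"
    using triangle_U[OF FE_obj] by (simp add: fobs)
  from fun_cong[OF this, of p] show ?thesis using p by (simp add: compose_eq)
qed

lemma Fh_mor: "fmor F (FE, FE.UA) (E, \<rho>) h \<in> equivariant_morphisms (TC G) (FE.FE, UF.FA) (FE, FA)"
proof -
  have "\<forall>A\<in>Obj C. \<forall>B\<in>Obj C. \<forall>f\<in>Hom C A B. fmor F A B f \<in> Hom D (fob F A) (fob F B)"
    using functor_FC[of T] unfolding is_functor_def by (elim conjE)
  then show ?thesis using UF_obj E_obj h_mor by (force simp: fobs)
qed

lemmas FhD = equivariant_morphismsD[OF Fh_mor]

abbreviation "B \<equiv> alg_act G X t \<eta> E \<rho> h"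

lemma B_apply: "w \<in> carrier (TC G) \<Longrightarrow> e \<in> PE \<Longrightarrow> B (w, e) = h (FA (w, \<eta> (E, \<rho>) e))"
  by (simp add: alg_act_def fob_FC_FA)

text \<open>As an algebra structure, h is a priori a morphism for G only. The equality trades it for
  F h and \<epsilon>, which are morphisms of affine actions and therefore commute with all of
  \<open>TC G\<close>.\<close>

lemma h_equivariant:
  assumes w: "w \<in> carrier (TC G)" and p: "p \<in> FP"
  shows "h (FA (w, p)) = B (w, h p)"
proof -
  let ?q = "\<eta> (FE, FE.UA) p"
  have q: "?q \<in> FE.FP" using eta_UFD(4)[of p] p by simp
  have hp: "h p \<in> PE" using hD(4)[of p] p by simp
  have "B (w, h p) = h (FA (w, fmor F (FE, FE.UA) (E, \<rho>) h ?q))"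
    using w hp p by (simp add: B_apply eta_h)
  also have "\<dots> = h (fmor F (FE, FE.UA) (E, \<rho>) h (UF.FA (w, ?q)))"
    using FhD(3)[OF w, of ?q] q by simp
  also have "\<dots> = h (\<epsilon> (FE, FA) (UF.FA (w, ?q)))"
    by (rule h_mult) (use FUF.aff_in[OF w] q in simp)
  also have "\<dots> = h (FA (w, \<epsilon> (FE, FA) ?q))"
    using eps_FED(3)[OF w, of ?q] q by simp
  finally show ?thesis using p by (simp add: eps_eta)
qed

lemma B_in: "w \<in> carrier (TC G) \<Longrightarrow> e \<in> PE \<Longrightarrow> B (w, e) \<in> PE"
  using FE.aff_in[of w "\<eta> (E, \<rho>) e"] etaD(4)[of e] hD(4) by (simp add: B_apply)

text \<open>Smoothness and the affine laws pass from the free action through \<eta> and h, both of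
  which are bundle morphisms. Only compatibility with products has to re-enter E between the two
  factors.\<close>

lemma affine_B: "is_affine_action G X t E B"
  unfolding is_affine_action_def
proof (intro conjI)
  show "complex_vector_bundle X E" by (rule E)
  show "B \<in> extensional (carrier (TC G) \<times> PE)" by (simp add: alg_act_def)
  show "left_action (TC G) PE B"
    unfolding left_action_def
  proof (intro conjI ballI)
    show "B \<in> carrier (TC G) \<times> PE \<rightarrow> PE" by (auto intro!: B_in)
    fix e assume e: "e \<in> PE"
    have ee: "\<eta> (E, \<rho>) e \<in> FP" using etaD(4)[OF e] by simp
    show "B (\<one>\<^bsub>TC G\<^esub>, e) = e"
      using e ee one_TC_in FE.aff_one[of "\<eta> (E, \<rho>) e"] by (simp add: one_TC B_apply h_eta)
    fix x y assume x: "x \<in> carrier (TC G)" and y: "y \<in> carrier (TC G)"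
    have "B (x \<otimes>\<^bsub>TC G\<^esub> y, e) = h (FA (x, FA (y, \<eta> (E, \<rho>) e)))"
      using x y e ee FE.aff_mult[OF x y, of "\<eta> (E, \<rho>) e"] by (simp add: B_apply TC_closed)
    \<comment> \<open>Here equivariance of h under the whole of \<open>TC G\<close> is
      indispensable: the inner point lies in F E but need not be in the image of \<eta>.\<close>
    also have "\<dots> = B (x, h (FA (y, \<eta> (E, \<rho>) e)))"
      by (rule h_equivariant[OF x]) (use FE.aff_in[OF y, of "\<eta> (E, \<rho>) e"] ee in simp)
    finally show "B (x \<otimes>\<^bsub>TC G\<^esub> y, e) = B (x, B (y, e))" using y e by (simp add: B_apply)
  qed
  let ?P = "prod_cbundle (ctangent_cbundle GG) E"
  have pts: "points (tot ?P) = carrier (TC G) \<times> PE"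
    by (simp add: prod_cbundle_def ctangent_cbundle_def carrier_TC)
  have eFP: "e \<in> PE \<Longrightarrow> \<eta> (E, \<rho>) e \<in> points (tot FE)" for e using etaD(4) .
  note em = cbundle_morphismD[OF etaD(1)] and hm = cbundle_morphismD[OF hD(1)]
  show "cbundle_morphism ?P E t B"
  proof (rule cbundle_morphismI)
    let ?Q = "prod_mfd TG (tot E)"
    have Q: "pre_mfd ?Q" by (rule prod_mfd_generated(1)[OF pre_TG pre_E])
    have "smooth_map ?Q (tot FE) (\<lambda>y. FA (fst y, \<eta> (E, \<rho>) (snd y)))"
      by (rule FE.smooth_aff[OF Q smooth_map_fst[OF pre_TG pre_E]
            smooth_map_compose[OF Q pre_E pre_FE smooth_map_snd[OF pre_TG pre_E] em(1)]])
    then have "smooth_map ?Q (tot E) (\<lambda>y. h (FA (fst y, \<eta> (E, \<rho>) (snd y))))"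
      by (rule smooth_map_compose[OF Q pre_FE pre_E _ hm(1)])
    then have "smooth_map ?Q (tot E) B"
      by (rule smooth_map_cong[OF _ Q pre_E]) (auto simp: B_apply carrier_TC)
    then show "smooth_map (tot ?P) (tot E) B" by (simp add: prod_cbundle_def ctangent_cbundle_def)
    fix w assume w: "w \<in> points (tot ?P)"
    obtain g v e where e: "w = ((g, v), e)" by (cases w) auto
    have gv: "(g, v) \<in> carrier (TC G)" "e \<in> PE" using w e pts by simp_all
    then have g: "g \<in> carrier G" and v: "v \<in> TT g" by (simp_all add: carrier_TC)
    have F1: "FA ((g, v), \<eta> (E, \<rho>) e) \<in> points (tot FE)" by (rule FE.aff_in[OF gv(1) eFP[OF gv(2)]])
    show "proj E (B w) = t (proj ?P w)"
      using gv F1 hm(2)[OF F1] FE.aff_proj[OF gv(1) eFP[OF gv(2)]] em(2)[OF gv(2)]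
      by (simp add: e B_apply prod_cbundle_def ctangent_cbundle_def)
    show "B (vscale ?P a w) = vscale E a (B w)" for a
    proof -
      have "(g, ct_scale a v) \<in> carrier (TC G)" using g v by (simp add: carrier_TC ct_scale_in)
      then show ?thesis
        using gv vscale_in(1)[OF gv(2)] em(4)[OF gv(2)] hm(4)[OF F1] FE.aff_scale[OF gv(1) eFP[OF gv(2)], of a]
        by (simp add: e B_apply prod_cbundle_def ctangent_cbundle_def)
    qed
    fix w' assume w': "w' \<in> points (tot ?P)" and pr: "proj ?P w = proj ?P w'"
    obtain g' v' e' where e': "w' = ((g', v'), e')" by (cases w') auto
    have eq: "g' = g" "proj E e = proj E e'" using pr e e' by (simp_all add: prod_cbundle_def ctangent_cbundle_def)
    have gv': "(g, v') \<in> carrier (TC G)" "e' \<in> PE" using w' e' pts eq by simp_all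
    have F2: "FA ((g, v'), \<eta> (E, \<rho>) e') \<in> points (tot FE)" by (rule FE.aff_in[OF gv'(1) eFP[OF gv'(2)]])
    have gvv: "(g, ct_add v v') \<in> carrier (TC G)" using gv' g v by (simp add: carrier_TC ct_add_in)
    have pe: "proj FE (\<eta> (E, \<rho>) e) = proj FE (\<eta> (E, \<rho>) e')" using em(2) gv gv' eq by simp
    have pF: "proj FE (FA ((g, v), \<eta> (E, \<rho>) e)) = proj FE (FA ((g, v'), \<eta> (E, \<rho>) e'))"
      using FE.aff_proj[OF gv(1) eFP[OF gv(2)]] FE.aff_proj[OF gv'(1) eFP[OF gv'(2)]] pe by simp
    have "B ((g, ct_add v v'), vadd E e e') = h (FA ((g, ct_add v v'), vadd FE (\<eta> (E, \<rho>) e) (\<eta> (E, \<rho>) e')))"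
      using gvv vadd_in(1)[OF gv(2) gv'(2) eq(2)] em(3)[OF gv(2) gv'(2) eq(2)] by (simp add: B_apply)
    also have "\<dots> = h (vadd FE (FA ((g, v), \<eta> (E, \<rho>) e)) (FA ((g, v'), \<eta> (E, \<rho>) e')))"
      using FE.aff_add[OF gv(1) gv'(1) eFP[OF gv(2)] eFP[OF gv'(2)] pe] by simp
    also have "\<dots> = vadd E (B ((g, v), e)) (B ((g, v'), e'))"
      using hm(3)[OF F1 F2 pF] gv gv' by (simp add: B_apply)
    finally show "B (vadd ?P w w') = vadd E (B w) (B w')"
      using eq by (simp add: e e' prod_cbundle_def ctangent_cbundle_def)
  qed
qed

sublocale B: affine_bdl G X t E B
  by (rule affine_bdlI[OF affine_B])

text \<open>A vector 0_g acts on F E through the underlying G-action, for which h is equivariant by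
  assumption; then h cancels \<eta>.\<close>

lemma UB: "B.UA = \<rho>"
proof (rule extensionalityI[OF _ act_ext])
  show "B.UA \<in> extensional (carrier G \<times> PE)" by (simp add: B.UA_def)
  fix x assume "x \<in> carrier G \<times> PE"
  then obtain g e where x: "x = (g, e)" "g \<in> carrier G" "e \<in> PE" by blast
  have "B.UA (g, e) = h (FE.UA (g, \<eta> (E, \<rho>) e))"
    using x zero_in_TC[OF x(2)] etaD(4)[OF x(3)] by (simp add: B.UA_apply B_apply FE.UA_apply)
  also have "\<dots> = \<rho> (g, e)" using hD(3)[OF x(2) etaD(4)[OF x(3)]] h_eta[OF x(3)] by simp
  finally show "B.UA x = \<rho> x" using x by simp
qed

lemma h_morphism: "h \<in> equivariant_morphisms (TC G) (FE, FA) (E, B)"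
  using hD(1,2) h_equivariant by (simp add: equivariant_morphisms_iff)

text \<open>Once h is a morphism from F E to E with the action B, naturality of \<epsilon> at h
  fixes the counit on the image of F h, and F h is onto. Thus the comparison functor sends the
  recovered action back to h.\<close>

lemma counit_B: "\<epsilon> (E, B) = h"
proof -
  have B_obj: "(E, B) \<in> Obj D" using affine_B by simp
  have UBo: "fob U (E, B) = (E, \<rho>)" by (simp add: B.fob_UC_UA UB)
  have m: "\<epsilon> (E, B) \<in> equivariant_morphisms (TC G) (FE, FA) (E, B)"
    using counit_hom[OF B_obj] by (simp add: UBo fobs)
  show ?thesis
  proof (rule extensionalityI[of _ FP])
    show "\<epsilon> (E, B) \<in> extensional FP" using equivariant_morphismsD(2)[OF m] by simp
    show "h \<in> extensional FP" using hD(2) by simp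
    fix p assume p: "p \<in> FP"
    then obtain \<alpha> e where p': "p = mk \<alpha> e" "\<alpha> \<in> lie_gC G" "e \<in> PE" by (rule FP_E)
    \<comment> \<open>A preimage of p under F h: since h cancels \<eta>, so does F h cancel F
      \<eta>. The triangle identity for F evaluates \<epsilon> at the same point.\<close>
    let ?q = "fmor F (E, \<rho>) (FE, FE.UA) (\<eta> (E, \<rho>)) p"
    have q: "?q = FE.mk \<alpha> (\<eta> (E, \<rho>) e)" using fmor_FC_apply[OF etaD(1) p'(2,3)] p' by simp
    have qU: "?q \<in> FE.FP" unfolding q using p' etaD(4)[OF p'(3)] by simp
    have hq: "fmor F (FE, FE.UA) (E, \<rho>) h ?q = p"
      unfolding q using fmor_FC_apply[OF hD(1) p'(2) etaD(4)[OF p'(3)]] h_eta[OF p'(3)] p' by simp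
    have "compose FE.FP (\<epsilon> (E, B)) (fmor F (FE, FE.UA) (E, \<rho>) h) = compose FE.FP h (\<epsilon> (FE, FA))"
      using counit_nat[OF FE_obj B_obj, of h] h_morphism by (simp add: UBo fobs)
    from compose_eqD[OF this qU] have "\<epsilon> (E, B) p = h (\<epsilon> (FE, FA) ?q)" by (simp add: hq)
    also have "compose FP (\<epsilon> (FE, FA)) (fmor F (E, \<rho>) (FE, FE.UA) (\<eta> (E, \<rho>))) = restrict id FP"
      using triangle_F[OF E_obj] by (simp add: fobs)
    from fun_cong[OF this, of p] have "\<epsilon> (FE, FA) ?q = p" using p by (simp add: compose_eq)
    finally show "\<epsilon> (E, B) p = h p" .
  qed
qed

end

context bundle_adjunction begin

definition L :: "(('x, 'g, 'a) G_bundle \<times> ('x, 'g, 'a) bundle_map, ('x, 'g, 'a) bundle_map,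
    ('x, 'g, 'a) affine_bundle, ('x, 'g, 'a) bundle_map) func" where
  "L = \<lparr>fob = (\<lambda>((E, \<rho>), h). (E, alg_act G X t \<eta> E \<rho> h)), fmor = (\<lambda>_ _ f. f)\<rparr>"

lemma L_simps [simp]: "fob L ((E, \<rho>), h) = (E, alg_act G X t \<eta> E \<rho> h)" "fmor L A B f = f"
  by (simp_all add: L_def)

lemma algebraI: "((E, \<rho>), h) \<in> Obj Alg \<Longrightarrow> bundle_algebra G X t T \<eta> \<epsilon> E \<rho> h"
proof -
  assume h: "((E, \<rho>), h) \<in> Obj Alg"
  then have "is_G_bundle G X t E \<rho>" by (simp add: algebras_def)
  then interpret G_bdl G X t E \<rho> by (rule G_bdlI)
  show ?thesis by unfold_locales (rule h)
qed

lemma functor_K: "is_functor D Alg K"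
  by (rule comparison_functor[OF adj])

text \<open>An algebra map f is equivariant for the recovered actions: the algebra square moves f
  past h, the morphism F f of affine actions moves past w, and naturality moves f past
  \<eta>.\<close>

lemma functor_L: "is_functor Alg D L"
  unfolding is_functor_def
proof (intro conjI ballI category_VectAff)
  show "is_category Alg" using functor_K unfolding is_functor_def by (elim conjE)
  fix Y assume Y: "Y \<in> Obj Alg"
  obtain E \<rho> h where [simp]: "Y = ((E, \<rho>), h)" by (cases Y) auto
  interpret E: bundle_algebra G X t T \<eta> \<epsilon> E \<rho> h by (rule algebraI) (use Y in simp)
  show "fob L Y \<in> Obj D" using E.affine_B by simp
  show "fmor L Y Y (Ident Alg Y) = Ident D (fob L Y)" by (simp add: algebras_simps)
  fix Z assume Z: "Z \<in> Obj Alg"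
  obtain E' \<rho>' h' where [simp]: "Z = ((E', \<rho>'), h')" by (cases Z) auto
  interpret E': bundle_algebra G X t T \<eta> \<epsilon> E' \<rho>' h' by (rule algebraI) (use Z in simp)
  show "fmor L Y Z f \<in> Hom D (fob L Y) (fob L Z)" if f: "f \<in> Hom Alg Y Z" for f
  proof -
    have fm: "f \<in> equivariant_morphisms G (E, \<rho>) (E', \<rho>')"
      and fc: "compose E.FP f h = compose E.FP h' (fmor F (E, \<rho>) (E', \<rho>') f)"
      using f by (simp_all add: algebras_simps func_comp_def E.fobs)
    note D = equivariant_morphismsD[OF fm]
    have "\<forall>A\<in>Obj C. \<forall>B\<in>Obj C. \<forall>f\<in>Hom C A B. fmor F A B f \<in> Hom D (fob F A) (fob F B)"
      using functor_FC[of T] unfolding is_functor_def by (elim conjE)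
    from this[rule_format, OF E.E_obj E'.E_obj, of f]
    have Ff: "fmor F (E, \<rho>) (E', \<rho>') f \<in> equivariant_morphisms (TC G) (E.FE, E.FA) (E'.FE, E'.FA)"
      using fm by (simp add: E.fobs E'.fobs)
    have "compose (points (tot E)) (\<eta> (E', \<rho>')) f = compose (points (tot E)) (fmor F (E, \<rho>) (E', \<rho>') f) (\<eta> (E, \<rho>))"
      using unit_nat[OF E.E_obj E'.E_obj, of f] fm by simp
    note nat = compose_eqD[OF this]
    have "f (E.B (w, e)) = E'.B (w, f e)" if w: "w \<in> carrier (TC G)" and e: "e \<in> points (tot E)" for w e
    proof -
      have ee: "\<eta> (E, \<rho>) e \<in> points (tot E.FE)" by (rule E.etaD(4)[OF e])
      have "f (E.B (w, e)) = f (h (E.FA (w, \<eta> (E, \<rho>) e)))" using w e by (simp add: E.B_apply)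
      also have "\<dots> = h' (fmor F (E, \<rho>) (E', \<rho>') f (E.FA (w, \<eta> (E, \<rho>) e)))"
        by (rule compose_eqD[OF fc]) (use E.FE.aff_in[OF w ee] in simp)
      also have "\<dots> = h' (E'.FA (w, \<eta> (E', \<rho>') (f e)))"
        using equivariant_morphismsD(3)[OF Ff w ee] nat[OF e] by simp
      finally show ?thesis using w D(4)[OF e] by (simp add: E'.B_apply)
    qed
    then show ?thesis using D(1,2) by (simp add: equivariant_morphisms_iff)
  qed
  fix W f g assume "W \<in> Obj Alg"
  obtain E'' \<rho>'' h'' where [simp]: "W = ((E'', \<rho>''), h'')" by (cases W) auto
  show "fmor L Y W (Cmp Alg Y Z W g f) = Cmp D (fob L Y) (fob L Z) (fob L W) (fmor L Z W g) (fmor L Y Z f)"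
    by (simp add: algebras_simps)
qed

text \<open>As \<epsilon> is a morphism of affine actions that cancels \<eta> on the underlying
  bundle, the recovered action of w on e is w applied to \<epsilon> (\<eta> e) = e.\<close>

lemma L_K: "func_eq D (func_comp L K) func_id"
  unfolding func_eq_def
proof (intro conjI ballI)
  fix Y assume Y: "Y \<in> Obj D"
  obtain E A where [simp]: "Y = (E, A)" by (cases Y)
  interpret A: affine_bdl G X t E A by (rule affine_bdlI) (use Y in simp)
  interpret U: G_bdl G X t E A.UA by (rule G_bdlI[OF A.G_bundle_UA])
  have KY: "fob K Y = ((E, A.UA), \<epsilon> (E, A))" by (simp add: comparison_def A.fob_UC_UA)
  have "fob K Y \<in> Obj Alg" using functor_K Y unfolding is_functor_def by blast
  then interpret K: bundle_algebra G X t T \<eta> \<epsilon> E A.UA "\<epsilon> (E, A)" by (intro algebraI) (simp only: KY)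
  have m: "\<epsilon> (E, A) \<in> equivariant_morphisms (TC G) (A.FE, U.FA) (E, A)"
    using counit_hom[OF Y] by (simp add: A.fob_UC_UA U.fob_FC_FA)
  have "K.B = A"
  proof (rule extensionalityI[OF _ A.aff_ext])
    show "K.B \<in> extensional (carrier (TC G) \<times> points (tot E))" by (simp add: alg_act_def)
    fix x assume "x \<in> carrier (TC G) \<times> points (tot E)"
    then obtain w e where x: "x = (w, e)" "w \<in> carrier (TC G)" "e \<in> points (tot E)" by blast
    show "K.B x = A x"
      using x K.h_eta[OF x(3)] equivariant_morphismsD(3)[OF m x(2) K.etaD(4)[OF x(3)]] by (simp add: K.B_apply)
  qed
  then show "fob (func_comp L K) Y = fob func_id Y"
    unfolding func_comp_def func_id_def by (simp add: KY[simplified])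
qed (simp add: func_comp_def func_id_def comparison_def)

lemma K_L: "func_eq Alg (func_comp K L) func_id"
  unfolding func_eq_def
proof (intro conjI ballI)
  fix Y assume Y: "Y \<in> Obj Alg"
  obtain E \<rho> h where [simp]: "Y = ((E, \<rho>), h)" by (cases Y) auto
  interpret E: bundle_algebra G X t T \<eta> \<epsilon> E \<rho> h by (rule algebraI) (use Y in simp)
  show "fob (func_comp K L) Y = fob func_id Y"
    by (simp add: func_comp_def func_id_def comparison_def E.B.fob_UC_UA E.UB E.counit_B)
qed (simp add: func_comp_def func_id_def comparison_def)

lemma monadic_adjunction: "monadic C D F U \<eta> \<epsilon>"
  unfolding monadic_def category_isomorphism_def
  using adj functor_K functor_L L_K K_L by blast

end

text \<open>Existence of a unit and counit is a clause of its own, so that the monadicity clause,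
  which ranges over all such pairs, is not vacuous.\<close>

theorem mainTheorem5:
  fixes G :: "'g lie_group" and X :: "'x smooth_mfd" and t :: "'g \<times> 'x \<Rightarrow> 'x"
  assumes "is_lie_group G" and "G_manifold G X t"
  shows "(\<exists>\<eta> \<epsilon>. adjunction (VectG TYPE('a) G X t) (VectAff TYPE('a) G X t)
                  (FC TYPE('a) G X t) (UC TYPE('a) G) \<eta> \<epsilon>)
       \<and> (\<forall>\<eta> \<epsilon>. adjunction (VectG TYPE('a) G X t) (VectAff TYPE('a) G X t)
                  (FC TYPE('a) G X t) (UC TYPE('a) G) \<eta> \<epsilon> \<longrightarrow>
               monadic (VectG TYPE('a) G X t) (VectAff TYPE('a) G X t)
                  (FC TYPE('a) G X t) (UC TYPE('a) G) \<eta> \<epsilon>)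
       \<and> is_functor (VectG TYPE('a) G X t) (VectAff TYPE('a) G X t) (sigmaC TYPE('a) G)
       \<and> func_eq (VectG TYPE('a) G X t) (func_comp (UC TYPE('a) G) (sigmaC TYPE('a) G)) func_id
       \<and> (\<forall>S. is_functor (VectG TYPE('a) G X t) (VectAff TYPE('a) G X t) S \<and>
               func_eq (VectG TYPE('a) G X t) (func_comp (UC TYPE('a) G) S) func_id \<longrightarrow>
               func_eq (VectG TYPE('a) G X t) S (sigmaC TYPE('a) G))"
proof -
  interpret g_manifold G X t by unfold_locales (rule assms)+
  show ?thesis
  proof (intro conjI allI impI)
    show "\<exists>\<eta> \<epsilon>. adjunction (VectG TYPE('a) G X t) (VectAff TYPE('a) G X t) (FC TYPE('a) G X t) (UC TYPE('a) G) \<eta> \<epsilon>"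
      using adjunction_FC_UC by (intro exI)
    show "monadic (VectG TYPE('a) G X t) (VectAff TYPE('a) G X t) (FC TYPE('a) G X t) (UC TYPE('a) G) \<eta> \<epsilon>"
      if "adjunction (VectG TYPE('a) G X t) (VectAff TYPE('a) G X t) (FC TYPE('a) G X t) (UC TYPE('a) G) \<eta> \<epsilon>" for \<eta> \<epsilon>
    proof -
      interpret bundle_adjunction G X t "TYPE('a)" \<eta> \<epsilon> by unfold_locales (rule that)
      show ?thesis by (rule monadic_adjunction)
    qed
  qed (use functor_sigmaC sigmaC_section section_unique in auto)
qed

end
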